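(* Let $d\ge3$ and $\theta>0$, and let $\Psi_{\mathsf{sph},N}^{\theta}$ be the spherical law on $\mathbb{T}_n^d$, $N=n^d$. As $N\to\infty$: (a) If $\theta<C_d$, then $\Psi_{\mathsf{sph},N}^{\theta}$ converges in the local weak sense to $\theta^{-1/2}\Phi_{m(\theta)}^{\mathbb{Z}^d}$, where $m(\theta)>0$ is the solution $m$ of $$\int_{[0,1]^d}\frac{d\kappa}{4\sum_{i=1}^d\sin^2(\pi\kappa_i)+m}=\theta .$$ (b) If $\theta\ge C_d$, then the local weak limit of $\Psi_{\mathsf{sph},N}^{\theta}$ is $\theta^{-1/2}\Phi^{\mathbb{Z}^d}+U\mathbf{1}$, where $U\in\mathbb{C}$ is independent of $\Phi^{\mathbb{Z}^d}$ and uniformly distributed on the disc of radius $\sqrt{1-C_d/\theta}$ centered at $0$, and $\mathbf{1}$ is the function identically equal to $1$ on $\mathbb{Z}^d$. In particular, if $\theta=C_d$ then $U=0$ almost surely.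
   Context: $\mathbb{T}_n^d=(\mathbb{Z}/n\mathbb{Z})^d$ is the discrete torus with nearest-neighbour edges, $N=n^d$. For $\psi:\mathbb{T}_n^d\to\mathbb{C}$, $\|\psi\|_2^2=\sum_x|\psi(x)|^2$ and $\|\nabla\psi\|_2^2=\sum_{x\sim y}|\psi(x)-\psi(y)|^2$ (sum over edges). The spherical law $\Psi_{\mathsf{sph},N}^{\theta}:\mathbb{T}_n^d\to\mathbb{C}$ is the random field with density, with respect to Lebesgue measure on $\mathbb{C}^N$, proportional to $\exp(-\theta\|\nabla\psi\|_2^2)\mathbf 1_{\{\|\psi\|_2^2\le N\}}$. Local weak convergence of $X_N:\mathbb{T}_n^d\to\mathbb{C}$ to $X:\mathbb{Z}^d\to\mathbb{C}$ means: for every finite $A\subset\mathbb{Z}^d$ (viewed inside $\mathbb{T}_n^d$ for $n$ large), $(X_N(x))_{x\in A}\to(X(x))_{x\in A}$ in distribution. For $m\ge0$, the massive Green's function on $\mathbb{Z}^d$ is $\mathsf G_m^{\mathbb{Z}^d}(x,y)=\frac1{2d+m}\sum_{t\ge0}\mathbb{P}(X_t^{m,x}=y)$, where $X^{m,x}$ is simple random walk on $\mathbb{Z}^d$ started at $x$ and killed with probability $\frac{m}{m+2d}$ at each step; $\mathsf G^{\mathbb{Z}^d}=\mathsf G_0^{\mathbb{Z}^d}$, and $C_d=\mathsf G^{\mathbb{Z}^d}(0,0)<\infty$. The complex massive Gaussian free field $\Phi_m^{\mathbb{Z}^d}$ is the centered complex Gaussian process on $\mathbb{Z}^d$, with real and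 imaginary parts i.i.d., such that $\mathbb{E}[\overline{\Phi_m^{\mathbb{Z}^d}(x)}\,\Phi_m^{\mathbb{Z}^d}(y)]=\mathsf G_m^{\mathbb{Z}^d}(x,y)$; $\Phi^{\mathbb{Z}^d}=\Phi_0^{\mathbb{Z}^d}$ is the (massless) GFF. *)

theory Defs
  imports "HOL-Probability.Probability"
begin

section \<open>The discrete torus and the spherical law\<close>

text \<open>The lattice is \<^typ>\<open>int ^ 'd\<close>, with dimension \<open>CARD('d)\<close>. The torus of side \<open>n\<close> is its set
  of representatives with coordinates in \<open>{0..<n}\<close>, and \<open>reduce n\<close> is the projection onto it.\<close>

definition torus :: "nat \<Rightarrow> (int ^ 'd) set" where
  "torus n = {x. \<forall>i. 0 \<le> x $ i \<and> x $ i < int n}"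

definition reduce :: "nat \<Rightarrow> int ^ 'd \<Rightarrow> int ^ 'd" where
  "reduce n x = (\<chi> i. x $ i mod int n)"

definition neighbours :: "int ^ 'd \<Rightarrow> (int ^ 'd) set" where
  "neighbours x = {y. \<exists>i. y = x + axis i 1 \<or> y = x - axis i 1}"

definition torus_adj :: "nat \<Rightarrow> int ^ 'd \<Rightarrow> int ^ 'd \<Rightarrow> bool" where
  "torus_adj n x y \<longleftrightarrow> x \<in> torus n \<and> y \<in> torus n \<and> y \<in> reduce n ` neighbours x"

definition norm2_sq :: "nat \<Rightarrow> (int ^ 'd \<Rightarrow> complex) \<Rightarrow> real" where
  "norm2_sq n \<psi> = (\<Sum>x\<in>torus n. (cmod (\<psi> x))\<^sup>2)"

text \<open>The sum over undirected edges is half the sum over ordered adjacent pairs.\<close>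

definition grad_sq :: "nat \<Rightarrow> (int ^ 'd \<Rightarrow> complex) \<Rightarrow> real" where
  "grad_sq n \<psi> = (\<Sum>(x, y)\<in>{(x, y). torus_adj n x y}. (cmod (\<psi> x - \<psi> y))\<^sup>2) / 2"

definition lebesgue_torus :: "nat \<Rightarrow> (int ^ 'd \<Rightarrow> complex) measure" where
  "lebesgue_torus n = Pi\<^sub>M (torus n) (\<lambda>_. lborel)"

definition spherical_weight :: "real \<Rightarrow> nat \<Rightarrow> (int ^ 'd \<Rightarrow> complex) \<Rightarrow> real" where
  "spherical_weight \<theta> n \<psi> =
     exp (- \<theta> * grad_sq n \<psi>) * indicator {\<psi>. norm2_sq n \<psi> \<le> real (n ^ CARD('d))} \<psi>"

definition spherical_law :: "real \<Rightarrow> nat \<Rightarrow> (int ^ 'd \<Rightarrow> complex) measure" where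
  "spherical_law \<theta> n = density (lebesgue_torus n)
     (\<lambda>\<psi>. ennreal (spherical_weight \<theta> n \<psi> /
       (\<integral>\<phi>. spherical_weight \<theta> n \<phi> \<partial>(lebesgue_torus n :: (int ^ 'd \<Rightarrow> complex) measure))))"

section \<open>Local weak convergence\<close>

definition weak_conv_on :: "'a topology \<Rightarrow> (nat \<Rightarrow> 'a measure) \<Rightarrow> 'a measure \<Rightarrow> bool" where
  "weak_conv_on T \<mu> \<nu> \<longleftrightarrow>
     (\<forall>f. continuous_map T euclideanreal f \<and> bounded (f ` topspace T) \<longrightarrow>
        (\<lambda>n. \<integral>x. f x \<partial>\<mu> n) \<longlonglongrightarrow> (\<integral>x. f x \<partial>\<nu>))"

text \<open>\<open>\<mu> n\<close> is the law of a field on the torus of side \<open>n\<close>; the limit \<open>X\<close> is a random field on the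
  whole lattice, defined on the probability space \<open>M\<close>. For all large \<open>n\<close> the projection \<open>reduce n\<close>
  embeds a given finite set \<open>A\<close> into the torus.\<close>

definition local_weak_conv ::
    "(nat \<Rightarrow> (int ^ 'd \<Rightarrow> complex) measure) \<Rightarrow> 'w measure \<Rightarrow> ('w \<Rightarrow> int ^ 'd \<Rightarrow> complex) \<Rightarrow> bool" where
  "local_weak_conv \<mu> M X \<longleftrightarrow>
     (\<forall>A. finite A \<longrightarrow>
        weak_conv_on (product_topology (\<lambda>_. euclidean) A)
          (\<lambda>n. distr (\<mu> n) (Pi\<^sub>M A (\<lambda>_. borel)) (\<lambda>\<psi>. \<lambda>x\<in>A. \<psi> (reduce n x)))
          (distr M (Pi\<^sub>M A (\<lambda>_. borel)) (\<lambda>\<omega>. \<lambda>x\<in>A. X \<omega> x)))"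

section \<open>Killed random walk and Green's function\<close>

text \<open>The state \<^const>\<open>None\<close> is the cemetery.\<close>

definition killed_step :: "real \<Rightarrow> (int ^ 'd) option \<Rightarrow> (int ^ 'd) option pmf" where
  "killed_step m s = (case s of
       None \<Rightarrow> return_pmf None
     | Some x \<Rightarrow> bind_pmf (bernoulli_pmf (m / (m + 2 * real CARD('d))))
         (\<lambda>killed. if killed then return_pmf None else map_pmf Some (pmf_of_set (neighbours x))))"

primrec killed_walk :: "real \<Rightarrow> int ^ 'd \<Rightarrow> nat \<Rightarrow> (int ^ 'd) option pmf" where
  "killed_walk m x 0 = return_pmf (Some x)"
| "killed_walk m x (Suc t) = bind_pmf (killed_walk m x t) (killed_step m)"

text \<open>The series converges if \<open>m > 0\<close>, or if \<open>m = 0\<close> and \<open>CARD('d) \<ge> 3\<close>.\<close>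

definition green :: "real \<Rightarrow> int ^ 'd \<Rightarrow> int ^ 'd \<Rightarrow> real" where
  "green m x y = 1 / (2 * real CARD('d) + m) * (\<Sum>t. pmf (killed_walk m x t) (Some y))"

definition green_const :: "'d::finite itself \<Rightarrow> real" where
  "green_const _ = green 0 (0 :: int ^ 'd) 0"

definition mass_integral :: "'d::finite itself \<Rightarrow> real \<Rightarrow> real" where
  "mass_integral _ m =
     (LINT \<kappa>:cbox 0 (1 :: real ^ 'd)|lborel. 1 / (4 * (\<Sum>i\<in>UNIV. (sin (pi * \<kappa> $ i))\<^sup>2) + m))"

section \<open>Gaussian free field\<close>

abbreviation field_space :: "('a \<Rightarrow> complex) measure" where
  "field_space \<equiv> Pi\<^sub>M UNIV (\<lambda>_. borel)"

text \<open>Point masses count as Gaussian, as usual for Gaussian processes.\<close>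

definition gaussian_rv :: "'w measure \<Rightarrow> ('w \<Rightarrow> real) \<Rightarrow> bool" where
  "gaussian_rv M Y \<longleftrightarrow> Y \<in> borel_measurable M \<and>
     (\<exists>\<mu> \<sigma>. distr M borel Y =
        (if \<sigma> > 0 then density lborel (normal_density \<mu> \<sigma>) else return borel \<mu>))"

text \<open>Every real-linear functional of finitely many values is Gaussian; that is, the real and
  imaginary parts of all values are jointly Gaussian.\<close>

definition complex_gaussian_process :: "'w measure \<Rightarrow> ('w \<Rightarrow> 'a \<Rightarrow> complex) \<Rightarrow> bool" where
  "complex_gaussian_process M X \<longleftrightarrow> X \<in> measurable M field_space \<and>
     (\<forall>A c. finite A \<longrightarrow> gaussian_rv M (\<lambda>\<omega>. \<Sum>x\<in>A. Re (c x * X \<omega> x)))"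

definition massive_gff :: "real \<Rightarrow> 'w measure \<Rightarrow> ('w \<Rightarrow> int ^ 'd \<Rightarrow> complex) \<Rightarrow> bool" where
  "massive_gff m M \<Phi> \<longleftrightarrow>
     complex_gaussian_process M \<Phi> \<and>
     (\<forall>x. (\<integral>\<omega>. \<Phi> \<omega> x \<partial>M) = 0) \<and>
     prob_space.indep_var M
       (Pi\<^sub>M UNIV (\<lambda>_. borel)) (\<lambda>\<omega> x. Re (\<Phi> \<omega> x)) (Pi\<^sub>M UNIV (\<lambda>_. borel)) (\<lambda>\<omega> x. Im (\<Phi> \<omega> x)) \<and>
     distr M (Pi\<^sub>M UNIV (\<lambda>_. borel)) (\<lambda>\<omega> x. Re (\<Phi> \<omega> x)) =
       distr M (Pi\<^sub>M UNIV (\<lambda>_. borel)) (\<lambda>\<omega> x. Im (\<Phi> \<omega> x)) \<and>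
     (\<forall>x y. (\<integral>\<omega>. cnj (\<Phi> \<omega> x) * \<Phi> \<omega> y \<partial>M) = complex_of_real (green m x y))"

section \<open>The random constant\<close>

text \<open>The uniform law on the degenerate disc of radius \<open>0\<close> is the point mass at \<open>0\<close>.\<close>

definition uniform_disc :: "real \<Rightarrow> complex measure" where
  "uniform_disc r = (if r > 0 then uniform_measure lborel (cball 0 r) else return borel 0)"

text \<open>Independence of the generated sigma-algebras; \<^const>\<open>prob_space.indep_var\<close> would require both
  variables to take values in the same type.\<close>

definition indep_of_field :: "'w measure \<Rightarrow> ('w \<Rightarrow> complex) \<Rightarrow> ('w \<Rightarrow> 'a \<Rightarrow> complex) \<Rightarrow> bool" where
  "indep_of_field M U X \<longleftrightarrow>
     prob_space.indep_set M
       (sets (vimage_algebra (space M) U borel)) (sets (vimage_algebra (space M) X field_space))"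

end

theory Submission
  imports Defs
begin

text \<open>In the orthonormal Fourier basis of the torus the spherical law is the density
  \<open>exp (- \<theta> \<Sum>k. \<lambda>_k |a_k|^2)\<close> on the ball \<open>\<Sum>k. |a_k|^2 \<le> N\<close>, where \<open>\<lambda>_0 = 0\<close>.
  It is invariant under rotating a single coordinate by a quarter turn, and dominated up to a factor \<open>exp (o N)\<close>
  by a product of Gaussians with rates \<open>\<theta> (\<lambda>_k + m)\<close>, \<open>m\<close> being chosen so that the total mass is close
  to \<open>N\<close>. The bound makes every quadratic form \<open>\<Sum>k. |w_k|^2 |a_k|^2\<close> with small coefficients concentrate,
  with exponentially small failure probability, at its Gaussian mean. By quarter-turn invariance the factor
  \<open>exp (i Re (w_k a_k))\<close> can be averaged over the four turns, which gives \<open>1 - |w_k a_k|^2 / 4\<close> to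
  leading order, so that characteristic functions converge to Gaussian ones with Riemann sums of the Green
  function as variances. For \<open>\<theta> > C_d\<close> no such \<open>m\<close> exists: the nonzero modes are Gaussian with \<open>m = 0\<close> and
  carry the mass fraction \<open>C_d / \<theta>\<close>, hence the mass constraint becomes \<open>|a_0|^2 \<le> (1 - C_d / \<theta>) N\<close>
  and leaves \<open>a_0 / sqrt N\<close> uniform on a disc, asymptotically independent of the other modes.\<close>

section \<open>Gaussian integrals on complex coordinates\<close>

text \<open>The indicator of the ball couples all modes, and dominating it multiplies every
  exponential moment by a factor exp (3 \<theta> m \<delta>0 N) that grows with N. It is affordable
  because a Gaussian deviation of order \<delta> costs exp (- const \<theta> m \<delta>^2 N). Hence
  the tolerance \<delta> is fixed before m, and m is taken strictly above the solution m0 of the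
  mass equation, so close to it that 3 \<delta>0 is below half of that cost. As m > 0 even for m0 =
  0, the critical value \<theta> = C_d is covered by the same argument. For \<theta> > C_d the rates
  of the nonzero modes are bounded below only by the spectral gap, 4 \<theta> / n^2. The resulting
  exponent of order N / n^2 = n^(d - 2) still beats every power of N because d \<ge> 3. Here the
  exponential factor disappears: the ball is exchanged for a disc constraint on the zero mode alone,
  which makes the modes independent, and the exchange is controlled in total variation.
  Characteristic functions give weak convergence only together with tightness. It comes from
  translation invariance: every site carries the same second moment, and these sum to at most
  N.\<close>

lemma nn_integral_gaussian_real:
  assumes "c > 0"
  shows "(\<integral>\<^sup>+x. ennreal (exp (- c * x\<^sup>2)) \<partial>lborel) = ennreal (sqrt (pi / c))"
proof -
  define s where "s = 1 / sqrt (2 * c)"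
  have s: "s > 0" and s2: "2 * s\<^sup>2 = 1 / c"
    using assms by (auto simp: s_def power_divide)
  have e: "exp (- c * x\<^sup>2) = sqrt (pi / c) * normal_density 0 s x" for x
  proof -
    have "2 * pi * s\<^sup>2 = pi / c" using s2 by (simp add: field_simps)
    moreover have "- (x - 0)\<^sup>2 / (2 * s\<^sup>2) = - c * x\<^sup>2" unfolding s2 using assms by simp
    ultimately show ?thesis using assms by (simp add: normal_density_def)
  qed
  have "(\<integral>\<^sup>+x. ennreal (normal_density 0 s x) \<partial>lborel) = 1"
    by (subst nn_integral_eq_integral) (auto simp: s integrable_normal_density[OF s] integral_normal_density[OF s])
  then show ?thesis
    unfolding e using assms by (simp add: ennreal_mult' nn_integral_cmult)
qed

lemma nn_integral_gaussian_complex: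
  assumes "c > 0"
  shows "(\<integral>\<^sup>+z. ennreal (exp (- c * (cmod z)\<^sup>2)) \<partial>lborel) = ennreal (pi / c)"
proof -
  have "(\<integral>\<^sup>+z. ennreal (exp (- c * (cmod z)\<^sup>2)) \<partial>lborel) =
      (\<integral>\<^sup>+z. (\<Prod>b\<in>(Basis :: complex set). ennreal (exp (- c * (z \<bullet> b)\<^sup>2))) \<partial>lborel)"
    by (intro nn_integral_cong)
      (auto simp: Basis_complex_def inner_complex_def cmod_power2 complex_eq_iff
          simp flip: ennreal_mult exp_add, simp add: algebra_simps)
  also have "\<dots> = (\<Prod>b\<in>(Basis::complex set). (\<integral>\<^sup>+x. ennreal (exp (- c * x\<^sup>2)) \<partial>lborel))"
    by (subst nn_integral_lborel_prod) auto
  also have "\<dots> = ennreal (pi / c)"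
    using assms unfolding nn_integral_gaussian_real[OF assms]
    by (simp add: Basis_complex_def complex_eq_iff flip: ennreal_mult)
  finally show ?thesis .
qed

section \<open>Lebesgue measure on finitely many complex coordinates\<close>

abbreviation cspace :: "'i set \<Rightarrow> ('i \<Rightarrow> complex) measure" where
  "cspace T \<equiv> Pi\<^sub>M T (\<lambda>_. lborel)"

interpretation lborel_complex: product_sigma_finite "\<lambda>_. lborel :: complex measure"
  by unfold_locales

lemma sigma_finite_cspace: "finite T \<Longrightarrow> sigma_finite_measure (cspace T)"
  by (rule lborel_complex.sigma_finite)

lemma space_cspace [simp]: "space (cspace T) = PiE T (\<lambda>_. UNIV)"
  by (simp add: space_PiM)

lemma nn_integral_gaussian_cspace:
  assumes "finite T" "\<And>k. k \<in> T \<Longrightarrow> c k > 0"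
  shows "(\<integral>\<^sup>+a. ennreal (exp (- (\<Sum>k\<in>T. c k * (cmod (a k))\<^sup>2))) \<partial>cspace T) = ennreal (\<Prod>k\<in>T. pi / c k)"
proof -
  have "(\<integral>\<^sup>+a. ennreal (exp (- (\<Sum>k\<in>T. c k * (cmod (a k))\<^sup>2))) \<partial>cspace T) =
    (\<integral>\<^sup>+a. (\<Prod>k\<in>T. ennreal (exp (- c k * (cmod (a k))\<^sup>2))) \<partial>cspace T)"
    by (intro nn_integral_cong) (simp add: exp_sum assms(1) prod_ennreal flip: sum_negf)
  also have "\<dots> = (\<Prod>k\<in>T. \<integral>\<^sup>+z. ennreal (exp (- c k * (cmod z)\<^sup>2)) \<partial>lborel)"
    using assms by (subst lborel_complex.product_nn_integral_prod) auto
  also have "\<dots> = (\<Prod>k\<in>T. ennreal (pi / c k))"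
    using assms by (intro prod.cong) (use nn_integral_gaussian_complex in auto)
  also have "\<dots> = ennreal (\<Prod>k\<in>T. pi / c k)"
    using assms by (intro prod_ennreal) (auto simp: less_imp_le)
  finally show ?thesis .
qed

text \<open>Product measures are determined by their values on product sets, and on these the claim
  reduces to translation invariance in each coordinate.\<close>

lemma distr_cspace_plus:
  assumes "finite T"
  shows "distr (cspace T) (cspace T) (\<lambda>x. \<lambda>i\<in>T. x i + h i) = cspace T"
proof (rule lborel_complex.PiM_eqI[OF assms])
  fix A :: "'a \<Rightarrow> complex set" assume A: "\<And>i. i \<in> T \<Longrightarrow> A i \<in> sets lborel"
  have [measurable]: "(\<lambda>x. \<lambda>i\<in>T. x i + h i) \<in> measurable (cspace T) (cspace T)"
    by (intro measurable_restrict) auto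
  have tr: "emeasure lborel ((\<lambda>z. z + h i) -` A i) = emeasure lborel (A i)" if "i \<in> T" for i
  proof -
    have "emeasure lborel (A i) = emeasure (distr lborel borel ((+) (h i))) (A i)"
      by (simp add: lborel_distr_plus)
    also have "\<dots> = emeasure lborel ((+) (h i) -` A i)"
      using A[OF that] by (subst emeasure_distr) auto
    also have "(+) (h i) = (\<lambda>z. z + h i)" by (simp add: fun_eq_iff add.commute)
    finally show ?thesis by simp
  qed
  have m: "(\<lambda>z. z + h i) -` A i \<in> sets lborel" if "i \<in> T" for i
    using measurable_sets_borel[of "\<lambda>z. z + h i" lborel "A i"] A[OF that] by auto
  have "PiE T A \<in> sets (cspace T)"
    using A assms by (intro sets_PiM_I_finite) auto
  moreover have "(\<lambda>x. \<lambda>i\<in>T. x i + h i) -` PiE T A \<inter> space (cspace T) = PiE T (\<lambda>i. (\<lambda>z. z + h i) -` A i)"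
    by (auto simp: PiE_iff)
  ultimately show "emeasure (distr (cspace T) (cspace T) (\<lambda>x. \<lambda>i\<in>T. x i + h i)) (PiE T A) =
      (\<Prod>i\<in>T. emeasure lborel (A i))"
    using assms m by (simp add: emeasure_distr lborel_complex.emeasure_PiM tr)
qed simp

lemma nn_integral_cspace_plus:
  assumes "finite T" "f \<in> borel_measurable (cspace T)"
  shows "(\<integral>\<^sup>+x. f (\<lambda>i\<in>T. x i + h i) \<partial>cspace T) = (\<integral>\<^sup>+x. f x \<partial>cspace T)"
proof -
  have m: "(\<lambda>x. \<lambda>i\<in>T. x i + h i) \<in> measurable (cspace T) (cspace T)"
    by (intro measurable_restrict) auto
  have "(\<integral>\<^sup>+x. f (\<lambda>i\<in>T. x i + h i) \<partial>cspace T) =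
        (\<integral>\<^sup>+x. f x \<partial>distr (cspace T) (cspace T) (\<lambda>x. \<lambda>i\<in>T. x i + h i))"
    by (subst nn_integral_distr[OF m]) (use assms in auto)
  then show ?thesis using assms by (simp add: distr_cspace_plus)
qed

text \<open>Takes the place of a determinant computation. Since \<open>F\<close> is additive and
  onto, the image measure is translation invariant. Convolving with a Gaussian and using Fubini
  shows that it is a multiple of Lebesgue measure. The multiple is 1 because \<open>F\<close>
  preserves the norm and therefore the Gaussian.\<close>

lemma distr_cspace_isometry:
  fixes F :: "('i \<Rightarrow> complex) \<Rightarrow> ('i \<Rightarrow> complex)"
  assumes T: "finite T" and F[measurable]: "F \<in> measurable (cspace T) (cspace T)"
    and add: "\<And>x y. x \<in> PiE T (\<lambda>_. UNIV) \<Longrightarrow> y \<in> PiE T (\<lambda>_. UNIV) \<Longrightarrow> F (\<lambda>i\<in>T. x i + y i) = (\<lambda>i\<in>T. F x i + F y i)"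
    and surj: "\<And>y. y \<in> PiE T (\<lambda>_. UNIV) \<Longrightarrow> \<exists>x\<in>PiE T (\<lambda>_. UNIV). F x = y"
    and norm: "\<And>x. x \<in> PiE T (\<lambda>_. UNIV) \<Longrightarrow> (\<Sum>i\<in>T. (cmod (F x i))\<^sup>2) = (\<Sum>i\<in>T. (cmod (x i))\<^sup>2)"
  shows "distr (cspace T) (cspace T) F = cspace T"
proof -
  interpret T: sigma_finite_measure "cspace T" using T by (rule sigma_finite_cspace)
  interpret TT: pair_sigma_finite "cspace T" "cspace T" ..
  \<comment> \<open>The Gaussian serves as a test function that depends on the norm only and has a
    positive finite integral, which can be cancelled at the end.\<close>
  define g :: "('i \<Rightarrow> complex) \<Rightarrow> ennreal" where "g = (\<lambda>x. ennreal (exp (- (\<Sum>k\<in>T. 1 * (cmod (x k))\<^sup>2))))"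
  have [measurable]: "g \<in> borel_measurable (cspace T)" unfolding g_def by measurable
  have gint: "(\<integral>\<^sup>+x. g x \<partial>cspace T) = ennreal (pi ^ card T)"
    unfolding g_def using nn_integral_gaussian_cspace[OF T, of "\<lambda>_. 1"] by simp
  have F_in: "F x \<in> PiE T (\<lambda>_. UNIV)" if "x \<in> PiE T (\<lambda>_. UNIV)" for x
    using measurable_space[OF F, of x] that by simp
  \<comment> \<open>Adding y = F h after applying \<open>F\<close> is the same as adding h before
    it, and the latter leaves the measure unchanged.\<close>
  have shift: "(\<integral>\<^sup>+x. f (\<lambda>i\<in>T. F x i + y i) \<partial>cspace T) = (\<integral>\<^sup>+x. f (F x) \<partial>cspace T)"
    if [measurable]: "f \<in> borel_measurable (cspace T)" and y: "y \<in> PiE T (\<lambda>_. UNIV)" for f :: "_ \<Rightarrow> ennreal" and y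
  proof -
    obtain h where h: "h \<in> PiE T (\<lambda>_. UNIV)" "F h = y" using surj y by blast
    have "(\<integral>\<^sup>+x. f (\<lambda>i\<in>T. F x i + y i) \<partial>cspace T) = (\<integral>\<^sup>+x. f (F (\<lambda>i\<in>T. x i + h i)) \<partial>cspace T)"
      by (intro nn_integral_cong) (use add h in auto)
    also have "\<dots> = (\<integral>\<^sup>+x. f (F x) \<partial>cspace T)"
      using T by (intro nn_integral_cspace_plus) auto
    finally show ?thesis .
  qed
  have [measurable]: "(\<lambda>(x, y). \<lambda>i\<in>T. F x i + y i) \<in> measurable (cspace T \<Otimes>\<^sub>M cspace T) (cspace T)"
  proof -
    have [measurable]: "(\<lambda>p. F (fst p) i) \<in> borel_measurable (cspace T \<Otimes>\<^sub>M cspace T)" if "i \<in> T" for i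
      using measurable_compose[OF measurable_compose[OF measurable_fst F] measurable_component_singleton[OF that]] by simp
    show ?thesis unfolding split_beta' by (intro measurable_restrict) measurable
  qed
  have [measurable]: "(\<lambda>(x, y). \<lambda>i\<in>T. y i - F x i) \<in> measurable (cspace T \<Otimes>\<^sub>M cspace T) (cspace T)"
  proof -
    have [measurable]: "(\<lambda>p. F (fst p) i) \<in> borel_measurable (cspace T \<Otimes>\<^sub>M cspace T)" if "i \<in> T" for i
      using measurable_compose[OF measurable_compose[OF measurable_fst F] measurable_component_singleton[OF that]] by simp
    show ?thesis unfolding split_beta' by (intro measurable_restrict) measurable
  qed
  have key: "(\<integral>\<^sup>+x. f (F x) \<partial>cspace T) = (\<integral>\<^sup>+x. f x \<partial>cspace T)"
    if [measurable]: "f \<in> borel_measurable (cspace T)" for f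
  proof -
    have "(\<integral>\<^sup>+x. f (F x) \<partial>cspace T) * ennreal (pi ^ card T) =
        (\<integral>\<^sup>+y. (\<integral>\<^sup>+x. f (F x) \<partial>cspace T) * g y \<partial>cspace T)"
      by (simp add: nn_integral_cmult gint)
    also have "\<dots> = (\<integral>\<^sup>+y. (\<integral>\<^sup>+x. f (\<lambda>i\<in>T. F x i + y i) * g y \<partial>cspace T) \<partial>cspace T)"
      by (intro nn_integral_cong, subst nn_integral_multc) (auto simp: shift)
    also have "\<dots> = (\<integral>\<^sup>+x. (\<integral>\<^sup>+y. f (\<lambda>i\<in>T. F x i + y i) * g y \<partial>cspace T) \<partial>cspace T)"
      by (rule TT.Fubini') measurable
    also have "\<dots> = (\<integral>\<^sup>+x. (\<integral>\<^sup>+y. f y * g (\<lambda>i\<in>T. y i - F x i) \<partial>cspace T) \<partial>cspace T)"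
    proof (rule nn_integral_cong)
      fix x assume "x \<in> space (cspace T)"
      have [measurable]: "(\<lambda>y. \<lambda>i\<in>T. y i - F x i) \<in> measurable (cspace T) (cspace T)"
        by (intro measurable_restrict) auto
      have "(\<integral>\<^sup>+y. f (\<lambda>i\<in>T. F x i + y i) * g y \<partial>cspace T) =
        (\<integral>\<^sup>+y. f (\<lambda>i\<in>T. y i + F x i) * g (\<lambda>i\<in>T. (\<lambda>i\<in>T. y i + F x i) i - F x i) \<partial>cspace T)"
        by (intro nn_integral_cong arg_cong2[where f = times] arg_cong[where f=f] arg_cong[where f=g])
          (auto simp: fun_eq_iff PiE_iff extensional_def)
      also have "\<dots> = (\<integral>\<^sup>+y. f y * g (\<lambda>i\<in>T. y i - F x i) \<partial>cspace T)"
        by (rule nn_integral_cspace_plus[OF T, of "\<lambda>y. f y * g (\<lambda>i\<in>T. y i - F x i)"]) measurable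
      finally show "(\<integral>\<^sup>+y. f (\<lambda>i\<in>T. F x i + y i) * g y \<partial>cspace T) =
        (\<integral>\<^sup>+y. f y * g (\<lambda>i\<in>T. y i - F x i) \<partial>cspace T)" .
    qed
    also have "\<dots> = (\<integral>\<^sup>+y. (\<integral>\<^sup>+x. f y * g (\<lambda>i\<in>T. y i - F x i) \<partial>cspace T) \<partial>cspace T)"
      by (rule TT.Fubini'[symmetric]) measurable
    also have "\<dots> = (\<integral>\<^sup>+y. f y * ennreal (pi ^ card T) \<partial>cspace T)"
    proof (rule nn_integral_cong)
      fix y assume y: "y \<in> space (cspace T)"
      have [measurable]: "(\<lambda>x. \<lambda>i\<in>T. y i - F x i) \<in> measurable (cspace T) (cspace T)"
      proof -
        have [measurable]: "(\<lambda>p. F p i) \<in> borel_measurable (cspace T)" if "i \<in> T" for i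
          using measurable_compose[OF F measurable_component_singleton[OF that]] by simp
        show ?thesis by (intro measurable_restrict) measurable
      qed
      \<comment> \<open>\<open>g\<close> is even, so the argument y - F x may be turned into F x +
        (- y), to which \<open>shift\<close> applies.\<close>
      have sym: "g (\<lambda>i\<in>T. y i - F x i) = g (\<lambda>i\<in>T. F x i + (\<lambda>i\<in>T. - y i) i)" for x
        unfolding g_def by (intro arg_cong[where f=ennreal] arg_cong[where f=exp] arg_cong[where f=uminus] sum.cong)
          (auto simp: norm_minus_commute)
      have "(\<integral>\<^sup>+x. f y * g (\<lambda>i\<in>T. y i - F x i) \<partial>cspace T) = f y * (\<integral>\<^sup>+x. g (\<lambda>i\<in>T. y i - F x i) \<partial>cspace T)"
        by (rule nn_integral_cmult) measurable
      also have "(\<integral>\<^sup>+x. g (\<lambda>i\<in>T. y i - F x i) \<partial>cspace T) = (\<integral>\<^sup>+x. g (F x) \<partial>cspace T)"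
        unfolding sym by (rule shift) (use y in auto)
      also have "\<dots> = (\<integral>\<^sup>+x. g x \<partial>cspace T)"
        by (intro nn_integral_cong) (simp add: g_def norm)
      finally show "(\<integral>\<^sup>+x. f y * g (\<lambda>i\<in>T. y i - F x i) \<partial>cspace T) = f y * ennreal (pi ^ card T)"
        by (simp only: gint)
    qed
    also have "\<dots> = (\<integral>\<^sup>+x. f x \<partial>cspace T) * ennreal (pi ^ card T)"
      by (rule nn_integral_multc) measurable
    finally show ?thesis
      unfolding mult_right_ennreal_cancel by (metis not_le pi_gt_zero zero_less_power)
  qed
  show ?thesis
  proof (rule measure_eqI)
    fix A assume "A \<in> sets (distr (cspace T) (cspace T) F)"
    then have A[measurable]: "A \<in> sets (cspace T)" by simp
    have "emeasure (distr (cspace T) (cspace T) F) A = (\<integral>\<^sup>+x. indicator A x \<partial>distr (cspace T) (cspace T) F)"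
      by (rule nn_integral_indicator[symmetric]) simp
    also have "\<dots> = (\<integral>\<^sup>+x. indicator A (F x) \<partial>cspace T)"
      by (rule nn_integral_distr) auto
    also have "\<dots> = (\<integral>\<^sup>+x. indicator A x \<partial>cspace T)" by (rule key) measurable
    also have "\<dots> = emeasure (cspace T) A"
      by (rule nn_integral_indicator) simp
    finally show "emeasure (distr (cspace T) (cspace T) F) A = emeasure (cspace T) A" .
  qed simp
qed

section \<open>Fourier modes on the torus\<close>

definition zdot :: "int ^ 'd \<Rightarrow> int ^ 'd \<Rightarrow> int" where
  "zdot k x = (\<Sum>i\<in>UNIV. k $ i * x $ i)"

text \<open>The characters of the torus, normalised to be orthonormal. The expression is symmetric
  in frequency and position, so orthonormality in one of them is also completeness in the
  other.\<close>

definition fmode :: "nat \<Rightarrow> int ^ 'd \<Rightarrow> int ^ 'd \<Rightarrow> complex" where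
  "fmode n k x = cis (2 * pi * real_of_int (zdot k x) / real n) / complex_of_real (sqrt (real (n ^ CARD('d))))"

lemma zdot_commute: "zdot k x = zdot x k"
  by (simp add: zdot_def mult.commute)

lemma zdot_add_right: "zdot k (x + y) = zdot k x + zdot k y"
  by (simp add: zdot_def sum.distrib algebra_simps)

lemma zdot_axis_right: "zdot k (axis i 1) = k $ i"
proof -
  have "zdot k (axis i 1) = (\<Sum>j\<in>UNIV. if j = i then k $ j else 0)"
    unfolding zdot_def by (intro sum.cong) (auto simp: axis_def)
  then show ?thesis by simp
qed

lemma fmode_commute: "fmode n k x = fmode n x k"
  by (simp add: fmode_def zdot_commute)

lemma cis_int_multiple: "cis (2 * pi * real_of_int m) = 1"
  by (metis cis_multiple_2pi Ints_of_int)

lemma cis_zdot_cong: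
  assumes "n > 0" "\<And>i. (x $ i) mod int n = (y $ i) mod int n"
  shows "cis (2 * pi * real_of_int (zdot k x) / real n) = cis (2 * pi * real_of_int (zdot k y) / real n)"
proof -
  have "int n dvd k $ i * (x $ i - y $ i)" for i
    using assms(2)[of i] by (intro dvd_mult) (simp add: mod_eq_dvd_iff)
  then have "int n dvd (\<Sum>i\<in>UNIV. k $ i * (x $ i - y $ i))"
    by (intro dvd_sum) auto
  also have "(\<Sum>i\<in>UNIV. k $ i * (x $ i - y $ i)) = zdot k x - zdot k y"
    by (simp add: zdot_def sum_subtractf right_diff_distrib)
  finally obtain q where "zdot k x = zdot k y + int n * q"
    by (metis dvdE add.commute diff_add_cancel)
  then have "2 * pi * real_of_int (zdot k x) / real n = 2 * pi * real_of_int (zdot k y) / real n + 2 * pi * real_of_int q"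
    using assms(1) by (simp add: field_simps)
  then show ?thesis by (simp add: cis_mult[symmetric] cis_int_multiple)
qed

lemma fmode_cong:
  assumes "n > 0" "\<And>i. (x $ i) mod int n = (y $ i) mod int n"
  shows "fmode n k x = fmode n k y"
  unfolding fmode_def by (simp only: cis_zdot_cong[OF assms])

lemma fmode_reduce: "n > 0 \<Longrightarrow> fmode n k (reduce n x) = fmode n k x"
  by (rule fmode_cong) (auto simp: reduce_def)

lemma fmode_add: "fmode n k (x + h) = fmode n k x * cis (2 * pi * real_of_int (zdot k h) / real n)"
  by (simp add: fmode_def zdot_add_right cis_mult add_divide_distrib algebra_simps)

lemma torus_eq_image: "(torus n :: (int ^ 'd) set) = vec_lambda ` (PiE UNIV (\<lambda>_. {0..<int n}))"
proof (intro set_eqI iffI)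
  fix x :: "int ^ 'd" assume "x \<in> torus n"
  then have "vec_nth x \<in> PiE UNIV (\<lambda>_. {0..<int n})" by (auto simp: torus_def)
  then show "x \<in> vec_lambda ` (PiE UNIV (\<lambda>_. {0..<int n}))"
    by (metis image_eqI vec_nth_inverse)
qed (auto simp: torus_def PiE_iff)

lemma finite_torus [simp]: "finite (torus n)"
  unfolding torus_eq_image by (intro finite_imageI finite_PiE) auto

lemma card_torus: "card (torus n :: (int ^ 'd) set) = n ^ CARD('d)"
proof -
  have "inj_on vec_lambda (PiE (UNIV :: 'd set) (\<lambda>_. {0..<int n}))"
    by (intro inj_onI) (simp add: vec_lambda_inject)
  then show ?thesis
    unfolding torus_eq_image by (simp add: card_image card_PiE)
qed

lemma reduce_in_torus: "n > 0 \<Longrightarrow> reduce n x \<in> torus n"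
  by (simp add: torus_def reduce_def)

lemma reduce_torus: "x \<in> torus n \<Longrightarrow> reduce n x = x"
  by (simp add: torus_def reduce_def vec_eq_iff)

lemma reduce_eq_iff: "reduce n x = reduce n y \<longleftrightarrow> (\<forall>i. (x $ i) mod int n = (y $ i) mod int n)"
  by (simp add: reduce_def vec_eq_iff)

lemma reduce_reduce_add: "reduce n (reduce n x + h) = reduce n (x + h)"
  by (simp add: reduce_def vec_eq_iff mod_add_left_eq)

lemma bij_betw_torus_shift:
  assumes "n > 0"
  shows "bij_betw (\<lambda>x. reduce n (x + h)) (torus n) (torus n)"
proof (rule bij_betwI[where g = "\<lambda>x. reduce n (x - h)"])
  have *: "reduce n (reduce n (x + h) + - h) = x" if "x \<in> torus n" for x h
    unfolding reduce_reduce_add using that by (simp add: reduce_torus)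
  show "reduce n (reduce n (x + h) - h) = x" if "x \<in> torus n" for x
    using *[OF that, of h] by simp
  show "reduce n (reduce n (x - h) + h) = x" if "x \<in> torus n" for x
    using *[OF that, of "- h"] by simp
qed (use assms in \<open>auto intro: reduce_in_torus\<close>)

lemma sum_torus_shift:
  assumes "n > 0"
  shows "(\<Sum>x\<in>torus n. f (reduce n (x + h))) = (\<Sum>x\<in>torus n. f x)"
  by (rule sum.reindex_bij_betw[OF bij_betw_torus_shift[OF assms]])

lemma cis_eq_1_imp:
  assumes "n > 0" "cis (2 * pi * real_of_int m / real n) = 1"
  shows "int n dvd m"
proof -
  have "cos (2 * pi * real_of_int m / real n) = 1"
    using assms(2) by (metis cis.simps(1) one_complex.simps(1))
  then obtain q :: int where "2 * pi * real_of_int m / real n = real_of_int q * 2 * pi"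
    by (auto simp: cos_one_2pi_int)
  then have "real_of_int m = real_of_int (q * int n)" using assms(1) by (simp add: field_simps)
  then have "m = q * int n" by (simp only: of_int_eq_iff)
  then show ?thesis by simp
qed

text \<open>If some coordinate of k is not divisible by n, shifting x by that unit vector permutes
  the torus and multiplies the sum by a root of unity different from 1; so the sum vanishes.\<close>

lemma sum_cis_torus:
  fixes k :: "int ^ 'd"
  assumes "n > 0"
  shows "(\<Sum>x\<in>torus n. cis (2 * pi * real_of_int (zdot k x) / real n)) =
    (if (\<forall>i. int n dvd k $ i) then of_nat (n ^ CARD('d)) else 0)"
proof (cases "\<forall>i. int n dvd k $ i")
  case True
  have "cis (2 * pi * real_of_int (zdot k x) / real n) = 1" for x
  proof -
    have "int n dvd zdot k x" unfolding zdot_def using True by (intro dvd_sum) auto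
    then obtain q where q: "zdot k x = int n * q" by auto
    have "2 * pi * real_of_int (zdot k x) / real n = 2 * pi * real_of_int q"
      using assms by (simp add: q)
    then show ?thesis by (simp only: cis_int_multiple)
  qed
  then show ?thesis using True by (simp add: card_torus)
next
  case False
  then obtain i where i: "\<not> int n dvd k $ i" by auto
  define \<omega> where "\<omega> = cis (2 * pi * real_of_int (k $ i) / real n)"
  have \<omega>: "\<omega> \<noteq> 1" using cis_eq_1_imp[OF assms] i unfolding \<omega>_def by blast
  let ?f = "\<lambda>x. cis (2 * pi * real_of_int (zdot k x) / real n)"
  have "(\<Sum>x\<in>torus n. ?f x) = (\<Sum>x\<in>torus n. ?f (reduce n (x + axis i 1)))"
    by (rule sum_torus_shift[OF assms, symmetric])
  also have "\<dots> = (\<Sum>x\<in>torus n. \<omega> * ?f x)"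
  proof (intro sum.cong refl)
    fix x :: "int ^ 'd"
    have "?f (reduce n (x + axis i 1)) = ?f (x + axis i 1)"
      by (rule cis_zdot_cong[OF assms]) (simp add: reduce_def)
    also have "\<dots> = \<omega> * ?f x"
      by (simp add: \<omega>_def zdot_add_right zdot_axis_right cis_mult add_divide_distrib algebra_simps)
    finally show "?f (reduce n (x + axis i 1)) = \<omega> * ?f x" .
  qed
  also have "\<dots> = \<omega> * (\<Sum>x\<in>torus n. ?f x)" by (simp add: sum_distrib_left)
  finally have "(1 - \<omega>) * (\<Sum>x\<in>torus n. ?f x) = 0" by (simp add: algebra_simps)
  then show ?thesis using \<omega> False unfolding if_not_P[OF False] by simp
qed

lemma torus_dvd_diff:
  assumes "k \<in> torus n" "l \<in> torus n"
  shows "(\<forall>i. int n dvd (k - l) $ i) \<longleftrightarrow> k = l"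
proof
  assume *: "\<forall>i. int n dvd (k - l) $ i"
  show "k = l"
  proof (rule vec_eq_iff[THEN iffD2], rule allI)
    fix i
    have "k $ i mod int n = l $ i mod int n" using * by (simp add: mod_eq_dvd_iff)
    then show "k $ i = l $ i" using assms by (simp add: torus_def)
  qed
qed simp

lemma fmode_orthonormal:
  assumes "n > 0" "k \<in> torus n" "l \<in> torus n"
  shows "(\<Sum>x\<in>torus n. fmode n k x * cnj (fmode n l x)) = (if k = l then 1 else 0)"
proof -
  let ?N = "real (n ^ CARD('a))"
  have N: "?N > 0" using assms(1) by simp
  have "fmode n k x * cnj (fmode n l x) = cis (2 * pi * real_of_int (zdot (k - l) x) / real n) / of_real ?N" for x
  proof -
    have z: "zdot (k - l) x = zdot k x - zdot l x"
      by (simp add: zdot_def sum_subtractf algebra_simps)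
    have s: "complex_of_real (sqrt ?N) * complex_of_real (sqrt ?N) = of_real ?N"
      using N by (simp flip: of_real_mult)
    have "fmode n k x * cnj (fmode n l x) =
       cis (2 * pi * real_of_int (zdot k x) / real n) * cis (- (2 * pi * real_of_int (zdot l x) / real n)) / of_real ?N"
      unfolding fmode_def s[symmetric] by (simp add: cis_cnj)
    also have "\<dots> = cis (2 * pi * real_of_int (zdot (k - l) x) / real n) / of_real ?N"
      by (simp add: cis_mult z diff_divide_distrib algebra_simps)
    finally show ?thesis .
  qed
  then have "(\<Sum>x\<in>torus n. fmode n k x * cnj (fmode n l x)) =
     (\<Sum>x\<in>torus n. cis (2 * pi * real_of_int (zdot (k - l) x) / real n)) / of_real ?N"
    by (simp add: sum_divide_distrib)
  then show ?thesis
    using assms torus_dvd_diff[OF assms(2,3)] N by (simp add: sum_cis_torus)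
qed

section \<open>The unitary transform\<close>

definition fourier :: "nat \<Rightarrow> (int ^ 'd \<Rightarrow> complex) \<Rightarrow> int ^ 'd \<Rightarrow> complex" where
  "fourier n a = (\<lambda>x\<in>torus n. \<Sum>k\<in>torus n. a k * fmode n k x)"

lemma parseval:
  assumes "n > 0"
  shows "(\<Sum>x\<in>torus n. (cmod (\<Sum>k\<in>torus n. b k * fmode n k x))\<^sup>2) = (\<Sum>k\<in>torus n. (cmod (b k))\<^sup>2)"
proof -
  have "complex_of_real (\<Sum>x\<in>torus n. (cmod (\<Sum>k\<in>torus n. b k * fmode n k x))\<^sup>2) =
     (\<Sum>x\<in>torus n. (\<Sum>k\<in>torus n. b k * fmode n k x) * cnj (\<Sum>l\<in>torus n. b l * fmode n l x))"
    by (simp add: complex_norm_square[symmetric] del: cnj_sum)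
  also have "\<dots> = (\<Sum>x\<in>torus n. \<Sum>k\<in>torus n. \<Sum>l\<in>torus n. b k * cnj (b l) * (fmode n k x * cnj (fmode n l x)))"
    by (simp add: sum_product mult_ac)
  also have "\<dots> = (\<Sum>k\<in>torus n. \<Sum>l\<in>torus n. b k * cnj (b l) * (\<Sum>x\<in>torus n. fmode n k x * cnj (fmode n l x)))"
    unfolding sum_distrib_left
    by (subst sum.swap, rule sum.cong[OF refl], rule sum.swap)
  also have "\<dots> = (\<Sum>k\<in>torus n. \<Sum>l\<in>torus n. if k = l then b k * cnj (b l) else 0)"
    by (intro sum.cong refl) (simp add: fmode_orthonormal[OF assms])
  also have "\<dots> = complex_of_real (\<Sum>k\<in>torus n. (cmod (b k))\<^sup>2)"
    by (simp add: complex_norm_square del: of_real_power)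
  finally show ?thesis by (simp only: of_real_eq_iff)
qed

lemma norm2_sq_fourier: "n > 0 \<Longrightarrow> norm2_sq n (fourier n a) = norm2_sq n a"
  unfolding norm2_sq_def fourier_def by (simp add: parseval)

text \<open>The preimage is the conjugate transform; that it inverts \<open>fourier\<close> is
  orthonormality with the roles of position and frequency exchanged.\<close>

lemma fourier_surj:
  assumes "n > 0" "\<psi> \<in> PiE (torus n) (\<lambda>_. UNIV)"
  shows "\<exists>a\<in>PiE (torus n) (\<lambda>_. UNIV). fourier n a = \<psi>"
proof
  define a where "a = (\<lambda>k\<in>torus n. \<Sum>y\<in>torus n. \<psi> y * cnj (fmode n y k))"
  show "a \<in> PiE (torus n) (\<lambda>_. UNIV)" by (simp add: a_def)
  have "(\<Sum>k\<in>torus n. a k * fmode n k x) = \<psi> x" if x: "x \<in> torus n" for x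
  proof -
    have "(\<Sum>k\<in>torus n. a k * fmode n k x) =
       (\<Sum>k\<in>torus n. \<Sum>y\<in>torus n. \<psi> y * (fmode n x k * cnj (fmode n y k)))"
      by (intro sum.cong refl)
        (simp add: a_def sum_distrib_left sum_distrib_right mult_ac fmode_commute[of n x])
    also have "\<dots> = (\<Sum>y\<in>torus n. \<psi> y * (\<Sum>k\<in>torus n. fmode n x k * cnj (fmode n y k)))"
      by (subst sum.swap) (simp add: sum_distrib_left)
    also have "\<dots> = (\<Sum>y\<in>torus n. if y = x then \<psi> y else 0)"
      by (intro sum.cong refl) (auto simp: fmode_orthonormal[OF assms(1) x])
    finally show ?thesis using x by simp
  qed
  then show "fourier n a = \<psi>"
    using assms(2) by (auto simp: fourier_def fun_eq_iff PiE_iff extensional_def)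
qed

text \<open>The eigenvalue of the graph Laplacian of the torus on the mode
  \<open>fmode n k\<close>.\<close>

definition eigval :: "nat \<Rightarrow> int ^ 'd \<Rightarrow> real" where
  "eigval n k = 4 * (\<Sum>i\<in>UNIV. (sin (pi * (real_of_int (k $ i) / real n)))\<^sup>2)"

lemma cmod_cis_minus_1: "(cmod (cis (2 * t) - 1))\<^sup>2 = 4 * (sin t)\<^sup>2"
proof -
  have "(cmod (cis (2 * t) - 1))\<^sup>2 = (cos (2 * t) - 1)\<^sup>2 + (sin (2 * t))\<^sup>2"
    by (simp add: cmod_power2)
  also have "\<dots> = 2 - 2 * cos (2 * t)"
    using sin_cos_squared_add[of "2 * t"] by (simp add: power2_eq_square algebra_simps)
  also have "\<dots> = 4 * (sin t)\<^sup>2" by (simp add: cos_double_sin)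
  finally show ?thesis .
qed

text \<open>For n \<ge> 3 the 2d neighbours in the torus are distinct. For n = 2 the steps +1 and -1
  reach the same site, and the set of edges would count each direction only once.\<close>

lemma neighbour_cases:
  assumes "n \<ge> 3"
  shows "inj_on (\<lambda>(i, s). reduce n (x + axis i s)) (UNIV \<times> {1, -1})"
proof (intro inj_onI, clarify)
  fix i j :: 'a and s t :: int
  assume st: "s \<in> {1, -1}" "t \<in> {1, -1}" and eq: "reduce n (x + axis i s) = reduce n (x + axis j t)"
  have d: "int n dvd (axis i s - axis j t) $ l" for l
  proof -
    have "(x + axis i s) $ l mod int n = (x + axis j t) $ l mod int n"
      using eq unfolding reduce_eq_iff by blast
    then show ?thesis by (simp add: mod_eq_dvd_iff)
  qed
  have small: "z = 0" if "int n dvd z" "\<bar>z\<bar> \<le> 2" for z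
    using that assms zdvd_not_zless[of "\<bar>z\<bar>" "int n"] by (cases "z = 0") auto
  have z: "(axis i s - axis j t) $ l = 0" for l
    by (rule small[OF d]) (use st in \<open>auto simp: axis_def\<close>)
  have "i = j"
    using z[of i] st by (auto simp: axis_def split: if_splits)
  then show "i = j \<and> s = t"
    using z[of i] by (auto simp: axis_def)
qed

text \<open>Ordered adjacent pairs are forward and backward steps in each direction, with equal
  contributions. A forward difference multiplies the k-th coefficient by a root of unity minus 1, so
  Parseval diagonalises the energy.\<close>

lemma grad_sq_fourier:
  fixes a :: "int ^ 'd \<Rightarrow> complex"
  assumes n: "n \<ge> 3"
  shows "grad_sq n (fourier n a) = (\<Sum>k\<in>torus n. eigval n k * (cmod (a k))\<^sup>2)"
proof -
  have n0: "n > 0" using n by simp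
  let ?\<psi> = "fourier n a"
  define g where "g i = (\<Sum>x\<in>torus n. (cmod (?\<psi> x - ?\<psi> (reduce n (x + axis i 1))))\<^sup>2)" for i :: 'd
  have pairs: "{(x, y). torus_adj n x y} = Sigma (torus n) (\<lambda>x. (\<lambda>(i :: 'd, s). reduce n (x + axis i s)) ` (UNIV \<times> {1, -1}))"
    (is "_ = Sigma _ ?nb")
  proof -
    have "reduce n ` neighbours x = ?nb x" for x :: "int ^ 'd"
    proof -
      have "neighbours x = (\<lambda>(i, s). x + axis i s) ` (UNIV \<times> {1, -1})"
      proof -
        have "axis i (- 1) = - axis i (1 :: int)" for i :: 'd by (simp add: vec_eq_iff axis_def)
        then show ?thesis by (auto simp: neighbours_def image_iff)
      qed
      then show ?thesis by (simp add: image_image case_prod_unfold)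
    qed
    then show ?thesis by (auto simp: torus_adj_def reduce_in_torus n0)
  qed
  have "2 * grad_sq n ?\<psi> = (\<Sum>x\<in>torus n. \<Sum>y\<in>?nb x. (cmod (?\<psi> x - ?\<psi> y))\<^sup>2)"
    unfolding grad_sq_def pairs by (subst sum.Sigma) auto
  also have "\<dots> = (\<Sum>x\<in>torus n. \<Sum>(i, s)\<in>UNIV \<times> {1, -1}. (cmod (?\<psi> x - ?\<psi> (reduce n (x + axis i s))))\<^sup>2)"
    by (intro sum.cong refl, subst sum.reindex[OF neighbour_cases[OF n]]) (simp add: case_prod_unfold)
  also have "\<dots> = (\<Sum>x\<in>torus n. \<Sum>i\<in>UNIV. (cmod (?\<psi> x - ?\<psi> (reduce n (x + axis i 1))))\<^sup>2 +
      (cmod (?\<psi> x - ?\<psi> (reduce n (x + axis i (- 1)))))\<^sup>2)"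
    by (intro sum.cong refl) (simp flip: sum.cartesian_product)
  also have "\<dots> = (\<Sum>i\<in>UNIV. g i) +
      (\<Sum>i\<in>UNIV. \<Sum>x\<in>torus n. (cmod (?\<psi> x - ?\<psi> (reduce n (x + axis i (- 1)))))\<^sup>2)"
    unfolding g_def by (simp add: sum.distrib sum.swap[of _ "torus n"])
  finally have G2: "2 * grad_sq n ?\<psi> = (\<Sum>i\<in>UNIV. g i) +
      (\<Sum>i\<in>UNIV. \<Sum>x\<in>torus n. (cmod (?\<psi> x - ?\<psi> (reduce n (x + axis i (- 1)))))\<^sup>2)" .
  \<comment> \<open>The substitution x := x + e_i turns backward differences into forward
    ones.\<close>
  have bwd: "(\<Sum>x\<in>torus n. (cmod (?\<psi> x - ?\<psi> (reduce n (x + axis i (- 1)))))\<^sup>2) = g i" for i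
  proof -
    have "(\<Sum>x\<in>torus n. (cmod (?\<psi> x - ?\<psi> (reduce n (x + axis i (- 1)))))\<^sup>2) =
      (\<Sum>x\<in>torus n. (cmod (?\<psi> (reduce n (x + axis i 1)) - ?\<psi> (reduce n (reduce n (x + axis i 1) + axis i (- 1)))))\<^sup>2)"
      by (rule sum_torus_shift[OF n0, symmetric])
    also have "\<dots> = g i"
      unfolding g_def
    proof (intro sum.cong refl)
      fix x :: "int ^ 'd" assume x: "x \<in> torus n"
      have "axis i 1 + axis i (- 1) = (0 :: int ^ 'd)" by (simp add: vec_eq_iff axis_def)
      then have "reduce n (reduce n (x + axis i 1) + axis i (- 1)) = x"
        unfolding reduce_reduce_add using x by (simp add: add.assoc reduce_torus)
      then show "(cmod (?\<psi> (reduce n (x + axis i 1)) - ?\<psi> (reduce n (reduce n (x + axis i 1) + axis i (- 1)))))\<^sup>2 =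
          (cmod (?\<psi> x - ?\<psi> (reduce n (x + axis i 1))))\<^sup>2"
        by (simp add: norm_minus_commute)
    qed
    finally show ?thesis .
  qed
  have G: "grad_sq n ?\<psi> = (\<Sum>i\<in>UNIV. g i)" using G2 unfolding bwd by simp
  have "g i = (\<Sum>k\<in>torus n. 4 * (sin (pi * (real_of_int (k $ i) / real n)))\<^sup>2 * (cmod (a k))\<^sup>2)" for i
  proof -
    let ?z = "\<lambda>k :: int ^ 'd. cis (2 * (pi * (real_of_int (k $ i) / real n)))"
    have "g i = (\<Sum>x\<in>torus n. (cmod (\<Sum>k\<in>torus n. (a k * (?z k - 1)) * fmode n k x))\<^sup>2)"
      unfolding g_def
    proof (intro sum.cong refl)
      fix x :: "int ^ 'd" assume x: "x \<in> torus n"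
      have "fmode n k (reduce n (x + axis i 1)) = fmode n k x * ?z k" for k
        by (simp add: fmode_reduce[OF n0] fmode_add zdot_axis_right mult.assoc)
      then have "?\<psi> (reduce n (x + axis i 1)) - ?\<psi> x = (\<Sum>k\<in>torus n. (a k * (?z k - 1)) * fmode n k x)"
        using x by (simp add: fourier_def reduce_in_torus n0 algebra_simps sum_subtractf)
      then show "(cmod (?\<psi> x - ?\<psi> (reduce n (x + axis i 1))))\<^sup>2 = (cmod (\<Sum>k\<in>torus n. (a k * (?z k - 1)) * fmode n k x))\<^sup>2"
        by (metis norm_minus_commute)
    qed
    also have "\<dots> = (\<Sum>k\<in>torus n. (cmod (a k * (?z k - 1)))\<^sup>2)" by (rule parseval[OF n0])
    finally show ?thesis
      unfolding norm_mult power_mult_distrib cmod_cis_minus_1 by (simp add: mult_ac)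
  qed
  then show ?thesis
    unfolding G eigval_def by (simp add: sum_distrib_left sum_distrib_right sum.swap[of _ UNIV])
qed

section \<open>Concentration and Gaussian approximation\<close>

text \<open>If z has density proportional to exp (- c |z|^2), then c |z|^2 is standard exponential,
  with moment generating function 1 / (1 - x). This is the second-order bound on it: mean term x,
  variance term 2 x^2.\<close>

lemma inverse_one_minus_le_exp:
  fixes x :: real
  assumes "\<bar>x\<bar> \<le> 1/2"
  shows "1 / (1 - x) \<le> exp (x + 2 * x\<^sup>2)"
proof -
  have "\<bar>ln (1 + - x) - (- x)\<bar> \<le> 2 * (- x)\<^sup>2"
    using assms by (intro abs_ln_one_plus_x_minus_x_bound) auto
  then have "- ln (1 - x) \<le> x + 2 * x\<^sup>2" by simp
  then have "exp (- ln (1 - x)) \<le> exp (x + 2 * x\<^sup>2)" by simp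
  then show ?thesis using assms by (simp add: exp_minus field_simps)
qed

lemma exp_minus_bounds:
  fixes y :: real
  assumes "y \<ge> 0"
  shows "\<bar>exp (- y) - (1 - y)\<bar> \<le> y\<^sup>2 / 2"
proof -
  have 1: "1 - y \<le> exp (- y)" using exp_ge_add_one_self[of "- y"] by simp
  \<comment> \<open>The quadratic Taylor polynomials at y and -y have a product of at least 1, so
    the lower bound for exp y yields an upper bound for exp (- y).\<close>
  have "(1 - y + y\<^sup>2 / 2) * (1 + y + y\<^sup>2 / 2) = 1 + (y\<^sup>2)\<^sup>2 / 4"
    by (simp add: algebra_simps power2_eq_square)
  then have "1 \<le> (1 - y + y\<^sup>2 / 2) * (1 + y + y\<^sup>2 / 2)" by simp
  also have "\<dots> \<le> (1 - y + y\<^sup>2 / 2) * exp y"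
  proof (rule mult_left_mono[OF exp_lower_Taylor_quadratic[OF assms]])
    have "0 \<le> (1 - y)\<^sup>2 + 1" by simp
    then show "0 \<le> 1 - y + y\<^sup>2 / 2" by (simp add: power2_eq_square algebra_simps)
  qed
  finally have "exp (- y) \<le> 1 - y + y\<^sup>2 / 2" by (simp add: exp_minus field_simps)
  with 1 show ?thesis by simp
qed

lemma cos_approx_quadratic: "\<bar>cos x - (1 - x\<^sup>2 / 2)\<bar> \<le> x ^ 4 / (24 :: real)"
proof -
  \<comment> \<open>The cubic Taylor term of exp (i x) is imaginary, so the real part of this
    remainder has the quadratic approximation of the cosine and an error of order four.\<close>
  define E where "E = iexp x - (\<Sum>k\<le>3. (\<i> * complex_of_real x) ^ k / fact k)"
  have "\<bar>Re E\<bar> \<le> cmod E" by (rule abs_Re_le_cmod)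
  also have "cmod E \<le> \<bar>x\<bar> ^ Suc 3 / fact (Suc 3)" unfolding E_def by (rule iexp_approx1)
  also have "\<dots> = x ^ 4 / 24" by (simp add: fact_numeral)
  also have "Re E = cos x - (1 - x\<^sup>2 / 2)"
    by (simp add: E_def numeral_3_eq_3 Re_exp fact_numeral power2_eq_square algebra_simps)
  finally show ?thesis .
qed

text \<open>The left-hand expression is the mean of exp (i Re z) over the four quarter turns of z.
  Odd orders cancel and the second-order term becomes |z|^2 / 4, so mean and exponential agree up to
  fourth order.\<close>

lemma four_phase_average_approx:
  "\<bar>(cos (Re z) + cos (Im z)) / 2 - exp (- (cmod z)\<^sup>2 / 4)\<bar> \<le> (cmod z) ^ 4"
proof -
  define u v where "u = Re z" and "v = Im z"
  have z2: "(cmod z)\<^sup>2 = u\<^sup>2 + v\<^sup>2" by (simp add: cmod_power2 u_def v_def)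
  have z4: "(cmod z) ^ 4 = (u\<^sup>2 + v\<^sup>2)\<^sup>2"
    using z2 by (metis power_mult mult_2_right numeral_Bit0)
  have e: "\<bar>exp (- ((u\<^sup>2 + v\<^sup>2) / 4)) - (1 - (u\<^sup>2 + v\<^sup>2) / 4)\<bar> \<le> (u\<^sup>2 + v\<^sup>2)\<^sup>2 / 32"
    using exp_minus_bounds[of "(u\<^sup>2 + v\<^sup>2) / 4"] by (simp add: power_divide)
  have uv: "u ^ 4 + v ^ 4 \<le> (u\<^sup>2 + v\<^sup>2)\<^sup>2"
  proof -
    have "(u\<^sup>2 + v\<^sup>2)\<^sup>2 = u ^ 4 + v ^ 4 + 2 * (u\<^sup>2 * v\<^sup>2)"
      by (simp add: power2_eq_square algebra_simps eval_nat_numeral)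
    then show ?thesis by simp
  qed
  define W where "W = (u\<^sup>2 + v\<^sup>2)\<^sup>2"
  define A B E where "A = cos u - (1 - u\<^sup>2 / 2)" and "B = cos v - (1 - v\<^sup>2 / 2)"
    and "E = exp (- ((u\<^sup>2 + v\<^sup>2) / 4)) - (1 - (u\<^sup>2 + v\<^sup>2) / 4)"
  have arith: "\<bar>(A + B) / 2 - E\<bar> \<le> W"
    if "\<bar>A\<bar> \<le> U / 24" "\<bar>B\<bar> \<le> V / 24" "\<bar>E\<bar> \<le> W / 32" "0 \<le> W" "U + V \<le> W" for A B E U V W :: real
  proof -
    have "A \<le> U / 24" "- A \<le> U / 24" "B \<le> V / 24" "- B \<le> V / 24" "E \<le> W / 32" "- E \<le> W / 32"
      using that(1-3) by (simp_all only: abs_le_iff)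
    then have "(A + B) / 2 - E \<le> W" "- ((A + B) / 2 - E) \<le> W" using that(4,5) by (simp_all add: field_simps)
    then show ?thesis by (simp only: abs_le_iff)
  qed
  have eq: "(cos u + cos v) / 2 - exp (- ((u\<^sup>2 + v\<^sup>2) / 4)) = (A + B) / 2 - E"
    by (simp add: A_def B_def E_def field_simps)
  have "\<bar>A\<bar> \<le> u ^ 4 / 24" "\<bar>B\<bar> \<le> v ^ 4 / 24" "\<bar>E\<bar> \<le> W / 32"
    using cos_approx_quadratic e by (auto simp: A_def B_def E_def W_def)
  moreover have "0 \<le> W" "u ^ 4 + v ^ 4 \<le> W" using uv by (auto simp: W_def)
  ultimately have "\<bar>(cos u + cos v) / 2 - exp (- ((u\<^sup>2 + v\<^sup>2) / 4))\<bar> \<le> W"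
    unfolding eq by (intro arith)
  then have "\<bar>(cos u + cos v) / 2 - exp (- ((u\<^sup>2 + v\<^sup>2) / 4))\<bar> \<le> (u\<^sup>2 + v\<^sup>2)\<^sup>2"
    by (simp only: W_def)
  then show ?thesis unfolding z2 z4 minus_divide_left[symmetric] by (simp only: u_def v_def)
qed

text \<open>The joint Laplace transform of the squared moduli is at most \<open>\<kappa>\<close>
  times that of independent complex Gaussians with rates \<open>c\<close>. The constant
  \<open>\<kappa>\<close> is the price of a constraint that couples the modes; nothing else about
  the measure enters the concentration bounds.\<close>

definition exp_moment_bound :: "('i \<Rightarrow> complex) measure \<Rightarrow> 'i set \<Rightarrow> ('i \<Rightarrow> real) \<Rightarrow> real \<Rightarrow> bool" where
  "exp_moment_bound \<mu> K c \<kappa> \<longleftrightarrow> (\<forall>t. (\<forall>k\<in>K. t k < c k) \<longrightarrow>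
     (\<integral>\<^sup>+a. ennreal (exp (\<Sum>k\<in>K. t k * (cmod (a k))\<^sup>2)) \<partial>\<mu>) \<le> ennreal (\<kappa> * (\<Prod>k\<in>K. 1 / (1 - t k / c k))))"

lemma measurable_cspace_component:
  "k \<in> T \<Longrightarrow> (\<lambda>a. a k) \<in> borel_measurable (cspace T)"
  using measurable_component_singleton[of k T "\<lambda>_. lborel :: complex measure"] by simp

text \<open>The condition |t| q \<le> c / 2 keeps every factor within reach of the second-order
  bound, whose linear terms add up to t times the mean and cancel. \<open>t\<close> may have either
  sign, for the two tails.\<close>

lemma exp_moment_centered:
  fixes t :: real
  assumes K: "finite K" "K \<subseteq> T" and M: "sets \<mu> = sets (cspace T)" and H: "exp_moment_bound \<mu> K c \<kappa>"
    and c: "\<And>k. k \<in> K \<Longrightarrow> c k > 0" and q: "\<And>k. k \<in> K \<Longrightarrow> q k \<ge> 0"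
    and t: "\<And>k. k \<in> K \<Longrightarrow> \<bar>t\<bar> * q k \<le> c k / 2" and \<kappa>: "\<kappa> \<ge> 0"
  shows "(\<integral>\<^sup>+a. ennreal (exp (t * ((\<Sum>k\<in>K. q k * (cmod (a k))\<^sup>2) - (\<Sum>k\<in>K. q k / c k)))) \<partial>\<mu>) \<le>
    ennreal (\<kappa> * exp (2 * t\<^sup>2 * (\<Sum>k\<in>K. (q k / c k)\<^sup>2)))"
proof -
  let ?v = "\<Sum>k\<in>K. q k / c k"
  have [measurable_cong]: "sets \<mu> = sets (cspace T)" by fact
  have [measurable]: "(\<lambda>a. a k) \<in> borel_measurable (cspace T)" if "k \<in> K" for k
    using K that by (intro measurable_cspace_component) auto
  have tq: "\<bar>t * q k / c k\<bar> \<le> 1/2" if "k \<in> K" for k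
    using t[OF that] c[OF that] q[OF that] by (simp add: abs_mult field_simps)
  have "(\<integral>\<^sup>+a. ennreal (exp (t * ((\<Sum>k\<in>K. q k * (cmod (a k))\<^sup>2) - ?v))) \<partial>\<mu>) =
      (\<integral>\<^sup>+a. ennreal (exp (- t * ?v)) * ennreal (exp (\<Sum>k\<in>K. (t * q k) * (cmod (a k))\<^sup>2)) \<partial>\<mu>)"
    by (intro nn_integral_cong) (simp add: right_diff_distrib sum_distrib_left mult.assoc sum_negf flip: ennreal_mult exp_add)
  also have "\<dots> = ennreal (exp (- t * ?v)) * (\<integral>\<^sup>+a. ennreal (exp (\<Sum>k\<in>K. (t * q k) * (cmod (a k))\<^sup>2)) \<partial>\<mu>)"
    by (rule nn_integral_cmult) measurable
  also have "\<dots> \<le> ennreal (exp (- t * ?v)) * ennreal (\<kappa> * (\<Prod>k\<in>K. 1 / (1 - t * q k / c k)))"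
  proof (rule mult_left_mono)
    have "t * q k < c k" if "k \<in> K" for k
      using tq[OF that] c[OF that] by (simp add: abs_le_iff field_simps)
    then show "(\<integral>\<^sup>+a. ennreal (exp (\<Sum>k\<in>K. (t * q k) * (cmod (a k))\<^sup>2)) \<partial>\<mu>) \<le>
        ennreal (\<kappa> * (\<Prod>k\<in>K. 1 / (1 - t * q k / c k)))"
      using H[unfolded exp_moment_bound_def, rule_format, of "\<lambda>k. t * q k"] by simp
  qed simp
  also have "\<dots> \<le> ennreal (exp (- t * ?v)) * ennreal (\<kappa> * (\<Prod>k\<in>K. exp (t * q k / c k + 2 * (t * q k / c k)\<^sup>2)))"
  proof (intro mult_left_mono ennreal_leI \<kappa> prod_mono conjI)
    fix k assume "k \<in> K"
    show "1 / (1 - t * q k / c k) \<le> exp (t * q k / c k + 2 * (t * q k / c k)\<^sup>2)"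
      by (rule inverse_one_minus_le_exp[OF tq[OF \<open>k \<in> K\<close>]])
    have "t * q k / c k \<le> 1 / 2" using tq[OF \<open>k \<in> K\<close>] by (rule order_trans[OF abs_ge_self])
    then have "0 \<le> 1 - t * q k / c k" by linarith
    then show "0 \<le> 1 / (1 - t * q k / c k)" by (rule divide_nonneg_nonneg[OF zero_le_one])
  qed simp
  also have "\<dots> = ennreal (\<kappa> * exp (2 * t\<^sup>2 * (\<Sum>k\<in>K. (q k / c k)\<^sup>2)))"
  proof -
    have "(\<Prod>k\<in>K. exp (t * q k / c k + 2 * (t * q k / c k)\<^sup>2)) = exp (t * ?v + 2 * t\<^sup>2 * (\<Sum>k\<in>K. (q k / c k)\<^sup>2))"
      unfolding exp_sum[OF K(1), symmetric]
      by (simp add: sum.distrib sum_distrib_left power_mult_distrib power_divide mult.assoc)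
    then show ?thesis using \<kappa> by (simp add: exp_add exp_minus flip: ennreal_mult)
  qed
  finally show ?thesis .
qed

text \<open>Chernoff bound: the exponential moments at t and -t are added, one for each
  tail.\<close>

lemma quadratic_concentration_raw:
  assumes K: "finite K" "K \<subseteq> T" and M: "sets \<mu> = sets (cspace T)" and H: "exp_moment_bound \<mu> K c \<kappa>"
    and c: "\<And>k. k \<in> K \<Longrightarrow> c k > 0" and q: "\<And>k. k \<in> K \<Longrightarrow> q k \<ge> 0"
    and t: "\<And>k. k \<in> K \<Longrightarrow> t * q k \<le> c k / 2" "t \<ge> 0" and \<kappa>: "\<kappa> \<ge> 0"
  shows "emeasure \<mu> {a\<in>space \<mu>. \<bar>(\<Sum>k\<in>K. q k * (cmod (a k))\<^sup>2) - (\<Sum>k\<in>K. q k / c k)\<bar> \<ge> \<delta>} \<le>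
    ennreal (2 * \<kappa> * exp (2 * t\<^sup>2 * (\<Sum>k\<in>K. (q k / c k)\<^sup>2) - t * \<delta>))" (is "emeasure \<mu> ?B \<le> _")
proof -
  let ?D = "\<lambda>a. (\<Sum>k\<in>K. q k * (cmod (a k))\<^sup>2) - (\<Sum>k\<in>K. q k / c k)"
  let ?E = "exp (2 * t\<^sup>2 * (\<Sum>k\<in>K. (q k / c k)\<^sup>2))"
  have [measurable_cong]: "sets \<mu> = sets (cspace T)" by fact
  have [measurable]: "(\<lambda>a. a k) \<in> borel_measurable (cspace T)" if "k \<in> K" for k
    using K that by (intro measurable_cspace_component) auto
  have e: "(\<integral>\<^sup>+a. ennreal (exp (s * ?D a)) \<partial>\<mu>) \<le> ennreal (\<kappa> * ?E)" if "\<bar>s\<bar> = t" for s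
  proof -
    have "s\<^sup>2 = t\<^sup>2" using that by (metis power2_abs)
    then show ?thesis
      using exp_moment_centered[OF K M H c q _ \<kappa>, where t = s] t that by simp
  qed
  have "emeasure \<mu> ?B = (\<integral>\<^sup>+a. indicator ?B a \<partial>\<mu>)" by (rule nn_integral_indicator[symmetric]) measurable
  also have "\<dots> \<le> (\<integral>\<^sup>+a. ennreal (exp (- t * \<delta>)) * (ennreal (exp (t * ?D a)) + ennreal (exp (- t * ?D a))) \<partial>\<mu>)"
  proof (intro nn_integral_mono)
    fix a
    show "indicator ?B a \<le> ennreal (exp (- t * \<delta>)) * (ennreal (exp (t * ?D a)) + ennreal (exp (- t * ?D a)))"
    proof (cases "a \<in> ?B")
      case True
      have "1 \<le> exp (- t * \<delta>) * (exp (t * ?D a) + exp (- t * ?D a))"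
      proof (cases "?D a \<ge> \<delta>")
        case True
        then have "t * \<delta> \<le> t * ?D a" using t by (intro mult_left_mono) auto
        then have "1 \<le> exp (- t * \<delta> + t * ?D a)" by simp
        then show ?thesis unfolding exp_add distrib_left by (smt (verit) exp_gt_zero mult_pos_pos)
      next
        case False
        then have "- ?D a \<ge> \<delta>" using True by auto
        then have "t * \<delta> \<le> t * - ?D a" using t by (intro mult_left_mono) auto
        then have "1 \<le> exp (- t * \<delta> + t * - ?D a)" by simp
        also have "t * - ?D a = - t * ?D a" by (simp only: mult_minus_left mult_minus_right)
        finally have "1 \<le> exp (- t * \<delta> + - t * ?D a)" .
        then show ?thesis unfolding exp_add distrib_left by (smt (verit) exp_gt_zero mult_pos_pos)
      qed
      then have "ennreal 1 \<le> ennreal (exp (- t * \<delta>) * (exp (t * ?D a) + exp (- t * ?D a)))"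
        by (rule ennreal_leI)
      then show ?thesis using True by (simp add: ennreal_mult ennreal_plus)
    qed simp
  qed
  also have "\<dots> = ennreal (exp (- t * \<delta>)) * ((\<integral>\<^sup>+a. ennreal (exp (t * ?D a)) \<partial>\<mu>) + (\<integral>\<^sup>+a. ennreal (exp (- t * ?D a)) \<partial>\<mu>))"
    by (subst nn_integral_cmult, measurable, subst nn_integral_add, auto)
  also have "\<dots> \<le> ennreal (exp (- t * \<delta>)) * (ennreal (\<kappa> * ?E) + ennreal (\<kappa> * ?E))"
    by (intro mult_left_mono add_mono e) (use t in auto)
  also have "\<dots> = ennreal (2 * \<kappa> * exp (2 * t\<^sup>2 * (\<Sum>k\<in>K. (q k / c k)\<^sup>2) - t * \<delta>))"
    using \<kappa> by (simp add: exp_diff exp_minus field_simps flip: ennreal_mult ennreal_plus)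
  finally show ?thesis .
qed

text \<open>One factor 1 / c is bounded by 1 / \<gamma> and the other is summed, so the variance
  term is at most B^2 / (\<gamma> N). The exponent is thus linear in N with a constant governed by
  the smallest rate \<gamma>.\<close>

lemma quadratic_concentration:
  assumes K: "finite K" "K \<subseteq> T" and M: "sets \<mu> = sets (cspace T)" and H: "exp_moment_bound \<mu> K c \<kappa>"
    and \<gamma>: "\<gamma> > 0" "\<And>k. k \<in> K \<Longrightarrow> \<gamma> \<le> c k" and q: "\<And>k. k \<in> K \<Longrightarrow> 0 \<le> q k" "\<And>k. k \<in> K \<Longrightarrow> q k \<le> B / N"
    and N: "N > 0" "(\<Sum>k\<in>K. 1 / c k) \<le> N" and B: "B \<ge> 1" and \<delta>: "0 < \<delta>" "\<delta> \<le> 1" and \<kappa>: "\<kappa> \<ge> 0"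
  shows "emeasure \<mu> {a\<in>space \<mu>. \<bar>(\<Sum>k\<in>K. q k * (cmod (a k))\<^sup>2) - (\<Sum>k\<in>K. q k / c k)\<bar> \<ge> \<delta>} \<le>
    ennreal (2 * \<kappa> * exp (- \<gamma> * N * \<delta>\<^sup>2 / (8 * B\<^sup>2)))"
proof -
  \<comment> \<open>The minimiser of 2 t^2 B^2 / (\<gamma> N) - t \<delta>; it is admissible because
    \<delta> \<le> 1 \<le> B.\<close>
  define t where "t = \<gamma> * N * \<delta> / (4 * B\<^sup>2)"
  have c: "c k > 0" if "k \<in> K" for k using \<gamma> that by (meson less_le_trans)
  have t0: "t \<ge> 0" using \<gamma> N \<delta> by (simp add: t_def)
  have t: "t * q k \<le> c k / 2" if "k \<in> K" for k
  proof -
    have "t * q k \<le> t * (B / N)" using q[OF that] t0 by (intro mult_left_mono) auto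
    also have "\<dots> = \<gamma> * (\<delta> / (4 * B))" using N B by (simp add: t_def power2_eq_square)
    also have "\<delta> / (4 * B) \<le> 1 / 2" using \<delta> B by (simp add: field_simps)
    finally show ?thesis using \<gamma>(2)[OF that] \<gamma>(1) by (simp add: mult_left_mono)
  qed
  have "(\<Sum>k\<in>K. (q k / c k)\<^sup>2) \<le> (\<Sum>k\<in>K. (B / N)\<^sup>2 / \<gamma> * (1 / c k))"
  proof (intro sum_mono)
    fix k assume k: "k \<in> K"
    have "(q k)\<^sup>2 \<le> (B / N)\<^sup>2" using q[OF k] by (intro power_mono)
    moreover have "1 / (c k)\<^sup>2 \<le> 1 / (\<gamma> * c k)"
      using \<gamma> c[OF k] \<gamma>(2)[OF k] by (intro divide_left_mono) (auto simp: power2_eq_square)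
    ultimately have "(q k)\<^sup>2 * (1 / (c k)\<^sup>2) \<le> (B / N)\<^sup>2 * (1 / (\<gamma> * c k))"
      by (intro mult_mono) auto
    then show "(q k / c k)\<^sup>2 \<le> (B / N)\<^sup>2 / \<gamma> * (1 / c k)" by (simp add: power_divide)
  qed
  also have "\<dots> = (B / N)\<^sup>2 / \<gamma> * (\<Sum>k\<in>K. 1 / c k)" by (simp only: sum_distrib_left)
  also have "\<dots> \<le> (B / N)\<^sup>2 / \<gamma> * N" using N \<gamma> by (intro mult_left_mono) auto
  also have "\<dots> = B\<^sup>2 / (\<gamma> * N)" using N by (simp add: power2_eq_square)
  finally have "2 * t\<^sup>2 * (\<Sum>k\<in>K. (q k / c k)\<^sup>2) \<le> 2 * t\<^sup>2 * (B\<^sup>2 / (\<gamma> * N))" by (intro mult_left_mono) auto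
  also have "\<dots> = \<gamma> * N * \<delta>\<^sup>2 / (8 * B\<^sup>2)" using N \<gamma> B by (simp add: t_def power2_eq_square field_simps)
  finally have "2 * t\<^sup>2 * (\<Sum>k\<in>K. (q k / c k)\<^sup>2) - t * \<delta> \<le> \<gamma> * N * \<delta>\<^sup>2 / (8 * B\<^sup>2) - t * \<delta>" by simp
  also have "\<dots> = - \<gamma> * N * \<delta>\<^sup>2 / (8 * B\<^sup>2)"
    using B by (simp add: t_def power2_eq_square field_simps)
  finally have *: "2 * t\<^sup>2 * (\<Sum>k\<in>K. (q k / c k)\<^sup>2) - t * \<delta> \<le> - \<gamma> * N * \<delta>\<^sup>2 / (8 * B\<^sup>2)" .
  have "emeasure \<mu> {a\<in>space \<mu>. \<bar>(\<Sum>k\<in>K. q k * (cmod (a k))\<^sup>2) - (\<Sum>k\<in>K. q k / c k)\<bar> \<ge> \<delta>} \<le>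
      ennreal (2 * \<kappa> * exp (2 * t\<^sup>2 * (\<Sum>k\<in>K. (q k / c k)\<^sup>2) - t * \<delta>))"
    by (rule quadratic_concentration_raw[OF K M H c q(1) t t0 \<kappa>])
  also have "\<dots> \<le> ennreal (2 * \<kappa> * exp (- \<gamma> * N * \<delta>\<^sup>2 / (8 * B\<^sup>2)))"
    using * \<kappa> by (intro ennreal_leI mult_left_mono) auto
  finally show ?thesis .
qed

lemma single_mode_tail:
  assumes K: "finite K" "K \<subseteq> T" and M: "sets \<mu> = sets (cspace T)" and H: "exp_moment_bound \<mu> K c \<kappa>"
    and c: "\<gamma> > 0" "\<And>k. k \<in> K \<Longrightarrow> \<gamma> \<le> c k" and \<kappa>: "\<kappa> \<ge> 0" and k: "k \<in> K" and r: "r \<ge> 0"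
  shows "emeasure \<mu> {a\<in>space \<mu>. (cmod (a k))\<^sup>2 \<ge> r} \<le> ennreal (2 * \<kappa> * exp (- \<gamma> * r / 2))"
    (is "emeasure \<mu> ?B \<le> _")
proof -
  have [measurable_cong]: "sets \<mu> = sets (cspace T)" by fact
  have [measurable]: "(\<lambda>a. a k) \<in> borel_measurable (cspace T)"
    using K k by (intro measurable_cspace_component) auto
  \<comment> \<open>Half of the smallest rate, on the mode k only: the single factor of the moment
    bound that differs from 1 is then at most 2.\<close>
  define t where "t = (\<lambda>l. if l = k then \<gamma> / 2 else 0 :: real)"
  have t: "t l < c l" if "l \<in> K" for l
    using c(1) c(2)[OF that] by (auto simp: t_def)
  have s: "(\<Sum>l\<in>K. t l * (cmod (a l))\<^sup>2) = \<gamma> / 2 * (cmod (a k))\<^sup>2" for a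
  proof -
    have "(\<Sum>l\<in>K. t l * (cmod (a l))\<^sup>2) = (\<Sum>l\<in>K. if l = k then \<gamma> / 2 * (cmod (a k))\<^sup>2 else 0)"
      by (intro sum.cong) (auto simp: t_def)
    then show ?thesis using K k by simp
  qed
  have "(\<Prod>l\<in>K. 1 / (1 - t l / c l)) = (\<Prod>l\<in>K. if l = k then 1 / (1 - \<gamma> / 2 / c k) else 1)"
    by (intro prod.cong) (auto simp: t_def)
  also have "\<dots> = 1 / (1 - \<gamma> / 2 / c k)" using K k by simp
  also have "\<dots> \<le> 2" using c(1) c(2)[OF k] by (simp add: field_simps)
  finally have p: "(\<Prod>l\<in>K. 1 / (1 - t l / c l)) \<le> 2" .
  have "emeasure \<mu> ?B = (\<integral>\<^sup>+a. indicator ?B a \<partial>\<mu>)" by (rule nn_integral_indicator[symmetric]) measurable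
  also have "\<dots> \<le> (\<integral>\<^sup>+a. ennreal (exp (- \<gamma> * r / 2)) * ennreal (exp (\<gamma> / 2 * (cmod (a k))\<^sup>2)) \<partial>\<mu>)"
  proof (intro nn_integral_mono)
    fix a
    show "indicator ?B a \<le> ennreal (exp (- \<gamma> * r / 2)) * ennreal (exp (\<gamma> / 2 * (cmod (a k))\<^sup>2))"
      using c(1) by (auto simp: indicator_def field_simps simp flip: ennreal_mult exp_add)
  qed
  also have "\<dots> = ennreal (exp (- \<gamma> * r / 2)) * (\<integral>\<^sup>+a. ennreal (exp (\<Sum>l\<in>K. t l * (cmod (a l))\<^sup>2)) \<partial>\<mu>)"
    unfolding s by (rule nn_integral_cmult) measurable
  also have "\<dots> \<le> ennreal (exp (- \<gamma> * r / 2)) * ennreal (\<kappa> * (\<Prod>l\<in>K. 1 / (1 - t l / c l)))"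
    using H t unfolding exp_moment_bound_def by (intro mult_left_mono) auto
  also have "\<dots> \<le> ennreal (exp (- \<gamma> * r / 2)) * ennreal (\<kappa> * 2)"
    using p \<kappa> by (intro mult_left_mono ennreal_leI) auto
  also have "\<dots> = ennreal (2 * \<kappa> * exp (- \<gamma> * r / 2))"
    using \<kappa> by (simp add: mult_ac flip: ennreal_mult)
  finally show ?thesis .
qed

section \<open>Averaging over quarter turns\<close>

definition quarter_turn_invariant :: "('i \<Rightarrow> complex) measure \<Rightarrow> 'i set \<Rightarrow> 'i set \<Rightarrow> bool" where
  "quarter_turn_invariant \<mu> T K \<longleftrightarrow> (\<forall>k\<in>K. distr \<mu> (cspace T) (\<lambda>a. a(k := \<i> * a k)) = \<mu>)"

lemma measurable_quarter_turn:
  assumes "k \<in> T"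
  shows "(\<lambda>a. a(k := \<i> * a k)) \<in> measurable (cspace T) (cspace T)"
proof (rule measurable_PiM_single')
  show "(\<lambda>a. a(k := \<i> * a k)) \<in> space (cspace T) \<rightarrow> T \<rightarrow>\<^sub>E space lborel"
    using assms by (auto simp: PiE_iff extensional_def)
  show "(\<lambda>a. (a(k := \<i> * a k)) i) \<in> measurable (cspace T) lborel" if "i \<in> T" for i
  proof -
    have [measurable]: "(\<lambda>a. a i) \<in> borel_measurable (cspace T)" "(\<lambda>a. a k) \<in> borel_measurable (cspace T)"
      using that assms by (auto intro: measurable_cspace_component)
    show ?thesis by (cases "i = k") auto
  qed
qed

lemma integral_quarter_turn:
  fixes f :: "_ \<Rightarrow> complex"
  assumes "quarter_turn_invariant \<mu> T K" "k \<in> K" "K \<subseteq> T" "sets \<mu> = sets (cspace T)"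
    and "f \<in> borel_measurable (cspace T)"
  shows "(\<integral>a. f (a(k := \<i> * a k)) \<partial>\<mu>) = (\<integral>a. f a \<partial>\<mu>)"
proof -
  have m: "(\<lambda>a. a(k := \<i> * a k)) \<in> measurable \<mu> (cspace T)"
    using measurable_quarter_turn[of k T] assms by (auto simp: measurable_cong_sets[OF assms(4) refl])
  have "(\<integral>a. f a \<partial>\<mu>) = (\<integral>a. f a \<partial>distr \<mu> (cspace T) (\<lambda>a. a(k := \<i> * a k)))"
    using assms by (simp add: quarter_turn_invariant_def)
  also have "\<dots> = (\<integral>a. f (a(k := \<i> * a k)) \<partial>\<mu>)"
    by (rule integral_distr[OF m]) fact
  finally show ?thesis by simp
qed

definition turn_average :: "(complex \<Rightarrow> complex) \<Rightarrow> complex \<Rightarrow> complex" where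
  "turn_average h z = (h z + h (\<i> * z) + h (- z) + h (- \<i> * z)) / 4"

text \<open>\<open>R\<close> ignores the coordinate k, so invariance, applied up to three times,
  shows that all four turned integrals are equal; hence each equals their mean.\<close>

lemma integral_turn_average_single:
  fixes R :: "('i \<Rightarrow> complex) \<Rightarrow> complex"
  assumes \<mu>: "prob_space \<mu>" "sets \<mu> = sets (cspace T)" and inv: "quarter_turn_invariant \<mu> T K" "k \<in> K" "K \<subseteq> T"
    and R: "R \<in> borel_measurable (cspace T)" "\<And>a. cmod (R a) \<le> C" "\<And>a z. R (a(k := z)) = R a"
    and h: "h \<in> borel_measurable borel" "\<And>z. cmod (h z) \<le> 1"
  shows "(\<integral>a. R a * h (a k) \<partial>\<mu>) = (\<integral>a. R a * turn_average h (a k) \<partial>\<mu>)"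
proof -
  interpret prob_space \<mu> by fact
  have [measurable_cong]: "sets \<mu> = sets (cspace T)" by fact
  have [measurable]: "(\<lambda>a. a k) \<in> borel_measurable (cspace T)"
    using inv by (intro measurable_cspace_component) auto
  note [measurable] = R(1) h(1)
  have int: "integrable \<mu> (\<lambda>a. R a * h (w * a k))" for w
  proof (rule integrable_const_bound)
    have "cmod (R a * h (w * a k)) \<le> C" for a
      using mult_mono[OF R(2)[of a] h(2)[of "w * a k"]] norm_ge_zero[of "R a"] R(2)[of a]
      by (auto simp: norm_mult intro: order_trans[OF norm_ge_zero])
    then show "AE a in \<mu>. cmod (R a * h (w * a k)) \<le> C" by simp
  qed measurable
  have step: "(\<integral>a. R a * h (w * (\<i> * a k)) \<partial>\<mu>) = (\<integral>a. R a * h (w * a k) \<partial>\<mu>)" for w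
    using integral_quarter_turn[OF inv \<mu>(2), of "\<lambda>a. R a * h (w * a k)"] by (simp add: R(3))
  have 1: "(\<integral>a. R a * h (\<i> * a k) \<partial>\<mu>) = (\<integral>a. R a * h (a k) \<partial>\<mu>)"
    using step[of 1] by simp
  have 2: "(\<integral>a. R a * h (- a k) \<partial>\<mu>) = (\<integral>a. R a * h (a k) \<partial>\<mu>)"
    using step[of \<i>] 1 by (simp flip: mult.assoc)
  have 3: "(\<integral>a. R a * h (- \<i> * a k) \<partial>\<mu>) = (\<integral>a. R a * h (a k) \<partial>\<mu>)"
    using step[of "-1"] 2 by simp
  have "(\<integral>a. R a * turn_average h (a k) \<partial>\<mu>) =
     (\<integral>a. (R a * h (1 * a k) + R a * h (\<i> * a k) + R a * h (-1 * a k) + R a * h (- \<i> * a k)) / 4 \<partial>\<mu>)"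
    by (simp add: turn_average_def algebra_simps)
  also have "\<dots> = ((\<integral>a. R a * h (1 * a k) \<partial>\<mu>) + (\<integral>a. R a * h (\<i> * a k) \<partial>\<mu>) +
      (\<integral>a. R a * h (-1 * a k) \<partial>\<mu>) + (\<integral>a. R a * h (- \<i> * a k) \<partial>\<mu>)) / 4"
    using int by (simp only: integral_divide_zero Bochner_Integration.integral_add Bochner_Integration.integrable_add)
  also have "\<dots> = (\<integral>a. R a * h (a k) \<partial>\<mu>)"
    using 1 2 3 by simp
  finally show ?thesis by simp
qed

lemma turn_average_bound: "(\<And>z. cmod (h z) \<le> 1) \<Longrightarrow> cmod (turn_average h z) \<le> 1"
proof -
  assume h: "\<And>z. cmod (h z) \<le> 1"
  have "cmod (h z + h (\<i> * z) + h (- z) + h (- \<i> * z)) \<le> 1 + 1 + 1 + 1"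
    by (intro norm_triangle_mono h)
  then show ?thesis by (simp add: turn_average_def norm_divide)
qed

text \<open>The coordinates need not be independent: they are averaged one at a time, the remaining
  factors being frozen. The free factor \<open>g\<close> makes the induction go through, since it
  absorbs the coordinates not yet treated; later it also carries the zero mode.\<close>

lemma integral_turn_average:
  fixes g :: "('i \<Rightarrow> complex) \<Rightarrow> complex"
  assumes \<mu>: "prob_space \<mu>" "sets \<mu> = sets (cspace T)" and inv: "quarter_turn_invariant \<mu> T K"
    and K: "finite K" "K \<subseteq> T"
    and g: "g \<in> borel_measurable (cspace T)" "\<And>a. cmod (g a) \<le> 1" "\<And>k a z. k \<in> K \<Longrightarrow> g (a(k := z)) = g a"
    and h: "\<And>k. h k \<in> borel_measurable borel" "\<And>k z. cmod (h k z) \<le> 1"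
  shows "(\<integral>a. g a * (\<Prod>k\<in>K. h k (a k)) \<partial>\<mu>) = (\<integral>a. g a * (\<Prod>k\<in>K. turn_average (h k) (a k)) \<partial>\<mu>)"
  using K(1) K(2) inv g
proof (induction K arbitrary: g rule: finite_induct)
  case (insert k K)
  have [measurable]: "(\<lambda>a. a l) \<in> borel_measurable (cspace T)" if "l \<in> insert k K" for l
    using insert.prems that by (intro measurable_cspace_component) auto
  note [measurable] = insert.prems(3) h(1)
  have [measurable]: "turn_average (h l) \<in> borel_measurable borel" for l
    unfolding turn_average_def by measurable
  have inv: "quarter_turn_invariant \<mu> T K" using insert.prems(2) by (simp add: quarter_turn_invariant_def)
  have "(\<integral>a. g a * (\<Prod>k\<in>insert k K. h k (a k)) \<partial>\<mu>) = (\<integral>a. (g a * h k (a k)) * (\<Prod>k\<in>K. h k (a k)) \<partial>\<mu>)"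
    using insert.hyps by (simp add: mult_ac)
  also have "\<dots> = (\<integral>a. (g a * h k (a k)) * (\<Prod>k\<in>K. turn_average (h k) (a k)) \<partial>\<mu>)"
  proof (rule insert.IH)
    show "cmod (g a * h k (a k)) \<le> 1" for a
      using mult_mono[OF insert.prems(4)[of a] h(2)[of k "a k"]] by (simp add: norm_mult)
  qed (use insert inv in auto)
  also have "\<dots> = (\<integral>a. (g a * (\<Prod>k\<in>K. turn_average (h k) (a k))) * h k (a k) \<partial>\<mu>)"
    by (simp add: mult_ac)
  also have "\<dots> = (\<integral>a. (g a * (\<Prod>k\<in>K. turn_average (h k) (a k))) * turn_average (h k) (a k) \<partial>\<mu>)"
  proof (rule integral_turn_average_single[OF \<mu> insert.prems(2) _ insert.prems(1) _ _ _ h])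
    show "cmod (g a * (\<Prod>k\<in>K. turn_average (h k) (a k))) \<le> 1" for a
    proof -
      have "cmod (\<Prod>k\<in>K. turn_average (h k) (a k)) \<le> 1"
        unfolding prod_norm[symmetric] by (intro prod_le_1 conjI turn_average_bound h) simp
      then show ?thesis using mult_mono[OF insert.prems(4)[of a]] by (fastforce simp: norm_mult)
    qed
    show "g (a(k := z)) * (\<Prod>l\<in>K. turn_average (h l) ((a(k := z)) l)) = g a * (\<Prod>l\<in>K. turn_average (h l) (a l))" for a z
    proof -
      have "(\<Prod>l\<in>K. turn_average (h l) ((a(k := z)) l)) = (\<Prod>l\<in>K. turn_average (h l) (a l))"
        using insert.hyps by (intro prod.cong) auto
      then show ?thesis by (simp only: insert.prems(5)[OF insertI1])
    qed
  qed (auto intro!: borel_measurable_times borel_measurable_prod insert.prems(3))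
  also have "\<dots> = (\<integral>a. g a * (\<Prod>k\<in>insert k K. turn_average (h k) (a k)) \<partial>\<mu>)"
    using insert.hyps by (simp add: mult_ac)
  finally show ?case .
qed simp

lemma turn_average_cis:
  "turn_average (\<lambda>z. cis (Re (w * z))) z = complex_of_real ((cos (Re (w * z)) + cos (Im (w * z))) / 2)"
proof -
  have *: "(cis U + cis (- V) + cis (- U) + cis V) / 4 = complex_of_real ((cos U + cos V) / 2)" for U V
    by (simp add: complex_eq_iff)
  have "Re (w * (\<i> * z)) = - Im (w * z)" "Re (w * - z) = - Re (w * z)" "Re (w * (- \<i> * z)) = Im (w * z)"
    by simp_all
  then show ?thesis unfolding turn_average_def by (simp only: *)
qed

text \<open>A central limit theorem for dependent modes. After averaging, the product is close to
  exp (- Q / 4), where the quadratic form \<open>Q\<close> concentrates at the constant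
  \<open>v\<close>. The product can therefore be pulled out of the integral as a number, whatever
  \<open>g\<close> is. The exceptional events are a deviation of \<open>Q\<close> and the presence
  of one atypically large mode.\<close>

lemma gaussian_approximation:
  fixes g :: "('i \<Rightarrow> complex) \<Rightarrow> complex" and w :: "'i \<Rightarrow> complex"
  assumes \<mu>: "prob_space \<mu>" "sets \<mu> = sets (cspace T)" and inv: "quarter_turn_invariant \<mu> T K"
    and K: "finite K" "K \<subseteq> T" and H: "exp_moment_bound \<mu> K c \<kappa>"
    and g: "g \<in> borel_measurable (cspace T)" "\<And>a. cmod (g a) \<le> 1" "\<And>k a z. k \<in> K \<Longrightarrow> g (a(k := z)) = g a"
    and \<gamma>: "\<gamma> > 0" "\<And>k. k \<in> K \<Longrightarrow> \<gamma> \<le> c k" and w: "\<And>k. k \<in> K \<Longrightarrow> (cmod (w k))\<^sup>2 \<le> B / N"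
    and N: "N \<ge> 1" "(\<Sum>k\<in>K. 1 / c k) \<le> N" "real (card K) \<le> N"
    and B: "B \<ge> 1" and \<delta>: "0 < \<delta>" "\<delta> \<le> 1" and \<kappa>: "\<kappa> \<ge> 0"
  shows "cmod ((\<integral>a. g a * (\<Prod>k\<in>K. cis (Re (w k * a k))) \<partial>\<mu>) -
      (\<integral>a. g a \<partial>\<mu>) * exp (- (\<Sum>k\<in>K. (cmod (w k))\<^sup>2 / c k) / 4)) \<le>
    3 * B\<^sup>2 * \<delta> + 8 * \<kappa> * N * exp (- \<gamma> * N * \<delta>\<^sup>2 / (8 * B\<^sup>2))"
proof -
  interpret prob_space \<mu> by fact
  have [measurable_cong]: "sets \<mu> = sets (cspace T)" by fact
  have mc [measurable]: "(\<lambda>a. a l) \<in> borel_measurable (cspace T)" if "l \<in> K" for l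
    using K that by (intro measurable_cspace_component) auto
  note [measurable] = g(1)
  have N0: "N > 0" using N by simp
  have c: "c k > 0" if "k \<in> K" for k using \<gamma> that by (meson less_le_trans)
  define v where "v = (\<Sum>k\<in>K. (cmod (w k))\<^sup>2 / c k)"
  define Q where "Q a = (\<Sum>k\<in>K. (cmod (w k))\<^sup>2 * (cmod (a k))\<^sup>2)" for a :: "'i \<Rightarrow> complex"
  define p where "p k z = (cos (Re (w k * z)) + cos (Im (w k * z))) / 2" for k z
  define P where "P a = (\<Prod>k\<in>K. p k (a k))" for a
  define e where "e = exp (- \<gamma> * N * \<delta>\<^sup>2 / (8 * B\<^sup>2))"
  define BQ where "BQ = {a\<in>space \<mu>. \<bar>Q a - v\<bar> \<ge> \<delta>}"
  \<comment> \<open>On the complement no single mode carries more than the fraction \<delta> of N.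
    The union bound over the modes is the source of the factor N in the error term.\<close>
  define BM where "BM = (\<Union>k\<in>K. {a\<in>space \<mu>. (cmod (a k))\<^sup>2 \<ge> \<delta> * N})"
  have [measurable]: "Q \<in> borel_measurable (cspace T)" unfolding Q_def by measurable
  have [measurable]: "P \<in> borel_measurable (cspace T)" unfolding P_def p_def by measurable
  have [measurable]: "BQ \<in> sets \<mu>" unfolding BQ_def by measurable
  have [measurable]: "BM \<in> sets \<mu>" unfolding BM_def using K(1) by (intro sets.finite_UN) measurable
  have v0: "v \<ge> 0" unfolding v_def using c by (intro sum_nonneg) (simp add: less_imp_le)
  have "v \<le> (\<Sum>k\<in>K. B / N * (1 / c k))"
    unfolding v_def
  proof (rule sum_mono)
    fix k assume "k \<in> K"
    show "(cmod (w k))\<^sup>2 / c k \<le> B / N * (1 / c k)"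
      using mult_right_mono[OF w[OF \<open>k \<in> K\<close>], of "1 / c k"] c[OF \<open>k \<in> K\<close>] by simp
  qed
  also have "\<dots> = B / N * (\<Sum>k\<in>K. 1 / c k)" by (simp only: sum_distrib_left)
  also have "\<dots> \<le> B / N * N" using N B by (intro mult_left_mono) auto
  finally have vB: "v \<le> B" using N0 by simp
  have PQ: "prob BQ \<le> 2 * \<kappa> * e"
    using quadratic_concentration[OF K \<mu>(2) H \<gamma> _ w N0 N(2) B \<delta> \<kappa>] \<kappa>
    unfolding BQ_def Q_def v_def e_def emeasure_eq_measure by (simp add: ennreal_le_iff)
  have PM: "prob BM \<le> 2 * \<kappa> * N * e"
  proof -
    have "prob BM \<le> (\<Sum>k\<in>K. prob {a\<in>space \<mu>. (cmod (a k))\<^sup>2 \<ge> \<delta> * N})"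
      unfolding BM_def using K(1) by (intro finite_measure_subadditive_finite) auto
    also have "\<dots> \<le> (\<Sum>k\<in>K. 2 * \<kappa> * e)"
    proof (rule sum_mono)
      fix k assume "k \<in> K"
      have "prob {a\<in>space \<mu>. (cmod (a k))\<^sup>2 \<ge> \<delta> * N} \<le> 2 * \<kappa> * exp (- \<gamma> * (\<delta> * N) / 2)"
        using single_mode_tail[OF K \<mu>(2) H \<gamma> \<kappa> \<open>k \<in> K\<close>, of "\<delta> * N"] \<kappa> \<delta> N0
        unfolding emeasure_eq_measure by (simp add: ennreal_le_iff)
      also have "exp (- \<gamma> * (\<delta> * N) / 2) \<le> e"
      proof -
        have "\<delta>\<^sup>2 / (8 * B\<^sup>2) \<le> \<delta> / 2"
        proof -
          have "\<delta>\<^sup>2 \<le> \<delta> * 1" unfolding power2_eq_square using \<delta> by (intro mult_left_mono) auto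
          moreover have "1 \<le> B\<^sup>2" using B by simp
          ultimately have "\<delta>\<^sup>2 / (8 * B\<^sup>2) \<le> \<delta> / (2 * 1)"
            using \<delta> by (intro frac_le) auto
          then show ?thesis by simp
        qed
        then have "(\<gamma> * N) * (\<delta>\<^sup>2 / (8 * B\<^sup>2)) \<le> (\<gamma> * N) * (\<delta> / 2)"
          using \<gamma> N0 by (intro mult_left_mono) auto
        then show ?thesis unfolding e_def by (simp add: mult_ac)
      qed
      finally show "prob {a\<in>space \<mu>. (cmod (a k))\<^sup>2 \<ge> \<delta> * N} \<le> 2 * \<kappa> * e"
        using \<kappa> by (simp add: mult_left_mono)
    qed
    also have "\<dots> = real (card K) * (2 * \<kappa> * e)" by simp
    also have "\<dots> \<le> N * (2 * \<kappa> * e)" using N \<kappa> by (intro mult_right_mono) (auto simp: e_def)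
    finally show ?thesis by (simp add: mult_ac)
  qed
  have p1: "\<bar>p k z\<bar> \<le> 1" for k z
  proof -
    have "\<bar>cos (Re (w k * z)) + cos (Im (w k * z))\<bar> \<le> 1 + 1"
      by (intro order_trans[OF abs_triangle_ineq] add_mono abs_cos_le_one)
    then show ?thesis by (simp add: p_def)
  qed
  have P1: "\<bar>P a\<bar> \<le> 1" for a
    unfolding P_def abs_prod by (intro prod_le_1) (simp add: p1)
  have bound: "\<bar>P a - exp (- v / 4)\<bar> \<le> 3 * B\<^sup>2 * \<delta> + 2 * (indicator BQ a + indicator BM a)"
    if a: "a \<in> space \<mu>" for a
  proof (cases "a \<in> BQ \<union> BM")
    case True
    have "\<bar>P a - exp (- v / 4)\<bar> \<le> \<bar>P a\<bar> + \<bar>exp (- v / 4)\<bar>" by (rule abs_triangle_ineq4)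
    also have "\<dots> \<le> 1 + 1" using P1[of a] v0 by (intro add_mono) auto
    finally have "\<bar>P a - exp (- v / 4)\<bar> \<le> 2" by simp
    moreover have "(1::real) \<le> indicator BQ a + indicator BM a" using True by (auto simp: indicator_def)
    moreover have "0 \<le> 3 * B\<^sup>2 * \<delta>" using \<delta> by simp
    ultimately show ?thesis unfolding distrib_left by linarith
  next
    case False
    then have Qv: "\<bar>Q a - v\<bar> < \<delta>" and M: "\<And>k. k \<in> K \<Longrightarrow> (cmod (a k))\<^sup>2 < \<delta> * N"
      using a by (auto simp: BQ_def BM_def not_le)
    have Q0: "Q a \<ge> 0" unfolding Q_def by (intro sum_nonneg) auto
    define f where "f k = exp (- (cmod (w k * a k))\<^sup>2 / 4)" for k
    have f: "(\<Prod>k\<in>K. f k) = exp (- Q a / 4)"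
      unfolding f_def Q_def exp_sum[OF K(1), symmetric]
      by (simp add: norm_mult power_mult_distrib sum_divide_distrib sum_negf)
    \<comment> \<open>Telescoping: a difference of products of numbers of modulus at most 1 is
      bounded by the sum of the differences of the factors.\<close>
    have "norm (P a - (\<Prod>k\<in>K. f k)) \<le> (\<Sum>k\<in>K. norm (p k (a k) - f k))"
      unfolding P_def by (rule norm_prod_diff) (auto simp: p1 f_def)
    \<comment> \<open>Of the fourth power |w a|^4 one square is at most (B / N) (\<delta> N); the
      other squares sum to \<open>Q\<close>.\<close>
    also have "\<dots> \<le> (\<Sum>k\<in>K. (B * \<delta>) * ((cmod (w k))\<^sup>2 * (cmod (a k))\<^sup>2))"
    proof (rule sum_mono)
      fix k assume k: "k \<in> K"
      have "norm (p k (a k) - f k) \<le> (cmod (w k * a k)) ^ 4"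
        unfolding p_def f_def real_norm_def by (rule four_phase_average_approx)
      also have "\<dots> = ((cmod (w k))\<^sup>2 * (cmod (a k))\<^sup>2) * ((cmod (w k))\<^sup>2 * (cmod (a k))\<^sup>2)"
        by (simp add: norm_mult power_mult_distrib eval_nat_numeral)
      also have "\<dots> \<le> (B / N * (\<delta> * N)) * ((cmod (w k))\<^sup>2 * (cmod (a k))\<^sup>2)"
        using M[OF k] w[OF k] B N0 by (intro mult_right_mono mult_mono) auto
      finally show "norm (p k (a k) - f k) \<le> (B * \<delta>) * ((cmod (w k))\<^sup>2 * (cmod (a k))\<^sup>2)"
        using N0 by simp
    qed
    also have "\<dots> = B * \<delta> * Q a" by (simp add: Q_def sum_distrib_left)
    \<comment> \<open>Here Q < v + \<delta> \<le> B + 1 \<le> 2 B.\<close>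
    also have "\<dots> \<le> B * \<delta> * (2 * B)" using Qv vB B \<delta> by (intro mult_left_mono) auto
    finally have 1: "\<bar>P a - exp (- Q a / 4)\<bar> \<le> 2 * B\<^sup>2 * \<delta>"
      unfolding f by (simp add: power2_eq_square mult_ac)
    have lip: "\<bar>exp (- x) - exp (- y)\<bar> \<le> \<bar>x - y\<bar>" if "x \<ge> 0" "y \<ge> 0" for x y :: real
    proof -
      have *: "exp (- s) - exp (- t) \<le> t - s" if "0 \<le> s" "s \<le> t" for s t :: real
      proof -
        have "exp (- s) - exp (- t) = exp (- s) * (1 - exp (- (t - s)))"
          by (simp add: right_diff_distrib flip: exp_add)
        also have "\<dots> \<le> 1 * (1 - exp (- (t - s)))" using that by (intro mult_right_mono) auto
        also have "\<dots> \<le> t - s" using exp_ge_add_one_self[of "s - t"] unfolding minus_diff_eq mult_1_left by linarith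
        finally show ?thesis .
      qed
      have "exp (- y) \<le> exp (- x) \<longleftrightarrow> x \<le> y" by simp
      then show ?thesis using *[of x y] *[of y x] that by (cases "x \<le> y") auto
    qed
    have "\<bar>exp (- (Q a / 4)) - exp (- (v / 4))\<bar> \<le> \<bar>Q a / 4 - v / 4\<bar>"
      using Q0 v0 by (intro lip) auto
    also have "\<dots> \<le> \<delta> * 1" using Qv by simp
    also have "\<dots> \<le> \<delta> * B\<^sup>2" using B \<delta> by (intro mult_left_mono) auto
    finally have "\<bar>P a - exp (- v / 4)\<bar> \<le> 3 * B\<^sup>2 * \<delta>" using 1 by (simp add: mult_ac)
    moreover have "0 \<le> (indicator BQ a + indicator BM a :: real)" by simp
    ultimately show ?thesis unfolding distrib_left by linarith
  qed
  have intg: "integrable \<mu> g" using g(2) by (intro integrable_const_bound[where B = 1]) auto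
  have intgP: "integrable \<mu> (\<lambda>a. g a * complex_of_real (P a))"
  proof (rule integrable_const_bound[where B = 1])
    have "cmod (g a * complex_of_real (P a)) \<le> 1" for a
      using mult_mono[OF g(2)[of a] P1[of a]] by (simp add: norm_mult)
    then show "AE a in \<mu>. cmod (g a * complex_of_real (P a)) \<le> 1" by simp
  qed measurable
  have "(\<integral>a. g a * (\<Prod>k\<in>K. cis (Re (w k * a k))) \<partial>\<mu>) = (\<integral>a. g a * complex_of_real (P a) \<partial>\<mu>)"
  proof -
    have "(\<lambda>z. cis (Re (w k * z))) \<in> borel_measurable borel" for k
      by (intro borel_measurable_continuous_onI continuous_intros)
    then have "(\<integral>a. g a * (\<Prod>k\<in>K. cis (Re (w k * a k))) \<partial>\<mu>) =
        (\<integral>a. g a * (\<Prod>k\<in>K. turn_average (\<lambda>z. cis (Re (w k * z))) (a k)) \<partial>\<mu>)"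
      by (intro integral_turn_average[OF \<mu> inv K g, of "\<lambda>k z. cis (Re (w k * z))"]) simp_all
    then show ?thesis unfolding turn_average_cis P_def p_def of_real_prod .
  qed
  then have "(\<integral>a. g a * (\<Prod>k\<in>K. cis (Re (w k * a k))) \<partial>\<mu>) - (\<integral>a. g a \<partial>\<mu>) * exp (- v / 4) =
      (\<integral>a. g a * complex_of_real (P a - exp (- v / 4)) \<partial>\<mu>)"
    using intg intgP by (simp add: right_diff_distrib exp_of_real[symmetric])
  also have "cmod \<dots> \<le> (\<integral>a. 3 * B\<^sup>2 * \<delta> + 2 * (indicator BQ a + indicator BM a) \<partial>\<mu>)"
  proof (rule order_trans[OF integral_norm_bound], rule integral_mono)
    have "integrable \<mu> (\<lambda>a. g a * complex_of_real (P a) - g a * complex_of_real (exp (- v / 4)))"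
      using intg intgP by simp
    then show "integrable \<mu> (\<lambda>a. cmod (g a * complex_of_real (P a - exp (- v / 4))))"
      by (simp add: right_diff_distrib)
    show "integrable \<mu> (\<lambda>a. 3 * B\<^sup>2 * \<delta> + 2 * (indicator BQ a + indicator BM a :: real))"
      by (intro Bochner_Integration.integrable_add integrable_mult_right) (auto simp: emeasure_eq_measure)
    fix a assume a: "a \<in> space \<mu>"
    have "cmod (g a * complex_of_real (P a - exp (- v / 4))) \<le> 1 * \<bar>P a - exp (- v / 4)\<bar>"
      unfolding norm_mult norm_of_real using g(2) by (intro mult_right_mono) auto
    then show "cmod (g a * complex_of_real (P a - exp (- v / 4))) \<le>
        3 * B\<^sup>2 * \<delta> + 2 * (indicator BQ a + indicator BM a)"
      using bound[OF a] by simp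
  qed
  also have "\<dots> = 3 * B\<^sup>2 * \<delta> + 2 * (prob BQ + prob BM)"
    by (subst Bochner_Integration.integral_add)
      (auto simp: prob_space emeasure_eq_measure Bochner_Integration.integral_add
        intro!: Bochner_Integration.integrable_add)
  also have "\<dots> \<le> 3 * B\<^sup>2 * \<delta> + 2 * (2 * \<kappa> * N * e + 2 * \<kappa> * N * e)"
  proof -
    have "2 * \<kappa> * e * 1 \<le> 2 * \<kappa> * e * N" using \<kappa> N by (intro mult_left_mono) (auto simp: e_def)
    then show ?thesis using PQ PM by (simp add: mult_ac)
  qed
  finally show ?thesis by (simp add: v_def e_def mult_ac)
qed

section \<open>Weak convergence from characteristic functions\<close>

definition rpair :: "'a set \<Rightarrow> ('a \<Rightarrow> complex) \<Rightarrow> ('a \<Rightarrow> complex) \<Rightarrow> real" where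
  "rpair A c \<psi> = (\<Sum>x\<in>A. Re (c x * \<psi> x))"

text \<open>Sums of shifted cosines of linear functionals. By the product formula for cosines they
  form an algebra, and their integrals are determined by the characteristic function.\<close>

inductive trig_poly :: "'a set \<Rightarrow> (('a \<Rightarrow> complex) \<Rightarrow> real) \<Rightarrow> bool" for A where
  cos: "trig_poly A (\<lambda>\<psi>. a * cos (rpair A c \<psi> + b))"
| add: "trig_poly A f \<Longrightarrow> trig_poly A g \<Longrightarrow> trig_poly A (\<lambda>\<psi>. f \<psi> + g \<psi>)"

lemma trig_poly_const: "trig_poly A (\<lambda>_. a)"
proof -
  have "trig_poly A (\<lambda>\<psi>. a * cos (rpair A (\<lambda>_. 0) \<psi> + 0))" by (rule trig_poly.cos)
  then show ?thesis by (simp add: rpair_def)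
qed

lemma trig_poly_mult_cos:
  assumes "trig_poly A g"
  shows "trig_poly A (\<lambda>\<psi>. a * cos (rpair A c \<psi> + b) * g \<psi>)"
  using assms
proof induction
  case (cos a' c' b')
  have e: "a * cos (rpair A c \<psi> + b) * (a' * cos (rpair A c' \<psi> + b')) =
      (a * a' / 2) * cos (rpair A (\<lambda>x. c x - c' x) \<psi> + (b - b')) +
      (a * a' / 2) * cos (rpair A (\<lambda>x. c x + c' x) \<psi> + (b + b'))" for \<psi>
  proof -
    have "rpair A (\<lambda>x. c x - c' x) \<psi> + (b - b') = (rpair A c \<psi> + b) - (rpair A c' \<psi> + b')"
      "rpair A (\<lambda>x. c x + c' x) \<psi> + (b + b') = (rpair A c \<psi> + b) + (rpair A c' \<psi> + b')"
      by (simp_all add: rpair_def sum_subtractf sum.distrib algebra_simps)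
    then show ?thesis by (simp only: cos_add cos_diff) (simp add: algebra_simps)
  qed
  show ?case unfolding e by (intro trig_poly.intros)
next
  case (add f g)
  then show ?case using trig_poly.add[OF add.IH] by (simp add: algebra_simps)
qed

lemma trig_poly_mult:
  assumes "trig_poly A f" "trig_poly A g"
  shows "trig_poly A (\<lambda>\<psi>. f \<psi> * g \<psi>)"
  using assms(1)
proof induction
  case (cos a c b)
  show ?case by (rule trig_poly_mult_cos[OF assms(2)])
next
  case (add f h)
  then show ?case using trig_poly.add[OF add.IH] by (simp add: algebra_simps)
qed

lemma trig_poly_compose:
  assumes "real_polynomial_function q" "trig_poly A f"
  shows "trig_poly A (\<lambda>\<psi>. q (f \<psi>))"
  using assms(1)
proof induction
  case (linear h)
  then obtain k where "h = (\<lambda>x. x * k)" using real_bounded_linear by auto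
  then show ?case using trig_poly_mult[OF assms(2) trig_poly_const] by simp
next
  case (mult f1 g1)
  then show ?case by (intro trig_poly_mult) auto
qed (auto intro: trig_poly_const trig_poly.add)

lemma trig_poly_bounded:
  assumes "trig_poly A f"
  obtains B where "\<And>\<psi>. \<bar>f \<psi>\<bar> \<le> B" "B \<ge> 0"
proof -
  have "\<exists>B\<ge>0. \<forall>\<psi>. \<bar>f \<psi>\<bar> \<le> B"
    using assms
  proof induction
    case (cos a c b)
    have "\<bar>a * cos (rpair A c \<psi> + b)\<bar> \<le> \<bar>a\<bar> * 1" for \<psi>
      unfolding abs_mult by (intro mult_left_mono) auto
    then show ?case by (intro exI[of _ "\<bar>a\<bar>"]) auto
  next
    case (add f g)
    then obtain B1 B2 where "B1 \<ge> 0" "B2 \<ge> 0" "\<And>\<psi>. \<bar>f \<psi>\<bar> \<le> B1" "\<And>\<psi>. \<bar>g \<psi>\<bar> \<le> B2" by auto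
    then show ?case by (intro exI[of _ "B1 + B2"]) (auto intro: order_trans[OF abs_triangle_ineq] add_mono)
  qed
  then show ?thesis using that by auto
qed

lemma measurable_rpair: "rpair A c \<in> borel_measurable (Pi\<^sub>M A (\<lambda>_. borel))"
  unfolding rpair_def by measurable

lemma trig_poly_measurable: "trig_poly A f \<Longrightarrow> f \<in> borel_measurable (Pi\<^sub>M A (\<lambda>_. borel))"
proof (induction rule: trig_poly.induct)
  case (cos a c b)
  note [measurable] = measurable_rpair
  show ?case by measurable
qed measurable

lemma trig_poly_continuous: "trig_poly A f \<Longrightarrow> continuous_on S f"
proof (induction rule: trig_poly.induct)
  case (cos a c b)
  have c: "continuous_on S (\<lambda>\<psi>. \<psi> x)" for x :: 'a
    by (rule continuous_on_subset[OF continuous_on_product_coordinates]) simp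
  have "continuous_on S (\<lambda>\<psi>. rpair A c' \<psi> + b)" for c'
    unfolding rpair_def by (intro continuous_on_add continuous_on_sum continuous_on_Re continuous_on_mult continuous_on_const c)
  then show ?case
    by (intro continuous_on_mult continuous_on_const continuous_on_compose2[of UNIV cos S]) (auto intro: continuous_on_cos[OF continuous_on_id])
qed (auto intro: continuous_intros)

text \<open>The integral of a shifted cosine is the real part of exp (i b) times a value of the
  characteristic function.\<close>

lemma trig_poly_integral_tendsto:
  assumes f: "trig_poly A f" and M: "\<And>n. prob_space (\<mu> n)" "\<And>n. sets (\<mu> n) = sets (Pi\<^sub>M A (\<lambda>_. borel))"
    and N: "prob_space \<nu>" "sets \<nu> = sets (Pi\<^sub>M A (\<lambda>_. borel))"
    and char: "\<And>c. (\<lambda>n. \<integral>\<psi>. cis (rpair A c \<psi>) \<partial>\<mu> n) \<longlonglongrightarrow> (\<integral>\<psi>. cis (rpair A c \<psi>) \<partial>\<nu>)"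
  shows "(\<lambda>n. \<integral>\<psi>. f \<psi> \<partial>\<mu> n) \<longlonglongrightarrow> (\<integral>\<psi>. f \<psi> \<partial>\<nu>)"
proof -
  have int: "integrable P h" if h: "trig_poly A h" and P: "prob_space P" "sets P = sets (Pi\<^sub>M A (\<lambda>_. borel))" for P h
  proof -
    interpret prob_space P by fact
    obtain B where "\<And>\<psi>. \<bar>h \<psi>\<bar> \<le> B" using trig_poly_bounded[OF h] by blast
    then show ?thesis
      using trig_poly_measurable[OF h]
      by (intro integrable_const_bound[where B = B]) (auto simp: measurable_cong_sets[OF P(2) refl])
  qed
  have c: "(\<integral>\<psi>. a * cos (rpair A c \<psi> + b) \<partial>P) = a * Re (cis b * (\<integral>\<psi>. cis (rpair A c \<psi>) \<partial>P))"
    if P: "prob_space P" "sets P = sets (Pi\<^sub>M A (\<lambda>_. borel))" for P a b c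
  proof -
    interpret prob_space P by fact
    have [measurable]: "rpair A c \<in> borel_measurable P"
      using measurable_rpair[of A c] by (simp add: measurable_cong_sets[OF P(2) refl])
    have [measurable]: "cis \<in> borel_measurable borel"
      by (intro borel_measurable_continuous_onI continuous_intros)
    have i: "integrable P (\<lambda>\<psi>. cis (rpair A c \<psi>))"
      by (intro integrable_const_bound[where B = 1]) auto
    have "Re (cis b * (\<integral>\<psi>. cis (rpair A c \<psi>) \<partial>P)) = Re (\<integral>\<psi>. cis b * cis (rpair A c \<psi>) \<partial>P)"
      using i by simp
    also have "\<dots> = (\<integral>\<psi>. Re (cis b * cis (rpair A c \<psi>)) \<partial>P)"
      using i by (intro integral_Re[symmetric] integrable_mult_right)
    also have "\<dots> = (\<integral>\<psi>. cos (rpair A c \<psi> + b) \<partial>P)"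
      by (simp add: cis_mult add.commute)
    finally show ?thesis by simp
  qed
  show ?thesis
    using f
  proof induction
    case (cos a c' b)
    show ?case unfolding c[OF M] c[OF N] by (intro tendsto_intros char)
  next
    case (add f g)
    then show ?case
      using int[OF add.hyps(1) M] int[OF add.hyps(2) M] int[OF add.hyps(1) N] int[OF add.hyps(2) N]
      by (simp add: tendsto_add)
  qed
qed

text \<open>On a countable index type the product sigma-algebra over all indices is the Borel one,
  and coordinates outside A are constantly \<open>undefined\<close>.\<close>

lemma measurable_PiM_to_borel:
  fixes A :: "'a::countable set"
  shows "(\<lambda>\<psi>. \<psi>) \<in> measurable (Pi\<^sub>M A (\<lambda>_. borel :: complex measure)) borel"
proof -
  have "(\<lambda>\<psi>. \<psi>) \<in> measurable (Pi\<^sub>M A (\<lambda>_. borel :: complex measure)) (Pi\<^sub>M UNIV (\<lambda>_. borel))"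
  proof (rule measurable_PiM_single')
    show "(\<lambda>\<psi>. \<psi> i) \<in> borel_measurable (Pi\<^sub>M A (\<lambda>_. borel :: complex measure))" for i
    proof (cases "i \<in> A")
      case False
      have "(\<lambda>\<psi>. \<psi> i) \<in> borel_measurable (Pi\<^sub>M A (\<lambda>_. borel :: complex measure)) \<longleftrightarrow>
          (\<lambda>\<psi>. undefined :: complex) \<in> borel_measurable (Pi\<^sub>M A (\<lambda>_. borel :: complex measure))"
        using False by (intro measurable_cong) (auto simp: space_PiM PiE_iff extensional_def)
      then show ?thesis by simp
    qed simp
  qed (auto simp: space_PiM)
  then show ?thesis by (simp add: measurable_cong_sets[OF refl sets_PiM_equal_borel])
qed

text \<open>Levy continuity with tightness assumed. A trigonometric polynomial approximates the test
  function on a compact box that carries almost all mass. Off the box that polynomial is bounded,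
  but not by a constant known in advance, so a polynomial approximation of the truncation map is
  applied to it; the result is again a trigonometric polynomial and is bounded by about
  \<open>B\<close> everywhere.\<close>

lemma weak_conv_on_char:
  fixes A :: "'a::countable set" and \<mu> :: "nat \<Rightarrow> ('a \<Rightarrow> complex) measure"
  assumes A: "finite A" and M: "\<And>n. prob_space (\<mu> n)" "\<And>n. sets (\<mu> n) = sets (Pi\<^sub>M A (\<lambda>_. borel))"
    and N: "prob_space \<nu>" "sets \<nu> = sets (Pi\<^sub>M A (\<lambda>_. borel))"
    and char: "\<And>c. (\<lambda>n. \<integral>\<psi>. cis (rpair A c \<psi>) \<partial>\<mu> n) \<longlonglongrightarrow> (\<integral>\<psi>. cis (rpair A c \<psi>) \<partial>\<nu>)"
    and tight: "\<And>\<epsilon>. \<epsilon> > 0 \<Longrightarrow> \<exists>R. \<forall>n. measure (\<mu> n) (space (\<mu> n) - PiE A (\<lambda>_. cball 0 R)) \<le> \<epsilon>"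
  shows "weak_conv_on (product_topology (\<lambda>_. euclidean) A) \<mu> \<nu>"
  unfolding weak_conv_on_def
proof (intro allI impI, elim conjE)
  fix f :: "('a \<Rightarrow> complex) \<Rightarrow> real"
  let ?X = "product_topology (\<lambda>_. euclidean :: complex topology) A"
  let ?P = "Pi\<^sub>M A (\<lambda>_. borel :: complex measure)"
  assume f: "continuous_map ?X euclideanreal f" and bf: "bounded (f ` topspace ?X)"
  \<comment> \<open>\<open>f\<close> is continuous on functions that are \<open>undefined\<close>
    off A; composing with the restriction makes it continuous on the whole function space, where
    Stone-Weierstrass is applied.\<close>
  define g where "g \<psi> = f (restrict \<psi> A)" for \<psi>
  have top: "restrict \<psi> A \<in> topspace ?X" for \<psi> by simp
  obtain M0 where M0: "\<And>\<psi>. \<psi> \<in> topspace ?X \<Longrightarrow> \<bar>f \<psi>\<bar> \<le> M0" using bf by (auto simp: bounded_iff)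
  define B where "B = max M0 1"
  have B: "\<bar>g \<psi>\<bar> \<le> B" "B \<ge> 1" for \<psi> using M0[OF top[of \<psi>]] by (auto simp: g_def B_def)
  have "continuous_map euclidean ?X (\<lambda>\<psi>. restrict \<psi> A)"
    unfolding continuous_map_componentwise
    by (auto simp: continuous_on_product_coordinates intro: continuous_map_eq[of _ _ "\<lambda>\<psi>. \<psi> _"])
  then have "continuous_map euclidean euclideanreal (f \<circ> (\<lambda>\<psi>. restrict \<psi> A))"
    using f by (rule continuous_map_compose)
  then have g: "continuous_on UNIV g" by (simp add: g_def[abs_def] o_def)
  have gm: "g \<in> borel_measurable ?P"
    using measurable_compose[OF measurable_PiM_to_borel borel_measurable_continuous_onI[OF g]] by simp
  have sp: "space P = PiE A (\<lambda>_. UNIV)" if "sets P = sets ?P" for P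
    using sets_eq_imp_space_eq[OF that] by (simp add: space_PiM)
  have fg: "(\<integral>\<psi>. f \<psi> \<partial>P) = (\<integral>\<psi>. g \<psi> \<partial>P)" if "sets P = sets ?P" for P
    by (intro Bochner_Integration.integral_cong refl) (auto simp: g_def sp[OF that] PiE_restrict)
  have Km [measurable]: "PiE A (\<lambda>_. cball 0 R) \<in> sets ?P" for R
    using A by (intro sets_PiM_I_finite) auto
  have tight\<nu>: "\<exists>R. measure \<nu> (space \<nu> - PiE A (\<lambda>_. cball 0 R)) \<le> \<epsilon>" if "\<epsilon> > 0" for \<epsilon>
  proof -
    interpret N: prob_space \<nu> by fact
    define K where "K i = space \<nu> - PiE A (\<lambda>_. cball 0 (real i))" for i
    have "(\<lambda>i. measure \<nu> (K i)) \<longlonglongrightarrow> measure \<nu> (\<Inter>i. K i)"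
    proof (rule N.finite_Lim_measure_decseq)
      have "K i \<in> sets \<nu>" for i unfolding K_def by (intro sets.Diff sets.top) (simp add: N(2))
      then show "range K \<subseteq> sets \<nu>" by blast
      have "PiE A (\<lambda>_. cball (0::complex) (real i)) \<subseteq> PiE A (\<lambda>_. cball 0 (real j))" if "i \<le> j" for i j
        using that by (intro PiE_mono) auto
      then show "decseq K" unfolding decseq_def K_def by blast
    qed
    also have "(\<Inter>i. K i) = {}"
    proof (rule equals0I)
      fix \<psi> assume \<psi>: "\<psi> \<in> (\<Inter>i. K i)"
      define i where "i = nat \<lceil>\<Sum>x\<in>A. cmod (\<psi> x)\<rceil>"
      have "cmod (\<psi> x) \<le> real i" if "x \<in> A" for x
      proof -
        have "cmod (\<psi> x) \<le> (\<Sum>x\<in>A. cmod (\<psi> x))" using A that by (intro member_le_sum) auto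
        then show ?thesis unfolding i_def by linarith
      qed
      moreover have "\<psi> \<in> K i" using \<psi> by blast
      ultimately show False using sp[OF N(2)] by (auto simp: K_def PiE_iff)
    qed
    finally have "\<forall>\<^sub>F i in sequentially. measure \<nu> (K i) < \<epsilon>" using that by (intro order_tendstoD(2)) auto
    then show ?thesis by (auto simp: K_def eventually_sequentially intro: less_imp_le)
  qed
  show "(\<lambda>n. \<integral>\<psi>. f \<psi> \<partial>\<mu> n) \<longlonglongrightarrow> (\<integral>\<psi>. f \<psi> \<partial>\<nu>)"
  proof (rule LIMSEQ_I)
    fix e :: real assume e: "e > 0"
    define \<epsilon> where "\<epsilon> = min 1 (e / (20 * B))"
    have \<epsilon>: "\<epsilon> > 0" "\<epsilon> \<le> 1" "20 * B * \<epsilon> \<le> e" using e B by (auto simp: \<epsilon>_def min_def field_simps)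
    obtain R1 where R1: "\<And>n. measure (\<mu> n) (space (\<mu> n) - PiE A (\<lambda>_. cball 0 R1)) \<le> \<epsilon>" using tight[OF \<epsilon>(1)] by blast
    obtain R2 where R2: "measure \<nu> (space \<nu> - PiE A (\<lambda>_. cball 0 R2)) \<le> \<epsilon>" using tight\<nu>[OF \<epsilon>(1)] by blast
    define R where "R = max R1 R2"
    define K where "K = PiE A (\<lambda>_. cball (0::complex) R)"
    have "PiE A (\<lambda>_. cball (0::complex) R1) \<subseteq> K" "PiE A (\<lambda>_. cball (0::complex) R2) \<subseteq> K"
      unfolding K_def R_def by (intro PiE_mono; auto)+
    moreover have mono: "measure P (space P - K) \<le> measure P (space P - PiE A (\<lambda>_. cball 0 r))"
      if "prob_space P" "sets P = sets ?P" "PiE A (\<lambda>_. cball 0 r) \<subseteq> K" for P r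
    proof -
      interpret prob_space P by fact
      show ?thesis using that Km by (intro finite_measure_mono) auto
    qed
    ultimately have K\<mu>: "measure (\<mu> n) (space (\<mu> n) - K) \<le> \<epsilon>" and K\<nu>: "measure \<nu> (space \<nu> - K) \<le> \<epsilon>" for n
      using R1[of n] R2 M N by (meson order_trans)+
    have "compact K"
    proof -
      have "K = PiE UNIV (\<lambda>x. if x \<in> A then cball 0 R else {undefined})"
        by (auto simp: K_def PiE_iff extensional_def split: if_splits)
      moreover have "compactin (product_topology (\<lambda>_. euclidean) UNIV) (PiE UNIV (\<lambda>x. if x \<in> A then cball (0::complex) R else {undefined}))"
        unfolding compactin_PiE by auto
      ultimately show ?thesis by (simp add: euclidean_product_topology)
    qed
    then obtain p where p: "trig_poly A p" "\<And>\<psi>. \<psi> \<in> K \<Longrightarrow> \<bar>g \<psi> - p \<psi>\<bar> < \<epsilon>"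
    proof -
      have "\<exists>p. trig_poly A p \<and> (\<forall>\<psi>\<in>K. \<bar>g \<psi> - p \<psi>\<bar> < \<epsilon>)"
      proof (rule Stone_Weierstrass_HOL[OF \<open>compact K\<close>])
        show "\<exists>h. trig_poly A h \<and> h \<psi> \<noteq> h \<phi>" if "\<psi> \<in> K \<and> \<phi> \<in> K \<and> \<psi> \<noteq> \<phi>" for \<psi> \<phi>
        proof -
          have "\<exists>x\<in>A. \<psi> x \<noteq> \<phi> x"
          proof (rule ccontr)
            assume *: "\<not> (\<exists>x\<in>A. \<psi> x \<noteq> \<phi> x)"
            have "\<psi> = \<phi>"
              by (rule PiE_ext[of \<psi> A "\<lambda>_. cball 0 R" \<phi>]) (use that * in \<open>simp_all add: K_def\<close>)
            then show False using that by simp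
          qed
          then obtain x where x: "x \<in> A" "\<psi> x \<noteq> \<phi> x" by blast
          define w where "w = cnj (\<psi> x - \<phi> x)"
          define c where "c = (\<lambda>y. if y = x then w else 0)"
          have rp: "rpair A (\<lambda>y. of_real s * c y) \<eta> = s * Re (w * \<eta> x)" for s \<eta>
          proof -
            have "rpair A (\<lambda>y. of_real s * c y) \<eta> = (\<Sum>y\<in>A. if y = x then s * Re (w * \<eta> x) else 0)"
              unfolding rpair_def c_def by (intro sum.cong) (auto simp: algebra_simps)
            then show ?thesis using x A by simp
          qed
          define l where "l = Re (w * \<psi> x) - Re (w * \<phi> x)"
          have "l = (cmod (\<psi> x - \<phi> x))\<^sup>2"
            unfolding cmod_power2 l_def w_def by (simp add: power2_eq_square algebra_simps)
          then have l: "l \<noteq> 0" using x by simp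
          \<comment> \<open>The functional increases by l = |\<psi> x - \<phi> x|^2 from \<phi> to
            \<psi>. Scaling by pi / l and subtracting the value at \<phi> makes the phase 0 at
            \<phi> and pi at \<psi>, where the cosine takes different values.\<close>
          let ?h = "\<lambda>\<eta>. 1 * cos (rpair A (\<lambda>y. of_real (pi / l) * c y) \<eta> + (- (pi / l * Re (w * \<phi> x))))"
          have "?h \<phi> = 1" unfolding rp by simp
          moreover have "pi / l * (Re (w * \<psi> x) - Re (w * \<phi> x)) = pi" unfolding l_def[symmetric] using l by simp
          then have "pi / l * Re (w * \<psi> x) + (- (pi / l * Re (w * \<phi> x))) = pi" by (simp only: right_diff_distrib)
          then have "?h \<psi> = -1" unfolding rp by (simp only: cos_pi mult_1_left)
          ultimately have "?h \<psi> \<noteq> ?h \<phi>" by linarith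
          moreover have "trig_poly A ?h" by (rule trig_poly.cos)
          ultimately show ?thesis by blast
        qed
      qed (use \<epsilon> g in \<open>auto intro: trig_poly_const trig_poly_mult trig_poly.add trig_poly_continuous continuous_on_subset\<close>)
      then show ?thesis using that by blast
    qed
    obtain C where C: "\<And>\<psi>. \<bar>p \<psi>\<bar> \<le> C" "C \<ge> 0" using trig_poly_bounded[OF p(1)] by blast
    \<comment> \<open>Truncation does not move \<open>p\<close> away from \<open>g\<close>, as |g|
      \<le> B, and it bounds \<open>p\<close> off the compact set. All values of \<open>p\<close>
      lie in [-C, C], so uniform approximation of \<open>clamp\<close> on this interval
      suffices.\<close>
    define clamp where "clamp t = max (- B) (min B t)" for t
    have "continuous_on {-C..C} clamp" unfolding clamp_def by (intro continuous_intros)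
    then obtain q where q: "real_polynomial_function q" "\<And>t. t \<in> {-C..C} \<Longrightarrow> \<bar>clamp t - q t\<bar> < \<epsilon>"
      using Stone_Weierstrass_real_polynomial_function[OF compact_Icc _ \<epsilon>(1)] by blast
    define h where "h \<psi> = q (p \<psi>)" for \<psi>
    have h: "trig_poly A h" unfolding h_def by (rule trig_poly_compose[OF q(1) p(1)])
    have qp: "\<bar>clamp (p \<psi>) - h \<psi>\<bar> < \<epsilon>" for \<psi>
      unfolding h_def using C(1)[of \<psi>] by (intro q(2)) (auto simp: abs_le_iff)
    have hg: "\<bar>h \<psi> - g \<psi>\<bar> \<le> 2 * \<epsilon>" if "\<psi> \<in> K" for \<psi>
    proof -
      have "\<bar>clamp (p \<psi>) - g \<psi>\<bar> \<le> \<bar>p \<psi> - g \<psi>\<bar>" using B(1)[of \<psi>] unfolding clamp_def by linarith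
      then show ?thesis using qp[of \<psi>] p(2)[OF that] by linarith
    qed
    have hb: "\<bar>h \<psi> - g \<psi>\<bar> \<le> 3 * B" for \<psi>
    proof -
      have "\<bar>clamp (p \<psi>)\<bar> \<le> B" using B unfolding clamp_def by auto
      then show ?thesis using qp[of \<psi>] B(1)[of \<psi>] B(2) \<epsilon> by linarith
    qed
    have close: "\<bar>(\<integral>\<psi>. h \<psi> \<partial>P) - (\<integral>\<psi>. g \<psi> \<partial>P)\<bar> \<le> 5 * B * \<epsilon>"
      if P: "prob_space P" "sets P = sets ?P" "measure P (space P - K) \<le> \<epsilon>" for P
    proof -
      interpret prob_space P by fact
      have [measurable]: "g \<in> borel_measurable P" "h \<in> borel_measurable P" "K \<in> sets P"
        using gm trig_poly_measurable[OF h] Km by (auto simp: measurable_cong_sets[OF P(2) refl] P(2) K_def)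
      obtain Ch where Ch: "\<And>\<psi>. \<bar>h \<psi>\<bar> \<le> Ch" using trig_poly_bounded[OF h] by blast
      have ig: "integrable P g" "integrable P h"
        by (rule integrable_const_bound[where B = B]; use B in simp) (rule integrable_const_bound[where B = Ch]; use Ch in simp)
      have "\<bar>(\<integral>\<psi>. h \<psi> \<partial>P) - (\<integral>\<psi>. g \<psi> \<partial>P)\<bar> = \<bar>\<integral>\<psi>. h \<psi> - g \<psi> \<partial>P\<bar>" using ig by simp
      also have "\<dots> \<le> (\<integral>\<psi>. \<bar>h \<psi> - g \<psi>\<bar> \<partial>P)" by (rule integral_abs_bound)
      also have "\<dots> \<le> (\<integral>\<psi>. 2 * \<epsilon> + 3 * B * indicator (space P - K) \<psi> \<partial>P)"
      proof (rule integral_mono)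
        show "integrable P (\<lambda>\<psi>. \<bar>h \<psi> - g \<psi>\<bar>)" using ig by simp
        show "integrable P (\<lambda>\<psi>. 2 * \<epsilon> + 3 * B * indicator (space P - K) \<psi>)"
          by (intro Bochner_Integration.integrable_add integrable_mult_right) (auto simp: emeasure_eq_measure)
        show "\<bar>h \<psi> - g \<psi>\<bar> \<le> 2 * \<epsilon> + 3 * B * indicator (space P - K) \<psi>" if "\<psi> \<in> space P" for \<psi>
          using hg[of \<psi>] hb[of \<psi>] that \<epsilon> by (cases "\<psi> \<in> K") auto
      qed
      also have "\<dots> = 2 * \<epsilon> + 3 * B * prob (space P - K)"
        by (subst Bochner_Integration.integral_add) (auto simp: prob_space emeasure_eq_measure)
      also have "\<dots> \<le> 2 * (B * \<epsilon>) + 3 * B * \<epsilon>"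
        using P(3) B \<epsilon> by (intro add_mono mult_left_mono) auto
      finally show ?thesis by (simp add: algebra_simps)
    qed
    have "(\<lambda>n. \<integral>\<psi>. h \<psi> \<partial>\<mu> n) \<longlonglongrightarrow> (\<integral>\<psi>. h \<psi> \<partial>\<nu>)"
      by (rule trig_poly_integral_tendsto[OF h M N char])
    then have "\<exists>n0. \<forall>n\<ge>n0. norm ((\<integral>\<psi>. h \<psi> \<partial>\<mu> n) - (\<integral>\<psi>. h \<psi> \<partial>\<nu>)) < e / 4"
      using e by (intro LIMSEQ_D) auto
    then obtain n0 where n0: "\<And>n. n \<ge> n0 \<Longrightarrow> \<bar>(\<integral>\<psi>. h \<psi> \<partial>\<mu> n) - (\<integral>\<psi>. h \<psi> \<partial>\<nu>)\<bar> < e / 4"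
      unfolding real_norm_def by blast
    have "5 * B * \<epsilon> \<le> e / 4" using \<epsilon>(3) by simp
    then have "\<bar>(\<integral>\<psi>. g \<psi> \<partial>\<mu> n) - (\<integral>\<psi>. g \<psi> \<partial>\<nu>)\<bar> < e" if "n \<ge> n0" for n
      using close[OF M(1)[of n] M(2)[of n] K\<mu>[of n]] close[OF N K\<nu>] n0[OF that] e by linarith
    then show "\<exists>no. \<forall>n\<ge>no. norm ((\<integral>\<psi>. f \<psi> \<partial>\<mu> n) - (\<integral>\<psi>. f \<psi> \<partial>\<nu>)) < e"
      unfolding fg[OF M(2)] fg[OF N(2)] real_norm_def by blast
  qed
qed

section \<open>Riemann sums for the lattice Green function\<close>

text \<open>With x = pi s \<le> 2, the Taylor bound x - x^3 / 6 \<le> sin x gives x / 3 \<le> sin x,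
  and pi > 3 turns this into s \<le> sin (pi s). The other half of the interval follows by
  reflection.\<close>

lemma sin_pi_ge_min:
  assumes "0 \<le> t" "t \<le> 1"
  shows "min t (1 - t) \<le> sin (pi * t)"
proof -
  have *: "s \<le> sin (pi * s)" if "0 \<le> s" "s \<le> 1/2" for s
  proof -
    define x where "x = pi * s"
    have "pi * s \<le> pi * (1 / 2)" using that by (intro mult_left_mono) auto
    then have "x \<le> 2" unfolding x_def using pi_less_4 by linarith
    moreover have "0 \<le> x" using that by (simp add: x_def)
    ultimately have x: "0 \<le> x" "x \<le> 2" by auto
    define E where "E = iexp x - (\<Sum>k\<le>2. (\<i> * complex_of_real x) ^ k / fact k)"
    have "\<bar>Im E\<bar> \<le> cmod E" by (rule abs_Im_le_cmod)
    also have "cmod E \<le> \<bar>x\<bar> ^ Suc 2 / fact (Suc 2)" unfolding E_def by (rule iexp_approx1)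
    also have "\<dots> = x ^ 3 / 6" using x by (simp add: fact_numeral)
    also have "Im E = sin x - x"
      by (simp add: E_def numeral_2_eq_2 Im_exp)
    finally have "x - x ^ 3 / 6 \<le> sin x" by linarith
    moreover have "x ^ 3 \<le> 4 * x"
    proof -
      have "x * x \<le> 2 * 2" using x by (intro mult_mono) auto
      then have "x * (x * x) \<le> x * 4" using x by (intro mult_left_mono) auto
      then show ?thesis by (simp add: eval_nat_numeral mult_ac)
    qed
    ultimately have "x / 3 \<le> sin x" by linarith
    moreover have "s * 3 \<le> s * pi" using that pi_gt3 by (intro mult_left_mono) auto
    ultimately show ?thesis by (simp add: x_def mult_ac)
  qed
  show ?thesis
  proof (cases "t \<le> 1/2")
    case True then show ?thesis using *[of t] assms by simp
  next
    case False
    have "sin (pi * (1 - t)) = sin (pi * t)" by (simp add: right_diff_distrib)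
    then show ?thesis using *[of "1 - t"] assms False by simp
  qed
qed

text \<open>The Fourier symbol of the lattice Laplacian, with momentum normalised to the unit cube.
  It vanishes at all corners of the cube.\<close>

definition lattice_symbol :: "real ^ 'd \<Rightarrow> real" where
  "lattice_symbol \<kappa> = 4 * (\<Sum>i\<in>UNIV. (sin (pi * \<kappa> $ i))\<^sup>2)"

definition scaled :: "nat \<Rightarrow> int ^ 'd \<Rightarrow> real ^ 'd" where
  "scaled n k = (\<chi> i. real_of_int (k $ i) / real n)"

lemma eigval_eq_symbol: "eigval n k = lattice_symbol (scaled n k)"
  by (simp add: eigval_def lattice_symbol_def scaled_def)

lemma lattice_symbol_nonneg: "lattice_symbol \<kappa> \<ge> 0"
  by (simp add: lattice_symbol_def sum_nonneg)

lemma continuous_lattice_symbol: "continuous_on A lattice_symbol"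
  unfolding lattice_symbol_def by (intro continuous_intros)

lemma lattice_symbol_ge:
  assumes "0 \<le> \<kappa> $ i" "\<kappa> $ i \<le> 1"
  shows "4 * (min (\<kappa> $ i) (1 - \<kappa> $ i))\<^sup>2 \<le> lattice_symbol \<kappa>"
proof -
  have "(min (\<kappa> $ i) (1 - \<kappa> $ i))\<^sup>2 \<le> (sin (pi * \<kappa> $ i))\<^sup>2"
    using sin_pi_ge_min[OF assms] assms by (intro power_mono) auto
  also have "\<dots> \<le> (\<Sum>i\<in>UNIV. (sin (pi * \<kappa> $ i))\<^sup>2)"
    by (rule member_le_sum) auto
  finally show ?thesis by (simp add: lattice_symbol_def)
qed

lemma eigval_nonneg: "eigval n k \<ge> 0"
  by (simp add: eigval_eq_symbol lattice_symbol_nonneg)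

text \<open>Spectral gap: some coordinate of k is nonzero, and then its fraction of n has distance
  at least 1 / n from both ends of the unit interval.\<close>

lemma eigval_ge:
  assumes "n > 0" "k \<in> torus n" "k \<noteq> 0"
  shows "4 / (real n)\<^sup>2 \<le> eigval n k"
proof -
  obtain i where i: "k $ i \<noteq> 0" using assms(3) by (auto simp: vec_eq_iff)
  have "0 \<le> k $ i" "k $ i < int n" using assms(2) unfolding torus_def by blast+
  then have ki: "1 \<le> k $ i" "k $ i \<le> int n - 1" using i by linarith+
  then have 1: "1 \<le> real_of_int (k $ i)" "real_of_int (k $ i) \<le> real n - 1" by linarith+
  have "1 / real n \<le> min (real_of_int (k $ i) / real n) (1 - real_of_int (k $ i) / real n)"
    using 1 assms(1) by (simp add: field_simps)
  then have "(1 / real n)\<^sup>2 \<le> (min (scaled n k $ i) (1 - scaled n k $ i))\<^sup>2"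
    by (intro power_mono) (auto simp: scaled_def)
  also have "4 * \<dots> \<le> eigval n k"
    unfolding eigval_eq_symbol by (rule lattice_symbol_ge) (use 1 assms in \<open>auto simp: scaled_def field_simps\<close>)
  finally show ?thesis by (simp add: power_divide)
qed

section \<open>Riemann sums as integrals of step functions\<close>

abbreviation unit_box :: "(real ^ 'd) set" where "unit_box \<equiv> box 0 1"

lemma mem_unit_box: "\<kappa> \<in> unit_box \<longleftrightarrow> (\<forall>i. 0 < \<kappa> $ i \<and> \<kappa> $ i < 1)"
  by (simp add: mem_box_cart)

lemma emeasure_unit_box: "emeasure lborel (unit_box :: (real ^ 'd) set) = 1"
proof -
  have "emeasure lborel (unit_box :: (real ^ 'd) set) = (\<Prod>b\<in>Basis. ((1 :: real ^ 'd) - 0) \<bullet> b)"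
    by (rule emeasure_lborel_box) (auto simp: Basis_vec_def inner_axis)
  also have "(\<Prod>b\<in>(Basis :: (real ^ 'd) set). (1 - 0) \<bullet> b) = 1"
    by (intro prod.neutral) (auto simp: Basis_vec_def inner_axis)
  finally show ?thesis by simp
qed

lemma null_sets_cbox_minus_box: "(cbox 0 1 :: (real ^ 'd) set) - unit_box \<in> null_sets lborel"
proof -
  have "emeasure lborel (cbox 0 1 - unit_box :: (real ^ 'd) set) =
      emeasure lborel (cbox 0 1 :: (real ^ 'd) set) - emeasure lborel (unit_box :: (real ^ 'd) set)"
    by (intro emeasure_Diff) (auto simp: emeasure_unit_box box_subset_cbox)
  also have "emeasure lborel (cbox 0 1 :: (real ^ 'd) set) = emeasure lborel (unit_box :: (real ^ 'd) set)"
    by (subst emeasure_lborel_cbox_eq, subst emeasure_lborel_box_eq) simp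
  finally have "emeasure lborel (cbox 0 1 - unit_box :: (real ^ 'd) set) = 0"
    by (simp add: emeasure_unit_box)
  then show ?thesis by (auto simp: null_sets_def)
qed

text \<open>The faces of the cube are null. On the open cube the symbol is positive, so integrands
  stay continuous there even for mass 0.\<close>

lemma integral_cbox_eq_box:
  fixes f :: "real ^ 'd \<Rightarrow> real"
  assumes "f \<in> borel_measurable borel"
  shows "(LINT \<kappa>:cbox 0 1|lborel. f \<kappa>) = (LINT \<kappa>:unit_box|lborel. f \<kappa>)"
  unfolding set_lebesgue_integral_def
proof (rule integral_cong_AE)
  show "AE \<kappa> in lborel. indicator (cbox 0 1) \<kappa> *\<^sub>R f \<kappa> = indicator unit_box \<kappa> *\<^sub>R f \<kappa>"
    using AE_not_in[OF null_sets_cbox_minus_box]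
    by eventually_elim (use box_subset_cbox[of 0 "1 :: real ^ 'd"] in \<open>auto simp: indicator_def\<close>)
qed (use assms in auto)

text \<open>Index of the half-open cell of side 1 / n containing the point; a Riemann sum at the
  lower corners becomes the integral of a function that is constant on cells.\<close>

definition grid :: "nat \<Rightarrow> real ^ 'd \<Rightarrow> int ^ 'd" where
  "grid n \<kappa> = (\<chi> i. \<lfloor>real n * \<kappa> $ i\<rfloor>)"

lemma grid_in_torus:
  assumes "n > 0" "\<kappa> \<in> unit_box"
  shows "grid n \<kappa> \<in> torus n"
proof -
  have "0 < real n * \<kappa> $ i" "real n * \<kappa> $ i < real n" for i
    using assms by (auto simp: mem_unit_box)
  then show ?thesis by (auto simp: torus_def grid_def floor_less_iff less_imp_le)
qed

lemma grid_eq_iff: "grid n \<kappa> = k \<longleftrightarrow> (\<forall>i. real_of_int (k $ i) \<le> real n * \<kappa> $ i \<and> real n * \<kappa> $ i < real_of_int (k $ i) + 1)"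
  by (simp add: grid_def vec_eq_iff floor_eq_iff)

lemma measurable_vec_nth [measurable]: "(\<lambda>\<kappa> :: real ^ 'd. \<kappa> $ i) \<in> borel_measurable borel"
  by (intro borel_measurable_continuous_onI continuous_intros)

lemma grid_cell_measurable [measurable]: "{\<kappa> :: real ^ 'd. grid n \<kappa> = k} \<in> sets borel"
proof -
  have "{\<kappa> :: real ^ 'd. grid n \<kappa> = k} = (\<Inter>i. {\<kappa>\<in>space borel. real_of_int (k $ i) \<le> real n * \<kappa> $ i \<and> real n * \<kappa> $ i < real_of_int (k $ i) + 1})"
    by (auto simp: grid_eq_iff)
  also have "\<dots> \<in> sets borel"
    by (intro sets.countable_INT'' ) (auto intro: countableI_type)
  finally show ?thesis .
qed

text \<open>Up to its boundary the cell is a cube of side 1 / n, so its measure is squeezed between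
  those of the open and the closed cube.\<close>

lemma emeasure_grid_cell:
  fixes k :: "int ^ 'd"
  assumes n: "n > 0" and k: "k \<in> torus n"
  shows "emeasure lborel ({\<kappa>. grid n \<kappa> = k} \<inter> unit_box) = ennreal (1 / real (n ^ CARD('d)))"
proof -
  let ?l = "scaled n k" and ?u = "scaled n (k + 1)"
  have lu: "?l $ i \<le> ?u $ i" for i by (simp add: scaled_def divide_right_mono)
  have vol: "(\<Prod>b\<in>Basis. (?u - ?l) \<bullet> b) = 1 / real (n ^ CARD('d))"
  proof -
    have "(?u - ?l) \<bullet> b = 1 / real n" if "b \<in> Basis" for b
      using that by (auto simp: Basis_vec_def inner_axis scaled_def simp flip: diff_divide_distrib)
    then have "(\<Prod>b\<in>Basis. (?u - ?l) \<bullet> b) = (\<Prod>b\<in>(Basis :: (real ^ 'd) set). 1 / real n)"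
      by (intro prod.cong) auto
    then show ?thesis by (simp add: power_one_over)
  qed
  have le: "?l \<bullet> b \<le> ?u \<bullet> b" if "b \<in> Basis" for b
    using that lu by (auto simp: Basis_vec_def inner_axis)
  have "emeasure lborel (box ?l ?u) \<le> emeasure lborel ({\<kappa>. grid n \<kappa> = k} \<inter> unit_box)"
  proof (rule emeasure_mono)
    show "box ?l ?u \<subseteq> {\<kappa>. grid n \<kappa> = k} \<inter> unit_box"
    proof
      fix \<kappa> assume \<kappa>: "\<kappa> \<in> box ?l ?u"
      have b: "real_of_int (k $ i) < real n * \<kappa> $ i" "real n * \<kappa> $ i < real_of_int (k $ i) + 1" for i
        using \<kappa> n by (auto simp: mem_box_cart scaled_def field_simps)
      have "0 < \<kappa> $ i \<and> \<kappa> $ i < 1" for i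
      proof -
        have "0 \<le> k $ i" "k $ i < int n" using k unfolding torus_def by blast+
        then have "0 \<le> real_of_int (k $ i)" "real_of_int (k $ i) + 1 \<le> real n" by linarith+
        then have "0 < real n * \<kappa> $ i" "real n * \<kappa> $ i < real n * 1" using b[of i] by linarith+
        then show ?thesis using n by (simp add: zero_less_mult_iff)
      qed
      then show "\<kappa> \<in> {\<kappa>. grid n \<kappa> = k} \<inter> unit_box"
        using b by (auto simp: grid_eq_iff mem_unit_box less_imp_le)
    qed
  qed simp
  moreover have "emeasure lborel ({\<kappa>. grid n \<kappa> = k} \<inter> unit_box) \<le> emeasure lborel (cbox ?l ?u)"
  proof (rule emeasure_mono)
    show "{\<kappa>. grid n \<kappa> = k} \<inter> unit_box \<subseteq> cbox ?l ?u"
      using n by (auto simp: grid_eq_iff mem_box_cart scaled_def field_simps less_imp_le)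
  qed simp
  ultimately show ?thesis
    using le vol by (simp add: emeasure_lborel_box emeasure_lborel_cbox)
qed

lemma riemann_sum_integral:
  fixes h :: "int ^ 'd \<Rightarrow> real"
  assumes n: "n > 0"
  shows "(LINT \<kappa>:unit_box|lborel. h (grid n \<kappa>)) = (\<Sum>k\<in>torus n. h k) / real (n ^ CARD('d))"
proof -
  let ?C = "\<lambda>k :: int ^ 'd. {\<kappa>. grid n \<kappa> = k} \<inter> unit_box"
  have "indicator unit_box \<kappa> *\<^sub>R h (grid n \<kappa>) = (\<Sum>k\<in>torus n. indicator (?C k) \<kappa> *\<^sub>R h k)" for \<kappa>
  proof (cases "\<kappa> \<in> unit_box")
    case True
    have "(\<Sum>k\<in>torus n. indicator (?C k) \<kappa> *\<^sub>R h k) = (\<Sum>k\<in>torus n. if k = grid n \<kappa> then h k else 0)"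
      using True by (intro sum.cong) (auto simp: indicator_def)
    then show ?thesis using True grid_in_torus[OF n True] by simp
  qed auto
  then have "(LINT \<kappa>:unit_box|lborel. h (grid n \<kappa>)) = (\<integral>\<kappa>. (\<Sum>k\<in>torus n. indicator (?C k) \<kappa> *\<^sub>R h k) \<partial>lborel)"
    by (simp add: set_lebesgue_integral_def)
  also have "\<dots> = (\<Sum>k\<in>torus n. \<integral>\<kappa>. indicator (?C k) \<kappa> *\<^sub>R h k \<partial>lborel)"
    by (intro Bochner_Integration.integral_sum)
      (auto simp: emeasure_grid_cell[OF n] intro!: integrable_mult_left)
  also have "\<dots> = (\<Sum>k\<in>torus n. h k / real (n ^ CARD('d)))"
    by (intro sum.cong refl) (simp add: measure_def emeasure_grid_cell[OF n])
  finally show ?thesis by (simp add: sum_divide_distrib)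
qed

lemma measurable_grid_comp [measurable]:
  fixes h :: "int ^ 'd \<Rightarrow> real"
  shows "(\<lambda>\<kappa>. h (grid n \<kappa>)) \<in> borel_measurable borel"
proof (rule measurable_compose[of "grid n" borel "count_space UNIV"])
  have "grid n -` {k} \<in> sets borel" for k :: "int ^ 'd"
  proof -
    have "grid n -` {k} = {\<kappa> :: real ^ 'd. grid n \<kappa> = k}" by auto
    then show ?thesis by simp
  qed
  then show "grid n \<in> borel \<rightarrow>\<^sub>M (count_space UNIV :: (int ^ 'd) measure)"
    by (subst measurable_count_space_eq_countable) auto
qed simp

lemma scaled_grid_tendsto: "(\<lambda>n. scaled n (grid n \<kappa>)) \<longlonglongrightarrow> \<kappa>"
proof (rule vec_tendstoI)
  fix i
  have "(\<lambda>n. real_of_int \<lfloor>real n * \<kappa> $ i\<rfloor> / real n) \<longlonglongrightarrow> \<kappa> $ i"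
  proof (rule tendsto_sandwich)
    show "\<forall>\<^sub>F n in sequentially. \<kappa> $ i - 1 / real n \<le> real_of_int \<lfloor>real n * \<kappa> $ i\<rfloor> / real n"
      using eventually_gt_at_top[of 0] proof eventually_elim
      case (elim n)
      have "real n * \<kappa> $ i - 1 \<le> real_of_int \<lfloor>real n * \<kappa> $ i\<rfloor>" by linarith
      then have "(real n * \<kappa> $ i - 1) / real n \<le> real_of_int \<lfloor>real n * \<kappa> $ i\<rfloor> / real n"
        by (rule divide_right_mono) simp
      then show ?case using elim by (simp add: diff_divide_distrib)
    qed
    show "\<forall>\<^sub>F n in sequentially. real_of_int \<lfloor>real n * \<kappa> $ i\<rfloor> / real n \<le> \<kappa> $ i"
      using eventually_gt_at_top[of 0] by eventually_elim (simp add: field_simps)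
    show "(\<lambda>n. \<kappa> $ i - 1 / real n) \<longlonglongrightarrow> \<kappa> $ i"
      using tendsto_diff[OF tendsto_const lim_1_over_n] by simp
  qed simp
  then show "(\<lambda>n. scaled n (grid n \<kappa>) $ i) \<longlonglongrightarrow> \<kappa> $ i" by (simp add: scaled_def grid_def)
qed

text \<open>Dominated convergence for the step functions. The integrands may be unbounded near the
  corners, so \<open>D\<close> has to bound the step functions themselves, uniformly in n, and not
  only \<open>h\<close>.\<close>

lemma riemann_sum_limit:
  fixes h :: "real ^ 'd \<Rightarrow> real"
  assumes h: "h \<in> borel_measurable borel" "\<And>\<kappa>. \<kappa> \<in> unit_box \<Longrightarrow> isCont h \<kappa>"
    and D: "set_integrable lborel unit_box D"
    and bound: "\<And>n \<kappa>. n > 0 \<Longrightarrow> \<kappa> \<in> unit_box \<Longrightarrow> \<bar>h (scaled n (grid n \<kappa>))\<bar> \<le> D \<kappa>"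
  shows "(\<lambda>n. (\<Sum>k\<in>torus n. h (scaled n k)) / real (n ^ CARD('d))) \<longlonglongrightarrow> (LINT \<kappa>:cbox 0 1|lborel. h \<kappa>)"
proof -
  \<comment> \<open>The index is shifted because the bound is available for positive n only; the
    shift is undone at the end.\<close>
  have "(\<lambda>n. LINT \<kappa>:unit_box|lborel. h (scaled (Suc n) (grid (Suc n) \<kappa>))) \<longlonglongrightarrow> (LINT \<kappa>:unit_box|lborel. h \<kappa>)"
    unfolding set_lebesgue_integral_def
  proof (rule integral_dominated_convergence)
    show "integrable lborel (\<lambda>\<kappa>. indicator unit_box \<kappa> *\<^sub>R D \<kappa>)"
      using D by (simp add: set_integrable_def)
    show "AE \<kappa> in lborel. (\<lambda>n. indicator unit_box \<kappa> *\<^sub>R h (scaled (Suc n) (grid (Suc n) \<kappa>))) \<longlonglongrightarrow> indicator unit_box \<kappa> *\<^sub>R h \<kappa>"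
    proof (rule AE_I2)
      fix \<kappa> :: "real ^ 'd"
      show "(\<lambda>n. indicator unit_box \<kappa> *\<^sub>R h (scaled (Suc n) (grid (Suc n) \<kappa>))) \<longlonglongrightarrow> indicator unit_box \<kappa> *\<^sub>R h \<kappa>"
      proof (cases "\<kappa> \<in> unit_box")
        case True
        have "(\<lambda>n. h (scaled n (grid n \<kappa>))) \<longlonglongrightarrow> h \<kappa>"
          by (rule isCont_tendsto_compose[OF h(2)[OF True] scaled_grid_tendsto])
        from LIMSEQ_Suc[OF this] show ?thesis using True by simp
      qed simp
    qed
    show "AE \<kappa> in lborel. norm (indicator unit_box \<kappa> *\<^sub>R h (scaled (Suc n) (grid (Suc n) \<kappa>))) \<le> indicator unit_box \<kappa> *\<^sub>R D \<kappa>" for n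
      using bound by (intro AE_I2) (auto simp: indicator_def)
    show "(\<lambda>\<kappa>. indicator unit_box \<kappa> *\<^sub>R h (scaled (Suc n) (grid (Suc n) \<kappa>))) \<in> borel_measurable lborel" for n
      using measurable_grid_comp[of "\<lambda>k. h (scaled (Suc n) k)" "Suc n"] by simp
  qed (use h in auto)
  then have "(\<lambda>n. (\<Sum>k\<in>torus (Suc n). h (scaled (Suc n) k)) / real (Suc n ^ CARD('d))) \<longlonglongrightarrow> (LINT \<kappa>:unit_box|lborel. h \<kappa>)"
    by (subst (asm) riemann_sum_integral) (simp_all only: zero_less_Suc)
  then show ?thesis unfolding integral_cbox_eq_box[OF h(1)] by (rule LIMSEQ_imp_Suc)
qed

section \<open>An integrable majorant of the inverse symbol\<close>

definition edge_dist :: "real \<Rightarrow> real" where "edge_dist t = min t (1 - t)"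

text \<open>Majorises the inverse of the symbol, which behaves like an inverse squared distance near
  each corner, by a product of one-dimensional powers. It handles all corners at once and is
  integrable by Fubini as soon as the exponent 2 / d is below 1, that is for d \<ge> 3.\<close>

definition symbol_dominator :: "real ^ 'd \<Rightarrow> real" where
  "symbol_dominator \<kappa> = (\<Prod>i\<in>UNIV. edge_dist (\<kappa> $ i) powr (- (2 / real CARD('d))))"

lemma nn_integral_powr_finite:
  assumes "a > -1"
  shows "(\<integral>\<^sup>+t. ennreal (indicator {0<..<1} t * t powr a) \<partial>lborel) < \<infinity>"
proof -
  have "((\<lambda>x. x powr a) has_integral 1 powr (a + 1) / (a + 1)) {0..1}"
    by (rule has_integral_powr_from_0) (use assms in auto)
  then have "(\<integral>\<^sup>+t. ennreal (t powr a) * indicator {0..1} t \<partial>lborel) = ennreal (1 powr (a + 1) / (a + 1))"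
    by (intro nn_integral_has_integral_lebesgue') auto
  moreover have "(\<integral>\<^sup>+t. ennreal (indicator {0<..<1} t * t powr a) \<partial>lborel) \<le>
      (\<integral>\<^sup>+t. ennreal (t powr a) * indicator {0..1} t \<partial>lborel)"
    by (intro nn_integral_mono) (auto simp: indicator_def)
  ultimately show ?thesis by (simp add: le_less_trans)
qed

text \<open>The integrand is bounded by the sum of the two powers that are singular at one end each;
  the second arises from the first by reflection.\<close>

lemma nn_integral_edge_dist_finite:
  assumes "a > -1" "a \<le> 0"
  shows "(\<integral>\<^sup>+t. ennreal (indicator {0<..<1} t * edge_dist t powr a) \<partial>lborel) < \<infinity>"
proof -
  let ?f = "\<lambda>t :: real. ennreal (indicator {0<..<1} t * t powr a)"
  have "(\<integral>\<^sup>+t. ennreal (indicator {0<..<1} t * edge_dist t powr a) \<partial>lborel) \<le>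
      (\<integral>\<^sup>+t. ?f t + ?f (1 + (-1) * t) \<partial>lborel)"
    by (intro nn_integral_mono) (auto simp: indicator_def edge_dist_def min_def simp flip: ennreal_plus)
  also have "\<dots> = (\<integral>\<^sup>+t. ?f t \<partial>lborel) + (\<integral>\<^sup>+t. ?f (1 + (-1) * t) \<partial>lborel)"
    by (intro nn_integral_add) auto
  also have "(\<integral>\<^sup>+t. ?f (1 + (-1) * t) \<partial>lborel) = (\<integral>\<^sup>+t. ?f t \<partial>lborel)"
    using nn_integral_real_affine[of ?f "-1" 1] by simp
  also have "(\<integral>\<^sup>+t. ?f t \<partial>lborel) + (\<integral>\<^sup>+t. ?f t \<partial>lborel) < \<infinity>"
    using nn_integral_powr_finite[OF assms(1)] by simp
  finally show ?thesis .
qed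

lemma edge_dist_pos: "\<kappa> \<in> unit_box \<Longrightarrow> edge_dist (\<kappa> $ i) > 0"
  unfolding mem_unit_box edge_dist_def by (drule spec[of _ i]) simp

lemma symbol_dominator_pos: "\<kappa> \<in> unit_box \<Longrightarrow> symbol_dominator \<kappa> > 0"
  unfolding symbol_dominator_def
proof (rule prod_pos)
  fix i
  assume "\<kappa> \<in> unit_box"
  then show "0 < edge_dist (\<kappa> $ i) powr (- (2 / real CARD('a)))" using edge_dist_pos[of \<kappa> i] by simp
qed

lemma measurable_symbol_dominator [measurable]: "symbol_dominator \<in> borel_measurable (borel :: (real ^ 'd) measure)"
  unfolding symbol_dominator_def edge_dist_def by measurable

lemma set_integrable_symbol_dominator:
  assumes "CARD('d) \<ge> 3"
  shows "set_integrable lborel (unit_box :: (real ^ 'd) set) symbol_dominator"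
proof -
  let ?a = "- (2 / real CARD('d))"
  let ?g = "\<lambda>t. ennreal (indicator {0<..<1} t * edge_dist t powr ?a)"
  have a: "?a > -1" "?a \<le> 0" using assms by (auto simp: field_simps)
  have g [measurable]: "?g \<in> borel_measurable borel" unfolding edge_dist_def by measurable
  have "ennreal (norm (indicator unit_box \<kappa> *\<^sub>R symbol_dominator \<kappa>)) = (\<Prod>b\<in>Basis. ?g (\<kappa> \<bullet> b))" for \<kappa> :: "real ^ 'd"
  proof -
    have B: "(Basis :: (real ^ 'd) set) = (\<lambda>i. axis i 1) ` UNIV" by (auto simp: Basis_vec_def)
    have "(\<Prod>b\<in>(Basis :: (real ^ 'd) set). ?g (\<kappa> \<bullet> b)) = (\<Prod>i\<in>UNIV. ?g (\<kappa> $ i))"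
      unfolding B by (subst prod.reindex) (auto simp: inj_on_def axis_eq_axis inner_axis)
    also have "\<dots> = ennreal (\<Prod>i\<in>UNIV. indicator {0<..<1} (\<kappa> $ i) * edge_dist (\<kappa> $ i) powr ?a)"
      by (rule prod_ennreal) auto
    also have "(\<Prod>i\<in>UNIV. indicator {0<..<1} (\<kappa> $ i) * edge_dist (\<kappa> $ i) powr ?a) =
        indicator unit_box \<kappa> * symbol_dominator \<kappa>"
    proof (cases "\<kappa> \<in> unit_box")
      case False
      then obtain i where "\<kappa> $ i \<notin> {0<..<1}" by (auto simp: mem_unit_box)
      then have "(\<Prod>i\<in>UNIV. indicator {0<..<1} (\<kappa> $ i) * edge_dist (\<kappa> $ i) powr ?a) = 0"
        by (intro prod_zero bexI[of _ i]) auto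
      then show ?thesis using False by simp
    qed (auto simp: symbol_dominator_def mem_unit_box intro!: prod.cong)
    finally show ?thesis
      by (cases "\<kappa> \<in> unit_box") (auto simp: symbol_dominator_pos less_imp_le)
  qed
  then have "(\<integral>\<^sup>+\<kappa>. ennreal (norm (indicator unit_box \<kappa> *\<^sub>R symbol_dominator (\<kappa> :: real ^ 'd))) \<partial>lborel) =
      (\<integral>\<^sup>+\<kappa>. (\<Prod>b\<in>(Basis :: (real ^ 'd) set). ?g (\<kappa> \<bullet> b)) \<partial>lborel)"
    by (intro nn_integral_cong)
  also have "\<dots> = (\<Prod>b\<in>(Basis :: (real ^ 'd) set). \<integral>\<^sup>+t. ?g t \<partial>lborel)"
    by (rule nn_integral_lborel_prod[of "\<lambda>_. ?g", OF g]) (rule zero_le)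
  also have "\<dots> < \<infinity>"
    unfolding prod_constant using nn_integral_edge_dist_finite[OF a]
    by (simp only: power_less_top_ennreal infinity_ennreal_def simp_thms)
  finally show ?thesis
    unfolding set_integrable_def by (intro integrableI_bounded) auto
qed

text \<open>1 / y is written as a product of d equal factors y^(-1/d), and the i-th one is bounded
  by means of the i-th coordinate alone.\<close>

lemma inverse_le_prod_powr:
  fixes e :: "'d::finite \<Rightarrow> real"
  assumes "\<And>i. e i > 0" "\<And>i. (e i)\<^sup>2 \<le> y"
  shows "1 / y \<le> (\<Prod>i\<in>UNIV. e i powr (- (2 / real CARD('d))))"
proof -
  let ?d = "real CARD('d)"
  have y: "y > 0" using assms[of undefined] by (meson less_le_trans zero_less_power)
  have "1 / y = (\<Prod>i\<in>(UNIV :: 'd set). y powr (- (1 / ?d)))"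
    using y by (simp add: powr_power powr_minus field_simps)
  also have "\<dots> \<le> (\<Prod>i\<in>(UNIV :: 'd set). e i powr (- (2 / ?d)))"
  proof (intro prod_mono conjI)
    fix i
    have "y powr (- (1 / ?d)) \<le> ((e i)\<^sup>2) powr (- (1 / ?d))"
      using assms[of i] by (intro powr_mono2') auto
    also have "\<dots> = (e i powr 2) powr (- (1 / ?d))" using assms(1)[of i] by simp
    also have "\<dots> = e i powr (- (2 / ?d))" unfolding powr_powr by simp
    finally show "y powr (- (1 / ?d)) \<le> e i powr (- (2 / ?d))" .
  qed simp
  finally show ?thesis .
qed

lemma inverse_symbol_le_dominator:
  fixes \<kappa> :: "real ^ 'd"
  assumes "\<kappa> \<in> unit_box"
  shows "1 / lattice_symbol \<kappa> \<le> symbol_dominator \<kappa>"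
  unfolding symbol_dominator_def
proof (rule inverse_le_prod_powr)
  fix i
  show "edge_dist (\<kappa> $ i) > 0" using assms by (auto simp: mem_unit_box edge_dist_def)
  have "(edge_dist (\<kappa> $ i))\<^sup>2 \<le> 4 * (edge_dist (\<kappa> $ i))\<^sup>2" by simp
  also have "\<dots> \<le> lattice_symbol \<kappa>"
    unfolding edge_dist_def using assms by (intro lattice_symbol_ge) (auto simp: mem_unit_box less_imp_le)
  finally show "(edge_dist (\<kappa> $ i))\<^sup>2 \<le> lattice_symbol \<kappa>" .
qed

text \<open>The symbol is taken at the corner of the cell and the majorant at the point itself. If a
  coordinate of the corner is 0, the point is within 1 / n of that face and the spectral gap helps.
  Otherwise rounding at most halves the distance to the edge, which the factor 4 in the lower bound
  of the symbol absorbs.\<close>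

lemma inverse_symbol_grid_le_dominator:
  fixes \<kappa> :: "real ^ 'd"
  assumes n: "n > 0" and \<kappa>: "\<kappa> \<in> unit_box"
  shows "1 / lattice_symbol (scaled n (grid n \<kappa>)) \<le> symbol_dominator \<kappa>"
proof (cases "grid n \<kappa> = 0")
  case True
  \<comment> \<open>In the cell of the zero mode the left-hand side is 1 / 0 = 0.\<close>
  then have "lattice_symbol (scaled n (grid n \<kappa>)) = 0" by (simp add: lattice_symbol_def scaled_def)
  then show ?thesis using symbol_dominator_pos[OF \<kappa>] by simp
next
  case False
  let ?k = "grid n \<kappa>"
  have T: "?k \<in> torus n" by (rule grid_in_torus[OF n \<kappa>])
  have kb: "0 \<le> ?k $ i" "?k $ i < int n" for i using T unfolding torus_def by blast+
  have \<kappa>b: "0 < \<kappa> $ i" "\<kappa> $ i < 1" for i using \<kappa> by (auto simp: mem_unit_box)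
  have fl: "real_of_int (?k $ i) \<le> real n * \<kappa> $ i" "real n * \<kappa> $ i < real_of_int (?k $ i) + 1" for i
    using grid_eq_iff[of n \<kappa> ?k] by auto
  have sc: "0 \<le> scaled n ?k $ i" "scaled n ?k $ i \<le> 1" for i
    using kb[of i] n by (auto simp: scaled_def field_simps)
  show ?thesis
    unfolding symbol_dominator_def
  proof (rule inverse_le_prod_powr)
    fix i
    show "edge_dist (\<kappa> $ i) > 0" using \<kappa>b by (auto simp: edge_dist_def)
    show "(edge_dist (\<kappa> $ i))\<^sup>2 \<le> lattice_symbol (scaled n ?k)"
    proof (cases "?k $ i = 0")
      case True
      have "edge_dist (\<kappa> $ i) \<le> 1 / real n"
        using fl(2)[of i] True n by (simp add: edge_dist_def min_le_iff_disj field_simps)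
      moreover have "0 \<le> edge_dist (\<kappa> $ i)" using \<kappa>b[of i] by (simp add: edge_dist_def)
      ultimately have "(edge_dist (\<kappa> $ i))\<^sup>2 \<le> (1 / real n)\<^sup>2" by (intro power_mono)
      also have "\<dots> \<le> 4 / (real n)\<^sup>2" by (simp add: power_divide divide_right_mono)
      also have "\<dots> \<le> eigval n ?k" by (rule eigval_ge[OF n T False])
      finally show ?thesis by (simp add: eigval_eq_symbol)
    next
      case False
      then have k1: "1 \<le> ?k $ i" using kb(1)[of i] by linarith
      then have "real n * \<kappa> $ i \<le> 2 * real_of_int (?k $ i)" using fl(2)[of i] by linarith
      then have 1: "\<kappa> $ i \<le> 2 * scaled n ?k $ i" using n by (simp add: scaled_def field_simps)
      have 2: "scaled n ?k $ i \<le> \<kappa> $ i" using fl(1)[of i] n by (simp add: scaled_def field_simps)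
      have "edge_dist (\<kappa> $ i) \<le> 2 * edge_dist (scaled n ?k $ i)"
        using 1 2 sc(2)[of i] by (auto simp: edge_dist_def min_def)
      moreover have "0 \<le> edge_dist (\<kappa> $ i)" using \<kappa>b[of i] by (simp add: edge_dist_def)
      ultimately have "(edge_dist (\<kappa> $ i))\<^sup>2 \<le> (2 * edge_dist (scaled n ?k $ i))\<^sup>2" by (intro power_mono)
      also have "\<dots> = 4 * (edge_dist (scaled n ?k $ i))\<^sup>2" by (simp add: power_mult_distrib)
      also have "\<dots> \<le> lattice_symbol (scaled n ?k)"
        unfolding edge_dist_def by (rule lattice_symbol_ge[OF sc])
      finally show ?thesis .
    qed
  qed
qed

lemma lattice_symbol_pos: "\<kappa> \<in> unit_box \<Longrightarrow> lattice_symbol \<kappa> > 0"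
proof -
  assume "\<kappa> \<in> unit_box"
  then have "0 < 4 * (min (\<kappa> $ undefined) (1 - \<kappa> $ undefined))\<^sup>2"
    using edge_dist_pos[of \<kappa> undefined] unfolding edge_dist_def by (intro mult_pos_pos zero_less_power) auto
  also have "\<dots> \<le> lattice_symbol \<kappa>"
    using \<open>\<kappa> \<in> unit_box\<close> by (intro lattice_symbol_ge) (auto simp: mem_unit_box less_imp_le)
  finally show ?thesis .
qed

lemma measurable_lattice_symbol [measurable]: "lattice_symbol \<in> borel_measurable borel"
  by (intro borel_measurable_continuous_onI continuous_lattice_symbol)

lemma set_integrable_const_unit_box: "set_integrable lborel (unit_box :: (real ^ 'd) set) (\<lambda>_. c :: real)"
  unfolding set_integrable_def by (auto simp: emeasure_unit_box)

text \<open>For m = 0 the convention x / 0 = 0 removes the zero mode from the sum, so the same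
  statement covers the sums over nonzero modes.\<close>

lemma green_riemann_limit:
  fixes F :: "real ^ 'd \<Rightarrow> real"
  assumes d: "CARD('d) \<ge> 3" and m: "m \<ge> 0" and F: "continuous_on UNIV F" "\<And>\<kappa>. \<bar>F \<kappa>\<bar> \<le> C"
  shows "(\<lambda>n. (\<Sum>k\<in>torus n. F (scaled n k) / (eigval n k + m)) / real (n ^ CARD('d)))
    \<longlonglongrightarrow> (LINT \<kappa>:cbox 0 1|lborel. F \<kappa> / (lattice_symbol \<kappa> + m))"
proof -
  have [measurable]: "F \<in> borel_measurable borel" using F by (intro borel_measurable_continuous_onI)
  have C: "C \<ge> 0" using F(2)[of 0] by linarith
  show ?thesis
    unfolding eigval_eq_symbol
  proof (rule riemann_sum_limit)
    show "(\<lambda>\<kappa>. F \<kappa> / (lattice_symbol \<kappa> + m)) \<in> borel_measurable borel" by measurable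
    show "isCont (\<lambda>\<kappa>. F \<kappa> / (lattice_symbol \<kappa> + m)) \<kappa>" if "\<kappa> \<in> unit_box" for \<kappa>
    proof -
      have "isCont F \<kappa>" "isCont lattice_symbol \<kappa>"
        using F(1) continuous_lattice_symbol[of UNIV] by (auto simp: continuous_on_eq_continuous_at)
      then show ?thesis using lattice_symbol_pos[OF that] m by (intro continuous_intros) auto
    qed
    show "set_integrable lborel (unit_box :: (real ^ 'd) set) (\<lambda>\<kappa>. C * (symbol_dominator \<kappa> + 1 / m))"
    proof -
      have "set_integrable lborel (unit_box :: (real ^ 'd) set) (\<lambda>\<kappa>. symbol_dominator \<kappa> + 1 / m)"
        by (rule set_integral_add(1)[OF set_integrable_symbol_dominator[OF d] set_integrable_const_unit_box])
      then show ?thesis by simp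
    qed
    fix n :: nat and \<kappa> :: "real ^ 'd" assume n: "n > 0" and \<kappa>: "\<kappa> \<in> unit_box"
    let ?y = "lattice_symbol (scaled n (grid n \<kappa>))"
    have y: "?y \<ge> 0" by (rule lattice_symbol_nonneg)
    \<comment> \<open>The convention 1 / 0 = 0 unites the cases: in the cell of the zero mode only 1
      / m counts, and for m = 0 only 1 / y.\<close>
    have "1 / (?y + m) \<le> 1 / ?y + 1 / m"
    proof (cases "?y = 0")
      case False
      then have "1 / (?y + m) \<le> 1 / ?y" using y m by (intro divide_left_mono) auto
      also have "\<dots> \<le> 1 / ?y + 1 / m" using m by simp
      finally show ?thesis .
    qed simp
    also have "\<dots> \<le> symbol_dominator \<kappa> + 1 / m"
      using inverse_symbol_grid_le_dominator[OF n \<kappa>] by simp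
    finally have "1 / (?y + m) \<le> symbol_dominator \<kappa> + 1 / m" .
    moreover have "0 \<le> 1 / (?y + m)" using y m by simp
    ultimately have "\<bar>F (scaled n (grid n \<kappa>))\<bar> * (1 / (?y + m)) \<le> C * (symbol_dominator \<kappa> + 1 / m)"
      using F(2) C by (intro mult_mono) auto
    then show "\<bar>F (scaled n (grid n \<kappa>)) / (?y + m)\<bar> \<le> C * (symbol_dominator \<kappa> + 1 / m)"
      using y m by (simp add: abs_divide)
  qed
qed

lemma continuous_riemann_limit:
  fixes F :: "real ^ 'd \<Rightarrow> real"
  assumes F: "continuous_on UNIV F" "\<And>\<kappa>. \<bar>F \<kappa>\<bar> \<le> C"
  shows "(\<lambda>n. (\<Sum>k\<in>torus n. F (scaled n k)) / real (n ^ CARD('d))) \<longlonglongrightarrow> (LINT \<kappa>:cbox 0 1|lborel. F \<kappa>)"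
  by (rule riemann_sum_limit[OF _ _ set_integrable_const_unit_box[of C]])
    (use F in \<open>auto simp: continuous_on_eq_continuous_at intro: borel_measurable_continuous_onI\<close>)

section \<open>The Fourier representation of the Green function\<close>

lemma neighbours_eq_image: "neighbours x = (\<lambda>(i, s). x + axis i s) ` (UNIV \<times> {1, -1})"
proof -
  have "axis i (- 1) = - axis i (1 :: int)" for i :: 'a by (simp add: vec_eq_iff axis_def)
  then show ?thesis by (auto simp: neighbours_def image_iff)
qed

lemma inj_neighbours: "inj_on (\<lambda>(i, s :: int). x + axis i s) (UNIV \<times> {1, -1})"
proof (intro inj_onI, clarify)
  fix i j :: 'a and s t :: int
  assume st: "s \<in> {1, -1}" "t \<in> {1, -1}" and "x + axis i s = x + axis j t"
  then have z: "axis i s $ l = axis j t $ l" for l by simp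
  have "i = j" using z[of i] st by (auto simp: axis_def split: if_splits)
  then show "i = j \<and> s = t" using z[of i] by (auto simp: axis_def)
qed

lemma finite_neighbours [simp]: "finite (neighbours x)"
  unfolding neighbours_eq_image by simp

lemma card_neighbours: "card (neighbours (x :: int ^ 'd)) = 2 * CARD('d)"
  unfolding neighbours_eq_image
  by (subst card_image[OF inj_neighbours]) (simp add: card_cartesian_product)

lemma sum_neighbours: "(\<Sum>z\<in>neighbours x. f z) = (\<Sum>i\<in>UNIV. f (x + axis i 1) + f (x + axis i (-1)))"
proof -
  have "(\<Sum>z\<in>neighbours x. f z) = (\<Sum>(i, s)\<in>UNIV \<times> {1, -1}. f (x + axis i s))"
    unfolding neighbours_eq_image by (subst sum.reindex[OF inj_neighbours]) (simp add: case_prod_unfold)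
  also have "\<dots> = (\<Sum>i\<in>UNIV. \<Sum>s\<in>{1, -1}. f (x + axis i s))"
    by (rule sum.cartesian_product[symmetric])
  finally show ?thesis by simp
qed

lemma neighbours_sym: "y \<in> neighbours x \<longleftrightarrow> x \<in> neighbours y"
  by (auto simp: neighbours_def algebra_simps)

text \<open>Survival with probability 2d / (2d + m) followed by one of 2d neighbours leaves 1 / (2d
  + m) for each. The condition is phrased through the neighbours of the target, so that the
  recursion in time becomes a finite sum over them.\<close>

lemma pmf_killed_step:
  fixes y :: "int ^ 'd"
  assumes "m \<ge> 0"
  shows "pmf (killed_step m s) (Some y) =
    (if s \<in> Some ` neighbours y then 1 / (2 * real CARD('d) + m) else 0)"
proof (cases s)
  case None
  then show ?thesis by (auto simp: killed_step_def)
next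
  case (Some z)
  let ?p = "m / (m + 2 * real CARD('d))"
  have "m + 2 * real CARD('d) > 0" using assms by (simp add: add_nonneg_pos)
  then have p: "0 \<le> ?p" "?p \<le> 1" using assms by (simp_all add: divide_le_eq_1_pos)
  have ne: "neighbours z \<noteq> {}" using card_neighbours[of z] by auto
  have "pmf (killed_step m s) (Some y) = (1 - ?p) * (indicator (neighbours z) y / real (card (neighbours z)))"
    unfolding killed_step_def Some using p ne
    by (simp add: pmf_bind integral_bernoulli_pmf pmf_map_inj' pmf_of_set)
  also have "1 - ?p = 2 * real CARD('d) / (2 * real CARD('d) + m)"
    using \<open>m + 2 * real CARD('d) > 0\<close> by (simp add: field_simps)
  also have "2 * real CARD('d) / (2 * real CARD('d) + m) * (indicator (neighbours z) y / real (card (neighbours z))) =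
      (if s \<in> Some ` neighbours y then 1 / (2 * real CARD('d) + m) else 0)"
    using neighbours_sym[of y z] Some by (auto simp: card_neighbours indicator_def)
  finally show ?thesis .
qed

lemma pmf_killed_walk_Suc:
  fixes y :: "int ^ 'd"
  assumes "m \<ge> 0"
  shows "pmf (killed_walk m x (Suc t)) (Some y) =
    (\<Sum>z\<in>neighbours y. pmf (killed_walk m x t) (Some z)) / (2 * real CARD('d) + m)"
proof -
  let ?c = "1 / (2 * real CARD('d) + m)"
  have "pmf (killed_walk m x (Suc t)) (Some y) =
      (\<integral>s. (if s \<in> Some ` neighbours y then ?c else 0) \<partial>killed_walk m x t)"
    by (simp add: pmf_bind pmf_killed_step[OF assms])
  also have "\<dots> = (\<Sum>s\<in>Some ` neighbours y. (if s \<in> Some ` neighbours y then ?c else 0) * pmf (killed_walk m x t) s)"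
    by (intro integral_measure_pmf_real) (auto split: if_splits)
  also have "\<dots> = (\<Sum>z\<in>neighbours y. ?c * pmf (killed_walk m x t) (Some z))"
    by (subst sum.reindex) auto
  finally show ?thesis by (simp add: sum_divide_distrib)
qed

section \<open>Fourier inversion for the walk\<close>

definition zphase :: "int ^ 'd \<Rightarrow> real ^ 'd \<Rightarrow> real" where
  "zphase z \<kappa> = 2 * pi * (\<Sum>i\<in>UNIV. \<kappa> $ i * real_of_int (z $ i))"

lemma continuous_zphase [continuous_intros]: "continuous_on A (zphase z)"
  unfolding zphase_def by (intro continuous_intros)

lemma zphase_add: "zphase (z + w) \<kappa> = zphase z \<kappa> + zphase w \<kappa>"
  by (simp add: zphase_def sum.distrib algebra_simps)

lemma zphase_diff: "zphase (z - w) \<kappa> = zphase z \<kappa> - zphase w \<kappa>"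
  by (simp add: zphase_def sum_subtractf algebra_simps)

lemma zphase_0 [simp]: "zphase 0 \<kappa> = 0"
  by (simp add: zphase_def)

lemma zphase_axis: "zphase (axis i s) \<kappa> = 2 * pi * \<kappa> $ i * real_of_int s"
proof -
  have "(\<Sum>j\<in>UNIV. \<kappa> $ j * real_of_int (axis i s $ j)) = (\<Sum>j\<in>UNIV. if j = i then \<kappa> $ i * real_of_int s else 0)"
    by (intro sum.cong) (auto simp: axis_def)
  then show ?thesis by (simp add: zphase_def)
qed

lemma zphase_scaled: "zphase z (scaled n k) = 2 * pi * real_of_int (zdot k z) / real n"
  by (simp add: zphase_def scaled_def zdot_def flip: sum_divide_distrib)

text \<open>The characteristic function of one step of simple random walk.\<close>

definition walk_symbol :: "real ^ 'd \<Rightarrow> real" where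
  "walk_symbol \<kappa> = (\<Sum>i\<in>UNIV. cos (2 * pi * \<kappa> $ i)) / real CARD('d)"

lemma continuous_walk_symbol [continuous_intros]: "continuous_on A walk_symbol"
  unfolding walk_symbol_def by (intro continuous_intros) auto

lemma lattice_symbol_walk:
  fixes \<kappa> :: "real ^ 'd"
  shows "lattice_symbol \<kappa> = 2 * real CARD('d) * (1 - walk_symbol \<kappa>)"
proof -
  have "4 * (sin (pi * t))\<^sup>2 = 2 - 2 * cos (2 * pi * t)" for t
    using cos_double_sin[of "pi * t"] by (simp add: mult.assoc)
  then have "lattice_symbol \<kappa> = (\<Sum>i\<in>UNIV. 2 - 2 * cos (2 * pi * \<kappa> $ i))"
    by (simp add: lattice_symbol_def sum_distrib_left)
  also have "\<dots> = 2 * real CARD('d) - 2 * (\<Sum>i\<in>UNIV. cos (2 * pi * \<kappa> $ i))"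
    by (simp add: sum_subtractf sum_distrib_left)
  finally show ?thesis by (simp add: walk_symbol_def right_diff_distrib)
qed

lemma abs_walk_symbol_le_1: "\<bar>walk_symbol (\<kappa> :: real ^ 'd)\<bar> \<le> 1"
proof -
  have "\<bar>\<Sum>i\<in>(UNIV :: 'd set). cos (2 * pi * \<kappa> $ i)\<bar> \<le> (\<Sum>i\<in>(UNIV :: 'd set). 1)"
    by (intro order_trans[OF sum_abs] sum_mono) simp
  then show ?thesis by (simp add: walk_symbol_def)
qed

lemma lattice_symbol_le: "lattice_symbol (\<kappa> :: real ^ 'd) \<le> 4 * real CARD('d)"
proof -
  have "- walk_symbol \<kappa> \<le> 1" using abs_walk_symbol_le_1[of \<kappa>] by linarith
  then have "2 * real CARD('d) * (1 - walk_symbol \<kappa>) \<le> 2 * real CARD('d) * 2"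
    by (intro mult_left_mono) auto
  then show ?thesis by (simp add: lattice_symbol_walk)
qed

text \<open>The value 1 is excluded by positivity of the symbol in the open cube. The value -1,
  which reflects the period 2 of the walk, forces all cosines to be -1 and occurs at the centre of
  the cube only.\<close>

lemma abs_walk_symbol_less_1:
  fixes \<kappa> :: "real ^ 'd"
  assumes "\<kappa> \<in> unit_box" "\<kappa> \<noteq> (\<chi> i. 1/2)"
  shows "\<bar>walk_symbol \<kappa>\<bar> < 1"
proof -
  have "0 < 2 * real CARD('d) * (1 - walk_symbol \<kappa>)"
    using lattice_symbol_pos[OF assms(1)] unfolding lattice_symbol_walk .
  then have 1: "walk_symbol \<kappa> < 1" by (simp add: zero_less_mult_iff)
  obtain i where i: "\<kappa> $ i \<noteq> 1/2" using assms(2) by (auto simp: vec_eq_iff)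
  have ki: "0 < \<kappa> $ i" "\<kappa> $ i < 1" using assms(1) unfolding mem_unit_box by blast+
  have c: "cos (pi * \<kappa> $ i) \<noteq> 0"
  proof
    assume "cos (pi * \<kappa> $ i) = 0"
    then have "cos (pi * \<kappa> $ i) = cos (pi / 2)" by simp
    then have eq: "cos (pi * \<kappa> $ i) = cos (pi * (1 / 2))" by simp
    have "pi * \<kappa> $ i \<le> pi * 1" using ki by (intro mult_left_mono) auto
    moreover have "0 \<le> pi * \<kappa> $ i" using ki by simp
    ultimately have "pi * \<kappa> $ i = pi * (1 / 2)" by (intro cos_inj_pi[OF _ _ _ _ eq]) simp_all
    then show False using i by (simp only: mult_left_cancel[OF pi_neq_zero])
  qed
  have "1 + cos (2 * pi * t) = 2 * (cos (pi * t))\<^sup>2" for t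
    using cos_double_cos[of "pi * t"] by (simp add: mult.assoc)
  then have "(\<Sum>j\<in>(UNIV :: 'd set). 1 + cos (2 * pi * \<kappa> $ j)) = (\<Sum>j\<in>UNIV. 2 * (cos (pi * \<kappa> $ j))\<^sup>2)"
    by simp
  also have "\<dots> > 0"
    using c by (intro sum_pos2[of _ i]) auto
  finally have "0 < real CARD('d) + (\<Sum>j\<in>(UNIV :: 'd set). cos (2 * pi * \<kappa> $ j))"
    by (simp add: sum.distrib)
  then have "-1 < walk_symbol \<kappa>" by (simp add: walk_symbol_def field_simps)
  with 1 show ?thesis by linarith
qed

text \<open>Fourier inversion formula for the probability that simple random walk without killing
  has displacement z after t steps.\<close>

definition walk_integral :: "nat \<Rightarrow> int ^ 'd \<Rightarrow> real" where
  "walk_integral t z = (LINT \<kappa>:cbox 0 1|lborel. cos (zphase z \<kappa>) * walk_symbol \<kappa> ^ t)"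

lemma set_integrable_cbox_continuous:
  fixes f :: "real ^ 'd \<Rightarrow> real"
  assumes "continuous_on UNIV f"
  shows "set_integrable lborel (cbox 0 1) f"
  unfolding set_integrable_def
  using assms by (intro borel_integrable_compact compact_cbox continuous_on_subset[OF assms]) auto

text \<open>The integral is a limit of Riemann sums which, once n exceeds the coordinates of z,
  equal 0 or 1 exactly by orthogonality of the characters of the finite torus.\<close>

lemma walk_integral_0: "walk_integral 0 (z :: int ^ 'd) = (if z = 0 then 1 else 0)"
proof -
  have lim: "(\<lambda>n. (\<Sum>k\<in>torus n. cos (zphase z (scaled n k))) / real (n ^ CARD('d))) \<longlonglongrightarrow> walk_integral 0 z"
    unfolding walk_integral_def power_0 mult_1_right
    by (rule continuous_riemann_limit[where C = 1]) (auto intro!: continuous_intros)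
  have "\<forall>\<^sub>F n in sequentially. (\<Sum>k\<in>torus n. cos (zphase z (scaled n k))) / real (n ^ CARD('d)) = (if z = 0 then 1 else 0)"
    using eventually_gt_at_top[of "nat (\<Sum>i\<in>UNIV. \<bar>z $ i\<bar>)"]
  proof eventually_elim
    case (elim n)
    then have n: "n > 0" by linarith
    have "\<bar>z $ i\<bar> \<le> (\<Sum>i\<in>UNIV. \<bar>z $ i\<bar>)" for i by (rule member_le_sum) auto
    then have small: "\<bar>z $ i\<bar> < int n" for i
    proof -
      have "(\<Sum>i\<in>UNIV. \<bar>z $ i\<bar>) < int n" using elim by linarith
      then show ?thesis using \<open>\<And>i. \<bar>z $ i\<bar> \<le> (\<Sum>i\<in>UNIV. \<bar>z $ i\<bar>)\<close>[of i] by linarith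
    qed
    have "(\<forall>i. int n dvd z $ i) \<longleftrightarrow> z = 0"
    proof
      assume *: "\<forall>i. int n dvd z $ i"
      have "z $ i = 0" for i
        using * small[of i] zdvd_not_zless[of "\<bar>z $ i\<bar>" "int n"] by (cases "z $ i = 0") auto
      then show "z = 0" by (simp add: vec_eq_iff)
    qed simp
    then have "(\<Sum>k\<in>torus n. cis (2 * pi * real_of_int (zdot z k) / real n)) =
        (if z = 0 then of_nat (n ^ CARD('d)) else 0)"
      using sum_cis_torus[OF n, of z] by simp
    then have "Re (\<Sum>k\<in>torus n. cis (2 * pi * real_of_int (zdot z k) / real n)) =
        (if z = 0 then real (n ^ CARD('d)) else 0)"
      by simp
    then have "(\<Sum>k\<in>torus n. cos (zphase z (scaled n k))) = (if z = 0 then real (n ^ CARD('d)) else 0)"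
      by (simp add: zphase_scaled zdot_commute[of _ z])
    then show ?case using n by simp
  qed
  then have "(\<lambda>n. (\<Sum>k\<in>torus n. cos (zphase z (scaled n k))) / real (n ^ CARD('d))) \<longlonglongrightarrow> (if z = 0 then 1 else 0)"
    by (rule tendsto_eventually)
  then show ?thesis using LIMSEQ_unique[OF lim] by blast
qed

lemma set_integral_sum:
  fixes f :: "'b \<Rightarrow> 'a \<Rightarrow> real"
  assumes "\<And>i. i \<in> I \<Longrightarrow> set_integrable M A (f i)"
  shows "(LINT x:A|M. \<Sum>i\<in>I. f i x) = (\<Sum>i\<in>I. LINT x:A|M. f i x)"
  using assms unfolding set_lebesgue_integral_def set_integrable_def scaleR_sum_right
  by (rule Bochner_Integration.integral_sum)

text \<open>Summing the phases over the neighbours multiplies the integrand by 2d times the step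
  symbol. With this recursion the walk probabilities and the integrals agree by induction on
  time.\<close>

lemma walk_integral_Suc:
  fixes z :: "int ^ 'd"
  shows "(\<Sum>w\<in>neighbours z. walk_integral t (w - x)) = 2 * real CARD('d) * walk_integral (Suc t) (z - x)"
proof -
  have int: "set_integrable lborel (cbox 0 1) (\<lambda>\<kappa>. cos (zphase w \<kappa>) * walk_symbol \<kappa> ^ s)" for w :: "int ^ 'd" and s
    by (intro set_integrable_cbox_continuous continuous_intros)
  have "(\<Sum>w\<in>neighbours z. walk_integral t (w - x)) =
     (LINT \<kappa>:cbox 0 1|lborel. \<Sum>w\<in>neighbours z. cos (zphase (w - x) \<kappa>) * walk_symbol \<kappa> ^ t)"
    unfolding walk_integral_def
    by (subst set_integral_sum) (use int in auto)
  also have "(\<lambda>\<kappa>. \<Sum>w\<in>neighbours z. cos (zphase (w - x) \<kappa>) * walk_symbol \<kappa> ^ t) =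
     (\<lambda>\<kappa>. 2 * real CARD('d) * (cos (zphase (z - x) \<kappa>) * walk_symbol \<kappa> ^ Suc t))"
  proof
    fix \<kappa> :: "real ^ 'd"
    have "(\<Sum>w\<in>neighbours z. cos (zphase (w - x) \<kappa>)) =
        (\<Sum>i\<in>UNIV. 2 * (cos (zphase (z - x) \<kappa>) * cos (2 * pi * \<kappa> $ i)))"
      unfolding sum_neighbours
    proof (intro sum.cong refl)
      fix i
      have "zphase (z + axis i s - x) \<kappa> = zphase (z - x) \<kappa> + 2 * pi * \<kappa> $ i * real_of_int s" for s
        by (simp add: zphase_diff zphase_add zphase_axis)
      then show "cos (zphase (z + axis i 1 - x) \<kappa>) + cos (zphase (z + axis i (-1) - x) \<kappa>) =
          2 * (cos (zphase (z - x) \<kappa>) * cos (2 * pi * \<kappa> $ i))"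
        by (simp add: cos_add cos_diff)
    qed
    also have "\<dots> = 2 * (cos (zphase (z - x) \<kappa>) * (\<Sum>i\<in>UNIV. cos (2 * pi * \<kappa> $ i)))"
      by (simp only: sum_distrib_left)
    also have "(\<Sum>i\<in>UNIV. cos (2 * pi * \<kappa> $ i)) = real CARD('d) * walk_symbol \<kappa>"
      by (simp add: walk_symbol_def)
    also have "2 * (cos (zphase (z - x) \<kappa>) * (real CARD('d) * walk_symbol \<kappa>)) =
        2 * real CARD('d) * (cos (zphase (z - x) \<kappa>) * walk_symbol \<kappa>)"
      by (simp only: mult_ac)
    finally show "(\<Sum>w\<in>neighbours z. cos (zphase (w - x) \<kappa>) * walk_symbol \<kappa> ^ t) =
        2 * real CARD('d) * (cos (zphase (z - x) \<kappa>) * walk_symbol \<kappa> ^ Suc t)"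
      by (simp add: sum_distrib_right[symmetric])
  qed
  finally show ?thesis by (simp add: walk_integral_def)
qed

lemma pmf_killed_walk_eq:
  fixes x y :: "int ^ 'd"
  assumes "m \<ge> 0"
  shows "pmf (killed_walk m x t) (Some y) = (2 * real CARD('d) / (2 * real CARD('d) + m)) ^ t * walk_integral t (y - x)"
proof (induction t arbitrary: y)
  case 0
  then show ?case by (simp add: walk_integral_0)
next
  case (Suc t)
  let ?r = "2 * real CARD('d) / (2 * real CARD('d) + m)"
  have "pmf (killed_walk m x (Suc t)) (Some y) = ?r ^ t * (\<Sum>z\<in>neighbours y. walk_integral t (z - x)) / (2 * real CARD('d) + m)"
    unfolding pmf_killed_walk_Suc[OF assms] Suc.IH by (simp add: sum_distrib_left)
  then show ?case unfolding walk_integral_Suc by simp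
qed

definition green_integral :: "real \<Rightarrow> (real ^ 'd \<Rightarrow> real) \<Rightarrow> real" where
  "green_integral m F = (LINT \<kappa>:cbox 0 1|lborel. F \<kappa> / (lattice_symbol \<kappa> + m))"

text \<open>The geometric series in the step symbol is summed under the integral. Its partial sums
  are in closed form and dominated by twice the majorant of the inverse symbol. For m = 0 the powers
  fail to converge only where the step symbol is -1, a single point.\<close>

lemma green_eq_integral:
  fixes x y :: "int ^ 'd"
  assumes d: "CARD('d) \<ge> 3" and m: "m \<ge> 0"
  shows "green m x y = green_integral m (\<lambda>\<kappa>. cos (zphase (y - x) \<kappa>))"
proof -
  let ?c = "2 * real CARD('d) + m"
  define r where "r = 2 * real CARD('d) / ?c"
  let ?f = "\<lambda>\<kappa> :: real ^ 'd. cos (zphase (y - x) \<kappa>)"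
  have c: "?c > 0" using m by (simp add: add_pos_nonneg)
  have r: "0 \<le> r" "r \<le> 1" using m c by (simp_all add: r_def divide_le_eq_1_pos)
  have [measurable]: "?f \<in> borel_measurable borel" "walk_symbol \<in> borel_measurable borel"
    by (intro borel_measurable_continuous_onI continuous_intros)+
  \<comment> \<open>The denominator is (2d + m) times 1 minus the ratio of the geometric series,
    \<open>r\<close> being the survival probability per step.\<close>
  have lr: "lattice_symbol \<kappa> + m = ?c * (1 - r * walk_symbol \<kappa>)" for \<kappa> :: "real ^ 'd"
    using c by (simp add: r_def lattice_symbol_walk field_simps)
  have partial: "(\<Sum>t<M. pmf (killed_walk m x t) (Some y)) = ?c * (LINT \<kappa>:unit_box|lborel. ?f \<kappa> * (1 - (r * walk_symbol \<kappa>) ^ M) / (lattice_symbol \<kappa> + m))" for M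
  proof -
    have "(\<Sum>t<M. pmf (killed_walk m x t) (Some y)) = (\<Sum>t<M. LINT \<kappa>:cbox 0 1|lborel. ?f \<kappa> * (r * walk_symbol \<kappa>) ^ t)"
      unfolding pmf_killed_walk_eq[OF m] walk_integral_def r_def[symmetric] set_integral_mult_right[symmetric]
      by (simp only: power_mult_distrib mult_ac)
    also have "\<dots> = (LINT \<kappa>:cbox 0 1|lborel. \<Sum>t<M. ?f \<kappa> * (r * walk_symbol \<kappa>) ^ t)"
      by (subst set_integral_sum) (auto intro!: set_integrable_cbox_continuous continuous_intros)
    also have "\<dots> = (LINT \<kappa>:unit_box|lborel. \<Sum>t<M. ?f \<kappa> * (r * walk_symbol \<kappa>) ^ t)"
      by (rule integral_cbox_eq_box) measurable
    also have "\<dots> = (LINT \<kappa>:unit_box|lborel. ?c * (?f \<kappa> * (1 - (r * walk_symbol \<kappa>) ^ M) / (lattice_symbol \<kappa> + m)))"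
    proof (rule set_lebesgue_integral_cong)
      show "\<forall>\<kappa>. \<kappa> \<in> unit_box \<longrightarrow> (\<Sum>t<M. ?f \<kappa> * (r * walk_symbol \<kappa>) ^ t) =
          ?c * (?f \<kappa> * (1 - (r * walk_symbol \<kappa>) ^ M) / (lattice_symbol \<kappa> + m))"
      proof (intro allI impI)
        fix \<kappa> :: "real ^ 'd" assume "\<kappa> \<in> unit_box"
        then have p: "lattice_symbol \<kappa> + m > 0" using lattice_symbol_pos[of \<kappa>] m by linarith
        define q where "q = r * walk_symbol \<kappa>"
        have q: "lattice_symbol \<kappa> + m = ?c * (1 - q)" unfolding q_def by (rule lr)
        then have q1: "1 - q \<noteq> 0" using p by auto
        have "(\<Sum>t<M. ?f \<kappa> * q ^ t) = ?f \<kappa> * ((1 - q ^ M) / (1 - q))"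
          using q1 by (simp add: sum_distrib_left[symmetric] sum_gp_strict)
        also have "\<dots> = ?c * (?f \<kappa> * (1 - q ^ M) / (lattice_symbol \<kappa> + m))"
          unfolding q using c q1 by simp
        finally show "(\<Sum>t<M. ?f \<kappa> * (r * walk_symbol \<kappa>) ^ t) =
          ?c * (?f \<kappa> * (1 - (r * walk_symbol \<kappa>) ^ M) / (lattice_symbol \<kappa> + m))"
          unfolding q_def .
      qed
    qed simp
    finally show ?thesis by (simp only: set_integral_mult_right)
  qed
  have lim: "(\<lambda>M. LINT \<kappa>:unit_box|lborel. ?f \<kappa> * (1 - (r * walk_symbol \<kappa>) ^ M) / (lattice_symbol \<kappa> + m))
      \<longlonglongrightarrow> (LINT \<kappa>:unit_box|lborel. ?f \<kappa> / (lattice_symbol \<kappa> + m))"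
    unfolding set_lebesgue_integral_def
  proof (rule integral_dominated_convergence)
    show "integrable lborel (\<lambda>\<kappa> :: real ^ 'd. indicator unit_box \<kappa> *\<^sub>R (2 * symbol_dominator \<kappa>))"
      using set_integrable_symbol_dominator[OF d] set_integrable_mult_right[of 2 lborel unit_box symbol_dominator]
      by (simp add: set_integrable_def)
    show "AE \<kappa> in lborel. (\<lambda>M. indicator unit_box \<kappa> *\<^sub>R (?f \<kappa> * (1 - (r * walk_symbol \<kappa>) ^ M) / (lattice_symbol \<kappa> + m)))
        \<longlonglongrightarrow> indicator unit_box \<kappa> *\<^sub>R (?f \<kappa> / (lattice_symbol \<kappa> + m))"
      using AE_lborel_singleton[of "\<chi> i. 1/2 :: real ^ 'd"]
    proof eventually_elim
      case (elim \<kappa>)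
      show ?case
      proof (cases "\<kappa> \<in> unit_box")
        case True
        have "\<bar>r * walk_symbol \<kappa>\<bar> = r * \<bar>walk_symbol \<kappa>\<bar>" using r by (simp add: abs_mult)
        also have "\<dots> \<le> 1 * \<bar>walk_symbol \<kappa>\<bar>" using r by (intro mult_right_mono) auto
        also have "\<dots> < 1" using abs_walk_symbol_less_1[OF True elim] by simp
        finally have pw: "(\<lambda>M. (r * walk_symbol \<kappa>) ^ M) \<longlonglongrightarrow> 0" by (intro LIMSEQ_power_zero) simp
        have "(\<lambda>M. ?f \<kappa> * (1 - (r * walk_symbol \<kappa>) ^ M) / (lattice_symbol \<kappa> + m)) \<longlonglongrightarrow> ?f \<kappa> * (1 - 0) / (lattice_symbol \<kappa> + m)"
          using lattice_symbol_pos[OF True] m by (intro tendsto_divide tendsto_mult tendsto_diff tendsto_const pw) auto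
        then show ?thesis using True by simp
      qed simp
    qed
    fix M
    show "AE \<kappa> in lborel. norm (indicator unit_box \<kappa> *\<^sub>R (?f \<kappa> * (1 - (r * walk_symbol \<kappa>) ^ M) / (lattice_symbol \<kappa> + m)))
        \<le> indicator unit_box \<kappa> *\<^sub>R (2 * symbol_dominator \<kappa>)"
    proof (rule AE_I2)
      fix \<kappa> :: "real ^ 'd"
      show "norm (indicator unit_box \<kappa> *\<^sub>R (?f \<kappa> * (1 - (r * walk_symbol \<kappa>) ^ M) / (lattice_symbol \<kappa> + m)))
          \<le> indicator unit_box \<kappa> *\<^sub>R (2 * symbol_dominator \<kappa>)"
      proof (cases "\<kappa> \<in> unit_box")
        case True
        have "\<bar>r * walk_symbol \<kappa>\<bar> \<le> 1 * 1"
          unfolding abs_mult using r abs_walk_symbol_le_1[of \<kappa>] by (intro mult_mono) auto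
        then have "\<bar>r * walk_symbol \<kappa>\<bar> ^ M \<le> 1" by (intro power_le_one) auto
        then have "\<bar>1 - (r * walk_symbol \<kappa>) ^ M\<bar> \<le> 2"
          using abs_triangle_ineq4[of 1 "(r * walk_symbol \<kappa>) ^ M"] unfolding power_abs by linarith
        then have 1: "\<bar>?f \<kappa> * (1 - (r * walk_symbol \<kappa>) ^ M)\<bar> \<le> 1 * 2"
          unfolding abs_mult by (intro mult_mono) auto
        have "1 / (lattice_symbol \<kappa> + m) \<le> 1 / lattice_symbol \<kappa>"
          using lattice_symbol_pos[OF True] m by (intro divide_left_mono) auto
        also have "\<dots> \<le> symbol_dominator \<kappa>" by (rule inverse_symbol_le_dominator[OF True])
        finally have "\<bar>?f \<kappa> * (1 - (r * walk_symbol \<kappa>) ^ M)\<bar> * (1 / (lattice_symbol \<kappa> + m)) \<le> (1 * 2) * symbol_dominator \<kappa>"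
          using 1 lattice_symbol_pos[OF True] m by (intro mult_mono) auto
        then show ?thesis using True lattice_symbol_pos[OF True] m by (simp add: abs_divide abs_mult)
      qed simp
    qed
  qed measurable
  have "(\<lambda>t. pmf (killed_walk m x t) (Some y)) sums (?c * (LINT \<kappa>:unit_box|lborel. ?f \<kappa> / (lattice_symbol \<kappa> + m)))"
    unfolding sums_def partial by (intro tendsto_intros lim)
  then have "green m x y = (LINT \<kappa>:unit_box|lborel. ?f \<kappa> / (lattice_symbol \<kappa> + m))"
    unfolding green_def using c by (simp add: sums_unique[symmetric])
  also have "\<dots> = green_integral m ?f"
    unfolding green_integral_def by (rule integral_cbox_eq_box[symmetric]) measurable
  finally show ?thesis .
qed

lemma mass_integral_eq: "mass_integral TYPE('d::finite) m = green_integral m (\<lambda>_ :: real ^ 'd. 1)"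
  by (simp add: mass_integral_def green_integral_def lattice_symbol_def)

lemma green_const_eq: "CARD('d::finite) \<ge> 3 \<Longrightarrow> green_const TYPE('d) = green_integral 0 (\<lambda>_ :: real ^ 'd. 1)"
  by (simp add: green_const_def green_eq_integral)

section \<open>Dependence of the Green integrals on the mass\<close>

context
  fixes F :: "real ^ 'd \<Rightarrow> real" and C :: real
  assumes d: "CARD('d) \<ge> 3" and F: "continuous_on UNIV F" "\<And>\<kappa>. \<bar>F \<kappa>\<bar> \<le> C"
begin

lemma measurable_bounded_symbol: "F \<in> borel_measurable borel"
  using F by (intro borel_measurable_continuous_onI)

lemma green_integrand_bound:
  assumes "m \<ge> 0" "\<kappa> \<in> unit_box"
  shows "\<bar>F \<kappa> / (lattice_symbol \<kappa> + m)\<bar> \<le> C * symbol_dominator \<kappa>"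
proof -
  have p: "lattice_symbol \<kappa> > 0" by (rule lattice_symbol_pos[OF assms(2)])
  have "1 / (lattice_symbol \<kappa> + m) \<le> 1 / lattice_symbol \<kappa>"
    using p assms(1) by (intro divide_left_mono) auto
  also have "\<dots> \<le> symbol_dominator \<kappa>" by (rule inverse_symbol_le_dominator[OF assms(2)])
  finally have "\<bar>F \<kappa>\<bar> * (1 / (lattice_symbol \<kappa> + m)) \<le> C * symbol_dominator \<kappa>"
    using F(2)[of \<kappa>] p assms(1) by (intro mult_mono) auto
  then show ?thesis using p assms(1) by (simp add: abs_divide)
qed

lemma integrable_dominator: "integrable lborel (\<lambda>\<kappa> :: real ^ 'd. indicator unit_box \<kappa> *\<^sub>R (C * symbol_dominator \<kappa>))"
  using set_integrable_symbol_dominator[OF d] set_integrable_mult_right[of C lborel unit_box symbol_dominator]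
  by (simp add: set_integrable_def)

lemma green_integral_box:
  "green_integral m F = (LINT \<kappa>:unit_box|lborel. F \<kappa> / (lattice_symbol \<kappa> + m))"
proof -
  note [measurable] = measurable_bounded_symbol
  show ?thesis unfolding green_integral_def by (rule integral_cbox_eq_box) measurable
qed

lemma set_integrable_green:
  assumes "m \<ge> 0"
  shows "set_integrable lborel unit_box (\<lambda>\<kappa>. F \<kappa> / (lattice_symbol \<kappa> + m))"
  unfolding set_integrable_def
proof (rule Bochner_Integration.integrable_bound[OF integrable_dominator])
  note [measurable] = measurable_bounded_symbol
  show "(\<lambda>\<kappa>. indicator unit_box \<kappa> *\<^sub>R (F \<kappa> / (lattice_symbol \<kappa> + m))) \<in> borel_measurable lborel"
    by measurable
  have "norm (indicator unit_box \<kappa> *\<^sub>R (F \<kappa> / (lattice_symbol \<kappa> + m))) \<le>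
      norm (indicator unit_box \<kappa> *\<^sub>R (C * symbol_dominator \<kappa>))" for \<kappa>
    using order_trans[OF green_integrand_bound[OF assms] abs_ge_self] by (cases "\<kappa> \<in> unit_box") auto
  then show "AE \<kappa> in lborel. norm (indicator unit_box \<kappa> *\<^sub>R (F \<kappa> / (lattice_symbol \<kappa> + m))) \<le>
      norm (indicator unit_box \<kappa> *\<^sub>R (C * symbol_dominator \<kappa>))"
    by simp
qed

text \<open>The majorant does not depend on the mass, so continuity extends down to mass 0; this is
  what lets positive masses approach the critical case.\<close>

lemma green_integral_tendsto:
  assumes m: "m \<ge> 0" "\<And>j. M j \<ge> 0" "M \<longlonglongrightarrow> m"
  shows "(\<lambda>j. green_integral (M j) F) \<longlonglongrightarrow> green_integral m F"
  unfolding green_integral_box set_lebesgue_integral_def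
proof (rule integral_dominated_convergence[OF _ _ integrable_dominator])
  note [measurable] = measurable_bounded_symbol
  show "AE \<kappa> in lborel. (\<lambda>j. indicator unit_box \<kappa> *\<^sub>R (F \<kappa> / (lattice_symbol \<kappa> + M j)))
      \<longlonglongrightarrow> indicator unit_box \<kappa> *\<^sub>R (F \<kappa> / (lattice_symbol \<kappa> + m))"
  proof (rule AE_I2)
    fix \<kappa> :: "real ^ 'd"
    show "(\<lambda>j. indicator unit_box \<kappa> *\<^sub>R (F \<kappa> / (lattice_symbol \<kappa> + M j)))
      \<longlonglongrightarrow> indicator unit_box \<kappa> *\<^sub>R (F \<kappa> / (lattice_symbol \<kappa> + m))"
    proof (cases "\<kappa> \<in> unit_box")
      case True
      have "(\<lambda>j. F \<kappa> / (lattice_symbol \<kappa> + M j)) \<longlonglongrightarrow> F \<kappa> / (lattice_symbol \<kappa> + m)"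
        using lattice_symbol_pos[OF True] m by (intro tendsto_intros) auto
      then show ?thesis using True by simp
    qed simp
  qed
  show "AE \<kappa> in lborel. norm (indicator unit_box \<kappa> *\<^sub>R (F \<kappa> / (lattice_symbol \<kappa> + M j))) \<le>
      indicator unit_box \<kappa> *\<^sub>R (C * symbol_dominator \<kappa>)" for j
    using green_integrand_bound[OF m(2)[of j]] by (intro AE_I2) (auto simp: indicator_def)
qed (use measurable_bounded_symbol in measurable)

end

text \<open>As the symbol is at most 4d, the integrands differ by at least a constant \<epsilon> > 0
  on the whole cube, which gives strictness of the integrated inequality.\<close>

lemma green_integral_strict_antimono:
  assumes d: "CARD('d) \<ge> 3" and m: "0 \<le> m" "m < m'"
  shows "green_integral m' (\<lambda>_ :: real ^ 'd. 1) < green_integral m (\<lambda>_ :: real ^ 'd. 1)"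
proof -
  let ?D = "4 * real CARD('d)"
  define \<epsilon> where "\<epsilon> = (m' - m) / ((?D + m) * (?D + m'))"
  have \<epsilon>: "\<epsilon> > 0" unfolding \<epsilon>_def using m by (intro divide_pos_pos mult_pos_pos add_pos_nonneg) auto
  have int: "set_integrable lborel (unit_box :: (real ^ 'd) set) (\<lambda>\<kappa>. 1 / (lattice_symbol \<kappa> + s))" if "s \<ge> 0" for s
    by (rule set_integrable_green[where F = "\<lambda>_. 1" and C = 1]) (use d that in auto)
  have le: "1 / (lattice_symbol \<kappa> + m') + \<epsilon> \<le> 1 / (lattice_symbol \<kappa> + m)" if "\<kappa> \<in> unit_box" for \<kappa> :: "real ^ 'd"
  proof -
    let ?y = "lattice_symbol \<kappa>"
    have y: "?y > 0" "?y \<le> ?D" using lattice_symbol_pos[OF that] lattice_symbol_le[of \<kappa>] by auto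
    have "\<epsilon> \<le> (m' - m) / ((?y + m) * (?y + m'))"
      unfolding \<epsilon>_def using y m by (intro divide_left_mono mult_mono mult_pos_pos) auto
    also have "\<dots> = 1 / (?y + m) - 1 / (?y + m')" using y m by (simp add: field_simps)
    finally show ?thesis by simp
  qed
  have "(LINT \<kappa>:(unit_box :: (real ^ 'd) set)|lborel. 1 / (lattice_symbol \<kappa> + m') + \<epsilon>) \<le>
      (LINT \<kappa>:(unit_box :: (real ^ 'd) set)|lborel. 1 / (lattice_symbol \<kappa> + m))"
    by (rule set_integral_mono) (use int m le set_integrable_const_unit_box in \<open>auto intro!: set_integral_add\<close>)
  also have "(LINT \<kappa>:(unit_box :: (real ^ 'd) set)|lborel. 1 / (lattice_symbol \<kappa> + m') + \<epsilon>) =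
      (LINT \<kappa>:(unit_box :: (real ^ 'd) set)|lborel. 1 / (lattice_symbol \<kappa> + m')) + \<epsilon>"
    using int m set_integrable_const_unit_box
    by (subst set_integral_add(2)) (auto simp: set_lebesgue_integral_def measure_def emeasure_unit_box)
  finally show ?thesis
    using \<epsilon> green_integral_box[OF d, of "\<lambda>_. 1" 1] by simp
qed

lemma green_integral_le_inverse:
  assumes d: "CARD('d) \<ge> 3" and m: "m > 0"
  shows "green_integral m (\<lambda>_ :: real ^ 'd. 1) \<le> 1 / m"
proof -
  have int: "set_integrable lborel (unit_box :: (real ^ 'd) set) (\<lambda>\<kappa>. 1 / (lattice_symbol \<kappa> + m))"
    by (rule set_integrable_green[where F = "\<lambda>_. 1" and C = 1]) (use d m in auto)
  have "(LINT \<kappa>:(unit_box :: (real ^ 'd) set)|lborel. 1 / (lattice_symbol \<kappa> + m)) \<le>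
      (LINT \<kappa>:(unit_box :: (real ^ 'd) set)|lborel. 1 / m)"
  proof (rule set_integral_mono[OF int set_integrable_const_unit_box])
    fix \<kappa> :: "real ^ 'd"
    show "1 / (lattice_symbol \<kappa> + m) \<le> 1 / m"
      using lattice_symbol_nonneg[of \<kappa>] m by (intro divide_left_mono) auto
  qed
  then show ?thesis
    using green_integral_box[OF d, of "\<lambda>_. 1" 1]
    by (simp add: set_lebesgue_integral_def measure_def emeasure_unit_box)
qed

lemma green_integral_pos:
  assumes d: "CARD('d) \<ge> 3"
  shows "green_integral 0 (\<lambda>_ :: real ^ 'd. 1) > 0"
proof -
  have "green_integral 1 (\<lambda>_ :: real ^ 'd. 1) \<ge> 0"
    unfolding green_integral_def set_lebesgue_integral_def
    by (intro integral_nonneg_AE AE_I2) (auto simp: indicator_def add_nonneg_nonneg lattice_symbol_nonneg)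
  then show ?thesis using green_integral_strict_antimono[OF d, of 0 1] by simp
qed

text \<open>The integral exceeds \<theta> for some small positive mass by continuity at 0, and is at
  most 1 / m for mass m; the intermediate value theorem and strict monotonicity do the rest.\<close>

lemma ex1_mass:
  assumes d: "CARD('d::finite) \<ge> 3" and \<theta>: "\<theta> > 0" "\<theta> < green_const TYPE('d)"
  shows "\<exists>!m. m > 0 \<and> mass_integral TYPE('d) m = \<theta>"
proof -
  let ?f = "\<lambda>m. green_integral m (\<lambda>_ :: real ^ 'd. 1)"
  have lim: "(\<lambda>j. ?f (M j)) \<longlonglongrightarrow> ?f m" if "m \<ge> 0" "\<And>j. M j \<ge> 0" "M \<longlonglongrightarrow> m" for M m
    by (rule green_integral_tendsto[where C = 1]) (use d that in auto)
  have "(\<lambda>j. ?f (1 / real (Suc j))) \<longlonglongrightarrow> ?f 0"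
    using LIMSEQ_Suc[OF lim_1_over_n[where 'a = real]] by (intro lim) simp_all
  moreover have "\<theta> < ?f 0" using \<theta> by (simp add: green_const_eq[OF d])
  ultimately have "\<forall>\<^sub>F j in sequentially. \<theta> < ?f (1 / real (Suc j))" by (rule order_tendstoD)
  then obtain j where j: "\<theta> < ?f (1 / real (Suc j))" by (auto simp: eventually_sequentially)
  \<comment> \<open>Since b \<ge> 1 / \<theta>, the bound 1 / b on the integral is at most
    \<theta>.\<close>
  define a b where "a = 1 / real (Suc j)" and "b = a + 1 / \<theta>"
  have a: "a > 0" "\<theta> < ?f a" using j by (auto simp: a_def)
  have b: "a < b" "0 < b" using a \<theta> by (auto simp: b_def add_pos_pos)
  have "?f b \<le> 1 / b" by (rule green_integral_le_inverse[OF d b(2)])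
  also have "\<dots> \<le> 1 / (1 / \<theta>)" using a \<theta> b by (intro divide_left_mono) (auto simp: b_def)
  finally have fb: "?f b \<le> \<theta>" by simp
  have "continuous_on {a..b} ?f"
  proof (rule continuous_on_sequentiallyI)
    fix u m assume "\<forall>j. u j \<in> {a..b}" "m \<in> {a..b}" "u \<longlonglongrightarrow> m"
    then show "(\<lambda>j. ?f (u j)) \<longlonglongrightarrow> ?f m" using a by (intro lim) (auto intro: order_trans[of 0 a])
  qed
  then obtain m where m: "a \<le> m" "?f m = \<theta>"
    using IVT2'[of ?f b \<theta> a] fb a b by auto
  show ?thesis
  proof (rule ex1I[of _ m])
    show "m > 0 \<and> mass_integral TYPE('d) m = \<theta>" using m a by (simp add: mass_integral_eq)
    fix m' assume "m' > 0 \<and> mass_integral TYPE('d) m' = \<theta>"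
    then have m': "m' > 0" "?f m' = \<theta>" by (auto simp: mass_integral_eq)
    show "m' = m"
    proof (rule ccontr)
      assume "m' \<noteq> m"
      then show False
        using green_integral_strict_antimono[OF d, of m m'] green_integral_strict_antimono[OF d, of m' m] m m' a by force
    qed
  qed
qed

section \<open>Characteristic functions of the limit fields\<close>

lemma gaussian_rv_cases:
  assumes "gaussian_rv M Y"
  obtains \<mu> where "distr M borel Y = return borel \<mu>" | \<mu> \<sigma> where "\<sigma> > 0" "distributed M lborel Y (normal_density \<mu> \<sigma>)"
proof -
  obtain \<mu> \<sigma> where Y: "Y \<in> borel_measurable M"
    "distr M borel Y = (if \<sigma> > 0 then density lborel (normal_density \<mu> \<sigma>) else return borel \<mu>)"
    using assms by (auto simp: gaussian_rv_def)
  show ?thesis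
  proof (cases "\<sigma> > 0")
    case True
    then have "distr M lborel Y = density lborel (normal_density \<mu> \<sigma>)"
      using Y by (simp add: distr_cong[of M M lborel borel])
    then have "distributed M lborel Y (normal_density \<mu> \<sigma>)"
      using Y by (auto simp: distributed_def)
    then show ?thesis using True that(2) by blast
  next
    case False
    then show ?thesis using Y that(1) by auto
  qed
qed

lemma (in prob_space) distr_return_AE:
  fixes Y :: "'a \<Rightarrow> real"
  assumes "Y \<in> borel_measurable M" "distr M borel Y = return borel \<mu>"
  shows "AE \<omega> in M. Y \<omega> = \<mu>"
proof -
  have "AE y in distr M borel Y. y = \<mu>" unfolding assms(2) by (subst AE_return) auto
  then show ?thesis using assms(1) by (subst (asm) AE_distr_iff) auto
qed

lemma (in prob_space) gaussian_rv_square_integrable: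
  assumes "gaussian_rv M Y"
  shows "integrable M (\<lambda>\<omega>. (Y \<omega>)\<^sup>2)"
proof -
  have Y: "Y \<in> borel_measurable M" using assms by (simp add: gaussian_rv_def)
  from assms show ?thesis
  proof (cases rule: gaussian_rv_cases)
    case (1 \<mu>)
    have "integrable M (\<lambda>_. \<mu>\<^sup>2)" by simp
    then show ?thesis
      by (rule Bochner_Integration.integrable_cong_AE_imp) (use Y distr_return_AE[OF Y 1] in auto)
  next
    case (2 \<mu> \<sigma>)
    have i: "integrable lborel (\<lambda>x. normal_density \<mu> \<sigma> x * (x - \<mu>) ^ k)" for k
      by (rule integrable_normal_moment[OF 2(1)])
    have "integrable lborel (\<lambda>x. normal_density \<mu> \<sigma> x * (x - \<mu>) ^ 2 + 2 * \<mu> * (normal_density \<mu> \<sigma> x * (x - \<mu>) ^ 1) + \<mu>\<^sup>2 * (normal_density \<mu> \<sigma> x * (x - \<mu>) ^ 0))"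
      by (intro Bochner_Integration.integrable_add integrable_mult_right i)
    also have "(\<lambda>x. normal_density \<mu> \<sigma> x * (x - \<mu>) ^ 2 + 2 * \<mu> * (normal_density \<mu> \<sigma> x * (x - \<mu>) ^ 1) + \<mu>\<^sup>2 * (normal_density \<mu> \<sigma> x * (x - \<mu>) ^ 0)) =
        (\<lambda>x. normal_density \<mu> \<sigma> x * x\<^sup>2)"
      by (simp add: fun_eq_iff power2_eq_square algebra_simps)
    finally show ?thesis
      using distributed_integrable[OF 2(2), of "\<lambda>x. x\<^sup>2"] normal_density_nonneg by simp
  qed
qed

lemma (in prob_space) gaussian_rv_char:
  assumes "gaussian_rv M Y" "expectation Y = 0"
  shows "expectation (\<lambda>\<omega>. cis (Y \<omega>)) = exp (- expectation (\<lambda>\<omega>. (Y \<omega>)\<^sup>2) / 2)"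
proof -
  have Y: "Y \<in> borel_measurable M" using assms by (simp add: gaussian_rv_def)
  have [measurable]: "cis \<in> borel_measurable borel"
    by (intro borel_measurable_continuous_onI continuous_intros)
  from assms(1) show ?thesis
  proof (cases rule: gaussian_rv_cases)
    case (1 \<mu>)
    have ae: "AE \<omega> in M. Y \<omega> = \<mu>" by (rule distr_return_AE[OF Y 1])
    have "expectation Y = expectation (\<lambda>_. \<mu>)" using ae Y by (intro integral_cong_AE) auto
    then have "\<mu> = 0" using assms(2) prob_space by simp
    then have ae: "AE \<omega> in M. Y \<omega> = 0" using ae by simp
    have "expectation (\<lambda>\<omega>. cis (Y \<omega>)) = expectation (\<lambda>_. 1)" using ae Y by (intro integral_cong_AE) auto
    moreover have "expectation (\<lambda>\<omega>. (Y \<omega>)\<^sup>2) = expectation (\<lambda>_. 0)" using ae Y by (intro integral_cong_AE) auto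
    ultimately show ?thesis by (simp add: prob_space)
  next
    case (2 \<mu> \<sigma>)
    have mu: "\<mu> = 0" using normal_distributed_expectation[OF 2(1) 2(2)] assms(2) by simp
    have var: "expectation (\<lambda>\<omega>. (Y \<omega>)\<^sup>2) = \<sigma>\<^sup>2"
      using normal_distributed_variance[OF 2(1) 2(2)] assms(2) by simp
    have "distributed M lborel (\<lambda>\<omega>. (Y \<omega> - \<mu>) / \<sigma>) std_normal_density"
      using normal_standard_normal_convert[OF 2(1), of Y \<mu>] 2(2) by blast
    then have Z: "distributed M lborel (\<lambda>\<omega>. Y \<omega> / \<sigma>) std_normal_density" by (simp add: mu)
    have ZM: "(\<lambda>\<omega>. Y \<omega> / \<sigma>) \<in> borel_measurable M" using Y by simp
    have "distr M borel (\<lambda>\<omega>. Y \<omega> / \<sigma>) = std_normal_distribution"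
      using distributed_distr_eq_density[OF Z] by (simp add: distr_cong[of M M lborel borel])
    then have "char (distr M borel (\<lambda>\<omega>. Y \<omega> / \<sigma>)) \<sigma> = complex_of_real (exp (- (\<sigma>\<^sup>2) / 2))"
      by (simp add: char_std_normal_distribution)
    also have "char (distr M borel (\<lambda>\<omega>. Y \<omega> / \<sigma>)) \<sigma> = expectation (\<lambda>\<omega>. cis (\<sigma> * (Y \<omega> / \<sigma>)))"
      unfolding char_def cis_conv_exp[symmetric]
      by (subst integral_distr[OF ZM]) auto
    finally show ?thesis using 2(1) by (simp add: var exp_of_real)
  qed
qed

text \<open>Independence and equality in law of real and imaginary parts split the complex
  covariance: each part has covariance G / 2 and the cross terms vanish. The variance of the
  functional is half of the quadratic form, hence the factor 1 / 4 in the exponent.\<close>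

lemma (in prob_space) massive_gff_char:
  fixes \<Phi> :: "'a \<Rightarrow> int ^ 'd \<Rightarrow> complex"
  assumes gff: "massive_gff m M \<Phi>" and A: "finite A"
  shows "expectation (\<lambda>\<omega>. cis (rpair A c (\<Phi> \<omega>))) =
    exp (- (\<Sum>x\<in>A. \<Sum>y\<in>A. Re (c x * cnj (c y)) * green m x y) / 4)"
proof -
  let ?F = "Pi\<^sub>M UNIV (\<lambda>_. borel) :: (int ^ 'd \<Rightarrow> real) measure"
  have cgp: "complex_gaussian_process M \<Phi>" and mean: "\<And>x. expectation (\<lambda>\<omega>. \<Phi> \<omega> x) = 0"
    and ind: "indep_var ?F (\<lambda>\<omega> x. Re (\<Phi> \<omega> x)) ?F (\<lambda>\<omega> x. Im (\<Phi> \<omega> x))"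
    and same: "distr M ?F (\<lambda>\<omega> x. Re (\<Phi> \<omega> x)) = distr M ?F (\<lambda>\<omega> x. Im (\<Phi> \<omega> x))"
    and cov: "\<And>x y. expectation (\<lambda>\<omega>. cnj (\<Phi> \<omega> x) * \<Phi> \<omega> y) = complex_of_real (green m x y)"
    using gff by (simp_all add: massive_gff_def)
  have gauss: "gaussian_rv M (\<lambda>\<omega>. rpair B e (\<Phi> \<omega>))" if "finite B" for B e
    using cgp that by (simp add: complex_gaussian_process_def rpair_def)
  define R I where "R x \<omega> = Re (\<Phi> \<omega> x)" and "I x \<omega> = Im (\<Phi> \<omega> x)" for x \<omega>
  have gR: "gaussian_rv M (R x)" for x
    using gauss[of "{x}" "\<lambda>_. 1"] by (simp add: rpair_def R_def[abs_def])
  have gI: "gaussian_rv M (I x)" for x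
    using gauss[of "{x}" "\<lambda>_. - \<i>"] by (simp add: rpair_def I_def[abs_def])
  have [measurable]: "R x \<in> borel_measurable M" "I x \<in> borel_measurable M" for x
    using gR gI by (simp_all add: gaussian_rv_def)
  have sqR: "integrable M (\<lambda>\<omega>. (R x \<omega>)\<^sup>2)" and sqI: "integrable M (\<lambda>\<omega>. (I x \<omega>)\<^sup>2)" for x
    using gaussian_rv_square_integrable gR gI by auto
  have prod: "integrable M (\<lambda>\<omega>. f \<omega> * g \<omega>)"
    if [measurable]: "f \<in> borel_measurable M" "g \<in> borel_measurable M"
      and sq: "integrable M (\<lambda>\<omega>. (f \<omega>)\<^sup>2)" "integrable M (\<lambda>\<omega>. (g \<omega>)\<^sup>2)" for f g :: "'a \<Rightarrow> real"
  proof (rule Bochner_Integration.integrable_bound)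
    show "integrable M (\<lambda>\<omega>. (f \<omega>)\<^sup>2 + (g \<omega>)\<^sup>2)" using sq by simp
    have "\<bar>a * b\<bar> \<le> a\<^sup>2 + b\<^sup>2" for a b :: real
    proof -
      have "0 \<le> (\<bar>a\<bar> - \<bar>b\<bar>)\<^sup>2" by simp
      also have "\<dots> = a\<^sup>2 + b\<^sup>2 - 2 * \<bar>a * b\<bar>" by (simp add: power2_diff abs_mult)
      finally have "2 * \<bar>a * b\<bar> \<le> a\<^sup>2 + b\<^sup>2" by simp
      moreover have "0 \<le> \<bar>a * b\<bar>" by simp
      ultimately show ?thesis by linarith
    qed
    then have "norm (f \<omega> * g \<omega>) \<le> norm ((f \<omega>)\<^sup>2 + (g \<omega>)\<^sup>2)" for \<omega> by (simp add: order_trans[OF _ abs_ge_self])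
    then show "AE \<omega> in M. norm (f \<omega> * g \<omega>) \<le> norm ((f \<omega>)\<^sup>2 + (g \<omega>)\<^sup>2)" by simp
  qed measurable
  have iR: "integrable M (R x)" and iI: "integrable M (I x)" for x
    using prod[of "R x" "\<lambda>_. 1"] prod[of "I x" "\<lambda>_. 1"] sqR sqI by simp_all
  have i\<Phi>: "integrable M (\<lambda>\<omega>. \<Phi> \<omega> x)" for x
  proof -
    have "(\<lambda>\<omega>. \<Phi> \<omega> x) = (\<lambda>\<omega>. complex_of_real (R x \<omega>) + \<i> * complex_of_real (I x \<omega>))"
      by (simp add: R_def I_def complex_eq_iff fun_eq_iff)
    then show ?thesis using iR iI by simp
  qed
  have meanR: "expectation (R x) = 0" and meanI: "expectation (I x) = 0" for x
    using integral_Re[OF i\<Phi>[of x]] integral_Im[OF i\<Phi>[of x]] mean[of x] by (simp_all add: R_def[abs_def] I_def[abs_def])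
  have RI: "expectation (\<lambda>\<omega>. R x \<omega> * I y \<omega>) = 0" for x y
  proof -
    have "indep_var borel ((\<lambda>f. f x) \<circ> (\<lambda>\<omega> x. Re (\<Phi> \<omega> x))) borel ((\<lambda>f. f y) \<circ> (\<lambda>\<omega> x. Im (\<Phi> \<omega> x)))"
      by (rule indep_var_compose[OF ind]) measurable
    then have "indep_var borel (R x) borel (I y)" by (simp add: o_def R_def[abs_def] I_def[abs_def])
    then show ?thesis using indep_var_lebesgue_integral[of "R x" "I y"] iR iI meanR by simp
  qed
  have IR: "expectation (\<lambda>\<omega>. I y \<omega> * R x \<omega>) = 0" for x y
    using RI[of x y] by (simp only: mult.commute)
  \<comment> \<open>Equality of the laws as fields, not only at single sites, identifies the mixed
    moments at two sites.\<close>
  have RRII: "expectation (\<lambda>\<omega>. R x \<omega> * R y \<omega>) = expectation (\<lambda>\<omega>. I x \<omega> * I y \<omega>)" for x y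
  proof -
    have mR: "(\<lambda>\<omega> x. Re (\<Phi> \<omega> x)) \<in> measurable M ?F" and mI: "(\<lambda>\<omega> x. Im (\<Phi> \<omega> x)) \<in> measurable M ?F"
      using ind by (auto dest: indep_var_rv1 indep_var_rv2)
    have [measurable]: "(\<lambda>f. f x * f y) \<in> borel_measurable ?F" by measurable
    show ?thesis
      using integral_distr[OF mR, of "\<lambda>f. f x * f y"] integral_distr[OF mI, of "\<lambda>f. f x * f y"]
      unfolding same by (simp add: R_def I_def)
  qed
  have RR: "expectation (\<lambda>\<omega>. R x \<omega> * R y \<omega>) = green m x y / 2" for x y
  proof -
    have i: "integrable M (\<lambda>\<omega>. R x \<omega> * R y \<omega>)" "integrable M (\<lambda>\<omega>. I x \<omega> * I y \<omega>)"
      "integrable M (\<lambda>\<omega>. R x \<omega> * I y \<omega>)" "integrable M (\<lambda>\<omega>. I x \<omega> * R y \<omega>)"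
      by (intro prod sqR sqI; measurable)+
    have "(\<lambda>\<omega>. cnj (\<Phi> \<omega> x) * \<Phi> \<omega> y) = (\<lambda>\<omega>. complex_of_real (R x \<omega> * R y \<omega> + I x \<omega> * I y \<omega>) +
        \<i> * complex_of_real (R x \<omega> * I y \<omega> - I x \<omega> * R y \<omega>))"
      by (simp add: R_def I_def complex_eq_iff fun_eq_iff)
    then have ip: "integrable M (\<lambda>\<omega>. cnj (\<Phi> \<omega> x) * \<Phi> \<omega> y)" using i by (simp del: of_real_add of_real_mult of_real_diff)
    have "green m x y = Re (expectation (\<lambda>\<omega>. cnj (\<Phi> \<omega> x) * \<Phi> \<omega> y))" by (simp add: cov)
    also have "\<dots> = expectation (\<lambda>\<omega>. Re (cnj (\<Phi> \<omega> x) * \<Phi> \<omega> y))" by (rule integral_Re[OF ip, symmetric])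
    also have "\<dots> = expectation (\<lambda>\<omega>. R x \<omega> * R y \<omega> + I x \<omega> * I y \<omega>)" by (simp add: R_def I_def)
    also have "\<dots> = 2 * expectation (\<lambda>\<omega>. R x \<omega> * R y \<omega>)" using i by (simp add: RRII)
    finally show ?thesis by simp
  qed
  let ?S = "\<lambda>\<omega>. rpair A c (\<Phi> \<omega>)"
  have S: "?S = (\<lambda>\<omega>. \<Sum>x\<in>A. Re (c x) * R x \<omega> - Im (c x) * I x \<omega>)"
    by (simp add: rpair_def R_def I_def)
  have S0: "expectation ?S = 0"
    unfolding S using iR iI meanR meanI by simp
  define T where "T x y \<omega> = (Re (c x) * R x \<omega> - Im (c x) * I x \<omega>) * (Re (c y) * R y \<omega> - Im (c y) * I y \<omega>)" for x y \<omega>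
  have T: "T x y = (\<lambda>\<omega>. Re (c x) * Re (c y) * (R x \<omega> * R y \<omega>) - Re (c x) * Im (c y) * (R x \<omega> * I y \<omega>)
       - Im (c x) * Re (c y) * (R y \<omega> * I x \<omega>) + Im (c x) * Im (c y) * (I x \<omega> * I y \<omega>))" for x y
    by (simp add: T_def fun_eq_iff algebra_simps)
  have i: "integrable M (\<lambda>\<omega>. R x \<omega> * R y \<omega>)" "integrable M (\<lambda>\<omega>. I x \<omega> * I y \<omega>)"
      "integrable M (\<lambda>\<omega>. R x \<omega> * I y \<omega>)" for x y
    by (intro prod sqR sqI; measurable)+
  have Ti: "integrable M (T x y)" for x y unfolding T using i by simp
  have ET: "expectation (T x y) = Re (c x * cnj (c y)) * green m x y / 2" for x y
    unfolding T using i by (simp add: RI IR RR RRII[symmetric] field_simps)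
  have "(\<lambda>\<omega>. (?S \<omega>)\<^sup>2) = (\<lambda>\<omega>. \<Sum>x\<in>A. \<Sum>y\<in>A. T x y \<omega>)"
    unfolding fun_cong[OF S] by (simp add: T_def power2_eq_square sum_product)
  then have "expectation (\<lambda>\<omega>. (?S \<omega>)\<^sup>2) = (\<Sum>x\<in>A. \<Sum>y\<in>A. expectation (T x y))"
    using Ti by simp
  also have "\<dots> = (\<Sum>x\<in>A. \<Sum>y\<in>A. Re (c x * cnj (c y)) * green m x y) / 2"
    unfolding ET by (simp add: sum_divide_distrib)
  finally show ?thesis
    using gaussian_rv_char[OF gauss[OF A, of c] S0] by simp
qed

text \<open>The linear functional generates a smaller sigma-algebra than the field, so it inherits
  independence from \<open>U\<close>.\<close>

lemma (in prob_space) indep_of_field_char: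
  fixes \<Phi> :: "'a \<Rightarrow> 'b \<Rightarrow> complex"
  assumes ind: "indep_of_field M U \<Phi>" and U: "U \<in> borel_measurable M" and \<Phi>: "\<Phi> \<in> measurable M field_space"
    and A: "finite A"
  shows "expectation (\<lambda>\<omega>. cis (rpair A c (\<Phi> \<omega>) + Re (j * U \<omega>))) =
    expectation (\<lambda>\<omega>. cis (rpair A c (\<Phi> \<omega>))) * expectation (\<lambda>\<omega>. cis (Re (j * U \<omega>)))"
proof -
  \<comment> \<open>The real functional is regarded as complex so that it has the same value type as
    \<open>U\<close>.\<close>
  let ?S = "\<lambda>\<omega>. complex_of_real (rpair A c (\<Phi> \<omega>))"
  have [measurable]: "cis \<in> borel_measurable borel"
    by (intro borel_measurable_continuous_onI continuous_intros)
  let ?r = "\<lambda>f. complex_of_real (rpair A c f)"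
  have rp [measurable]: "?r \<in> borel_measurable field_space"
    unfolding rpair_def by measurable
  have S [measurable]: "?S \<in> borel_measurable M" using measurable_compose[OF \<Phi> rp] .
  note U [measurable]
  have sub: "{?S -` B \<inter> space M |B. B \<in> sets borel} \<subseteq> {\<Phi> -` B \<inter> space M |B. B \<in> sets (field_space :: ('b \<Rightarrow> complex) measure)}"
  proof clarify
    fix B :: "complex set" assume "B \<in> sets borel"
    then have "?r -` B \<inter> space field_space \<in> sets (field_space :: ('b \<Rightarrow> complex) measure)"
      by (rule measurable_sets[OF rp])
    moreover have "?S -` B \<inter> space M = \<Phi> -` (?r -` B \<inter> space field_space) \<inter> space M"
      using measurable_space[OF \<Phi>] by auto
    ultimately show "\<exists>C. ?S -` B \<inter> space M = \<Phi> -` C \<inter> space M \<and> C \<in> sets (field_space :: ('b \<Rightarrow> complex) measure)" by blast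
  qed
  have "indep_set (sigma_sets (space M) {U -` B \<inter> space M |B. B \<in> sets borel})
      (sigma_sets (space M) {\<Phi> -` B \<inter> space M |B. B \<in> sets field_space})"
    using ind by (simp add: indep_of_field_def sets_vimage_algebra)
  then have "indep_set (sigma_sets (space M) {U -` B \<inter> space M |B. B \<in> sets borel})
      (sigma_sets (space M) {?S -` B \<inter> space M |B. B \<in> sets borel})"
    unfolding indep_set_def
    by (rule indep_sets_mono_sets) (auto split: bool.split intro: sigma_sets_mono'[OF sub, THEN subsetD])
  then have "indep_var borel U borel ?S"
    unfolding indep_var_eq using S U by simp
  then have "indep_var borel ((\<lambda>u. cis (Re (j * u))) \<circ> U) borel ((\<lambda>u. cis (Re u)) \<circ> ?S)"
    by (rule indep_var_compose) measurable
  then have iv: "indep_var borel (\<lambda>\<omega>. cis (Re (j * U \<omega>))) borel (\<lambda>\<omega>. cis (rpair A c (\<Phi> \<omega>)))" by (simp add: o_def)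
  have "integrable M (\<lambda>\<omega>. cis (Re (j * U \<omega>)))" "integrable M (\<lambda>\<omega>. cis (rpair A c (\<Phi> \<omega>)))"
  proof -
    have [measurable]: "(\<lambda>\<omega>. rpair A c (\<Phi> \<omega>)) \<in> borel_measurable M"
      using measurable_compose[OF S, of Re borel] by simp
    show "integrable M (\<lambda>\<omega>. cis (Re (j * U \<omega>)))" "integrable M (\<lambda>\<omega>. cis (rpair A c (\<Phi> \<omega>)))"
      by (rule integrable_const_bound[where B = 1]; simp)+
  qed
  then show ?thesis
    using indep_var_lebesgue_integral[OF iv] by (simp add: cis_mult add.commute mult.commute)
qed

section \<open>The spherical law in Fourier coordinates\<close>

text \<open>Two symmetries have this form in Fourier coordinates: the quarter turn of one mode, and
  a spatial translation, which multiplies each mode by its character.\<close>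

definition phase_rotate :: "'i set \<Rightarrow> ('i \<Rightarrow> complex) \<Rightarrow> ('i \<Rightarrow> complex) \<Rightarrow> ('i \<Rightarrow> complex)" where
  "phase_rotate T \<omega> a = (\<lambda>k\<in>T. \<omega> k * a k)"

lemma measurable_phase_rotate: "phase_rotate T \<omega> \<in> measurable (cspace T) (cspace T)"
proof -
  have "(\<lambda>a. \<omega> k * a k) \<in> measurable (cspace T) lborel" if "k \<in> T" for k
  proof -
    have [measurable]: "(\<lambda>a. a k) \<in> borel_measurable (cspace T)" using that by (rule measurable_cspace_component)
    show ?thesis by simp
  qed
  then show ?thesis unfolding phase_rotate_def[abs_def] by (intro measurable_restrict)
qed

lemma distr_cspace_phase_rotate:
  assumes T: "finite T" and \<omega>: "\<And>k. k \<in> T \<Longrightarrow> cmod (\<omega> k) = 1"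
  shows "distr (cspace T) (cspace T) (phase_rotate T \<omega>) = cspace T"
proof (rule distr_cspace_isometry[OF T measurable_phase_rotate])
  show "\<exists>x\<in>PiE T (\<lambda>_. UNIV). phase_rotate T \<omega> x = y" if y: "y \<in> PiE T (\<lambda>_. UNIV)" for y
  proof (intro bexI[of _ "\<lambda>k\<in>T. y k / \<omega> k"])
    have "\<omega> k \<noteq> 0" if "k \<in> T" for k using \<omega>[OF that] by auto
    then show "phase_rotate T \<omega> (\<lambda>k\<in>T. y k / \<omega> k) = y"
      using y by (auto simp: phase_rotate_def fun_eq_iff PiE_iff extensional_def)
  qed simp
  show "(\<Sum>i\<in>T. (cmod (phase_rotate T \<omega> x i))\<^sup>2) = (\<Sum>i\<in>T. (cmod (x i))\<^sup>2)" for x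
    using \<omega> by (intro sum.cong) (auto simp: phase_rotate_def norm_mult)
  show "phase_rotate T \<omega> (\<lambda>i\<in>T. x i + y i) = (\<lambda>i\<in>T. phase_rotate T \<omega> x i + phase_rotate T \<omega> y i)" for x y
    by (rule ext) (simp add: phase_rotate_def distrib_left)
qed

lemma distr_density_phase_rotate:
  assumes T: "finite T" and \<omega>: "\<And>k. k \<in> T \<Longrightarrow> cmod (\<omega> k) = 1"
    and f: "f \<in> borel_measurable (cspace T)" "\<And>a. f (phase_rotate T \<omega> a) = f a"
  shows "distr (density (cspace T) f) (cspace T) (phase_rotate T \<omega>) = density (cspace T) f"
proof -
  have 1: "density (distr (cspace T) (cspace T) (phase_rotate T \<omega>)) f =
      distr (density (cspace T) (\<lambda>x. f (phase_rotate T \<omega> x))) (cspace T) (phase_rotate T \<omega>)"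
    by (rule density_distr[OF f(1) measurable_phase_rotate[of T \<omega>]])
  have 2: "distr (cspace T) (cspace T) (phase_rotate T \<omega>) = cspace T"
    by (rule distr_cspace_phase_rotate) (use T \<omega> in auto)
  show ?thesis using 1[symmetric] unfolding 2 f(2) .
qed

lemma quarter_turn_invariant_density:
  assumes T: "finite T" "K \<subseteq> T"
    and f: "f \<in> borel_measurable (cspace T)" "\<And>a k. k \<in> K \<Longrightarrow> f (phase_rotate T ((\<lambda>_. 1)(k := \<i>)) a) = f a"
  shows "quarter_turn_invariant (density (cspace T) f) T K"
  unfolding quarter_turn_invariant_def
proof
  fix k assume k: "k \<in> K"
  have "distr (density (cspace T) f) (cspace T) (\<lambda>a. a(k := \<i> * a k)) =
      distr (density (cspace T) f) (cspace T) (phase_rotate T ((\<lambda>_. 1)(k := \<i>)))"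
    using k T by (intro distr_cong) (auto simp: phase_rotate_def fun_eq_iff PiE_iff extensional_def)
  also have "\<dots> = density (cspace T) f"
    by (rule distr_density_phase_rotate) (use T f k in auto)
  finally show "distr (density (cspace T) f) (cspace T) (\<lambda>a. a(k := \<i> * a k)) = density (cspace T) f" .
qed

section \<open>Product Gaussian laws\<close>

definition sqnorm :: "'i set \<Rightarrow> ('i \<Rightarrow> real) \<Rightarrow> ('i \<Rightarrow> complex) \<Rightarrow> real" where
  "sqnorm T b a = (\<Sum>k\<in>T. b k * (cmod (a k))\<^sup>2)"

lemma measurable_sqnorm [measurable]: "sqnorm T b \<in> borel_measurable (cspace T)"
proof -
  have [measurable]: "(\<lambda>a. a k) \<in> borel_measurable (cspace T)" if "k \<in> T" for k
    using that by (rule measurable_cspace_component)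
  show ?thesis unfolding sqnorm_def[abs_def] by measurable
qed

lemma sqnorm_phase_rotate: "(\<And>k. k \<in> T \<Longrightarrow> cmod (\<omega> k) = 1) \<Longrightarrow> sqnorm T b (phase_rotate T \<omega> a) = sqnorm T b a"
  unfolding sqnorm_def phase_rotate_def by (intro sum.cong) (auto simp: norm_mult)

lemma nn_integral_gaussian_sqnorm:
  assumes "finite T" "\<And>k. k \<in> T \<Longrightarrow> c k > 0"
  shows "(\<integral>\<^sup>+a. ennreal (exp (- sqnorm T c a)) \<partial>cspace T) = ennreal (\<Prod>k\<in>T. pi / c k)"
  unfolding sqnorm_def by (rule nn_integral_gaussian_cspace[OF assms])

definition gauss_law :: "'i set \<Rightarrow> ('i \<Rightarrow> real) \<Rightarrow> ('i \<Rightarrow> complex) measure" where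
  "gauss_law T c = density (cspace T) (\<lambda>a. ennreal (exp (- sqnorm T c a) / (\<Prod>k\<in>T. pi / c k)))"

text \<open>Tilting by t turns the rates c into c - t, so the moment is a quotient of two
  normalisations.\<close>

lemma gauss_law_moment:
  assumes T: "finite T" and c: "\<And>k. k \<in> T \<Longrightarrow> c k > 0" and t: "\<And>k. k \<in> T \<Longrightarrow> t k < c k"
  shows "(\<integral>\<^sup>+a. ennreal (exp (sqnorm T t a)) \<partial>gauss_law T c) = ennreal (\<Prod>k\<in>T. 1 / (1 - t k / c k))"
proof -
  let ?Z = "\<Prod>k\<in>T. pi / c k"
  have Z: "?Z > 0" by (rule prod_pos) (simp add: c)
  have e: "exp (- sqnorm T c a) / ?Z * exp (sqnorm T t a) = 1 / ?Z * exp (- sqnorm T (\<lambda>k. c k - t k) a)" for a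
  proof -
    have "- sqnorm T c a + sqnorm T t a = - sqnorm T (\<lambda>k. c k - t k) a"
      by (simp add: sqnorm_def left_diff_distrib sum_subtractf)
    then show ?thesis by (simp add: exp_add[symmetric])
  qed
  have "(\<integral>\<^sup>+a. ennreal (exp (sqnorm T t a)) \<partial>gauss_law T c) =
      (\<integral>\<^sup>+a. ennreal (exp (- sqnorm T c a) / ?Z) * ennreal (exp (sqnorm T t a)) \<partial>cspace T)"
    unfolding gauss_law_def by (rule nn_integral_density) measurable
  also have "\<dots> = (\<integral>\<^sup>+a. ennreal (1 / ?Z) * ennreal (exp (- sqnorm T (\<lambda>k. c k - t k) a)) \<partial>cspace T)"
  proof (rule nn_integral_cong)
    fix a
    have "ennreal (exp (- sqnorm T c a) / ?Z) * ennreal (exp (sqnorm T t a)) = ennreal (exp (- sqnorm T c a) / ?Z * exp (sqnorm T t a))"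
      using Z by (intro ennreal_mult[symmetric]) auto
    also have "\<dots> = ennreal (1 / ?Z) * ennreal (exp (- sqnorm T (\<lambda>k. c k - t k) a))"
      unfolding e using Z by (intro ennreal_mult) auto
    finally show "ennreal (exp (- sqnorm T c a) / ?Z) * ennreal (exp (sqnorm T t a)) =
      ennreal (1 / ?Z) * ennreal (exp (- sqnorm T (\<lambda>k. c k - t k) a))" .
  qed
  also have "\<dots> = ennreal (1 / ?Z) * ennreal (\<Prod>k\<in>T. pi / (c k - t k))"
    by (subst nn_integral_cmult) (use T t in \<open>simp_all add: nn_integral_gaussian_sqnorm\<close>)
  also have "\<dots> = ennreal (1 / ?Z * (\<Prod>k\<in>T. pi / (c k - t k)))"
    using Z t by (intro ennreal_mult[symmetric] prod_nonneg) (auto simp: less_imp_le)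
  also have "1 / ?Z * (\<Prod>k\<in>T. pi / (c k - t k)) = (\<Prod>k\<in>T. 1 / (1 - t k / c k))"
  proof -
    have "1 / ?Z = (\<Prod>k\<in>T. c k / pi)" by (simp add: prod_dividef)
    then have "1 / ?Z * (\<Prod>k\<in>T. pi / (c k - t k)) = (\<Prod>k\<in>T. c k / pi * (pi / (c k - t k)))"
      by (simp only: prod.distrib)
    also have "\<dots> = (\<Prod>k\<in>T. 1 / (1 - t k / c k))"
    proof (intro prod.cong refl)
      fix k assume "k \<in> T"
      then show "c k / pi * (pi / (c k - t k)) = 1 / (1 - t k / c k)"
        using c[of k] t[of k] by (simp add: field_simps)
    qed
    finally show ?thesis .
  qed
  finally show ?thesis .
qed

lemma sets_gauss_law [simp]: "sets (gauss_law T c) = sets (cspace T)"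
  by (simp add: gauss_law_def)

lemma prob_space_gauss_law:
  assumes "finite T" "\<And>k. k \<in> T \<Longrightarrow> c k > 0"
  shows "prob_space (gauss_law T c)"
proof
  have "emeasure (gauss_law T c) (space (gauss_law T c)) = (\<integral>\<^sup>+a. 1 \<partial>gauss_law T c)" by simp
  also have "\<dots> = (\<integral>\<^sup>+a. ennreal (exp (sqnorm T (\<lambda>_. 0) a)) \<partial>gauss_law T c)"
    by (simp add: sqnorm_def)
  also have "\<dots> = ennreal (\<Prod>k\<in>T. 1 / (1 - 0 / c k))" by (rule gauss_law_moment) (use assms in auto)
  finally show "emeasure (gauss_law T c) (space (gauss_law T c)) = 1" by simp
qed

lemma exp_moment_bound_gauss_law:
  assumes "finite T" "\<And>k. k \<in> T \<Longrightarrow> c k > 0"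
  shows "exp_moment_bound (gauss_law T c) T c 1"
  unfolding exp_moment_bound_def
  using gauss_law_moment[OF assms] by (simp add: sqnorm_def)

section \<open>The law of the Fourier coefficients\<close>

definition mode_weight :: "real \<Rightarrow> nat \<Rightarrow> (int ^ 'd \<Rightarrow> complex) \<Rightarrow> real" where
  "mode_weight \<theta> n a = exp (- sqnorm (torus n) (\<lambda>k. \<theta> * eigval n k) a) *
     indicator {a. sqnorm (torus n) (\<lambda>_. 1) a \<le> real (n ^ CARD('d))} a"

definition mode_partition :: "'d::finite itself \<Rightarrow> real \<Rightarrow> nat \<Rightarrow> real" where
  "mode_partition _ \<theta> n = (\<integral>a. mode_weight \<theta> n a \<partial>cspace (torus n :: (int ^ 'd) set))"

definition mode_law :: "real \<Rightarrow> nat \<Rightarrow> (int ^ 'd \<Rightarrow> complex) measure" where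
  "mode_law \<theta> n = density (cspace (torus n)) (\<lambda>a. ennreal (mode_weight \<theta> n a / mode_partition TYPE('d) \<theta> n))"

lemma sets_mode_law [simp]: "sets (mode_law \<theta> n :: (int ^ 'd \<Rightarrow> complex) measure) = sets (cspace (torus n))"
  by (simp add: mode_law_def)

lemma measurable_mode_weight [measurable]:
  "(mode_weight \<theta> n :: (int ^ 'd \<Rightarrow> complex) \<Rightarrow> real) \<in> borel_measurable (cspace (torus n))"
  unfolding mode_weight_def[abs_def] by measurable

lemma mode_weight_phase_rotate:
  "(\<And>k. k \<in> torus n \<Longrightarrow> cmod (\<omega> k) = 1) \<Longrightarrow> mode_weight \<theta> n (phase_rotate (torus n) \<omega> a) = mode_weight \<theta> n a"
  by (simp add: mode_weight_def sqnorm_phase_rotate indicator_def)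

lemma measurable_fourier: "(fourier n :: (int ^ 'd \<Rightarrow> complex) \<Rightarrow> _) \<in> measurable (cspace (torus n)) (cspace (torus n))"
proof -
  have [measurable]: "(\<lambda>a. a k) \<in> borel_measurable (cspace (torus n))" if "k \<in> torus n" for k :: "int ^ 'd"
    using that by (rule measurable_cspace_component)
  show ?thesis unfolding fourier_def[abs_def] by (intro measurable_restrict) simp
qed

lemma distr_cspace_fourier:
  assumes "n > 0"
  shows "distr (cspace (torus n)) (cspace (torus n)) (fourier n) = (cspace (torus n) :: (int ^ 'd \<Rightarrow> complex) measure)"
proof (rule distr_cspace_isometry[OF finite_torus measurable_fourier])
  show "fourier n (\<lambda>i\<in>torus n. x i + y i) = (\<lambda>i\<in>torus n. fourier n x i + fourier n y i)" for x y :: "int ^ 'd \<Rightarrow> complex"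
    by (simp add: fourier_def fun_eq_iff distrib_right sum.distrib)
  show "\<exists>x\<in>torus n \<rightarrow>\<^sub>E UNIV. fourier n x = y" if "y \<in> torus n \<rightarrow>\<^sub>E UNIV" for y :: "int ^ 'd \<Rightarrow> complex"
    by (rule fourier_surj[OF assms that])
  show "(\<Sum>i\<in>torus n. (cmod (fourier n x i))\<^sup>2) = (\<Sum>i\<in>torus n. (cmod (x i))\<^sup>2)" for x :: "int ^ 'd \<Rightarrow> complex"
    using norm2_sq_fourier[OF assms, of x] by (simp add: norm2_sq_def)
qed

lemma spherical_weight_fourier:
  assumes "n \<ge> 3"
  shows "spherical_weight \<theta> n (fourier n a) = mode_weight \<theta> n a"
  using assms norm2_sq_fourier[of n a]
  by (simp add: spherical_weight_def mode_weight_def grad_sq_fourier sqnorm_def norm2_sq_def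
      sum_distrib_left sum_negf mult.assoc indicator_def)

lemma measurable_spherical_weight:
  "(spherical_weight \<theta> n :: (int ^ 'd \<Rightarrow> complex) \<Rightarrow> real) \<in> borel_measurable (cspace (torus n))"
proof -
  have [measurable]: "(\<lambda>a. a k) \<in> borel_measurable (cspace (torus n))" if "k \<in> torus n" for k :: "int ^ 'd"
    using that by (rule measurable_cspace_component)
  have [measurable]: "(norm2_sq n :: (int ^ 'd \<Rightarrow> complex) \<Rightarrow> real) \<in> borel_measurable (cspace (torus n))"
    unfolding norm2_sq_def[abs_def] by measurable
  have [measurable]: "(grad_sq n :: (int ^ 'd \<Rightarrow> complex) \<Rightarrow> real) \<in> borel_measurable (cspace (torus n))"
    unfolding grad_sq_def[abs_def]
    by (intro borel_measurable_divide borel_measurable_const borel_measurable_sum)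
      (auto simp: torus_adj_def)
  show ?thesis unfolding spherical_weight_def[abs_def] by measurable
qed

text \<open>The transform preserves Lebesgue measure and turns the spherical weight into the
  diagonal one; the bound n \<ge> 3 stems from the diagonalisation of the energy.\<close>

lemma spherical_law_eq_distr:
  assumes n: "n \<ge> 3"
  shows "spherical_law \<theta> n = (distr (mode_law \<theta> n) (cspace (torus n)) (fourier n) :: (int ^ 'd \<Rightarrow> complex) measure)"
proof -
  have n0: "n > 0" using n by simp
  let ?L = "cspace (torus n) :: (int ^ 'd \<Rightarrow> complex) measure"
  let ?Z = "\<integral>\<phi>. spherical_weight \<theta> n \<phi> \<partial>?L"
  note [measurable] = measurable_spherical_weight
  have "?Z = (\<integral>\<phi>. spherical_weight \<theta> n \<phi> \<partial>distr ?L ?L (fourier n))"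
    by (simp add: distr_cspace_fourier[OF n0])
  also have "\<dots> = (\<integral>a. spherical_weight \<theta> n (fourier n a) \<partial>?L)"
    by (rule integral_distr[OF measurable_fourier measurable_spherical_weight])
  finally have Z: "?Z = mode_partition TYPE('d) \<theta> n"
    by (simp add: spherical_weight_fourier[OF n] mode_partition_def)
  have "spherical_law \<theta> n = density (distr ?L ?L (fourier n)) (\<lambda>\<psi>. ennreal (spherical_weight \<theta> n \<psi> / ?Z))"
    by (simp add: spherical_law_def lebesgue_torus_def distr_cspace_fourier[OF n0])
  also have "\<dots> = distr (density ?L (\<lambda>a. ennreal (spherical_weight \<theta> n (fourier n a) / ?Z))) ?L (fourier n)"
    by (rule density_distr[OF _ measurable_fourier]) measurable
  also have "\<dots> = distr (mode_law \<theta> n) ?L (fourier n)"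
    by (simp add: spherical_weight_fourier[OF n] Z mode_law_def)
  finally show ?thesis .
qed

text \<open>The mass m multiplies the weight by exp (- \<theta> m |a|^2). This damps the zero mode,
  and on the ball it costs at most the factor exp (\<theta> m N).\<close>

definition mode_rate :: "real \<Rightarrow> real \<Rightarrow> nat \<Rightarrow> int ^ 'd \<Rightarrow> real" where
  "mode_rate \<theta> m n k = \<theta> * (eigval n k + m)"

lemma emeasure_unit_cball_pos: "emeasure lborel (cball 0 1 :: complex set) > 0"
proof -
  have "ball 0 1 \<noteq> ({} :: complex set)" by simp
  then have "\<not> negligible (ball 0 1 :: complex set)" using open_not_negligible by blast
  then have "\<not> negligible (cball 0 1 :: complex set)"
    using negligible_subset ball_subset_cball by blast
  then have "cball 0 1 \<notin> null_sets (lborel :: complex measure)"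
    by (simp add: negligible_iff_null_sets null_sets_completionI null_sets_def)
  then show ?thesis by (auto simp: null_sets_def zero_less_iff_neq_zero)
qed

context
  fixes \<theta> :: real and n :: nat
  assumes \<theta>: "\<theta> > 0" and n: "n > 0"
begin

lemma mode_weight_nonneg: "mode_weight \<theta> n (a :: int ^ 'd \<Rightarrow> complex) \<ge> 0"
  by (simp add: mode_weight_def)

lemma sqnorm_nonneg: "(\<And>k. k \<in> T \<Longrightarrow> b k \<ge> 0) \<Longrightarrow> sqnorm T b a \<ge> 0"
  unfolding sqnorm_def by (intro sum_nonneg) auto

text \<open>The energy does not damp the zero mode, so integrability has to come from the ball, on
  which 1 \<le> exp (N - |a|^2).\<close>

lemma integrable_mode_weight: "integrable (cspace (torus n :: (int ^ 'd) set)) (mode_weight \<theta> n)"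
proof (rule integrableI_bounded)
  have "(\<integral>\<^sup>+a. ennreal (norm (mode_weight \<theta> n a)) \<partial>cspace (torus n :: (int ^ 'd) set)) \<le>
      (\<integral>\<^sup>+a. ennreal (exp (real (n ^ CARD('d)))) * ennreal (exp (- sqnorm (torus n :: (int ^ 'd) set) (\<lambda>_. 1) a)) \<partial>cspace (torus n :: (int ^ 'd) set))"
  proof (rule nn_integral_mono)
    fix a :: "int ^ 'd \<Rightarrow> complex"
    have "mode_weight \<theta> n a \<le> exp (real (n ^ CARD('d))) * exp (- sqnorm (torus n :: (int ^ 'd) set) (\<lambda>_. 1) a)"
    proof (cases "sqnorm (torus n :: (int ^ 'd) set) (\<lambda>_. 1) a \<le> (real (n ^ CARD('d)))")
      case True
      have "0 \<le> sqnorm (torus n :: (int ^ 'd) set) (\<lambda>k. \<theta> * eigval n k) a"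
        using \<theta> by (intro sqnorm_nonneg mult_nonneg_nonneg eigval_nonneg) auto
      then have "mode_weight \<theta> n a \<le> 1" by (simp add: mode_weight_def indicator_def)
      also have "1 \<le> exp ((real (n ^ CARD('d))) - sqnorm (torus n :: (int ^ 'd) set) (\<lambda>_. 1) a)" using True by simp
      finally show ?thesis by (simp add: exp_add[symmetric])
    qed (simp add: mode_weight_def)
    then show "ennreal (norm (mode_weight \<theta> n a)) \<le> ennreal (exp (real (n ^ CARD('d)))) * ennreal (exp (- sqnorm (torus n :: (int ^ 'd) set) (\<lambda>_. 1) a))"
      using mode_weight_nonneg[of a] by (simp flip: ennreal_mult)
  qed
  also have "\<dots> = ennreal (exp (real (n ^ CARD('d)))) * ennreal (\<Prod>k\<in>(torus n :: (int ^ 'd) set). pi / 1)"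
    by (subst nn_integral_cmult) (simp_all add: nn_integral_gaussian_sqnorm)
  also have "\<dots> < \<infinity>" by (simp add: ennreal_mult_less_top)
  finally show "(\<integral>\<^sup>+a. ennreal (norm (mode_weight \<theta> n a)) \<partial>cspace (torus n :: (int ^ 'd) set)) < \<infinity>" .
qed measurable

lemma nn_integral_mode_weight: "(\<integral>\<^sup>+a. ennreal (mode_weight \<theta> n a) \<partial>cspace (torus n :: (int ^ 'd) set)) = ennreal (mode_partition TYPE('d::finite) \<theta> n)"
  unfolding mode_partition_def
  by (rule nn_integral_eq_integral[OF integrable_mode_weight]) (simp add: mode_weight_nonneg)

text \<open>There are N coordinates, so the polydisc of radius 1 lies in the ball; on it the
  exponential is bounded below.\<close>

lemma mode_partition_pos: "mode_partition TYPE('d::finite) \<theta> n > 0"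
proof -
  let ?B = "PiE (torus n :: (int ^ 'd) set) (\<lambda>_. cball (0::complex) 1)"
  define e where "e = exp (- (\<Sum>k\<in>(torus n :: (int ^ 'd) set). \<theta> * eigval n k))"
  have B [measurable]: "?B \<in> sets (cspace (torus n :: (int ^ 'd) set))" by (intro sets_PiM_I_finite) auto
  have "emeasure (cspace (torus n :: (int ^ 'd) set)) ?B = (\<Prod>k\<in>(torus n :: (int ^ 'd) set). emeasure lborel (cball 0 1 :: complex set))"
    by (rule lborel_complex.emeasure_PiM) auto
  also have "\<dots> > 0" using emeasure_unit_cball_pos by (simp add: zero_less_iff_neq_zero)
  finally have "0 < ennreal e * emeasure (cspace (torus n :: (int ^ 'd) set)) ?B" by (simp add: e_def zero_less_iff_neq_zero)
  also have "\<dots> = (\<integral>\<^sup>+a. ennreal e * indicator ?B a \<partial>cspace (torus n :: (int ^ 'd) set))"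
    by (subst nn_integral_cmult) auto
  also have "\<dots> \<le> (\<integral>\<^sup>+a. ennreal (mode_weight \<theta> n a) \<partial>cspace (torus n :: (int ^ 'd) set))"
  proof (rule nn_integral_mono)
    fix a :: "int ^ 'd \<Rightarrow> complex"
    show "ennreal e * indicator ?B a \<le> ennreal (mode_weight \<theta> n a)"
    proof (cases "a \<in> ?B")
      case True
      then have a: "(cmod (a k))\<^sup>2 \<le> 1" if "k \<in> (torus n :: (int ^ 'd) set)" for k
        using that power_mono[of "cmod (a k)" 1 2] by (auto simp: PiE_iff)
      have "sqnorm (torus n :: (int ^ 'd) set) (\<lambda>_. 1) a \<le> (\<Sum>k\<in>(torus n :: (int ^ 'd) set). 1)" unfolding sqnorm_def using a by (intro sum_mono) auto
      then have 1: "sqnorm (torus n :: (int ^ 'd) set) (\<lambda>_. 1) a \<le> (real (n ^ CARD('d)))" by (simp add: card_torus)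
      have "sqnorm (torus n :: (int ^ 'd) set) (\<lambda>k. \<theta> * eigval n k) a \<le> (\<Sum>k\<in>(torus n :: (int ^ 'd) set). \<theta> * eigval n k * 1)"
        unfolding sqnorm_def using a \<theta> by (intro sum_mono mult_left_mono) (auto simp: eigval_nonneg)
      then have "e \<le> mode_weight \<theta> n a" using 1 by (simp add: mode_weight_def e_def)
      then show ?thesis using True by (simp add: ennreal_leI)
    qed simp
  qed
  finally show ?thesis by (simp add: nn_integral_mode_weight)
qed

lemma nn_integral_mode_law:
  assumes [measurable]: "g \<in> borel_measurable (cspace (torus n :: (int ^ 'd) set))"
  shows "(\<integral>\<^sup>+a. g a \<partial>mode_law \<theta> n) =
    ennreal (1 / mode_partition TYPE('d::finite) \<theta> n) * (\<integral>\<^sup>+a. ennreal (mode_weight \<theta> n a) * g a \<partial>cspace (torus n :: (int ^ 'd) set))"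
proof -
  let ?Z = "mode_partition TYPE('d::finite) \<theta> n"
  have e: "ennreal (mode_weight \<theta> n a / ?Z) = ennreal (1 / ?Z) * ennreal (mode_weight \<theta> n a)" for a :: "int ^ 'd \<Rightarrow> complex"
    using mode_partition_pos[where 'd = 'd] by (subst ennreal_mult[symmetric]) (auto simp: mode_weight_nonneg)
  have "(\<integral>\<^sup>+a. g a \<partial>mode_law \<theta> n) = (\<integral>\<^sup>+a. ennreal (mode_weight \<theta> n a / ?Z) * g a \<partial>cspace (torus n :: (int ^ 'd) set))"
    unfolding mode_law_def by (rule nn_integral_density) measurable
  also have "\<dots> = (\<integral>\<^sup>+a. ennreal (1 / ?Z) * (ennreal (mode_weight \<theta> n a) * g a) \<partial>cspace (torus n :: (int ^ 'd) set))"
    unfolding e by (simp only: mult.assoc)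
  also have "\<dots> = ennreal (1 / ?Z) * (\<integral>\<^sup>+a. ennreal (mode_weight \<theta> n a) * g a \<partial>cspace (torus n :: (int ^ 'd) set))"
    by (rule nn_integral_cmult) measurable
  finally show ?thesis .
qed

lemma prob_space_mode_law: "prob_space (mode_law \<theta> n :: (int ^ 'd \<Rightarrow> complex) measure)"
proof
  have "emeasure (mode_law \<theta> n) (space (mode_law \<theta> n :: (int ^ 'd \<Rightarrow> complex) measure)) = (\<integral>\<^sup>+(a :: int ^ 'd \<Rightarrow> complex). 1 \<partial>mode_law \<theta> n)" by simp
  also have "\<dots> = ennreal (1 / mode_partition TYPE('d::finite) \<theta> n) * ennreal (mode_partition TYPE('d::finite) \<theta> n)"
    by (subst nn_integral_mode_law) (simp_all add: nn_integral_mode_weight)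
  also have "\<dots> = 1" using mode_partition_pos[where 'd = 'd] by (simp flip: ennreal_mult)
  finally show "emeasure (mode_law \<theta> n) (space (mode_law \<theta> n :: (int ^ 'd \<Rightarrow> complex) measure)) = 1" .
qed

lemma mode_law_phase_rotate:
  assumes "\<And>k. k \<in> (torus n :: (int ^ 'd) set) \<Longrightarrow> cmod (\<omega> k) = 1"
  shows "distr (mode_law \<theta> n) (cspace (torus n :: (int ^ 'd) set)) (phase_rotate (torus n :: (int ^ 'd) set) \<omega>) = mode_law \<theta> n"
  unfolding mode_law_def
  by (rule distr_density_phase_rotate) (use assms in \<open>auto simp: mode_weight_phase_rotate\<close>)

lemma mode_law_quarter_turn: "quarter_turn_invariant (mode_law \<theta> n) (torus n :: (int ^ 'd) set) (torus n :: (int ^ 'd) set)"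
  unfolding mode_law_def
  by (rule quarter_turn_invariant_density) (auto simp: mode_weight_phase_rotate)

text \<open>Translation invariance makes the second moment equal at all N sites, and by Parseval and
  the constraint their sum is at most N. This is the source of tightness.\<close>

lemma mode_law_second_moment:
  fixes x :: "int ^ 'd"
  assumes x: "x \<in> (torus n :: (int ^ 'd) set)"
  shows "(\<integral>\<^sup>+a. ennreal ((cmod (fourier n a x))\<^sup>2) \<partial>mode_law \<theta> n) \<le> 1"
proof -
  let ?M = "mode_law \<theta> n :: (int ^ 'd \<Rightarrow> complex) measure"
  let ?f = "\<lambda>x. \<integral>\<^sup>+a. ennreal ((cmod (fourier n a x))\<^sup>2) \<partial>?M"
  have [measurable]: "(\<lambda>a. fourier n a x) \<in> borel_measurable (cspace (torus n :: (int ^ 'd) set))" if "x \<in> (torus n :: (int ^ 'd) set)" for x :: "int ^ 'd"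
    using measurable_compose[OF measurable_fourier measurable_cspace_component[OF that]] .
  have [measurable_cong]: "sets ?M = sets (cspace (torus n :: (int ^ 'd) set))" by simp
  have const: "?f y = ?f 0" if y: "y \<in> (torus n :: (int ^ 'd) set)" for y
  proof -
    define \<omega> where "\<omega> k = cis (2 * pi * real_of_int (zdot k y) / real n)" for k :: "int ^ 'd"
    have 0: "(0 :: int ^ 'd) \<in> (torus n :: (int ^ 'd) set)" using n by (simp add: torus_def)
    have "fourier n (phase_rotate (torus n :: (int ^ 'd) set) \<omega> a) 0 = fourier n a y" for a
    proof -
      have "phase_rotate (torus n :: (int ^ 'd) set) \<omega> a k * fmode n k 0 = a k * fmode n k y" if "k \<in> (torus n :: (int ^ 'd) set)" for k
        using that fmode_add[of n k 0 y] by (simp add: phase_rotate_def \<omega>_def mult_ac)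
      then show ?thesis using 0 y by (simp add: fourier_def)
    qed
    then have "?f y = (\<integral>\<^sup>+a. ennreal ((cmod (fourier n (phase_rotate (torus n :: (int ^ 'd) set) \<omega> a) 0))\<^sup>2) \<partial>?M)" by simp
    also have "\<dots> = (\<integral>\<^sup>+a. ennreal ((cmod (fourier n a 0))\<^sup>2) \<partial>distr ?M (cspace (torus n :: (int ^ 'd) set)) (phase_rotate (torus n :: (int ^ 'd) set) \<omega>))"
      using 0 measurable_phase_rotate[of "torus n" \<omega>] by (subst nn_integral_distr) auto
    also have "\<dots> = ?f 0" by (subst mode_law_phase_rotate) (auto simp: \<omega>_def)
    finally show ?thesis .
  qed
  have "ennreal (real (n ^ CARD('d))) * ?f x = (\<Sum>y\<in>(torus n :: (int ^ 'd) set). ?f y)"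
    using const x by (simp add: card_torus ennreal_of_nat_eq_real_of_nat)
  also have "\<dots> = (\<integral>\<^sup>+a. (\<Sum>y\<in>(torus n :: (int ^ 'd) set). ennreal ((cmod (fourier n a y))\<^sup>2)) \<partial>?M)"
    by (rule nn_integral_sum[symmetric]) measurable
  also have "\<dots> = (\<integral>\<^sup>+a. ennreal (sqnorm (torus n :: (int ^ 'd) set) (\<lambda>_. 1) a) \<partial>?M)"
  proof -
    have "(\<Sum>y\<in>torus n. (cmod (fourier n a y))\<^sup>2) = sqnorm (torus n) (\<lambda>_. 1) a" for a :: "int ^ 'd \<Rightarrow> complex"
      using norm2_sq_fourier[OF n, of a] by (simp add: norm2_sq_def sqnorm_def)
    then show ?thesis by simp
  qed
  also have "\<dots> = ennreal (1 / mode_partition TYPE('d::finite) \<theta> n) *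
      (\<integral>\<^sup>+a. ennreal (mode_weight \<theta> n a) * ennreal (sqnorm (torus n :: (int ^ 'd) set) (\<lambda>_. 1) a) \<partial>cspace (torus n :: (int ^ 'd) set))"
    by (rule nn_integral_mode_law) measurable
  also have "\<dots> \<le> ennreal (1 / mode_partition TYPE('d::finite) \<theta> n) *
      (\<integral>\<^sup>+a. ennreal (mode_weight \<theta> n a) * ennreal (real (n ^ CARD('d))) \<partial>cspace (torus n :: (int ^ 'd) set))"
  proof (rule mult_left_mono, rule nn_integral_mono)
    fix a :: "int ^ 'd \<Rightarrow> complex"
    show "ennreal (mode_weight \<theta> n a) * ennreal (sqnorm (torus n :: (int ^ 'd) set) (\<lambda>_. 1) a) \<le> ennreal (mode_weight \<theta> n a) * ennreal (real (n ^ CARD('d)))"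
      by (cases "sqnorm (torus n :: (int ^ 'd) set) (\<lambda>_. 1) a \<le> (real (n ^ CARD('d)))") (auto simp: mode_weight_def intro!: mult_left_mono ennreal_leI)
  qed simp
  also have "\<dots> = ennreal (1 / mode_partition TYPE('d::finite) \<theta> n) * (ennreal (mode_partition TYPE('d::finite) \<theta> n) * ennreal (real (n ^ CARD('d))))"
    by (simp add: nn_integral_multc nn_integral_mode_weight)
  also have "\<dots> = ennreal (real (n ^ CARD('d))) * 1"
    using mode_partition_pos[where 'd = 'd] by (simp flip: ennreal_mult)
  finally have "ennreal (real (n ^ CARD('d))) * ?f x \<le> ennreal (real (n ^ CARD('d))) * 1" .
  moreover have "(real (n ^ CARD('d))) > 0" using n by simp
  ultimately show ?thesis by (subst (asm) ennreal_mult_le_mult_iff) auto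
qed

context
  fixes m \<delta> :: real
  assumes m: "m > 0" and \<delta>: "0 < \<delta>" "\<delta> \<le> 1"
begin

lemma cc_ge: "\<theta> * m \<le> mode_rate \<theta> m n k"
  unfolding mode_rate_def using \<theta> by (intro mult_left_mono) (auto simp: eigval_nonneg)

lemma cc_pos: "mode_rate \<theta> m n k > 0"
  using cc_ge[of k] \<theta> m by (meson less_le_trans mult_pos_pos)

lemma sqnorm_cc: "sqnorm (torus n :: (int ^ 'd) set) (mode_rate \<theta> m n) a = sqnorm (torus n :: (int ^ 'd) set) (\<lambda>k. \<theta> * eigval n k) a + \<theta> * m * sqnorm (torus n :: (int ^ 'd) set) (\<lambda>_. 1) a"
  by (simp add: sqnorm_def mode_rate_def sum_distrib_left algebra_simps sum.distrib)

text \<open>From above, the weight is at most exp (\<theta> m N) times the Gaussian density. For the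
  partition function from below, the Gaussian law puts at least half of its mass where the squared
  norm lies between (1 - 3 \<delta>) N and N, and there the weight is at least exp (\<theta> m (1 -
  3 \<delta>) N) times that density. The quotient of the two is the constant.\<close>

lemma exp_moment_bound_mode_law:
  assumes v: "1 - 2 * \<delta> \<le> (\<Sum>k\<in>(torus n :: (int ^ 'd) set). 1 / mode_rate \<theta> m n k) / (real (n ^ CARD('d)))" "(\<Sum>k\<in>(torus n :: (int ^ 'd) set). 1 / mode_rate \<theta> m n k) / (real (n ^ CARD('d))) \<le> 1 - \<delta>"
    and large: "2 * exp (- (\<theta> * m) * (real (n ^ CARD('d))) * \<delta>\<^sup>2 / 8) \<le> 1 / 2"
  shows "exp_moment_bound (mode_law \<theta> n) (torus n :: (int ^ 'd) set) (mode_rate \<theta> m n) (2 * exp (3 * \<theta> * m * \<delta> * (real (n ^ CARD('d)))))"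
proof -
  have N: "(real (n ^ CARD('d))) > 0" using n by simp
  let ?G = "gauss_law (torus n :: (int ^ 'd) set) (mode_rate \<theta> m n)" and ?S = "sqnorm (torus n :: (int ^ 'd) set) (\<lambda>_. 1)"
  let ?Z = "mode_partition TYPE('d::finite) \<theta> n"
  define v where "v = (\<Sum>k\<in>(torus n :: (int ^ 'd) set). 1 / mode_rate \<theta> m n k) / (real (n ^ CARD('d)))"
  define P where "P = (\<Prod>k\<in>(torus n :: (int ^ 'd) set). pi / mode_rate \<theta> m n k)"
  have P: "P > 0" unfolding P_def by (intro prod_pos) (simp add: cc_pos)
  interpret G: prob_space ?G by (rule prob_space_gauss_law) (auto simp: cc_pos)
  have [measurable_cong]: "sets ?G = sets (cspace (torus n :: (int ^ 'd) set))" by simp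
  \<comment> \<open>The mean lies between 1 - 2 \<delta> and 1 - \<delta>; a fluctuation below
    \<delta> keeps the normalised mass inside this window and, crucially, inside the ball.\<close>
  define E where "E = {a\<in>space (cspace (torus n :: (int ^ 'd) set)). (1 - 3 * \<delta>) * (real (n ^ CARD('d))) \<le> ?S a \<and> ?S a \<le> (real (n ^ CARD('d)))}"
  define Q where "Q a = (\<Sum>k\<in>(torus n :: (int ^ 'd) set). 1 / (real (n ^ CARD('d))) * (cmod (a k))\<^sup>2)" for a :: "int ^ 'd \<Rightarrow> complex"
  have QS: "Q a = ?S a / (real (n ^ CARD('d)))" for a by (simp add: Q_def sqnorm_def sum_divide_distrib)
  have vs: "(\<Sum>k\<in>(torus n :: (int ^ 'd) set). 1 / (real (n ^ CARD('d))) / mode_rate \<theta> m n k) = v" by (simp add: v_def sum_divide_distrib mult.commute)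
  have Em [measurable]: "E \<in> sets (cspace (torus n :: (int ^ 'd) set))" unfolding E_def by measurable
  have "emeasure ?G {a\<in>space ?G. \<bar>Q a - v\<bar> \<ge> \<delta>} \<le> ennreal (2 * 1 * exp (- (\<theta> * m) * (real (n ^ CARD('d))) * \<delta>\<^sup>2 / (8 * 1\<^sup>2)))"
    unfolding Q_def vs[symmetric]
  proof (rule quadratic_concentration)
    show "exp_moment_bound ?G (torus n :: (int ^ 'd) set) (mode_rate \<theta> m n) 1" by (rule exp_moment_bound_gauss_law) (auto simp: cc_pos)
    have "v \<le> 1" using assms(2) \<delta> by (simp add: v_def)
    then show "(\<Sum>k\<in>(torus n :: (int ^ 'd) set). 1 / mode_rate \<theta> m n k) \<le> (real (n ^ CARD('d)))" using N by (simp add: v_def)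
  qed (use \<theta> m \<delta> N cc_ge in auto)
  also have "\<dots> \<le> ennreal (1 / 2)" using large by (intro ennreal_leI) simp
  finally have "G.prob {a\<in>space ?G. \<bar>Q a - v\<bar> \<ge> \<delta>} \<le> 1 / 2"
    unfolding G.emeasure_eq_measure by (subst (asm) ennreal_le_iff) auto
  moreover have "space ?G - {a\<in>space ?G. \<bar>Q a - v\<bar> \<ge> \<delta>} \<subseteq> E"
  proof
    fix a assume "a \<in> space ?G - {a\<in>space ?G. \<bar>Q a - v\<bar> \<ge> \<delta>}"
    then have a: "a \<in> space (cspace (torus n :: (int ^ 'd) set))" "\<bar>Q a - v\<bar> < \<delta>" by (auto simp: gauss_law_def)
    then have "1 - 3 * \<delta> \<le> Q a" "Q a \<le> 1" using v unfolding v_def[symmetric] by linarith+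
    then show "a \<in> E" using a N by (simp add: E_def QS field_simps)
  qed
  then have "G.prob (space ?G - {a\<in>space ?G. \<bar>Q a - v\<bar> \<ge> \<delta>}) \<le> G.prob E"
    by (rule G.finite_measure_mono) simp
  moreover have "G.prob (space ?G - {a\<in>space ?G. \<bar>Q a - v\<bar> \<ge> \<delta>}) = 1 - G.prob {a\<in>space ?G. \<bar>Q a - v\<bar> \<ge> \<delta>}"
    by (rule G.prob_compl) (unfold QS, measurable)
  ultimately have PE: "1 / 2 \<le> G.prob E" by linarith
  define L where "L = exp (\<theta> * m * ((1 - 3 * \<delta>) * (real (n ^ CARD('d)))))"
  have ind: "(\<integral>\<^sup>+a. ennreal (exp (- sqnorm (torus n :: (int ^ 'd) set) (mode_rate \<theta> m n) a) / P) * g a \<partial>cspace (torus n :: (int ^ 'd) set)) = (\<integral>\<^sup>+a. g a \<partial>?G)"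
    if [measurable]: "g \<in> borel_measurable (cspace (torus n :: (int ^ 'd) set))" for g
    unfolding gauss_law_def P_def by (rule nn_integral_density[symmetric]) measurable
  have "ennreal (L * P * (1 / 2)) \<le> ennreal (L * P * G.prob E)"
    using PE P by (intro ennreal_leI mult_left_mono) (auto simp: L_def)
  also have "\<dots> = ennreal (L * P) * (\<integral>\<^sup>+a. indicator E a \<partial>?G)"
    using P by (subst ennreal_mult) (auto simp: L_def G.emeasure_eq_measure)
  also have "\<dots> = (\<integral>\<^sup>+a. ennreal (L * P) * (ennreal (exp (- sqnorm (torus n :: (int ^ 'd) set) (mode_rate \<theta> m n) a) / P) * indicator E a) \<partial>cspace (torus n :: (int ^ 'd) set))"
    by (subst nn_integral_cmult) (auto simp: ind)
  also have "\<dots> \<le> (\<integral>\<^sup>+a. ennreal (mode_weight \<theta> n a) \<partial>cspace (torus n :: (int ^ 'd) set))"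
  proof (rule nn_integral_mono)
    fix a :: "int ^ 'd \<Rightarrow> complex"
    show "ennreal (L * P) * (ennreal (exp (- sqnorm (torus n :: (int ^ 'd) set) (mode_rate \<theta> m n) a) / P) * indicator E a) \<le> ennreal (mode_weight \<theta> n a)"
    proof (cases "a \<in> E")
      case True
      then have S: "(1 - 3 * \<delta>) * (real (n ^ CARD('d))) \<le> ?S a" "?S a \<le> (real (n ^ CARD('d)))" by (auto simp: E_def)
      have "L * P * (exp (- sqnorm (torus n :: (int ^ 'd) set) (mode_rate \<theta> m n) a) / P) = L * exp (- sqnorm (torus n :: (int ^ 'd) set) (mode_rate \<theta> m n) a)" using P by simp
      also have "\<dots> \<le> exp (\<theta> * m * ?S a) * exp (- sqnorm (torus n :: (int ^ 'd) set) (mode_rate \<theta> m n) a)"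
        unfolding L_def using S \<theta> m by (intro mult_right_mono) auto
      also have "\<dots> = mode_weight \<theta> n a" using S by (simp add: mode_weight_def sqnorm_cc flip: exp_add)
      finally show ?thesis using True P by (simp add: L_def ennreal_leI flip: ennreal_mult)
    qed simp
  qed
  finally have Zlow: "L * P * (1 / 2) \<le> ?Z"
    using mode_partition_pos[where 'd = 'd] by (simp add: nn_integral_mode_weight ennreal_le_iff)
  show ?thesis
    unfolding exp_moment_bound_def
  proof (intro allI impI)
    fix t :: "int ^ 'd \<Rightarrow> real" assume "\<forall>k\<in>(torus n :: (int ^ 'd) set). t k < mode_rate \<theta> m n k"
    then have t: "\<And>k. k \<in> (torus n :: (int ^ 'd) set) \<Longrightarrow> t k < mode_rate \<theta> m n k" by blast
    let ?R = "\<Prod>k\<in>(torus n :: (int ^ 'd) set). 1 / (1 - t k / mode_rate \<theta> m n k)"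
    have R: "?R \<ge> 0" by (intro prod_nonneg) (simp add: divide_le_eq_1_pos cc_pos less_imp_le t)
    have "(\<integral>\<^sup>+a. ennreal (mode_weight \<theta> n a) * ennreal (exp (sqnorm (torus n :: (int ^ 'd) set) t a)) \<partial>cspace (torus n :: (int ^ 'd) set)) \<le>
      (\<integral>\<^sup>+a. ennreal (exp (\<theta> * m * (real (n ^ CARD('d)))) * P) * (ennreal (exp (- sqnorm (torus n :: (int ^ 'd) set) (mode_rate \<theta> m n) a) / P) * ennreal (exp (sqnorm (torus n :: (int ^ 'd) set) t a))) \<partial>cspace (torus n :: (int ^ 'd) set))"
    proof (rule nn_integral_mono)
      fix a :: "int ^ 'd \<Rightarrow> complex"
      have "mode_weight \<theta> n a \<le> exp (\<theta> * m * (real (n ^ CARD('d)))) * exp (- sqnorm (torus n :: (int ^ 'd) set) (mode_rate \<theta> m n) a)"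
      proof (cases "?S a \<le> (real (n ^ CARD('d)))")
        case True
        then have "mode_weight \<theta> n a = exp (\<theta> * m * ?S a) * exp (- sqnorm (torus n :: (int ^ 'd) set) (mode_rate \<theta> m n) a)"
          by (simp add: mode_weight_def sqnorm_cc flip: exp_add)
        also have "\<dots> \<le> exp (\<theta> * m * (real (n ^ CARD('d)))) * exp (- sqnorm (torus n :: (int ^ 'd) set) (mode_rate \<theta> m n) a)"
          using True \<theta> m by (intro mult_right_mono) auto
        finally show ?thesis .
      qed (simp add: mode_weight_def)
      also have "\<dots> = (exp (\<theta> * m * (real (n ^ CARD('d)))) * P) * (exp (- sqnorm (torus n :: (int ^ 'd) set) (mode_rate \<theta> m n) a) / P)" using P by simp
      finally have "ennreal (mode_weight \<theta> n a) \<le> ennreal (exp (\<theta> * m * (real (n ^ CARD('d)))) * P) * ennreal (exp (- sqnorm (torus n :: (int ^ 'd) set) (mode_rate \<theta> m n) a) / P)"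
        using P by (simp add: ennreal_leI flip: ennreal_mult)
      then show "ennreal (mode_weight \<theta> n a) * ennreal (exp (sqnorm (torus n :: (int ^ 'd) set) t a)) \<le>
        ennreal (exp (\<theta> * m * (real (n ^ CARD('d)))) * P) * (ennreal (exp (- sqnorm (torus n :: (int ^ 'd) set) (mode_rate \<theta> m n) a) / P) * ennreal (exp (sqnorm (torus n :: (int ^ 'd) set) t a)))"
        unfolding mult.assoc[symmetric] by (intro mult_right_mono) auto
    qed
    also have "\<dots> = ennreal (exp (\<theta> * m * (real (n ^ CARD('d)))) * P) * ennreal ?R"
    proof -
      have "(\<integral>\<^sup>+a. ennreal (exp (sqnorm (torus n) t a)) \<partial>?G) = ennreal ?R"
        by (rule gauss_law_moment) (simp_all add: cc_pos t)
      moreover have "(\<integral>\<^sup>+a. ennreal (exp (- sqnorm (torus n) (mode_rate \<theta> m n) a) / P) * ennreal (exp (sqnorm (torus n) t a)) \<partial>cspace (torus n)) =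
          (\<integral>\<^sup>+a. ennreal (exp (sqnorm (torus n) t a)) \<partial>?G)"
        by (rule ind) measurable
      moreover have "(\<integral>\<^sup>+a. ennreal (exp (\<theta> * m * (real (n ^ CARD('d)))) * P) * (ennreal (exp (- sqnorm (torus n) (mode_rate \<theta> m n) a) / P) * ennreal (exp (sqnorm (torus n) t a))) \<partial>cspace (torus n)) =
          ennreal (exp (\<theta> * m * (real (n ^ CARD('d)))) * P) *
          (\<integral>\<^sup>+a. ennreal (exp (- sqnorm (torus n) (mode_rate \<theta> m n) a) / P) * ennreal (exp (sqnorm (torus n) t a)) \<partial>cspace (torus n))"
        by (rule nn_integral_cmult) measurable
      ultimately show ?thesis by (simp only:)
    qed
    also have "\<dots> = ennreal (exp (\<theta> * m * (real (n ^ CARD('d)))) * P * ?R)" using P R by (intro ennreal_mult[symmetric]) auto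
    finally have up: "(\<integral>\<^sup>+a. ennreal (mode_weight \<theta> n a) * ennreal (exp (sqnorm (torus n :: (int ^ 'd) set) t a)) \<partial>cspace (torus n :: (int ^ 'd) set)) \<le>
      ennreal (exp (\<theta> * m * (real (n ^ CARD('d)))) * P * ?R)" .
    have "(\<integral>\<^sup>+a. ennreal (exp (\<Sum>k\<in>(torus n :: (int ^ 'd) set). t k * (cmod (a k))\<^sup>2)) \<partial>mode_law \<theta> n) =
        ennreal (1 / ?Z) * (\<integral>\<^sup>+a. ennreal (mode_weight \<theta> n a) * ennreal (exp (sqnorm (torus n :: (int ^ 'd) set) t a)) \<partial>cspace (torus n :: (int ^ 'd) set))"
      unfolding sqnorm_def[symmetric] by (rule nn_integral_mode_law) measurable
    also have "\<dots> \<le> ennreal (1 / ?Z) * ennreal (exp (\<theta> * m * (real (n ^ CARD('d)))) * P * ?R)"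
      by (intro mult_left_mono up) simp
    also have "\<dots> = ennreal (1 / ?Z * (exp (\<theta> * m * (real (n ^ CARD('d)))) * P * ?R))"
      using mode_partition_pos[where 'd = 'd] P R by (intro ennreal_mult[symmetric]) auto
    also have "\<dots> \<le> ennreal (2 * exp (3 * \<theta> * m * \<delta> * (real (n ^ CARD('d)))) * ?R)"
    proof (rule ennreal_leI)
      have L: "L > 0" by (simp add: L_def)
      have "1 / ?Z \<le> 1 / (L * P * (1 / 2))"
        using Zlow mode_partition_pos[where 'd = 'd] P L by (intro divide_left_mono mult_pos_pos) auto
      then have "1 / ?Z * (exp (\<theta> * m * (real (n ^ CARD('d)))) * P * ?R) \<le> 1 / (L * P * (1 / 2)) * (exp (\<theta> * m * (real (n ^ CARD('d)))) * P * ?R)"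
        using P R by (intro mult_right_mono) auto
      also have "\<dots> = 2 * (exp (\<theta> * m * (real (n ^ CARD('d)))) / L) * ?R" using P L by simp
      also have "exp (\<theta> * m * (real (n ^ CARD('d)))) / L = exp (3 * \<theta> * m * \<delta> * (real (n ^ CARD('d))))"
        unfolding L_def by (simp add: algebra_simps flip: exp_diff)
      finally show "1 / ?Z * (exp (\<theta> * m * (real (n ^ CARD('d)))) * P * ?R) \<le> 2 * exp (3 * \<theta> * m * \<delta> * (real (n ^ CARD('d)))) * ?R" .
    qed
    finally show "(\<integral>\<^sup>+a. ennreal (exp (\<Sum>k\<in>(torus n :: (int ^ 'd) set). t k * (cmod (a k))\<^sup>2)) \<partial>mode_law \<theta> n) \<le>
        ennreal (2 * exp (3 * \<theta> * m * \<delta> * (real (n ^ CARD('d)))) * ?R)" .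
  qed
qed

end

end

section \<open>The covariance as a Green integral\<close>

lemma distr_lborel_reflect: "distr lborel borel (\<lambda>x :: 'a::euclidean_space. t - x) = lborel"
  using lborel_affine[of "-1" t] by (simp add: density_1)

text \<open>Reflection of the cube at its centre preserves the symbol and changes the sign of the
  sine, because the phase of the vector 1 is a multiple of 2 pi.\<close>

lemma green_integral_sin: "green_integral m (\<lambda>\<kappa>. sin (zphase z \<kappa>)) = 0"
proof -
  let ?f = "\<lambda>\<kappa>. indicator (cbox 0 1) \<kappa> *\<^sub>R (sin (zphase z \<kappa>) / (lattice_symbol \<kappa> + m))"
  have [measurable]: "zphase z \<in> borel_measurable borel"
    by (intro borel_measurable_continuous_onI continuous_intros)
  have f: "?f (1 - \<kappa>) = - ?f \<kappa>" for \<kappa>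
  proof -
    define M where "M = (\<Sum>i\<in>UNIV. z $ i)"
    have "zphase z (1 - \<kappa>) = 2 * pi * real_of_int M - zphase z \<kappa>"
      by (simp add: M_def zphase_def left_diff_distrib sum_subtractf right_diff_distrib)
    then have "sin (zphase z (1 - \<kappa>)) = - sin (zphase z \<kappa>)"
      by (simp add: sin_diff)
    moreover have "lattice_symbol (1 - \<kappa>) = lattice_symbol \<kappa>"
      by (simp add: lattice_symbol_def right_diff_distrib)
    moreover have "1 - \<kappa> \<in> cbox 0 1 \<longleftrightarrow> \<kappa> \<in> cbox 0 1" by (auto simp: mem_box_cart)
    ultimately show ?thesis by (simp add: indicator_def)
  qed
  have "(\<integral>\<kappa>. ?f \<kappa> \<partial>lborel) = (\<integral>\<kappa>. ?f \<kappa> \<partial>distr lborel borel (\<lambda>\<kappa>. 1 - \<kappa>))"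
    by (simp only: distr_lborel_reflect)
  also have "\<dots> = (\<integral>\<kappa>. ?f (1 - \<kappa>) \<partial>lborel)"
    by (rule integral_distr) measurable
  also have "\<dots> = - (\<integral>\<kappa>. ?f \<kappa> \<partial>lborel)" unfolding f by simp
  finally show ?thesis by (simp add: green_integral_def set_lebesgue_integral_def)
qed

text \<open>The coefficient of the mode a_k in the linear functional of the field with test function
  c.\<close>

definition amplitude :: "(int ^ 'd) set \<Rightarrow> (int ^ 'd \<Rightarrow> complex) \<Rightarrow> nat \<Rightarrow> int ^ 'd \<Rightarrow> complex" where
  "amplitude A c n k = (\<Sum>x\<in>A. c x * fmode n k x)"

text \<open>The continuum counterpart of N |amplitude|^2; it turns the sums of squared amplitudes
  into Riemann sums.\<close>

definition power_symbol :: "(int ^ 'd) set \<Rightarrow> (int ^ 'd \<Rightarrow> complex) \<Rightarrow> real ^ 'd \<Rightarrow> real" where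
  "power_symbol A c \<kappa> = (cmod (\<Sum>x\<in>A. c x * cis (zphase x \<kappa>)))\<^sup>2"

lemma amplitude_power_symbol:
  assumes "n > 0"
  shows "(cmod (amplitude A c n (k :: int ^ 'd)))\<^sup>2 = power_symbol A c (scaled n k) / real (n ^ CARD('d))"
proof -
  have "amplitude A c n k = (\<Sum>x\<in>A. c x * cis (zphase x (scaled n k))) / complex_of_real (sqrt (real (n ^ CARD('d))))"
    by (simp add: amplitude_def fmode_def zphase_scaled zdot_commute sum_divide_distrib)
  then show ?thesis using assms by (simp add: power_symbol_def norm_divide power_divide)
qed

lemma power_symbol_nonneg: "power_symbol A c \<kappa> \<ge> 0"
  by (simp add: power_symbol_def)

lemma power_symbol_le: "power_symbol A c \<kappa> \<le> (\<Sum>x\<in>A. cmod (c x))\<^sup>2"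
proof -
  have "cmod (\<Sum>x\<in>A. c x * cis (zphase x \<kappa>)) \<le> (\<Sum>x\<in>A. cmod (c x * cis (zphase x \<kappa>)))" by (rule norm_sum)
  then show ?thesis unfolding power_symbol_def by (intro power_mono) (auto simp: norm_mult)
qed

lemma continuous_power_symbol: "continuous_on S (power_symbol A c)"
  unfolding power_symbol_def by (intro continuous_intros)

definition covariance_form :: "real \<Rightarrow> (int ^ 'd) set \<Rightarrow> (int ^ 'd \<Rightarrow> complex) \<Rightarrow> real" where
  "covariance_form m A c = (\<Sum>x\<in>A. \<Sum>y\<in>A. Re (c x * cnj (c y)) * green m x y)"

text \<open>Expanding the square gives cosines and sines of differences of sites. The cosines
  integrate to values of the Green function, the sines to 0.\<close>

lemma green_integral_power_symbol:
  fixes A :: "(int ^ 'd) set"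
  assumes d: "CARD('d) \<ge> 3" and m: "m \<ge> 0"
  shows "green_integral m (power_symbol A c) = covariance_form m A c"
proof -
  let ?w = "\<lambda>x y. c x * cnj (c y)"
  have e: "power_symbol A c \<kappa> = (\<Sum>x\<in>A. \<Sum>y\<in>A. Re (?w x y) * cos (zphase (y - x) \<kappa>) + Im (?w x y) * sin (zphase (y - x) \<kappa>))" for \<kappa>
  proof -
    have "complex_of_real (power_symbol A c \<kappa>) = (\<Sum>x\<in>A. c x * cis (zphase x \<kappa>)) * cnj (\<Sum>y\<in>A. c y * cis (zphase y \<kappa>))"
      unfolding power_symbol_def by (rule complex_norm_square)
    also have "\<dots> = (\<Sum>x\<in>A. \<Sum>y\<in>A. ?w x y * cis (- zphase (y - x) \<kappa>))"
      unfolding cnj_sum sum_product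
    proof (intro sum.cong refl)
      fix x y
      have "cis (zphase x \<kappa>) * cis (- zphase y \<kappa>) = cis (- zphase (y - x) \<kappa>)"
        by (simp add: cis_mult zphase_diff)
      then show "c x * cis (zphase x \<kappa>) * cnj (c y * cis (zphase y \<kappa>)) = ?w x y * cis (- zphase (y - x) \<kappa>)"
        by (simp only: complex_cnj_mult cis_cnj mult_ac)
    qed
    finally have "power_symbol A c \<kappa> = Re (\<Sum>x\<in>A. \<Sum>y\<in>A. ?w x y * cis (- zphase (y - x) \<kappa>))"
      by (metis Re_complex_of_real)
    then show ?thesis by simp
  qed
  have i: "set_integrable lborel unit_box (\<lambda>\<kappa>. f (zphase z \<kappa>) / (lattice_symbol \<kappa> + m))"
    if "f = sin \<or> f = cos" for f :: "real \<Rightarrow> real" and z :: "int ^ 'd"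
    by (rule set_integrable_green[OF d _ _ m, where C = 1]) (use that in \<open>auto intro!: continuous_intros\<close>)
  have g: "green_integral m (\<lambda>\<kappa>. f (zphase z \<kappa>)) = (LINT \<kappa>:unit_box|lborel. f (zphase z \<kappa>) / (lattice_symbol \<kappa> + m))"
    if "f = sin \<or> f = cos" for f :: "real \<Rightarrow> real" and z :: "int ^ 'd"
    by (rule green_integral_box[OF d, where C = 1]) (use that in \<open>auto intro!: continuous_intros\<close>)
  define T where "T x y \<kappa> = Re (?w x y) * (cos (zphase (y - x) \<kappa>) / (lattice_symbol \<kappa> + m)) +
      Im (?w x y) * (sin (zphase (y - x) \<kappa>) / (lattice_symbol \<kappa> + m))" for x y \<kappa>
  have iT: "set_integrable lborel unit_box (T x y)" for x y
    unfolding T_def by (intro set_integral_add(1) set_integrable_mult_right i) auto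
  have "green_integral m (power_symbol A c) = (LINT \<kappa>:unit_box|lborel. power_symbol A c \<kappa> / (lattice_symbol \<kappa> + m))"
    by (rule green_integral_box[OF d continuous_power_symbol, where C = "(\<Sum>x\<in>A. cmod (c x))\<^sup>2"])
      (use power_symbol_le[of A c] power_symbol_nonneg[of A c] in auto)
  also have "\<dots> = (LINT \<kappa>:unit_box|lborel. \<Sum>x\<in>A. \<Sum>y\<in>A. T x y \<kappa>)"
    unfolding e T_def by (simp only: sum_divide_distrib add_divide_distrib times_divide_eq_right)
  also have "\<dots> = (\<Sum>x\<in>A. LINT \<kappa>:unit_box|lborel. \<Sum>y\<in>A. T x y \<kappa>)"
    by (rule set_integral_sum) (use iT in \<open>auto simp: set_integrable_def sum_distrib_left\<close>)
  also have "\<dots> = (\<Sum>x\<in>A. \<Sum>y\<in>A. LINT \<kappa>:unit_box|lborel. T x y \<kappa>)"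
    by (intro sum.cong refl set_integral_sum iT)
  also have "\<dots> = (\<Sum>x\<in>A. \<Sum>y\<in>A. Re (?w x y) * green_integral m (\<lambda>\<kappa>. cos (zphase (y - x) \<kappa>)) +
      Im (?w x y) * green_integral m (\<lambda>\<kappa>. sin (zphase (y - x) \<kappa>)))"
    unfolding T_def g[OF disjI1[OF refl]] g[OF disjI2[OF refl]] set_integral_mult_right[symmetric]
    by (intro sum.cong refl set_integral_add(2) set_integrable_mult_right i) auto
  also have "\<dots> = covariance_form m A c"
    unfolding covariance_form_def green_eq_integral[OF d m] green_integral_sin by simp
  finally show ?thesis .
qed

lemma tendsto_times_exp_neg:
  assumes "a > 0" and x: "filterlim x at_top F"
  shows "((\<lambda>n. x n * exp (- a * x n)) \<longlongrightarrow> (0 :: real)) F"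
proof -
  have "filterlim (\<lambda>n. a * x n) at_top F"
    using assms by (intro filterlim_tendsto_pos_mult_at_top[OF tendsto_const]) auto
  then have "((\<lambda>n. (a * x n) ^ 1 / exp (a * x n)) \<longlongrightarrow> 0) F"
    by (rule filterlim_compose[OF tendsto_power_div_exp_0])
  then have "((\<lambda>n. 1 / a * ((a * x n) ^ 1 / exp (a * x n))) \<longlongrightarrow> 1 / a * 0) F"
    by (intro tendsto_mult tendsto_const)
  then show ?thesis using assms(1) by (simp add: exp_minus field_simps)
qed

lemma filterlim_volume: "filterlim (\<lambda>n. real (n ^ CARD('d::finite))) at_top sequentially"
proof (rule filterlim_at_top_mono[OF filterlim_real_sequentially])
  show "\<forall>\<^sub>F n in sequentially. real n \<le> real (n ^ CARD('d))"
    using eventually_ge_at_top[of 1]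
  proof eventually_elim
    case (elim n)
    have "n ^ 1 \<le> n ^ CARD('d)" using elim by (intro power_increasing) auto
    then show ?case by (simp only: of_nat_le_iff power_one_right)
  qed
qed

text \<open>Stated for m0 \<ge> 0 so that it includes the critical case. The mass m used in the
  proof lies strictly above m0, is fixed while n tends to infinity, and is close enough to m0 that
  the variances differ little.\<close>

lemma subcritical_char_limit:
  fixes A :: "(int ^ 'd) set"
  assumes d: "CARD('d) \<ge> 3" and \<theta>: "\<theta> > 0" and m0: "m0 \<ge> 0"
    and crit: "green_integral m0 (\<lambda>_ :: real ^ 'd. 1) = \<theta>"
  shows "(\<lambda>n. \<integral>a. (\<Prod>k\<in>torus n. cis (Re (amplitude A c n k * a k))) \<partial>mode_law \<theta> n)
    \<longlonglongrightarrow> complex_of_real (exp (- (covariance_form m0 A c / \<theta>) / 4))"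
proof (rule LIMSEQ_I)
  fix e :: real assume e: "e > 0"
  let ?F = "power_symbol A c"
  define B where "B = max 1 ((\<Sum>x\<in>A. cmod (c x))\<^sup>2)"
  have B: "B \<ge> 1" "?F \<kappa> \<le> B" for \<kappa> using power_symbol_le[of A c \<kappa>] by (auto simp: B_def)
  have FB: "\<bar>?F \<kappa>\<bar> \<le> B" for \<kappa> using B(2)[of \<kappa>] power_symbol_nonneg[of A c \<kappa>] by simp
  \<comment> \<open>Makes the error 3 B^2 \<delta> of the Gaussian approximation at most e /
    4.\<close>
  define \<delta> where "\<delta> = min 1 (e / (12 * B\<^sup>2))"
  have B0: "0 < B" using B(1) by linarith
  have B2: "B\<^sup>2 > 0" using B by (intro zero_less_power) auto
  have \<delta>: "0 < \<delta>" "\<delta> \<le> 1" using e B2 by (auto simp: \<delta>_def)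
  have "\<delta> \<le> e / (12 * B\<^sup>2)" by (simp add: \<delta>_def)
  then have \<delta>e: "3 * B\<^sup>2 * \<delta> \<le> e / 4" using B2 by (simp add: field_simps)
  let ?V = "\<lambda>m. green_integral m ?F / \<theta>"
  let ?G = "\<lambda>m. green_integral m (\<lambda>_ :: real ^ 'd. 1)"
  define mj where "mj j = m0 + 1 / real (Suc j)" for j
  have mj: "mj \<longlonglongrightarrow> m0" "\<And>j. mj j > m0" "\<And>j. mj j \<ge> 0"
    using tendsto_add[OF tendsto_const[of m0] LIMSEQ_Suc[OF lim_1_over_n[where 'a = real]]] m0
    by (auto simp: mj_def[abs_def] add_nonneg_pos less_imp_le)
  have "(\<lambda>j. ?G (mj j)) \<longlonglongrightarrow> ?G m0"
    by (rule green_integral_tendsto[where C = 1]) (use d m0 mj in auto)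
  then have l1: "(\<lambda>j. 2 / 3 * (1 - ?G (mj j) / \<theta>)) \<longlonglongrightarrow> 2 / 3 * (1 - ?G m0 / \<theta>)"
    using \<theta> by (intro tendsto_intros) auto
  have l1: "\<forall>\<^sub>F j in sequentially. 2 / 3 * (1 - ?G (mj j) / \<theta>) < \<delta>\<^sup>2 / (48 * B\<^sup>2)"
    using \<delta> B2 \<theta> by (intro order_tendstoD(2)[OF l1]) (simp add: crit)
  have "(\<lambda>j. green_integral (mj j) ?F) \<longlonglongrightarrow> green_integral m0 ?F"
    by (rule green_integral_tendsto[OF d continuous_power_symbol FB m0 mj(3) mj(1)])
  then have "(\<lambda>j. ?V (mj j)) \<longlonglongrightarrow> ?V m0"
    using \<theta> by (intro tendsto_divide tendsto_const) auto
  from tendsto_exp[OF tendsto_divide[OF tendsto_minus[OF this] tendsto_const[of 4]]]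
  have "(\<lambda>j. exp (- ?V (mj j) / 4)) \<longlonglongrightarrow> exp (- ?V m0 / 4)" by simp
  then have l2: "\<forall>\<^sub>F j in sequentially. dist (exp (- ?V (mj j) / 4)) (exp (- ?V m0 / 4)) < e / 4"
    using e by (intro tendstoD) auto
  obtain j where j: "2 / 3 * (1 - ?G (mj j) / \<theta>) < \<delta>\<^sup>2 / (48 * B\<^sup>2)"
      "dist (exp (- ?V (mj j) / 4)) (exp (- ?V m0 / 4)) < e / 4"
    using eventually_happens'[OF _ eventually_conj[OF l1 l2]] by auto
  define m where "m = mj j"
  have m: "m > 0" "m0 < m" using mj(2)[of j] m0 by (auto simp: m_def)
  \<comment> \<open>Chosen so that the limit of the normalised Gaussian mass is 1 - 3 \<delta>0 / 2,
    the midpoint of the window from 1 - 2 \<delta>0 to 1 - \<delta>0; the sums for large n then lie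
    inside it.\<close>
  define \<delta>0 where "\<delta>0 = 2 / 3 * (1 - ?G m / \<theta>)"
  have "?G m < ?G m0" by (rule green_integral_strict_antimono[OF d m0 m(2)])
  then have "?G m / \<theta> < 1" using \<theta> by (simp add: crit)
  then have \<delta>0_pos: "\<delta>0 > 0" by (simp add: \<delta>0_def)
  have \<delta>0_small: "\<delta>0 < \<delta>\<^sup>2 / (48 * B\<^sup>2)" using j by (simp add: \<delta>0_def m_def)
  have "\<delta>\<^sup>2 / (48 * B\<^sup>2) \<le> 1 / 1"
    using \<delta> B by (intro frac_le) (auto simp: power_le_one one_le_power intro: order_trans[of _ "48 * 1"])
  then have \<delta>01: "\<delta>0 \<le> 1" using \<delta>0_small by simp
  have GV: "?G m / \<theta> = 1 - 3 / 2 * \<delta>0"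
  proof -
    have "3 / 2 * \<delta>0 = 1 - ?G m / \<theta>" unfolding \<delta>0_def mult.assoc[symmetric] by simp
    then show ?thesis by linarith
  qed
  let ?N = "\<lambda>n. real (n ^ CARD('d))"
  let ?v = "\<lambda>n. (\<Sum>k\<in>torus n. 1 / mode_rate \<theta> m n (k :: int ^ 'd)) / ?N n"
  have "(\<lambda>n. (\<Sum>k\<in>torus n. 1 / (eigval n (k :: int ^ 'd) + m)) / ?N n / \<theta>) \<longlonglongrightarrow> ?G m / \<theta>"
    unfolding green_integral_def using \<theta> m
    by (intro tendsto_divide tendsto_const green_riemann_limit[OF d, where F = "\<lambda>_. 1" and C = 1]) auto
  also have "(\<lambda>n. (\<Sum>k\<in>torus n. 1 / (eigval n (k :: int ^ 'd) + m)) / ?N n / \<theta>) = ?v"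
    by (simp add: mode_rate_def sum_divide_distrib mult_ac)
  finally have "?v \<longlonglongrightarrow> 1 - 3 / 2 * \<delta>0" unfolding GV .
  then have v1: "\<forall>\<^sub>F n in sequentially. 1 - 2 * \<delta>0 < ?v n" and v2: "\<forall>\<^sub>F n in sequentially. ?v n < 1 - \<delta>0"
    using \<delta>0_pos by (auto intro!: order_tendstoD)
  let ?s = "\<lambda>n. \<Sum>k\<in>torus n. (cmod (amplitude A c n (k :: int ^ 'd)))\<^sup>2 / mode_rate \<theta> m n k"
  have "(\<lambda>n. (\<Sum>k\<in>torus n. ?F (scaled n k) / (eigval n (k :: int ^ 'd) + m)) / ?N n / \<theta>) \<longlonglongrightarrow> ?V m"
    unfolding green_integral_def using \<theta> m
    by (intro tendsto_divide tendsto_const green_riemann_limit[OF d _ continuous_power_symbol FB]) auto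
  moreover have "\<forall>\<^sub>F n in sequentially. (\<Sum>k\<in>torus n. ?F (scaled n k) / (eigval n (k :: int ^ 'd) + m)) / ?N n / \<theta> = ?s n"
    using eventually_gt_at_top[of 0]
    by eventually_elim (simp add: mode_rate_def amplitude_power_symbol sum_divide_distrib mult_ac)
  ultimately have "?s \<longlonglongrightarrow> ?V m" by (rule Lim_transform_eventually)
  from tendsto_exp[OF tendsto_divide[OF tendsto_minus[OF this] tendsto_const[of 4]]]
  have "(\<lambda>n. exp (- ?s n / 4)) \<longlonglongrightarrow> exp (- ?V m / 4)" by simp
  then have s: "\<forall>\<^sub>F n in sequentially. dist (exp (- ?s n / 4)) (exp (- ?V m / 4)) < e / 4"
    using e by (intro tendstoD) auto
  have x1: "\<forall>\<^sub>F n in sequentially. ?N n * exp (- (\<theta> * m * \<delta>\<^sup>2 / (16 * B\<^sup>2)) * ?N n) < e / 64"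
    using e \<theta> m \<delta> B0
    by (intro order_tendstoD(2)[OF tendsto_times_exp_neg[OF _ filterlim_volume]] divide_pos_pos mult_pos_pos zero_less_power) auto
  have x2: "\<forall>\<^sub>F n in sequentially. ?N n * exp (- (\<theta> * m * \<delta>0\<^sup>2 / 8) * ?N n) < 1 / 4"
    using \<theta> m \<delta>0_pos
    by (intro order_tendstoD(2)[OF tendsto_times_exp_neg[OF _ filterlim_volume]] divide_pos_pos mult_pos_pos zero_less_power) auto
  have "\<forall>\<^sub>F n in sequentially. norm ((\<integral>a. (\<Prod>k\<in>torus n. cis (Re (amplitude A c n k * a k))) \<partial>mode_law \<theta> n) -
      complex_of_real (exp (- (covariance_form m0 A c / \<theta>) / 4))) < e"
    using v1 v2 s x1 x2 eventually_ge_at_top[of 3]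
  proof eventually_elim
    case (elim n)
    have n: "n > 0" using elim by simp
    have N: "?N n \<ge> 1" using n by (simp add: one_le_power)
    have large: "2 * exp (- (\<theta> * m) * ?N n * \<delta>0\<^sup>2 / 8) \<le> 1 / 2"
    proof -
      have "1 * exp (- (\<theta> * m * \<delta>0\<^sup>2 / 8) * ?N n) \<le> ?N n * exp (- (\<theta> * m * \<delta>0\<^sup>2 / 8) * ?N n)"
        using N by (intro mult_right_mono) auto
      then have "exp (- (\<theta> * m * \<delta>0\<^sup>2 / 8) * ?N n) \<le> 1 / 4" using elim(5) unfolding mult_1_left by linarith
      then have "2 * exp (- (\<theta> * m * \<delta>0\<^sup>2 / 8) * ?N n) \<le> 1 / 2" by linarith
      moreover have "- (\<theta> * m) * ?N n * \<delta>0\<^sup>2 / 8 = - (\<theta> * m * \<delta>0\<^sup>2 / 8) * ?N n" by simp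
      ultimately show ?thesis by (simp only:)
    qed
    define \<kappa> where "\<kappa> = 2 * exp (3 * \<theta> * m * \<delta>0 * ?N n)"
    have "exp_moment_bound (mode_law \<theta> n) (torus n) (mode_rate \<theta> m n :: int ^ 'd \<Rightarrow> real) \<kappa>"
      unfolding \<kappa>_def using elim by (intro exp_moment_bound_mode_law[OF \<theta> n m(1) \<delta>0_pos \<delta>01 _ _ large]) auto
    then have "cmod ((\<integral>a. 1 * (\<Prod>k\<in>torus n. cis (Re (amplitude A c n k * a k))) \<partial>mode_law \<theta> n) -
        (\<integral>a. 1 \<partial>(mode_law \<theta> n :: (int ^ 'd \<Rightarrow> complex) measure)) * complex_of_real (exp (- ?s n / 4))) \<le>
        3 * B\<^sup>2 * \<delta> + 8 * \<kappa> * ?N n * exp (- (\<theta> * m) * ?N n * \<delta>\<^sup>2 / (8 * B\<^sup>2))"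
    proof (rule gaussian_approximation[rotated 5])
      show "quarter_turn_invariant (mode_law \<theta> n) (torus n) (torus n :: (int ^ 'd) set)"
        by (rule mode_law_quarter_turn[OF \<theta> n])
      show "prob_space (mode_law \<theta> n :: (int ^ 'd \<Rightarrow> complex) measure)" by (rule prob_space_mode_law[OF \<theta> n])
      show "(cmod (amplitude A c n k))\<^sup>2 \<le> B / ?N n" for k
        unfolding amplitude_power_symbol[OF n] using B by (intro divide_right_mono) auto
      have "?v n \<le> 1" using elim(2) \<delta>0_pos by linarith
      moreover have "0 < ?N n" using N by linarith
      ultimately show "(\<Sum>k\<in>torus n. 1 / mode_rate \<theta> m n (k :: int ^ 'd)) \<le> ?N n"
        using divide_le_eq_1_pos by blast
    qed (use \<theta> m n N B \<delta> cc_ge[OF \<theta> n m(1) \<delta>] in \<open>auto simp: card_torus \<kappa>_def\<close>)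
    also have "8 * \<kappa> * ?N n * exp (- (\<theta> * m) * ?N n * \<delta>\<^sup>2 / (8 * B\<^sup>2)) \<le> 16 * (?N n * exp (- (\<theta> * m * \<delta>\<^sup>2 / (16 * B\<^sup>2)) * ?N n))"
    proof -
      \<comment> \<open>The bound \<delta>0 < \<delta>^2 / (48 B^2) means that the price exp (3
        \<theta> m \<delta>0 N) uses up at most half of the concentration exponent.\<close>
      have "3 * \<delta>0 - \<delta>\<^sup>2 / (8 * B\<^sup>2) \<le> - (\<delta>\<^sup>2 / (16 * B\<^sup>2))"
      proof -
        have "\<delta>\<^sup>2 / (8 * B\<^sup>2) = 6 * (\<delta>\<^sup>2 / (48 * B\<^sup>2))" "\<delta>\<^sup>2 / (16 * B\<^sup>2) = 3 * (\<delta>\<^sup>2 / (48 * B\<^sup>2))" by simp_all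
        then show ?thesis using \<delta>0_small by linarith
      qed
      then have "(\<theta> * m * ?N n) * (3 * \<delta>0 - \<delta>\<^sup>2 / (8 * B\<^sup>2)) \<le> (\<theta> * m * ?N n) * - (\<delta>\<^sup>2 / (16 * B\<^sup>2))"
        using \<theta> m N by (intro mult_left_mono) auto
      then have "exp (3 * \<theta> * m * \<delta>0 * ?N n + - (\<theta> * m) * ?N n * \<delta>\<^sup>2 / (8 * B\<^sup>2)) \<le> exp (- (\<theta> * m * \<delta>\<^sup>2 / (16 * B\<^sup>2)) * ?N n)"
        by (simp add: algebra_simps)
      then have "(16 * ?N n) * exp (3 * \<theta> * m * \<delta>0 * ?N n + - (\<theta> * m) * ?N n * \<delta>\<^sup>2 / (8 * B\<^sup>2)) \<le>
          (16 * ?N n) * exp (- (\<theta> * m * \<delta>\<^sup>2 / (16 * B\<^sup>2)) * ?N n)"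
        using N by (intro mult_left_mono) auto
      then show ?thesis by (simp only: \<kappa>_def exp_add mult_ac)
    qed
    finally have "cmod ((\<integral>a. (\<Prod>k\<in>torus n. cis (Re (amplitude A c n k * a k))) \<partial>mode_law \<theta> n) - complex_of_real (exp (- ?s n / 4))) < e / 2"
      using \<delta>e elim(4) prob_space.prob_space[OF prob_space_mode_law[OF \<theta> n, where 'd = 'd]]
      by (simp add: exp_of_real[symmetric])
    moreover have "cmod (complex_of_real (exp (- ?s n / 4)) - complex_of_real (exp (- (covariance_form m0 A c / \<theta>) / 4))) < e / 2"
    proof -
      have "dist (exp (- ?s n / 4)) (exp (- ?V m0 / 4)) < e / 4 + e / 4"
      proof (rule dist_triangle_less_add[OF elim(3)])
        show "dist (exp (- ?V m0 / 4)) (exp (- ?V m / 4)) < e / 4"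
          using j(2) by (simp only: m_def dist_commute)
      qed
      then show ?thesis
        unfolding green_integral_power_symbol[OF d m0] dist_real_def of_real_diff[symmetric] norm_of_real by simp
    qed
    ultimately have "norm ((\<integral>a. (\<Prod>k\<in>torus n. cis (Re (amplitude A c n k * a k))) \<partial>mode_law \<theta> n) -
        complex_of_real (exp (- (covariance_form m0 A c / \<theta>) / 4))) < e / 2 + e / 2"
      by (rule norm_diff_triangle_less)
    then show ?case by (simp only: field_sum_of_halves)
  qed
  then show "\<exists>no. \<forall>n\<ge>no. norm ((\<integral>a. (\<Prod>k\<in>torus n. cis (Re (amplitude A c n k * a k))) \<partial>mode_law \<theta> n) -
      complex_of_real (exp (- (covariance_form m0 A c / \<theta>) / 4))) < e"
    by (simp add: eventually_sequentially)
qed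

section \<open>Decoupling the zero mode\<close>

text \<open>Only unnormalised weights can be compared pointwise. The numerators and the
  normalisations each contribute one term of the L1 distance, and only the integral of the reference
  weight \<open>w0\<close> remains in the denominator.\<close>

lemma normalized_weight_compare:
  fixes f :: "'a \<Rightarrow> complex" and w w0 :: "'a \<Rightarrow> real"
  assumes [measurable]: "f \<in> borel_measurable M" and f: "\<And>x. cmod (f x) \<le> 1"
    and w: "integrable M w" "\<And>x. w x \<ge> 0" "(\<integral>x. w x \<partial>M) > 0"
    and w0: "integrable M w0" "\<And>x. w0 x \<ge> 0" "(\<integral>x. w0 x \<partial>M) > 0"
  shows "cmod ((\<integral>x. f x \<partial>density M (\<lambda>x. ennreal (w x / (\<integral>x. w x \<partial>M)))) -
      (\<integral>x. f x \<partial>density M (\<lambda>x. ennreal (w0 x / (\<integral>x. w0 x \<partial>M))))) \<le>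
    2 * (\<integral>x. \<bar>w x - w0 x\<bar> \<partial>M) / (\<integral>x. w0 x \<partial>M)"
proof -
  define Z Z0 D where "Z = (\<integral>x. w x \<partial>M)" and "Z0 = (\<integral>x. w0 x \<partial>M)" and "D = (\<integral>x. \<bar>w x - w0 x\<bar> \<partial>M)"
  have Z: "Z > 0" "Z0 > 0" using w w0 by (auto simp: Z_def Z0_def)
  have [measurable]: "w \<in> borel_measurable M" "w0 \<in> borel_measurable M" using w w0 by auto
  have fw: "integrable M (\<lambda>x. v x *\<^sub>R f x)" if "integrable M v" for v :: "'a \<Rightarrow> real"
  proof (rule Bochner_Integration.integrable_bound[OF that])
    have [measurable]: "v \<in> borel_measurable M" using that by auto
    show "(\<lambda>x. v x *\<^sub>R f x) \<in> borel_measurable M" by measurable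
    have "norm (v x *\<^sub>R f x) \<le> norm (v x)" for x using mult_left_mono[OF f[of x], of "\<bar>v x\<bar>"] by simp
    then show "AE x in M. norm (v x *\<^sub>R f x) \<le> norm (v x)" by simp
  qed
  have bound: "cmod (\<integral>x. v x *\<^sub>R f x \<partial>M) \<le> (\<integral>x. \<bar>v x\<bar> \<partial>M)" if "integrable M v" for v :: "'a \<Rightarrow> real"
  proof (rule order_trans[OF integral_norm_bound], rule integral_mono)
    show "integrable M (\<lambda>x. cmod (v x *\<^sub>R f x))" by (rule integrable_norm[OF fw[OF that]])
    show "cmod (v x *\<^sub>R f x) \<le> \<bar>v x\<bar>" for x using mult_left_mono[OF f[of x], of "\<bar>v x\<bar>"] by simp
  qed (use that in simp)
  have e: "(\<integral>x. f x \<partial>density M (\<lambda>x. ennreal (v x / c))) = (\<integral>x. v x *\<^sub>R f x \<partial>M) /\<^sub>R c"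
    if [measurable]: "v \<in> borel_measurable M" and v: "\<And>x. v x \<ge> 0" "c > 0" for v c
  proof -
    have "(\<integral>x. f x \<partial>density M (\<lambda>x. ennreal (v x / c))) = (\<integral>x. (v x / c) *\<^sub>R f x \<partial>M)"
      by (rule integral_density) (use v in auto)
    also have "\<dots> = (\<integral>x. (1 / c) *\<^sub>R (v x *\<^sub>R f x) \<partial>M)" by (simp add: divide_inverse mult.commute)
    also have "\<dots> = (1 / c) *\<^sub>R (\<integral>x. v x *\<^sub>R f x \<partial>M)" by (rule integral_scaleR_right)
    finally show ?thesis by (simp add: divide_inverse)
  qed
  define I I0 where "I = (\<integral>x. w x *\<^sub>R f x \<partial>M)" and "I0 = (\<integral>x. w0 x *\<^sub>R f x \<partial>M)"
  have "I - I0 = (\<integral>x. (w x - w0 x) *\<^sub>R f x \<partial>M)"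
    unfolding I_def I0_def using fw w w0 by (simp add: scaleR_left_diff_distrib)
  then have II: "cmod (I - I0) \<le> D" unfolding D_def using bound[of "\<lambda>x. w x - w0 x"] w w0 by simp
  have IZ: "cmod I \<le> Z" using bound[OF w(1)] w(2) by (simp add: I_def Z_def)
  have "Z - Z0 = (\<integral>x. w x - w0 x \<partial>M)" using w w0 by (simp add: Z_def Z0_def)
  then have ZZ: "\<bar>Z - Z0\<bar> \<le> D" unfolding D_def by (simp add: integral_abs_bound)
  have "I /\<^sub>R Z - I0 /\<^sub>R Z0 = (I - I0) /\<^sub>R Z0 + (1 / Z - 1 / Z0) *\<^sub>R I"
    by (simp add: scaleR_diff_right scaleR_left_diff_distrib inverse_eq_divide)
  also have "cmod \<dots> \<le> cmod ((I - I0) /\<^sub>R Z0) + cmod ((1 / Z - 1 / Z0) *\<^sub>R I)" by (rule norm_triangle_ineq)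
  also have "\<dots> \<le> D / Z0 + D / Z0"
  proof (rule add_mono)
    show "cmod ((I - I0) /\<^sub>R Z0) \<le> D / Z0"
      using II Z by (simp add: divide_inverse mult.commute mult_left_mono)
    have "\<bar>1 / Z - 1 / Z0\<bar> = \<bar>Z - Z0\<bar> / (Z * Z0)"
    proof -
      have "1 / Z - 1 / Z0 = (Z0 - Z) / (Z * Z0)" using Z by (simp add: field_simps)
      then show ?thesis using Z by (simp add: abs_mult abs_minus_commute)
    qed
    then have "cmod ((1 / Z - 1 / Z0) *\<^sub>R I) = \<bar>Z - Z0\<bar> / (Z * Z0) * cmod I" by simp
    also have "\<dots> \<le> D / (Z * Z0) * Z" using ZZ IZ Z by (intro mult_mono divide_right_mono) auto
    finally show "cmod ((1 / Z - 1 / Z0) *\<^sub>R I) \<le> D / Z0" using Z by simp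
  qed
  finally show ?thesis
    using e[of w Z] e[of w0 Z0] w w0 Z by (simp add: I_def I0_def Z_def Z0_def D_def)
qed

text \<open>The constraint now involves the zero mode only. Its squared modulus is confined to R N
  while the other modes are unrestricted Gaussians, so the law is a product. The value R = s gives
  the limit, and R = 1 dominates the error.\<close>

definition disc_weight :: "real \<Rightarrow> nat \<Rightarrow> real \<Rightarrow> (int ^ 'd \<Rightarrow> complex) \<Rightarrow> real" where
  "disc_weight \<theta> n R a = exp (- sqnorm (torus n) (\<lambda>k. \<theta> * eigval n k) a) *
     indicator {z. (cmod z)\<^sup>2 \<le> R * real (n ^ CARD('d))} (a 0)"

definition disc_law :: "real \<Rightarrow> nat \<Rightarrow> real \<Rightarrow> (int ^ 'd \<Rightarrow> complex) measure" where
  "disc_law \<theta> n R = density (cspace (torus n)) (\<lambda>a. ennreal (disc_weight \<theta> n R a /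
     (\<integral>a. disc_weight \<theta> n R a \<partial>cspace (torus n :: (int ^ 'd) set))))"

lemma sets_disc_law [simp]: "sets (disc_law \<theta> n R :: (int ^ 'd \<Rightarrow> complex) measure) = sets (cspace (torus n))"
  by (simp add: disc_law_def)

lemma disc_weight_nonneg: "disc_weight \<theta> n R a \<ge> 0"
  by (simp add: disc_weight_def)

lemma emeasure_complex_cball: "r \<ge> 0 \<Longrightarrow> emeasure lborel (cball (0::complex) r) = ennreal (pi * r\<^sup>2)"
  by (simp add: emeasure_cball unit_ball_vol_2)

lemma disc_eq_cball: "R \<ge> 0 \<Longrightarrow> {z :: complex. (cmod z)\<^sup>2 \<le> R} = cball 0 (sqrt R)"
  by (auto simp: real_le_rsqrt sqrt_ge_absD intro: power2_le_imp_le[of _ "sqrt R", simplified] real_le_lsqrt)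

definition nonzero_partition :: "'d::finite itself \<Rightarrow> real \<Rightarrow> nat \<Rightarrow> real" where
  "nonzero_partition _ \<theta> n = (\<Prod>k\<in>torus n - {0 :: int ^ 'd}. pi / (\<theta> * eigval n k))"

lemma prod_pi_ratio:
  fixes c t :: "'i \<Rightarrow> real"
  assumes "\<And>k. k \<in> K \<Longrightarrow> c k > 0" "\<And>k. k \<in> K \<Longrightarrow> t k < c k"
  shows "(\<Prod>k\<in>K. pi / (c k - t k)) = (\<Prod>k\<in>K. pi / c k) * (\<Prod>k\<in>K. 1 / (1 - t k / c k))"
  unfolding prod.distrib[symmetric]
proof (intro prod.cong refl)
  fix k assume "k \<in> K"
  then show "pi / (c k - t k) = pi / c k * (1 / (1 - t k / c k))"
    using assms[of k] by (simp add: field_simps)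
qed

lemma nn_integral_complex_scale:
  assumes s: "s > 0" and [measurable]: "G \<in> borel_measurable borel"
  shows "(\<integral>\<^sup>+z. G z \<partial>(lborel :: complex measure)) = ennreal (s\<^sup>2) * (\<integral>\<^sup>+u. G (of_real s * u) \<partial>lborel)"
proof -
  have "(\<integral>\<^sup>+z. G z \<partial>(lborel :: complex measure)) =
      (\<integral>\<^sup>+z. G z \<partial>density (distr lborel borel (\<lambda>x. 0 + s *\<^sub>R x)) (\<lambda>_. ennreal (\<bar>s\<bar> ^ DIM(complex))))"
    by (subst lborel_affine[of s 0]) (use s in auto)
  also have "\<dots> = (\<integral>\<^sup>+z. ennreal (s\<^sup>2) * G z \<partial>distr lborel borel (\<lambda>x :: complex. 0 + s *\<^sub>R x))"
    by (subst nn_integral_density) (use s in \<open>simp_all add: power2_eq_square\<close>)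
  also have "\<dots> = (\<integral>\<^sup>+u. ennreal (s\<^sup>2) * G (0 + s *\<^sub>R u) \<partial>lborel)"
    by (rule nn_integral_distr) measurable
  also have "\<dots> = ennreal (s\<^sup>2) * (\<integral>\<^sup>+u. G (0 + s *\<^sub>R u) \<partial>lborel)"
    by (rule nn_integral_cmult) measurable
  finally show ?thesis by (simp add: scaleR_conv_of_real)
qed

context
  fixes \<theta> :: real and n :: nat
  assumes \<theta>: "\<theta> > 0" and n: "n > 0"
begin

lemma zero_in_torus: "(0 :: int ^ 'd) \<in> torus n"
  using n by (simp add: torus_def)

lemma measurable_zero_mode [measurable]: "(\<lambda>a. a 0) \<in> borel_measurable (cspace (torus n :: (int ^ 'd) set))"
  by (rule measurable_cspace_component[OF zero_in_torus])

lemma measurable_disc_weight [measurable]: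
  "disc_weight \<theta> n R \<in> borel_measurable (cspace (torus n :: (int ^ 'd) set))"
  unfolding disc_weight_def[abs_def] by measurable

lemma rate_pos: "k \<in> torus n - {0 :: int ^ 'd} \<Longrightarrow> \<theta> * eigval n k > 0"
  using eigval_ge[OF n, of k] n \<theta> by (auto intro!: mult_pos_pos less_le_trans[of 0 "4 / (real n)\<^sup>2" "eigval n k"])

text \<open>The eigenvalue at 0 vanishes, so the zero mode enters through \<open>f\<close> alone and
  the integral factorises over the modes.\<close>

lemma nn_integral_split_zero_mode:
  fixes t :: "int ^ 'd \<Rightarrow> real"
  assumes f [measurable]: "f \<in> borel_measurable borel"
    and t: "\<And>k. k \<in> torus n - {0} \<Longrightarrow> t k < \<theta> * eigval n k"
  shows "(\<integral>\<^sup>+a. f (a 0) * ennreal (exp (- sqnorm (torus n) (\<lambda>k. \<theta> * eigval n k) a)) * ennreal (exp (sqnorm (torus n - {0}) t a))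
      \<partial>cspace (torus n)) = (\<integral>\<^sup>+z. f z \<partial>lborel) * ennreal (\<Prod>k\<in>torus n - {0}. pi / (\<theta> * eigval n k - t k))"
proof -
  let ?T = "torus n :: (int ^ 'd) set"
  define h where "h k = (if k = 0 then f else (\<lambda>z. ennreal (exp (- (\<theta> * eigval n k - t k) * (cmod z)\<^sup>2))))" for k
  have hm: "h k \<in> borel_measurable lborel" for k unfolding h_def by (cases "k = 0") simp_all
  have T: "?T = insert 0 (?T - {0})" using zero_in_torus by auto
  have prodT: "(\<Prod>k\<in>?T. p k) = p 0 * (\<Prod>k\<in>?T - {0}. p k)" for p :: "int ^ 'd \<Rightarrow> ennreal"
    by (rule prod.remove[OF finite_torus zero_in_torus])
  have "f (a 0) * ennreal (exp (- sqnorm ?T (\<lambda>k. \<theta> * eigval n k) a)) * ennreal (exp (sqnorm (?T - {0}) t a)) = (\<Prod>k\<in>?T. h k (a k))" for a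
  proof -
    have s: "sqnorm ?T (\<lambda>k. \<theta> * eigval n k) a = sqnorm (?T - {0}) (\<lambda>k. \<theta> * eigval n k) a"
      unfolding sqnorm_def by (subst sum.remove[OF finite_torus zero_in_torus]) (simp add: eigval_def)
    have "(\<Prod>k\<in>?T - {0}. h k (a k)) = (\<Prod>k\<in>?T - {0}. ennreal (exp (- (\<theta> * eigval n k - t k) * (cmod (a k))\<^sup>2)))"
      by (intro prod.cong) (auto simp: h_def)
    also have "\<dots> = ennreal (\<Prod>k\<in>?T - {0}. exp (- (\<theta> * eigval n k - t k) * (cmod (a k))\<^sup>2))" by (rule prod_ennreal) simp
    also have "(\<Prod>k\<in>?T - {0}. exp (- (\<theta> * eigval n k - t k) * (cmod (a k))\<^sup>2)) =
        exp (- sqnorm ?T (\<lambda>k. \<theta> * eigval n k) a + sqnorm (?T - {0}) t a)"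
      unfolding s by (simp add: sqnorm_def exp_sum[symmetric] left_diff_distrib sum_subtractf sum_negf)
    also have "ennreal \<dots> = ennreal (exp (- sqnorm ?T (\<lambda>k. \<theta> * eigval n k) a)) * ennreal (exp (sqnorm (?T - {0}) t a))"
      unfolding exp_add by (rule ennreal_mult) auto
    finally show ?thesis unfolding prodT by (simp add: h_def mult.assoc)
  qed
  then have "(\<integral>\<^sup>+a. f (a 0) * ennreal (exp (- sqnorm ?T (\<lambda>k. \<theta> * eigval n k) a)) * ennreal (exp (sqnorm (?T - {0}) t a)) \<partial>cspace ?T) =
      (\<integral>\<^sup>+a. (\<Prod>k\<in>?T. h k (a k)) \<partial>cspace ?T)" by simp
  also have "\<dots> = (\<Prod>k\<in>?T. \<integral>\<^sup>+z. h k z \<partial>lborel)"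
    by (rule lborel_complex.product_nn_integral_prod[OF finite_torus hm])
  also have "\<dots> = (\<integral>\<^sup>+z. f z \<partial>lborel) * (\<Prod>k\<in>?T - {0}. \<integral>\<^sup>+z. h k z \<partial>lborel)"
    unfolding prodT by (simp add: h_def)
  also have "(\<Prod>k\<in>?T - {0}. \<integral>\<^sup>+z. h k z \<partial>lborel) = (\<Prod>k\<in>?T - {0}. ennreal (pi / (\<theta> * eigval n k - t k)))"
  proof (rule prod.cong[OF refl])
    fix k assume k: "k \<in> ?T - {0}"
    have "(\<integral>\<^sup>+z. h k z \<partial>lborel) = (\<integral>\<^sup>+z. ennreal (exp (- (\<theta> * eigval n k - t k) * (cmod z)\<^sup>2)) \<partial>lborel)"
      using k by (simp add: h_def)
    also have "\<dots> = ennreal (pi / (\<theta> * eigval n k - t k))"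
      by (rule nn_integral_gaussian_complex) (use t[OF k] in simp)
    finally show "(\<integral>\<^sup>+z. h k z \<partial>lborel) = ennreal (pi / (\<theta> * eigval n k - t k))" .
  qed
  also have "\<dots> = ennreal (\<Prod>k\<in>?T - {0}. pi / (\<theta> * eigval n k - t k))"
    by (rule prod_ennreal) (use t in \<open>auto simp: less_imp_le\<close>)
  finally show ?thesis .
qed

lemma nonzero_partition_pos: "nonzero_partition TYPE('d::finite) \<theta> n > 0"
  unfolding nonzero_partition_def
  by (intro prod_pos divide_pos_pos rate_pos) auto

lemma nn_integral_disc_weight:
  fixes t :: "int ^ 'd \<Rightarrow> real"
  assumes R: "R > 0" and f [measurable]: "f \<in> borel_measurable borel"
    and t: "\<And>k. k \<in> torus n - {0} \<Longrightarrow> t k < \<theta> * eigval n k"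
  shows "(\<integral>\<^sup>+a. ennreal (disc_weight \<theta> n R a) * (f (a 0) * ennreal (exp (sqnorm (torus n - {0}) t a))) \<partial>cspace (torus n)) =
    (\<integral>\<^sup>+z. f z * indicator (cball 0 (sqrt (R * real (n ^ CARD('d))))) z \<partial>lborel) *
      ennreal (nonzero_partition TYPE('d::finite) \<theta> n * (\<Prod>k\<in>torus n - {0}. 1 / (1 - t k / (\<theta> * eigval n k))))"
proof -
  let ?D = "cball (0::complex) (sqrt (R * real (n ^ CARD('d))))"
  have D: "{z :: complex. (cmod z)\<^sup>2 \<le> R * real (n ^ CARD('d))} = ?D" using R by (intro disc_eq_cball) auto
  have w: "ennreal (disc_weight \<theta> n R a) = indicator ?D (a 0) * ennreal (exp (- sqnorm (torus n) (\<lambda>k. \<theta> * eigval n k) a))"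
    for a :: "int ^ 'd \<Rightarrow> complex"
    unfolding disc_weight_def D by (cases "a 0 \<in> ?D") (simp_all del: mem_cball mem_cball_0 of_nat_power)
  have "(\<integral>\<^sup>+a. ennreal (disc_weight \<theta> n R a) * (f (a 0) * ennreal (exp (sqnorm (torus n - {0}) t a))) \<partial>cspace (torus n)) =
      (\<integral>\<^sup>+a. (f (a 0) * indicator ?D (a 0)) * ennreal (exp (- sqnorm (torus n) (\<lambda>k. \<theta> * eigval n k) a)) *
        ennreal (exp (sqnorm (torus n - {0}) t a)) \<partial>cspace (torus n))"
    unfolding w by (simp only: mult_ac)
  also have "\<dots> = (\<integral>\<^sup>+z. f z * indicator ?D z \<partial>lborel) * ennreal (\<Prod>k\<in>torus n - {0}. pi / (\<theta> * eigval n k - t k))"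
  proof (rule nn_integral_split_zero_mode[of "\<lambda>z. f z * indicator ?D z" t])
    have [measurable]: "?D \<in> sets borel" by (rule borel_closed) simp
    show "(\<lambda>z. f z * indicator ?D z) \<in> borel_measurable borel" by measurable
  qed (rule t)
  also have "(\<Prod>k\<in>torus n - {0}. pi / (\<theta> * eigval n k - t k)) =
      nonzero_partition TYPE('d) \<theta> n * (\<Prod>k\<in>torus n - {0}. 1 / (1 - t k / (\<theta> * eigval n k)))"
    unfolding nonzero_partition_def by (rule prod_pi_ratio) (use rate_pos t in auto)
  finally show ?thesis .
qed

lemma nn_integral_disc_weight_1:
  assumes R: "R > 0"
  shows "(\<integral>\<^sup>+a. ennreal (disc_weight \<theta> n R a) \<partial>cspace (torus n :: (int ^ 'd) set)) =
    ennreal (pi * (R * real (n ^ CARD('d))) * nonzero_partition TYPE('d::finite) \<theta> n)"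
proof -
  have "0 < \<theta> * eigval n k" if "k \<in> torus n - {0 :: int ^ 'd}" for k using rate_pos that by blast
  then have "(\<integral>\<^sup>+a. ennreal (disc_weight \<theta> n R a) \<partial>cspace (torus n :: (int ^ 'd) set)) =
      emeasure lborel (cball (0::complex) (sqrt (R * real (n ^ CARD('d))))) * ennreal (nonzero_partition TYPE('d::finite) \<theta> n)"
    using nn_integral_disc_weight[OF R, of "\<lambda>_. 1" "\<lambda>_ :: int ^ 'd. 0"] by (simp add: sqnorm_def)
  also have "emeasure lborel (cball (0::complex) (sqrt (R * real (n ^ CARD('d))))) = ennreal (pi * (R * real (n ^ CARD('d))))"
    using R by (subst emeasure_complex_cball) auto
  finally show ?thesis
    using nonzero_partition_pos[where 'd = 'd] R by (simp add: ennreal_mult[symmetric] less_imp_le del: of_nat_power)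
qed

lemma integrable_disc_weight:
  assumes R: "R > 0"
  shows "integrable (cspace (torus n :: (int ^ 'd) set)) (disc_weight \<theta> n R)"
    "(\<integral>a. disc_weight \<theta> n R a \<partial>cspace (torus n :: (int ^ 'd) set)) =
      pi * (R * real (n ^ CARD('d))) * nonzero_partition TYPE('d::finite) \<theta> n"
proof -
  have nn: "0 \<le> pi * (R * real (n ^ CARD('d))) * nonzero_partition TYPE('d::finite) \<theta> n"
    using R nonzero_partition_pos[where 'd = 'd] by (intro mult_nonneg_nonneg) auto
  have "has_bochner_integral (cspace (torus n :: (int ^ 'd) set)) (disc_weight \<theta> n R)
      (pi * (R * real (n ^ CARD('d))) * nonzero_partition TYPE('d::finite) \<theta> n)"
    by (rule has_bochner_integral_nn_integral[OF _ _ nn nn_integral_disc_weight_1[OF R]])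
      (auto simp: disc_weight_nonneg)
  then show "integrable (cspace (torus n :: (int ^ 'd) set)) (disc_weight \<theta> n R)"
    "(\<integral>a. disc_weight \<theta> n R a \<partial>cspace (torus n :: (int ^ 'd) set)) =
      pi * (R * real (n ^ CARD('d))) * nonzero_partition TYPE('d::finite) \<theta> n"
    by (auto simp: has_bochner_integral_iff)
qed

lemma disc_partition_pos: "R > 0 \<Longrightarrow> pi * (R * real (n ^ CARD('d))) * nonzero_partition TYPE('d::finite) \<theta> n > 0"
  using n nonzero_partition_pos[where 'd = 'd] by (intro mult_pos_pos) auto

lemma nn_integral_disc_law:
  fixes t :: "int ^ 'd \<Rightarrow> real"
  assumes R: "R > 0" and f [measurable]: "f \<in> borel_measurable borel"
    and t: "\<And>k. k \<in> torus n - {0} \<Longrightarrow> t k < \<theta> * eigval n k"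
  shows "(\<integral>\<^sup>+a. f (a 0) * ennreal (exp (sqnorm (torus n - {0}) t a)) \<partial>disc_law \<theta> n R) =
    ennreal (1 / (pi * (R * real (n ^ CARD('d))))) * (\<integral>\<^sup>+z. f z * indicator (cball 0 (sqrt (R * real (n ^ CARD('d))))) z \<partial>lborel) *
      ennreal (\<Prod>k\<in>torus n - {0}. 1 / (1 - t k / (\<theta> * eigval n k)))"
proof -
  define Z P where "Z = nonzero_partition TYPE('d::finite) \<theta> n" and "P = pi * (R * real (n ^ CARD('d)))"
  define r where "r = (\<Prod>k\<in>torus n - {0}. 1 / (1 - t k / (\<theta> * eigval n k)))"
  have Z: "Z > 0" unfolding Z_def by (rule nonzero_partition_pos)
  have P: "P > 0" unfolding P_def using R n by (intro mult_pos_pos) auto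
  have "0 \<le> 1 / (1 - t k / (\<theta> * eigval n k))" if k: "k \<in> torus n - {0}" for k
  proof -
    have "t k / (\<theta> * eigval n k) < 1" using t[OF k] rate_pos[OF k] by (simp only: divide_less_eq_1_pos)
    then show ?thesis by simp
  qed
  then have r: "r \<ge> 0" unfolding r_def by (rule prod_nonneg)
  have [measurable]: "(\<lambda>a. sqnorm (torus n - {0}) t a) \<in> borel_measurable (cspace (torus n))"
  proof -
    have [measurable]: "(\<lambda>a. a k) \<in> borel_measurable (cspace (torus n))" if "k \<in> torus n - {0}" for k :: "int ^ 'd"
      using that by (intro measurable_cspace_component) auto
    show ?thesis unfolding sqnorm_def by measurable
  qed
  have e: "ennreal (disc_weight \<theta> n R a / (P * Z)) = ennreal (1 / (P * Z)) * ennreal (disc_weight \<theta> n R a)" for a :: "int ^ 'd \<Rightarrow> complex"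
    using P Z by (subst ennreal_mult[symmetric]) (auto simp: disc_weight_nonneg)
  have "(\<integral>\<^sup>+a. f (a 0) * ennreal (exp (sqnorm (torus n - {0}) t a)) \<partial>disc_law \<theta> n R) =
      (\<integral>\<^sup>+a. ennreal (disc_weight \<theta> n R a / (P * Z)) * (f (a 0) * ennreal (exp (sqnorm (torus n - {0}) t a))) \<partial>cspace (torus n))"
    unfolding disc_law_def integrable_disc_weight(2)[OF R] P_def[symmetric] Z_def[symmetric]
    by (rule nn_integral_density) measurable
  also have "\<dots> = ennreal (1 / (P * Z)) *
      (\<integral>\<^sup>+a. ennreal (disc_weight \<theta> n R a) * (f (a 0) * ennreal (exp (sqnorm (torus n - {0}) t a))) \<partial>cspace (torus n))"
    unfolding e mult.assoc by (rule nn_integral_cmult) measurable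
  also have "\<dots> = ennreal (1 / (P * Z)) * ((\<integral>\<^sup>+z. f z * indicator (cball 0 (sqrt (R * real (n ^ CARD('d))))) z \<partial>lborel) * ennreal (Z * r))"
    unfolding Z_def r_def by (subst nn_integral_disc_weight[OF R f t]) auto
  also have "\<dots> = (ennreal (1 / (P * Z)) * ennreal (Z * r)) * (\<integral>\<^sup>+z. f z * indicator (cball 0 (sqrt (R * real (n ^ CARD('d))))) z \<partial>lborel)"
    by (simp only: mult_ac)
  also have "ennreal (1 / (P * Z)) * ennreal (Z * r) = ennreal (1 / P) * ennreal r"
    using P Z r by (simp flip: ennreal_mult)
  finally show ?thesis unfolding P_def r_def by (simp only: mult_ac)
qed

lemma nn_integral_disc_area:
  assumes "R > 0"
  shows "ennreal (1 / (pi * (R * real (n ^ CARD('d::finite))))) * (\<integral>\<^sup>+z. indicator (cball (0::complex) (sqrt (R * real (n ^ CARD('d))))) z \<partial>lborel) = 1"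
proof -
  define P where "P = pi * (R * real (n ^ CARD('d)))"
  have P: "P > 0" unfolding P_def using assms n by (intro mult_pos_pos) auto
  have "(\<integral>\<^sup>+z. indicator (cball (0::complex) (sqrt (R * real (n ^ CARD('d))))) z \<partial>lborel) = ennreal P"
    using assms by (simp add: emeasure_complex_cball P_def)
  moreover have "ennreal (1 / P) * ennreal P = 1"
    using P by (simp add: ennreal_mult[symmetric])
  ultimately show ?thesis by (simp only: P_def)
qed

text \<open>The nonzero modes are exactly Gaussian with mass 0, so the constant is 1 and no
  exponential price arises.\<close>

lemma exp_moment_bound_disc_law:
  assumes R: "R > 0"
  shows "exp_moment_bound (disc_law \<theta> n R) (torus n - {0 :: int ^ 'd}) (\<lambda>k. \<theta> * eigval n k) 1"
  unfolding exp_moment_bound_def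
proof (intro allI impI)
  fix t :: "int ^ 'd \<Rightarrow> real" assume "\<forall>k\<in>torus n - {0}. t k < \<theta> * eigval n k"
  then have t: "\<And>k. k \<in> torus n - {0} \<Longrightarrow> t k < \<theta> * eigval n k" by blast
  have "(\<integral>\<^sup>+a. 1 * ennreal (exp (sqnorm (torus n - {0}) t a)) \<partial>disc_law \<theta> n R) =
    ennreal (1 / (pi * (R * real (n ^ CARD('d))))) * (\<integral>\<^sup>+z. 1 * indicator (cball (0::complex) (sqrt (R * real (n ^ CARD('d))))) z \<partial>lborel) *
      ennreal (\<Prod>k\<in>torus n - {0}. 1 / (1 - t k / (\<theta> * eigval n k)))"
    by (rule nn_integral_disc_law[OF R, of "\<lambda>_. 1" t]) (use t in auto)
  then show "(\<integral>\<^sup>+a. ennreal (exp (\<Sum>k\<in>torus n - {0}. t k * (cmod (a k))\<^sup>2)) \<partial>disc_law \<theta> n R) \<le>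
      ennreal (1 * (\<Prod>k\<in>torus n - {0}. 1 / (1 - t k / (\<theta> * eigval n k))))"
    using nn_integral_disc_area[OF R, where 'd = 'd] unfolding mult_1_left sqnorm_def by simp
qed

lemma nn_integral_disc_law_zero_mode:
  assumes R: "R > 0" and f [measurable]: "f \<in> borel_measurable borel"
  shows "(\<integral>\<^sup>+a. f (a 0) \<partial>(disc_law \<theta> n R :: (int ^ 'd \<Rightarrow> complex) measure)) =
    ennreal (1 / (pi * (R * real (n ^ CARD('d::finite))))) * (\<integral>\<^sup>+z. f z * indicator (cball 0 (sqrt (R * real (n ^ CARD('d))))) z \<partial>lborel)"
proof -
  have "0 < \<theta> * eigval n k" if "k \<in> torus n - {0 :: int ^ 'd}" for k using rate_pos that by blast
  then show ?thesis using nn_integral_disc_law[OF R f, of "\<lambda>_ :: int ^ 'd. 0"] by (simp add: sqnorm_def)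
qed

lemma prob_space_disc_law:
  assumes R: "R > 0"
  shows "prob_space (disc_law \<theta> n R :: (int ^ 'd \<Rightarrow> complex) measure)"
proof
  have "emeasure (disc_law \<theta> n R) (space (disc_law \<theta> n R :: (int ^ 'd \<Rightarrow> complex) measure)) =
      (\<integral>\<^sup>+(a :: int ^ 'd \<Rightarrow> complex). 1 \<partial>disc_law \<theta> n R)" by simp
  also have "\<dots> = 1"
    using nn_integral_disc_law_zero_mode[OF R, of "\<lambda>_. 1", where 'd = 'd] nn_integral_disc_area[OF R, where 'd = 'd] by simp
  finally show "emeasure (disc_law \<theta> n R) (space (disc_law \<theta> n R :: (int ^ 'd \<Rightarrow> complex) measure)) = 1" .
qed

lemma disc_law_quarter_turn:
  "quarter_turn_invariant (disc_law \<theta> n R) (torus n :: (int ^ 'd) set) (torus n - {0})"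
  unfolding disc_law_def
proof (rule quarter_turn_invariant_density)
  fix a :: "int ^ 'd \<Rightarrow> complex" and k :: "int ^ 'd" assume k: "k \<in> torus n - {0}"
  have "disc_weight \<theta> n R (phase_rotate (torus n) ((\<lambda>_. 1)(k := \<i>)) a) = disc_weight \<theta> n R a"
    using k zero_in_torus unfolding disc_weight_def
    by (subst sqnorm_phase_rotate) (auto simp: phase_rotate_def)
  then show "ennreal (disc_weight \<theta> n R (phase_rotate (torus n) ((\<lambda>_. 1)(k := \<i>)) a) / (\<integral>a. disc_weight \<theta> n R a \<partial>cspace (torus n :: (int ^ 'd) set))) =
    ennreal (disc_weight \<theta> n R a / (\<integral>a. disc_weight \<theta> n R a \<partial>cspace (torus n :: (int ^ 'd) set)))" by simp
qed auto

text \<open>For every n the rescaled zero mode is exactly uniform on the disc; no limit is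
  involved.\<close>

lemma distr_disc_law_zero_mode:
  assumes R: "R > 0"
  shows "distr (disc_law \<theta> n R :: (int ^ 'd \<Rightarrow> complex) measure) borel (\<lambda>a. a 0 / of_real (sqrt (real (n ^ CARD('d::finite))))) =
    uniform_disc (sqrt R)"
proof (rule measure_eqI)
  define N where "N = real (n ^ CARD('d))"
  let ?M = "disc_law \<theta> n R :: (int ^ 'd \<Rightarrow> complex) measure"
  have N: "N > 0" using n by (simp add: N_def)
  have s: "sqrt N > 0" using N by simp
  show "sets (distr ?M borel (\<lambda>a. a 0 / of_real (sqrt (real (n ^ CARD('d)))))) = sets (uniform_disc (sqrt R))"
    using R by (simp add: uniform_disc_def)
  fix B assume "B \<in> sets (distr ?M borel (\<lambda>a. a 0 / of_real (sqrt (real (n ^ CARD('d))))))"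
  then have B: "B \<in> sets borel" by simp
  have C: "cball (0::complex) r \<in> sets borel" for r by (rule borel_closed) simp
  have g: "(\<lambda>z::complex. z / of_real (sqrt N)) \<in> borel_measurable borel"
    by (intro borel_measurable_continuous_onI continuous_intros) (use s in simp)
  have iB: "(\<lambda>z. indicator B (z / of_real (sqrt N)) :: ennreal) \<in> borel_measurable borel"
    by (rule measurable_compose[OF g borel_measurable_indicator[OF B]])
  have "measurable ?M (borel :: complex measure) = measurable (cspace (torus n)) borel"
    by (rule measurable_cong_sets) simp_all
  then have m: "(\<lambda>a. a 0 / of_real (sqrt N)) \<in> borel_measurable ?M"
    using measurable_compose[OF measurable_zero_mode[where 'd = 'd] g] by (simp only:)
  have "emeasure (distr ?M borel (\<lambda>a. a 0 / of_real (sqrt N))) B =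
      (\<integral>\<^sup>+u. indicator B u \<partial>distr ?M borel (\<lambda>a. a 0 / of_real (sqrt N)))"
    by (rule nn_integral_indicator[symmetric]) (use B in simp)
  also have "\<dots> = (\<integral>\<^sup>+a. indicator B (a 0 / of_real (sqrt N)) \<partial>?M)"
    by (rule nn_integral_distr[OF m]) (use B in simp)
  also have "\<dots> = ennreal (1 / (pi * (R * N))) * (\<integral>\<^sup>+z. indicator B (z / of_real (sqrt N)) * indicator (cball 0 (sqrt (R * N))) z \<partial>lborel)"
    unfolding N_def
    by (rule nn_integral_disc_law_zero_mode[OF R iB[unfolded N_def]])
  also have "(\<integral>\<^sup>+z. indicator B (z / of_real (sqrt N)) * indicator (cball 0 (sqrt (R * N))) z \<partial>(lborel :: complex measure)) =
      ennreal ((sqrt N)\<^sup>2) * (\<integral>\<^sup>+u. indicator B (of_real (sqrt N) * u / of_real (sqrt N)) * indicator (cball 0 (sqrt (R * N))) (of_real (sqrt N) * u) \<partial>lborel)"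
    by (rule nn_integral_complex_scale[OF s]) (intro borel_measurable_times_ennreal iB borel_measurable_indicator C)
  also have "(\<integral>\<^sup>+u. indicator B (of_real (sqrt N) * u / of_real (sqrt N)) * indicator (cball 0 (sqrt (R * N))) (of_real (sqrt N) * u) \<partial>(lborel :: complex measure)) =
      (\<integral>\<^sup>+u. indicator (cball 0 (sqrt R) \<inter> B) u \<partial>lborel)"
  proof (rule nn_integral_cong)
    fix u :: complex
    have c: "of_real (sqrt N) * u / of_real (sqrt N) = u" using s by (simp add: less_imp_neq[symmetric])
    have "cmod (of_real (sqrt N) * u) = sqrt N * cmod u" using s by (simp only: norm_mult norm_of_real abs_of_pos)
    moreover have "sqrt (R * N) = sqrt N * sqrt R" by (simp only: real_sqrt_mult mult.commute)
    ultimately have "cmod (of_real (sqrt N) * u) \<le> sqrt (R * N) \<longleftrightarrow> cmod u \<le> sqrt R"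
      using s by (simp only: mult_le_cancel_left_pos)
    then have m: "of_real (sqrt N) * u \<in> cball 0 (sqrt (R * N)) \<longleftrightarrow> u \<in> cball 0 (sqrt R)"
      by (simp only: mem_cball dist_0_norm)
    show "indicator B (of_real (sqrt N) * u / of_real (sqrt N)) * indicator (cball 0 (sqrt (R * N))) (of_real (sqrt N) * u) =
        (indicator (cball 0 (sqrt R) \<inter> B) u :: ennreal)"
      unfolding c indicator_def m Int_iff
      by (cases "u \<in> cball 0 (sqrt R)"; cases "u \<in> B") (simp_all del: mem_cball mem_cball_0)
  qed
  also have "ennreal (1 / (pi * (R * N))) * (ennreal ((sqrt N)\<^sup>2) * (\<integral>\<^sup>+u. indicator (cball 0 (sqrt R) \<inter> B) u \<partial>(lborel :: complex measure))) =
      ennreal (1 / (pi * R)) * emeasure lborel (cball 0 (sqrt R) \<inter> B)"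
  proof -
    have "1 / (pi * (R * N)) * (sqrt N)\<^sup>2 = 1 / (pi * R)" using R N by simp
    then have "ennreal (1 / (pi * (R * N))) * ennreal ((sqrt N)\<^sup>2) = ennreal (1 / (pi * R))"
      using R N by (subst ennreal_mult[symmetric]) auto
    moreover have "(\<integral>\<^sup>+u. indicator (cball 0 (sqrt R) \<inter> B) u \<partial>(lborel :: complex measure)) = emeasure lborel (cball 0 (sqrt R) \<inter> B)"
      by (rule nn_integral_indicator) (use B C in auto)
    ultimately show ?thesis by (simp only: mult.assoc[symmetric])
  qed
  also have "\<dots> = emeasure lborel (cball 0 (sqrt R) \<inter> B) / emeasure lborel (cball (0::complex) (sqrt R))"
  proof -
    have "emeasure lborel (cball (0::complex) (sqrt R)) = ennreal (pi * R)" using R by (simp add: emeasure_complex_cball)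
    moreover have "inverse (ennreal (pi * R)) = ennreal (1 / (pi * R))" using R by (subst inverse_ennreal) (auto simp: inverse_eq_divide)
    ultimately show ?thesis by (simp only: divide_ennreal_def mult.commute)
  qed
  also have "\<dots> = emeasure (uniform_disc (sqrt R)) B"
  proof -
    have "uniform_disc (sqrt R) = uniform_measure lborel (cball 0 (sqrt R))" using R by (simp add: uniform_disc_def)
    then show ?thesis using B C by (simp only:) (rule emeasure_uniform_measure[symmetric], auto)
  qed
  finally show "emeasure (distr ?M borel (\<lambda>a. a 0 / of_real (sqrt (real (n ^ CARD('d)))))) B = emeasure (uniform_disc (sqrt R)) B"
    unfolding N_def .
qed

end

text \<open>Area is linear in the squared radius, so an annulus of width of order \<epsilon> in
  |u|^2 has probability of that order.\<close>

lemma uniform_disc_annulus: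
  assumes \<epsilon>: "0 < \<epsilon>" "2 * \<epsilon> \<le> s"
  shows "measure (uniform_disc 1) {u. \<bar>(cmod u)\<^sup>2 - s\<bar> \<le> \<epsilon>} \<le> 3 * \<epsilon>"
proof -
  let ?A = "{u :: complex. \<bar>(cmod u)\<^sup>2 - s\<bar> \<le> \<epsilon>}"
  let ?B = "\<lambda>r. cball (0::complex) (sqrt r)"
  have B: "?B r \<in> sets lborel" for r by simp
  have A: "?A \<in> sets lborel" by measurable
  \<comment> \<open>The removed disc is closed, so its squared radius is lowered to s - 2 \<epsilon>
    to keep the inner boundary circle; this is why the bound is 3 \<epsilon>.\<close>
  have "?A \<subseteq> ?B (s + \<epsilon>) - ?B (s - 2 * \<epsilon>)"
  proof
    fix u assume "u \<in> ?A"
    then have "(cmod u)\<^sup>2 \<le> s + \<epsilon>" "\<not> (cmod u)\<^sup>2 \<le> s - 2 * \<epsilon>" using \<epsilon> by auto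
    moreover have "?B (s + \<epsilon>) = {z. (cmod z)\<^sup>2 \<le> s + \<epsilon>}" "?B (s - 2 * \<epsilon>) = {z. (cmod z)\<^sup>2 \<le> s - 2 * \<epsilon>}"
      using \<epsilon> by (simp_all add: disc_eq_cball)
    ultimately show "u \<in> ?B (s + \<epsilon>) - ?B (s - 2 * \<epsilon>)" by (simp only: Diff_iff mem_Collect_eq simp_thms)
  qed
  then have "emeasure lborel (cball 0 1 \<inter> ?A) \<le> emeasure lborel (?B (s + \<epsilon>) - ?B (s - 2 * \<epsilon>))"
    by (intro emeasure_mono sets.Diff B) auto
  also have "\<dots> = emeasure lborel (?B (s + \<epsilon>)) - emeasure lborel (?B (s - 2 * \<epsilon>))"
  proof (rule emeasure_Diff[OF _ B B])
    show "emeasure lborel (?B (s - 2 * \<epsilon>)) \<noteq> \<infinity>" using \<epsilon> by (subst emeasure_complex_cball) auto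
    show "?B (s - 2 * \<epsilon>) \<subseteq> ?B (s + \<epsilon>)" using \<epsilon> by (intro subset_cball) auto
  qed
  also have "\<dots> = ennreal (pi * (s + \<epsilon>) - pi * (s - 2 * \<epsilon>))"
    using \<epsilon> by (simp add: emeasure_complex_cball ennreal_minus)
  also have "pi * (s + \<epsilon>) - pi * (s - 2 * \<epsilon>) = pi * (3 * \<epsilon>)" by (simp add: algebra_simps)
  finally have le: "emeasure lborel (cball 0 1 \<inter> ?A) \<le> ennreal (pi * (3 * \<epsilon>))" .
  have u: "uniform_disc 1 = uniform_measure lborel (cball 0 1)" by (simp add: uniform_disc_def)
  have "emeasure (uniform_disc 1) ?A = emeasure lborel (cball 0 1 \<inter> ?A) / emeasure lborel (cball (0::complex) 1)"
    unfolding u by (rule emeasure_uniform_measure[OF _ A]) simp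
  also have "\<dots> \<le> ennreal (pi * (3 * \<epsilon>)) / emeasure lborel (cball (0::complex) 1)" by (rule divide_right_mono_ennreal[OF le])
  also have "emeasure lborel (cball (0::complex) 1) = ennreal pi" by (simp add: emeasure_complex_cball)
  also have "ennreal (pi * (3 * \<epsilon>)) / ennreal pi = ennreal (pi * (3 * \<epsilon>) / pi)"
    using \<epsilon> by (intro divide_ennreal) auto
  finally show ?thesis unfolding measure_def using \<epsilon> by (intro enn2real_leI) auto
qed

section \<open>Exchanging the ball constraint for the disc constraint\<close>

context
  fixes \<theta> :: real and n :: nat
  assumes \<theta>: "\<theta> > 0" and n: "n > 0"
begin

text \<open>The constraint \<open>x + y \<le> 1\<close> on the normalised masses \<open>x\<close> of the zero mode and \<open>y\<close> of the other modes
  differs from \<open>x \<le> s\<close> only if \<open>y\<close> is far from \<open>1 - s\<close> or \<open>x\<close> is close to \<open>s\<close>.\<close>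

lemma mode_disc_weight_diff:
  fixes a :: "int ^ 'd \<Rightarrow> complex"
  assumes s: "s \<le> 1"
  shows "\<bar>mode_weight \<theta> n a - disc_weight \<theta> n s a\<bar> \<le> disc_weight \<theta> n 1 a *
    (indicator {a. \<epsilon> \<le> \<bar>(\<Sum>k\<in>torus n - {0}. 1 / real (n ^ CARD('d)) * (cmod (a k))\<^sup>2) - (1 - s)\<bar>} a +
     indicator {a. \<bar>(cmod (a 0))\<^sup>2 / real (n ^ CARD('d)) - s\<bar> \<le> \<epsilon>} a)"
proof -
  define N where "N = real (n ^ CARD('d))"
  define E where "E = exp (- sqnorm (torus n) (\<lambda>k. \<theta> * eigval n k) a)"
  define S where "S = (\<Sum>k\<in>torus n - {0}. (cmod (a k))\<^sup>2)"
  define x y where "x = (cmod (a 0))\<^sup>2 / N" and "y = S / N"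
  have N: "N > 0" using n by (simp add: N_def)
  have xN: "(cmod (a 0))\<^sup>2 = x * N" "S = y * N" using N by (auto simp: x_def y_def)
  have "S \<ge> 0" unfolding S_def by (intro sum_nonneg) auto
  then have nn: "x \<ge> 0" "y \<ge> 0" using N by (auto simp: x_def y_def)
  have "sqnorm (torus n) (\<lambda>_. 1) a = (cmod (a 0))\<^sup>2 + S"
    unfolding sqnorm_def S_def mult_1_left by (rule sum.remove[OF finite_torus zero_in_torus[OF \<theta> n]])
  then have sq: "sqnorm (torus n) (\<lambda>_. 1) a = (x + y) * N" unfolding xN by (simp only: distrib_right)
  have "(x + y) * N \<le> N \<longleftrightarrow> x + y \<le> 1" using N mult_le_cancel_right_pos[of N "x + y" 1] by simp
  then have W: "mode_weight \<theta> n a = E * of_bool (x + y \<le> 1)"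
    unfolding mode_weight_def E_def indicator_def mem_Collect_eq sq N_def[symmetric] by simp
  have D: "disc_weight \<theta> n R a = E * of_bool (x \<le> R)" for R
    unfolding disc_weight_def E_def indicator_def mem_Collect_eq N_def[symmetric] xN(1)
    by (simp only: mult_le_cancel_right_pos[OF N])
  have y: "(\<Sum>k\<in>torus n - {0}. 1 / N * (cmod (a k))\<^sup>2) = y" by (simp add: y_def S_def sum_divide_distrib)
  have "x \<le> 1 \<and> (\<epsilon> \<le> \<bar>y - (1 - s)\<bar> \<or> \<bar>x - s\<bar> \<le> \<epsilon>)" if "x + y \<le> 1" "\<not> x \<le> s"
  proof (intro conjI disjCI)
    show "x \<le> 1" using that nn by linarith
    show "\<epsilon> \<le> \<bar>y - (1 - s)\<bar>" if "\<not> \<bar>x - s\<bar> \<le> \<epsilon>"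
      using that \<open>x + y \<le> 1\<close> \<open>\<not> x \<le> s\<close> nn by linarith
  qed
  moreover have "x \<le> 1 \<and> (\<epsilon> \<le> \<bar>y - (1 - s)\<bar> \<or> \<bar>x - s\<bar> \<le> \<epsilon>)" if "\<not> x + y \<le> 1" "x \<le> s"
  proof (intro conjI disjCI)
    show "x \<le> 1" using that s by linarith
    show "\<epsilon> \<le> \<bar>y - (1 - s)\<bar>" if "\<not> \<bar>x - s\<bar> \<le> \<epsilon>"
      using that \<open>\<not> x + y \<le> 1\<close> \<open>x \<le> s\<close> nn by linarith
  qed
  ultimately have "\<bar>of_bool (x + y \<le> 1) - of_bool (x \<le> s)\<bar> \<le>
      of_bool (x \<le> 1) * (of_bool (\<epsilon> \<le> \<bar>y - (1 - s)\<bar>) + (of_bool (\<bar>x - s\<bar> \<le> \<epsilon>) :: real))"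
    by (cases "x + y \<le> 1"; cases "x \<le> s"; cases "x \<le> 1"; cases "\<epsilon> \<le> \<bar>y - (1 - s)\<bar>"; cases "\<bar>x - s\<bar> \<le> \<epsilon>")
      (simp_all only: of_bool_eq simp_thms, simp_all)
  then have "E * \<bar>of_bool (x + y \<le> 1) - of_bool (x \<le> s)\<bar> \<le>
      E * (of_bool (x \<le> 1) * (of_bool (\<epsilon> \<le> \<bar>y - (1 - s)\<bar>) + of_bool (\<bar>x - s\<bar> \<le> \<epsilon>)))"
    by (intro mult_left_mono) (auto simp: E_def)
  moreover have "\<bar>E * u - E * v\<bar> = E * \<bar>u - v\<bar>" for u v
    unfolding right_diff_distrib[symmetric] abs_mult by (simp add: E_def)
  ultimately show ?thesis
    unfolding W D indicator_def mem_Collect_eq N_def[symmetric] y x_def[symmetric] by (simp only: mult.assoc)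
qed

lemma integral_disc_weight_indicator:
  assumes R: "R > 0" and B: "B \<in> sets (cspace (torus n :: (int ^ 'd) set))"
  shows "integrable (cspace (torus n)) (\<lambda>a. disc_weight \<theta> n R a * indicator B a)"
    and "(\<integral>a. disc_weight \<theta> n R a * indicator B a \<partial>cspace (torus n)) =
      pi * (R * real (n ^ CARD('d))) * nonzero_partition TYPE('d::finite) \<theta> n * measure (disc_law \<theta> n R) B"
proof -
  let ?L = "cspace (torus n :: (int ^ 'd) set)"
  define Z where "Z = pi * (R * real (n ^ CARD('d))) * nonzero_partition TYPE('d) \<theta> n"
  have Z: "Z > 0" unfolding Z_def by (rule disc_partition_pos[OF \<theta> n R])
  have D: "disc_weight \<theta> n R \<in> borel_measurable ?L" by (rule measurable_disc_weight[OF \<theta> n])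
  have iB: "(indicator B :: _ \<Rightarrow> real) \<in> borel_measurable ?L" by (rule borel_measurable_indicator[OF B])
  show "integrable ?L (\<lambda>a. disc_weight \<theta> n R a * indicator B a)"
    by (rule integrable_mult_indicator[OF B integrable_disc_weight(1)[OF \<theta> n R], unfolded real_scaleR_def, unfolded mult.commute[of "indicator B _"]])
  have "measure (disc_law \<theta> n R) B = (\<integral>a. indicator B a \<partial>disc_law \<theta> n R)"
    using B by simp
  also have "\<dots> = (\<integral>a. (disc_weight \<theta> n R a / Z) *\<^sub>R indicator B a \<partial>?L)"
    unfolding disc_law_def integrable_disc_weight(2)[OF \<theta> n R] Z_def[symmetric]
    by (rule integral_density) (use Z D iB in \<open>auto simp: disc_weight_nonneg\<close>)
  also have "\<dots> = (\<integral>a. disc_weight \<theta> n R a * indicator B a \<partial>?L) / Z" by simp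
  finally show "(\<integral>a. disc_weight \<theta> n R a * indicator B a \<partial>?L) =
      pi * (R * real (n ^ CARD('d))) * nonzero_partition TYPE('d) \<theta> n * measure (disc_law \<theta> n R) B"
    using Z unfolding Z_def[symmetric] by simp
qed

text \<open>The pointwise difference of the weights is dominated by the weight with R = 1 on two
  exceptional events. The partition functions for R = 1 and R = s have the ratio 1 / s, which
  appears in the bound.\<close>

lemma mode_disc_compare:
  fixes f :: "(int ^ 'd \<Rightarrow> complex) \<Rightarrow> complex"
  assumes f: "f \<in> borel_measurable (cspace (torus n))" "\<And>a. cmod (f a) \<le> 1" and s: "0 < s" "s \<le> 1"
  shows "cmod ((\<integral>a. f a \<partial>mode_law \<theta> n) - (\<integral>a. f a \<partial>disc_law \<theta> n s)) \<le>
    2 * (measure (disc_law \<theta> n 1) {a \<in> space (disc_law \<theta> n 1 :: (int ^ 'd \<Rightarrow> complex) measure).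
          \<epsilon> \<le> \<bar>(\<Sum>k\<in>torus n - {0}. 1 / real (n ^ CARD('d)) * (cmod (a k))\<^sup>2) - (1 - s)\<bar>} +
      measure (disc_law \<theta> n 1) {a \<in> space (disc_law \<theta> n 1 :: (int ^ 'd \<Rightarrow> complex) measure).
          \<bar>(cmod (a 0))\<^sup>2 / real (n ^ CARD('d)) - s\<bar> \<le> \<epsilon>}) / s"
proof -
  let ?L = "cspace (torus n :: (int ^ 'd) set)" and ?N = "real (n ^ CARD('d))"
  have sp: "space (disc_law \<theta> n 1 :: (int ^ 'd \<Rightarrow> complex) measure) = space ?L" by (simp add: disc_law_def del: space_cspace)
  define B1 where "B1 = {a \<in> space ?L. \<epsilon> \<le> \<bar>(\<Sum>k\<in>torus n - {0}. 1 / ?N * (cmod (a k))\<^sup>2) - (1 - s)\<bar>}"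
  define B2 where "B2 = {a \<in> space ?L. \<bar>(cmod (a 0))\<^sup>2 / ?N - s\<bar> \<le> \<epsilon>}"
  have [measurable]: "(\<lambda>a. a k) \<in> borel_measurable ?L" if "k \<in> torus n - {0}" for k :: "int ^ 'd"
    using that by (intro measurable_cspace_component) auto
  note [measurable] = measurable_zero_mode[OF \<theta> n]
  have B: "B1 \<in> sets ?L" "B2 \<in> sets ?L" unfolding B1_def B2_def by measurable
  define Z where "Z = nonzero_partition TYPE('d) \<theta> n"
  have Z: "Z > 0" unfolding Z_def by (rule nonzero_partition_pos[OF \<theta> n])
  have N: "?N > 0" using n by simp
  let ?W = "mode_weight \<theta> n :: _ \<Rightarrow> real" and ?V = "disc_weight \<theta> n s :: _ \<Rightarrow> real"
  note iW = integrable_mode_weight[OF \<theta> n, where 'd = 'd] and iW0 = integrable_disc_weight[OF \<theta> n s(1), where 'd = 'd]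
  have W0: "(\<integral>a. ?V a \<partial>?L) = pi * (s * ?N) * Z" unfolding Z_def by (rule iW0(2))
  have "(\<integral>a. \<bar>?W a - ?V a\<bar> \<partial>?L) \<le> (\<integral>a. disc_weight \<theta> n 1 a * indicator B1 a + disc_weight \<theta> n 1 a * indicator B2 a \<partial>?L)"
  proof (rule integral_mono)
    show "integrable ?L (\<lambda>a. \<bar>?W a - ?V a\<bar>)" by (intro integrable_abs Bochner_Integration.integrable_diff iW iW0(1))
    show "integrable ?L (\<lambda>a. disc_weight \<theta> n 1 a * indicator B1 a + disc_weight \<theta> n 1 a * indicator B2 a)"
      by (intro Bochner_Integration.integrable_add integral_disc_weight_indicator B) auto
    fix a assume a: "a \<in> space ?L"
    have "indicator B1 a = (indicator {a. \<epsilon> \<le> \<bar>(\<Sum>k\<in>torus n - {0}. 1 / ?N * (cmod (a k))\<^sup>2) - (1 - s)\<bar>} a :: real)"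
        "indicator B2 a = (indicator {a. \<bar>(cmod (a 0))\<^sup>2 / ?N - s\<bar> \<le> \<epsilon>} a :: real)"
      using a by (simp_all only: B1_def B2_def indicator_def mem_Collect_eq simp_thms)
    then show "\<bar>?W a - ?V a\<bar> \<le> disc_weight \<theta> n 1 a * indicator B1 a + disc_weight \<theta> n 1 a * indicator B2 a"
      using mode_disc_weight_diff[OF s(2), of a \<epsilon>] by (simp only: distrib_left)
  qed
  also have "\<dots> = (\<integral>a. disc_weight \<theta> n 1 a * indicator B1 a \<partial>?L) + (\<integral>a. disc_weight \<theta> n 1 a * indicator B2 a \<partial>?L)"
    by (intro Bochner_Integration.integral_add integral_disc_weight_indicator B) auto
  also have "\<dots> = pi * (1 * ?N) * Z * (measure (disc_law \<theta> n 1) B1 + measure (disc_law \<theta> n 1) B2)"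
    unfolding integral_disc_weight_indicator(2)[OF zero_less_one B(1)] integral_disc_weight_indicator(2)[OF zero_less_one B(2)] Z_def
    by (simp only: distrib_left)
  finally have "2 * (\<integral>a. \<bar>?W a - ?V a\<bar> \<partial>?L) / (pi * (s * ?N) * Z) \<le>
      2 * (pi * (1 * ?N) * Z * (measure (disc_law \<theta> n 1) B1 + measure (disc_law \<theta> n 1) B2)) / (pi * (s * ?N) * Z)"
    using Z s N by (intro divide_right_mono mult_left_mono mult_nonneg_nonneg) auto
  also have "\<dots> = 2 * (measure (disc_law \<theta> n 1) B1 + measure (disc_law \<theta> n 1) B2) / s"
  proof -
    define P where "P = pi * ?N * Z"
    have "P > 0" unfolding P_def using Z N by (intro mult_pos_pos) auto
    then have "2 * (P * x) / (P * s) = 2 * x / s" for x by simp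
    moreover have "pi * (1 * ?N) * Z = P" "pi * (s * ?N) * Z = P * s" by (simp_all only: P_def mult_1_left mult_ac)
    ultimately show ?thesis by (simp only:)
  qed
  finally have le: "2 * (\<integral>a. \<bar>?W a - ?V a\<bar> \<partial>?L) / (\<integral>a. ?V a \<partial>?L) \<le> 2 * (measure (disc_law \<theta> n 1) B1 + measure (disc_law \<theta> n 1) B2) / s"
    unfolding W0 .
  have "cmod ((\<integral>a. f a \<partial>mode_law \<theta> n) - (\<integral>a. f a \<partial>disc_law \<theta> n s)) \<le> 2 * (\<integral>a. \<bar>?W a - ?V a\<bar> \<partial>?L) / (\<integral>a. ?V a \<partial>?L)"
  proof -
    have "cmod ((\<integral>a. f a \<partial>density ?L (\<lambda>a. ennreal (?W a / (\<integral>a. ?W a \<partial>?L)))) -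
        (\<integral>a. f a \<partial>density ?L (\<lambda>a. ennreal (?V a / (\<integral>a. ?V a \<partial>?L))))) \<le>
        2 * (\<integral>a. \<bar>?W a - ?V a\<bar> \<partial>?L) / (\<integral>a. ?V a \<partial>?L)"
    proof (rule normalized_weight_compare[OF f])
      have "0 < (\<integral>a. ?W a \<partial>?L)" using mode_partition_pos[OF \<theta> n, where 'd = 'd] by (simp only: mode_partition_def)
      then show "0 < integral\<^sup>L ?L ?W" .
      have "0 < (\<integral>a. ?V a \<partial>?L)" unfolding iW0(2) by (rule disc_partition_pos[OF \<theta> n s(1)])
      then show "0 < integral\<^sup>L ?L ?V" .
      show "integrable ?L ?W" by (rule iW)
      show "integrable ?L ?V" by (rule iW0(1))
      show "0 \<le> ?W a" for a by (simp add: mode_weight_def)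
      show "0 \<le> ?V a" for a by (rule disc_weight_nonneg)
    qed
    then show ?thesis by (simp only: mode_law_def mode_partition_def disc_law_def)
  qed
  also note le
  finally show ?thesis unfolding sp B1_def B2_def .
qed

lemma disc_law_annulus:
  assumes \<epsilon>: "0 < \<epsilon>" "2 * \<epsilon> \<le> s"
  shows "measure (disc_law \<theta> n 1) {a \<in> space (disc_law \<theta> n 1 :: (int ^ 'd \<Rightarrow> complex) measure).
    \<bar>(cmod (a 0))\<^sup>2 / real (n ^ CARD('d::finite)) - s\<bar> \<le> \<epsilon>} \<le> 3 * \<epsilon>"
proof -
  let ?M = "disc_law \<theta> n 1 :: (int ^ 'd \<Rightarrow> complex) measure"
  define N where "N = real (n ^ CARD('d))"
  have N: "N > 0" using n by (simp add: N_def)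
  let ?g = "\<lambda>a :: int ^ 'd \<Rightarrow> complex. a 0 / of_real (sqrt N)"
  let ?A = "{u :: complex. \<bar>(cmod u)\<^sup>2 - s\<bar> \<le> \<epsilon>}"
  have "measurable ?M (borel :: complex measure) = measurable (cspace (torus n)) borel"
    by (rule measurable_cong_sets) simp_all
  moreover have "?g \<in> borel_measurable (cspace (torus n))"
    by (intro borel_measurable_divide measurable_zero_mode[OF \<theta> n] borel_measurable_const)
  ultimately have g: "?g \<in> borel_measurable ?M" by (simp only:)
  have A: "?A \<in> sets borel" by measurable
  have "(cmod (?g a))\<^sup>2 = (cmod (a 0))\<^sup>2 / N" for a
    using N by (simp add: norm_divide power_divide)
  then have "{a \<in> space ?M. \<bar>(cmod (a 0))\<^sup>2 / N - s\<bar> \<le> \<epsilon>} = ?g -` ?A \<inter> space ?M"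
    by auto
  then have "measure ?M {a \<in> space ?M. \<bar>(cmod (a 0))\<^sup>2 / N - s\<bar> \<le> \<epsilon>} = measure (distr ?M borel ?g) ?A"
    by (simp only: measure_distr[OF g A])
  also have "distr ?M borel ?g = uniform_disc 1"
    using distr_disc_law_zero_mode[OF \<theta> n zero_less_one, where 'd = 'd] by (simp only: N_def real_sqrt_one)
  also have "measure (uniform_disc 1) ?A \<le> 3 * \<epsilon>" by (rule uniform_disc_annulus[OF \<epsilon>])
  finally show ?thesis unfolding N_def .
qed

lemma rate_ge: "k \<in> torus n - {0 :: int ^ 'd} \<Longrightarrow> 4 * \<theta> / (real n)\<^sup>2 \<le> \<theta> * eigval n k"
  using mult_left_mono[OF eigval_ge[OF n, of k], of \<theta>] \<theta> by (simp add: mult.commute)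

text \<open>Without a mass the smallest rate is 4 \<theta> / n^2, so the concentration exponent is
  only of order N / n^2. Half of \<epsilon> is spent on the distance of the mean from
  \<open>\<rho>\<close>, the other half on the fluctuation.\<close>

lemma disc_law_mass_fluctuation:
  assumes \<epsilon>: "0 < \<epsilon>" "\<epsilon> \<le> 1"
    and mean: "\<bar>(\<Sum>k\<in>torus n - {0 :: int ^ 'd}. 1 / real (n ^ CARD('d)) / (\<theta> * eigval n k)) - \<rho>\<bar> \<le> \<epsilon> / 2"
      "(\<Sum>k\<in>torus n - {0 :: int ^ 'd}. 1 / real (n ^ CARD('d)) / (\<theta> * eigval n k)) \<le> 1"
  shows "measure (disc_law \<theta> n 1) {a \<in> space (disc_law \<theta> n 1 :: (int ^ 'd \<Rightarrow> complex) measure).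
      \<epsilon> \<le> \<bar>(\<Sum>k\<in>torus n - {0}. 1 / real (n ^ CARD('d)) * (cmod (a k))\<^sup>2) - \<rho>\<bar>} \<le>
    2 * exp (- (\<theta> * \<epsilon>\<^sup>2 / 8) * (real (n ^ CARD('d)) / (real n)\<^sup>2))"
proof -
  let ?M = "disc_law \<theta> n 1 :: (int ^ 'd \<Rightarrow> complex) measure"
  interpret prob_space ?M by (rule prob_space_disc_law[OF \<theta> n]) simp
  define N where "N = real (n ^ CARD('d))"
  have N: "N > 0" using n by (simp add: N_def)
  let ?K = "torus n - {0 :: int ^ 'd}"
  define q where "q = (\<lambda>_ :: int ^ 'd. 1 / N)"
  define r where "r = (\<Sum>k\<in>?K. q k / (\<theta> * eigval n k))"
  have r: "\<bar>r - \<rho>\<bar> \<le> \<epsilon> / 2" "r \<le> 1" using mean by (simp_all only: r_def q_def N_def)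
  let ?S = "\<lambda>a :: int ^ 'd \<Rightarrow> complex. \<Sum>k\<in>?K. q k * (cmod (a k))\<^sup>2"
  have "(\<Sum>k\<in>?K. 1 / (\<theta> * eigval n k)) = N * r"
    unfolding r_def q_def sum_distrib_left using N by (intro sum.cong) auto
  then have N1: "(\<Sum>k\<in>?K. 1 / (\<theta> * eigval n k)) \<le> N" using r(2) N by (simp add: mult_left_le)
  have "emeasure ?M {a \<in> space ?M. \<epsilon> / 2 \<le> \<bar>?S a - r\<bar>} \<le>
      ennreal (2 * 1 * exp (- (4 * \<theta> / (real n)\<^sup>2) * N * (\<epsilon> / 2)\<^sup>2 / (8 * 1\<^sup>2)))"
    unfolding r_def
  proof (rule quadratic_concentration[where T = "torus n"])
    show "exp_moment_bound ?M ?K (\<lambda>k. \<theta> * eigval n k) 1" by (rule exp_moment_bound_disc_law[OF \<theta> n]) simp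
    show "0 < 4 * \<theta> / (real n)\<^sup>2" using \<theta> n by simp
    show "4 * \<theta> / (real n)\<^sup>2 \<le> \<theta> * eigval n k" if "k \<in> ?K" for k by (rule rate_ge[OF that])
  qed (use N N1 \<epsilon> in \<open>auto simp: q_def\<close>)
  then have "measure ?M {a \<in> space ?M. \<epsilon> / 2 \<le> \<bar>?S a - r\<bar>} \<le> 2 * exp (- (4 * \<theta> / (real n)\<^sup>2) * N * (\<epsilon> / 2)\<^sup>2 / 8)"
    unfolding emeasure_eq_measure by (subst (asm) ennreal_le_iff) simp_all
  also have "- (4 * \<theta> / (real n)\<^sup>2) * N * (\<epsilon> / 2)\<^sup>2 / 8 = - (\<theta> * \<epsilon>\<^sup>2 / 8) * (N / (real n)\<^sup>2)"
    by (simp add: power_divide mult_ac)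
  finally have b: "measure ?M {a \<in> space ?M. \<epsilon> / 2 \<le> \<bar>?S a - r\<bar>} \<le> 2 * exp (- (\<theta> * \<epsilon>\<^sup>2 / 8) * (N / (real n)\<^sup>2))" .
  have "measure ?M {a \<in> space ?M. \<epsilon> \<le> \<bar>?S a - \<rho>\<bar>} \<le> measure ?M {a \<in> space ?M. \<epsilon> / 2 \<le> \<bar>?S a - r\<bar>}"
  proof (rule finite_measure_mono)
    have "\<epsilon> / 2 \<le> \<bar>S - r\<bar>" if "\<epsilon> \<le> \<bar>S - \<rho>\<bar>" for S using that r(1) by linarith
    then show "{a \<in> space ?M. \<epsilon> \<le> \<bar>?S a - \<rho>\<bar>} \<subseteq> {a \<in> space ?M. \<epsilon> / 2 \<le> \<bar>?S a - r\<bar>}" by blast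
    have c: "(\<lambda>a. a k) \<in> borel_measurable (cspace (torus n))" if "k \<in> ?K" for k :: "int ^ 'd"
      using that by (intro measurable_cspace_component) auto
    have "?S \<in> borel_measurable (cspace (torus n))"
      by (intro borel_measurable_sum borel_measurable_times borel_measurable_const borel_measurable_power
          measurable_compose[OF c borel_measurable_norm])
    moreover have "borel_measurable ?M = (borel_measurable (cspace (torus n)) :: ((int ^ 'd \<Rightarrow> complex) \<Rightarrow> real) set)"
      by (rule measurable_cong_sets) simp_all
    ultimately have S: "?S \<in> borel_measurable ?M" by (simp only:)
    have "(\<lambda>u. \<bar>u - r\<bar>) \<in> borel_measurable borel" by (intro borel_measurable_continuous_onI continuous_intros)
    from measurable_compose[OF S this] have "(\<lambda>a. \<bar>?S a - r\<bar>) \<in> borel_measurable ?M" .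
    then show "{a \<in> space ?M. \<epsilon> / 2 \<le> \<bar>?S a - r\<bar>} \<in> sets ?M" unfolding borel_measurable_iff_ge by (rule spec)
  qed
  with b show ?thesis unfolding q_def N_def by (rule order_trans[rotated])
qed

end

text \<open>With y = n^(d - 2) the exponent is linear in y, and N \<le> y^3 since d \<le> 3 (d - 2)
  for d \<ge> 3.\<close>

lemma tendsto_volume_exp:
  assumes d: "CARD('d::finite) \<ge> 3" and b: "b > 0"
  shows "(\<lambda>n. real (n ^ CARD('d)) * exp (- b * (real (n ^ CARD('d)) / (real n)\<^sup>2))) \<longlonglongrightarrow> 0"
proof -
  let ?y = "\<lambda>n. real n ^ (CARD('d) - 2)"
  have ge: "\<forall>\<^sub>F n in sequentially. real n \<le> ?y n"
    using eventually_ge_at_top[of 1] by eventually_elim (use d in \<open>auto intro!: self_le_power\<close>)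
  have "filterlim (\<lambda>n. b * ?y n) at_top sequentially"
    using b by (intro filterlim_tendsto_pos_mult_at_top[OF tendsto_const] filterlim_at_top_mono[OF filterlim_real_sequentially ge])
  then have "(\<lambda>n. (b * ?y n) ^ 3 / exp (b * ?y n)) \<longlonglongrightarrow> 0" by (rule filterlim_compose[OF tendsto_power_div_exp_0])
  then have lim: "(\<lambda>n. 1 / b ^ 3 * ((b * ?y n) ^ 3 / exp (b * ?y n))) \<longlonglongrightarrow> 0" by (rule tendsto_mult_right_zero)
  show ?thesis
  proof (rule tendsto_sandwich[OF _ _ tendsto_const lim])
    show "\<forall>\<^sub>F n in sequentially. real (n ^ CARD('d)) * exp (- b * (real (n ^ CARD('d)) / (real n)\<^sup>2)) \<le>
        1 / b ^ 3 * ((b * ?y n) ^ 3 / exp (b * ?y n))"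
      using eventually_ge_at_top[of 1]
    proof eventually_elim
      case (elim n)
      have "CARD('d) - 2 + 2 = CARD('d)" using d by simp
      then have "real n ^ CARD('d) = ?y n * (real n)\<^sup>2" by (simp only: power_add[symmetric])
      then have y: "real (n ^ CARD('d)) / (real n)\<^sup>2 = ?y n" using elim by simp
      have "real n ^ CARD('d) \<le> real n ^ ((CARD('d) - 2) * 3)" using elim d by (intro power_increasing) auto
      then have "real (n ^ CARD('d)) \<le> ?y n ^ 3" by (simp add: power_mult)
      then have "real (n ^ CARD('d)) * exp (- (b * ?y n)) \<le> ?y n ^ 3 * exp (- (b * ?y n))" by (intro mult_right_mono) auto
      also have "\<dots> = 1 / b ^ 3 * ((b * ?y n) ^ 3 / exp (b * ?y n))"
        using b by (simp add: power_mult_distrib exp_minus divide_inverse)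
      finally show ?case unfolding y by simp
    qed
  qed simp
qed

lemma supercritical_char_limit:
  fixes A :: "(int ^ 'd) set"
  assumes d: "CARD('d) \<ge> 3" and \<theta>: "\<theta> > 0" "green_const TYPE('d) < \<theta>"
  shows "(\<lambda>n. \<integral>a. (\<Prod>k\<in>torus n. cis (Re (amplitude A c n k * a k))) \<partial>mode_law \<theta> n)
    \<longlonglongrightarrow> (\<integral>u. cis (Re ((\<Sum>x\<in>A. c x) * u)) \<partial>uniform_disc (sqrt (1 - green_const TYPE('d) / \<theta>))) *
      complex_of_real (exp (- (covariance_form 0 A c / \<theta>) / 4))"
proof (rule LIMSEQ_I)
  fix e :: real assume e: "e > 0"
  let ?F = "power_symbol A c"
  define \<rho> s V where "\<rho> = green_const TYPE('d) / \<theta>" and "s = 1 - \<rho>" and "V = covariance_form 0 A c / \<theta>"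
  define j where "j = (\<Sum>x\<in>A. c x)"
  define J where "J = (\<integral>u. cis (Re (j * u)) \<partial>uniform_disc (sqrt s))"
  have "\<rho> > 0" "\<rho> < 1" unfolding \<rho>_def green_const_eq[OF d]
    using green_integral_pos[OF d] \<theta> by (simp_all add: green_const_eq[OF d])
  then have s: "0 < s" "s \<le> 1" and \<rho>s: "\<rho> = 1 - s" by (simp_all add: s_def)
  define B where "B = max 1 ((\<Sum>x\<in>A. cmod (c x))\<^sup>2)"
  have B: "B \<ge> 1" "?F \<kappa> \<le> B" for \<kappa> using power_symbol_le[of A c \<kappa>] by (auto simp: B_def)
  have FB: "\<bar>?F \<kappa>\<bar> \<le> B" for \<kappa> using B(2)[of \<kappa>] power_symbol_nonneg[of A c \<kappa>] by simp
  have B0: "B > 0" using B(1) by linarith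
  have B2: "B\<^sup>2 > 0" using B by (intro zero_less_power) auto
  define \<delta> where "\<delta> = min 1 (e / (12 * B\<^sup>2))"
  have \<delta>: "0 < \<delta>" "\<delta> \<le> 1" using e B2 by (auto simp: \<delta>_def)
  have "\<delta> \<le> e / (12 * B\<^sup>2)" by (simp add: \<delta>_def)
  then have \<delta>e: "3 * B\<^sup>2 * \<delta> \<le> e / 4" using B2 by (simp add: field_simps)
  \<comment> \<open>The first bound makes the annulus estimate applicable; the second compensates
    the factor 1 / s in the comparison of the two laws.\<close>
  define \<epsilon> where "\<epsilon> = min (s / 2) (e * s / 24)"
  have "\<epsilon> \<le> s / 2" "\<epsilon> \<le> e * s / 24" "0 < \<epsilon>" using e s by (simp_all add: \<epsilon>_def)
  then have \<epsilon>: "0 < \<epsilon>" "2 * \<epsilon> \<le> s" "\<epsilon> \<le> 1" "\<epsilon> \<le> e * s / 24" using s by linarith+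
  let ?N = "\<lambda>n. real (n ^ CARD('d))"
  let ?K = "\<lambda>n. torus n - {0 :: int ^ 'd}"
  \<comment> \<open>The term of the zero mode is a quotient by 0, hence 0, so the limit theorem for
    sums over the whole torus applies to the nonzero modes.\<close>
  have split0: "(\<Sum>k\<in>torus n. f k / (eigval n k + 0)) / ?N n / \<theta> = (\<Sum>k\<in>?K n. f k / ?N n / (\<theta> * eigval n k))"
    if "n > 0" for f :: "int ^ 'd \<Rightarrow> real" and n
  proof -
    have "(\<Sum>k\<in>torus n. f k / eigval n k) = (\<Sum>k\<in>?K n. f k / eigval n k)"
      by (subst sum.remove[OF finite_torus zero_in_torus[OF \<theta>(1) that]]) (simp add: eigval_def)
    then show ?thesis by (simp add: sum_divide_distrib mult_ac)
  qed
  let ?r = "\<lambda>n. \<Sum>k\<in>?K n. 1 / ?N n / (\<theta> * eigval n k)"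
  have "(\<lambda>n. (\<Sum>k\<in>torus n. 1 / (eigval n (k :: int ^ 'd) + 0)) / ?N n / \<theta>) \<longlonglongrightarrow> \<rho>"
    unfolding \<rho>_def green_const_eq[OF d] green_integral_def using \<theta>
    by (intro tendsto_divide tendsto_const green_riemann_limit[OF d, where F = "\<lambda>_. 1" and C = 1]) auto
  moreover have "\<forall>\<^sub>F n in sequentially. (\<Sum>k\<in>torus n. 1 / (eigval n (k :: int ^ 'd) + 0)) / ?N n / \<theta> = ?r n"
    using eventually_gt_at_top[of 0] by eventually_elim (rule split0)
  ultimately have r: "?r \<longlonglongrightarrow> \<rho>" by (rule Lim_transform_eventually)
  have r1: "\<forall>\<^sub>F n in sequentially. dist (?r n) \<rho> < \<epsilon> / 2" using \<epsilon> by (intro tendstoD[OF r]) simp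
  let ?s = "\<lambda>n. \<Sum>k\<in>?K n. (cmod (amplitude A c n k))\<^sup>2 / (\<theta> * eigval n k)"
  have "(\<lambda>n. (\<Sum>k\<in>torus n. ?F (scaled n k) / (eigval n (k :: int ^ 'd) + 0)) / ?N n / \<theta>) \<longlonglongrightarrow> V"
    unfolding V_def green_integral_power_symbol[OF d order_refl, symmetric] green_integral_def using \<theta>
    by (intro tendsto_divide tendsto_const green_riemann_limit[OF d order_refl continuous_power_symbol FB]) auto
  moreover have "\<forall>\<^sub>F n in sequentially. (\<Sum>k\<in>torus n. ?F (scaled n k) / (eigval n (k :: int ^ 'd) + 0)) / ?N n / \<theta> = ?s n"
    using eventually_gt_at_top[of 0]
    by eventually_elim (simp only: split0 amplitude_power_symbol)
  ultimately have "?s \<longlonglongrightarrow> V" by (rule Lim_transform_eventually)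
  from tendsto_exp[OF tendsto_divide[OF tendsto_minus[OF this] tendsto_const[of 4]]]
  have "(\<lambda>n. exp (- ?s n / 4)) \<longlonglongrightarrow> exp (- V / 4)" by simp
  then have s1: "\<forall>\<^sub>F n in sequentially. dist (exp (- ?s n / 4)) (exp (- V / 4)) < e / 8"
    using e by (intro tendstoD) auto
  have x1: "\<forall>\<^sub>F n in sequentially. ?N n * exp (- (\<theta> * \<epsilon>\<^sup>2 / 8) * (?N n / (real n)\<^sup>2)) < e * s / 32"
    using e s \<theta> \<epsilon> by (intro order_tendstoD(2)[OF tendsto_volume_exp[OF d]] divide_pos_pos mult_pos_pos zero_less_power) auto
  have x2: "\<forall>\<^sub>F n in sequentially. ?N n * exp (- (\<theta> * \<delta>\<^sup>2 / (2 * B\<^sup>2)) * (?N n / (real n)\<^sup>2)) < e / 64"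
    using e \<theta> \<delta> B0 by (intro order_tendstoD(2)[OF tendsto_volume_exp[OF d]] divide_pos_pos mult_pos_pos zero_less_power) auto
  have "\<forall>\<^sub>F n in sequentially. norm ((\<integral>a. (\<Prod>k\<in>torus n. cis (Re (amplitude A c n k * a k))) \<partial>mode_law \<theta> n) -
      J * complex_of_real (exp (- V / 4))) < e"
    using r1 s1 x1 x2 eventually_ge_at_top[of 1] order_tendstoD(2)[OF r \<open>\<rho> < 1\<close>]
  proof eventually_elim
    case (elim n)
    have n: "n > 0" using elim by simp
    have N: "?N n \<ge> 1" using n by (simp add: one_le_power)
    let ?L = "cspace (torus n :: (int ^ 'd) set)"
    let ?D = "disc_law \<theta> n s :: (int ^ 'd \<Rightarrow> complex) measure"
    let ?f = "\<lambda>a. \<Prod>k\<in>torus n. cis (Re (amplitude A c n k * a k))"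
    let ?g = "\<lambda>a. cis (Re (amplitude A c n 0 * a 0))"
    have char_meas: "(\<lambda>u. cis (Re (z * u))) \<in> borel_measurable borel" for z
      by (intro borel_measurable_continuous_onI continuous_intros)
    have comp: "(\<lambda>a. cis (Re (z * a k))) \<in> borel_measurable ?L" if "k \<in> torus n" for z and k :: "int ^ 'd"
      by (rule measurable_compose[OF measurable_cspace_component[OF that] char_meas])
    have f: "?f \<in> borel_measurable ?L" by (intro borel_measurable_prod comp)
    have f1: "cmod (?f a) \<le> 1" for a by (simp add: prod_norm[symmetric])
    have z: "(0 :: int ^ 'd) \<in> torus n" by (rule zero_in_torus[OF \<theta>(1) n])
    have fg: "?f a = ?g a * (\<Prod>k\<in>?K n. cis (Re (amplitude A c n k * a k)))" for a
      by (rule prod.remove[OF finite_torus z])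
    interpret D: prob_space ?D by (rule prob_space_disc_law[OF \<theta>(1) n s(1)])
    \<comment> \<open>The constant mode has the value 1 / sqrt N, so the zero mode enters precisely
      through the rescaled variable whose law is the uniform disc.\<close>
    have amp0: "amplitude A c n 0 = j / of_real (sqrt (?N n))"
      by (simp add: amplitude_def j_def fmode_def zdot_def sum_divide_distrib)
    have Jg: "J = (\<integral>a. ?g a \<partial>?D)"
    proof -
      have "measurable ?D (borel :: complex measure) = measurable ?L borel" by (rule measurable_cong_sets) simp_all
      moreover have "(\<lambda>a. a 0 / of_real (sqrt (?N n))) \<in> borel_measurable ?L"
        by (intro borel_measurable_divide measurable_zero_mode[OF \<theta>(1) n] borel_measurable_const)
      ultimately have m: "(\<lambda>a. a 0 / of_real (sqrt (?N n))) \<in> borel_measurable ?D" by (simp only:)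
      have "J = (\<integral>a. cis (Re (j * (a 0 / of_real (sqrt (?N n))))) \<partial>?D)"
        unfolding J_def distr_disc_law_zero_mode[OF \<theta>(1) n s(1), where 'd = 'd, symmetric] by (rule integral_distr[OF m char_meas])
      then show ?thesis unfolding amp0 by (simp only: times_divide_eq_left times_divide_eq_right)
    qed
    have J1: "cmod J \<le> 1"
      unfolding Jg by (rule order_trans[OF integral_norm_bound]) (simp add: D.prob_space)
    have "cmod ((\<integral>a. ?f a \<partial>mode_law \<theta> n) - (\<integral>a. ?f a \<partial>?D)) \<le>
        2 * (2 * exp (- (\<theta> * \<epsilon>\<^sup>2 / 8) * (?N n / (real n)\<^sup>2)) + 3 * \<epsilon>) / s"
    proof (rule order_trans[OF mode_disc_compare[OF \<theta>(1) n f f1 s, where \<epsilon> = \<epsilon>]])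
      have "\<bar>?r n - (1 - s)\<bar> \<le> \<epsilon> / 2" using elim(1) unfolding \<rho>s dist_real_def by linarith
      moreover have "?r n \<le> 1" using elim(6) by linarith
      ultimately show "2 * (measure (disc_law \<theta> n 1) {a \<in> space (disc_law \<theta> n 1).
          \<epsilon> \<le> \<bar>(\<Sum>k\<in>?K n. 1 / ?N n * (cmod (a k))\<^sup>2) - (1 - s)\<bar>} +
        measure (disc_law \<theta> n 1) {a \<in> space (disc_law \<theta> n 1 :: (int ^ 'd \<Rightarrow> complex) measure).
          \<bar>(cmod (a 0))\<^sup>2 / ?N n - s\<bar> \<le> \<epsilon>}) / s \<le>
        2 * (2 * exp (- (\<theta> * \<epsilon>\<^sup>2 / 8) * (?N n / (real n)\<^sup>2)) + 3 * \<epsilon>) / s"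
        using s by (intro divide_right_mono mult_left_mono add_mono disc_law_annulus[OF \<theta>(1) n \<epsilon>(1,2)]
            disc_law_mass_fluctuation[OF \<theta>(1) n \<epsilon>(1,3)]) auto
    qed
    also have "\<dots> \<le> 2 * (3 * (e * s / 16)) / s"
    proof (intro divide_right_mono mult_left_mono)
      have "1 * exp (- (\<theta> * \<epsilon>\<^sup>2 / 8) * (?N n / (real n)\<^sup>2)) \<le> ?N n * exp (- (\<theta> * \<epsilon>\<^sup>2 / 8) * (?N n / (real n)\<^sup>2))"
        using N by (intro mult_right_mono) auto
      then have "exp (- (\<theta> * \<epsilon>\<^sup>2 / 8) * (?N n / (real n)\<^sup>2)) \<le> e * s / 32" using elim(3) unfolding mult_1_left by linarith
      then show "2 * exp (- (\<theta> * \<epsilon>\<^sup>2 / 8) * (?N n / (real n)\<^sup>2)) + 3 * \<epsilon> \<le> 3 * (e * s / 16)" using \<epsilon>(4) by linarith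
    qed (use s in auto)
    also have "\<dots> = 3 / 8 * e" using s by simp
    finally have 1: "cmod ((\<integral>a. ?f a \<partial>mode_law \<theta> n) - (\<integral>a. ?f a \<partial>?D)) \<le> 3 / 8 * e" .
    have "exp_moment_bound ?D (?K n) (\<lambda>k. \<theta> * eigval n k) 1" by (rule exp_moment_bound_disc_law[OF \<theta>(1) n s(1)])
    then have "cmod ((\<integral>a. ?g a * (\<Prod>k\<in>?K n. cis (Re (amplitude A c n k * a k))) \<partial>?D) -
        (\<integral>a. ?g a \<partial>?D) * complex_of_real (exp (- ?s n / 4))) \<le>
        3 * B\<^sup>2 * \<delta> + 8 * 1 * ?N n * exp (- (4 * \<theta> / (real n)\<^sup>2) * ?N n * \<delta>\<^sup>2 / (8 * B\<^sup>2))"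
    proof (rule gaussian_approximation[rotated 5])
      show "quarter_turn_invariant ?D (torus n) (?K n)" by (rule disc_law_quarter_turn[OF \<theta>(1) n])
      show "prob_space ?D" by (rule D.prob_space_axioms)
      show "?g \<in> borel_measurable ?L" by (rule comp[OF z])
      show "(cmod (amplitude A c n k))\<^sup>2 \<le> B / ?N n" for k
        unfolding amplitude_power_symbol[OF n] using B by (intro divide_right_mono) auto
      show "4 * \<theta> / (real n)\<^sup>2 \<le> \<theta> * eigval n k" if "k \<in> ?K n" for k by (rule rate_ge[OF \<theta>(1) n that])
      show "0 < 4 * \<theta> / (real n)\<^sup>2" using \<theta> n by simp
      have "(\<Sum>k\<in>?K n. 1 / (\<theta> * eigval n k)) = ?N n * ?r n"
        unfolding sum_distrib_left using N n by (intro sum.cong) auto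
      also have "\<dots> \<le> ?N n * 1" using elim(6) by (intro mult_left_mono) auto
      finally show "(\<Sum>k\<in>?K n. 1 / (\<theta> * eigval n k)) \<le> ?N n" unfolding mult_1_right .
      have "card (?K n) \<le> card (torus n :: (int ^ 'd) set)" by (intro card_mono) auto
      then show "real (card (?K n)) \<le> ?N n" unfolding card_torus by (simp only: of_nat_le_iff)
    qed (use N B \<delta> in auto)
    also have "- (4 * \<theta> / (real n)\<^sup>2) * ?N n * \<delta>\<^sup>2 / (8 * B\<^sup>2) = - (\<theta> * \<delta>\<^sup>2 / (2 * B\<^sup>2)) * (?N n / (real n)\<^sup>2)"
    proof -
      have "- (4 * \<theta> / u) * v * w / (8 * b) = - (\<theta> * w / (2 * b)) * (v / u)" for u v w b :: real
        by (cases "u = 0"; cases "b = 0") (simp_all add: field_simps)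
      then show ?thesis .
    qed
    also have "3 * B\<^sup>2 * \<delta> + 8 * 1 * ?N n * exp (- (\<theta> * \<delta>\<^sup>2 / (2 * B\<^sup>2)) * (?N n / (real n)\<^sup>2)) \<le> 3 / 8 * e"
      using \<delta>e elim(4) unfolding mult_1_right mult.assoc[of 8] by linarith
    finally have 2: "cmod ((\<integral>a. ?f a \<partial>?D) - J * complex_of_real (exp (- ?s n / 4))) \<le> 3 / 8 * e"
      unfolding fg Jg .
    have "cmod (J * complex_of_real (exp (- ?s n / 4)) - J * complex_of_real (exp (- V / 4))) =
        cmod J * dist (exp (- ?s n / 4)) (exp (- V / 4))"
      unfolding right_diff_distrib[symmetric] norm_mult of_real_diff[symmetric] norm_of_real dist_real_def ..
    also have "\<dots> \<le> 1 * (e / 8)" using J1 elim(2) by (intro mult_mono) auto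
    finally have 3: "cmod (J * complex_of_real (exp (- ?s n / 4)) - J * complex_of_real (exp (- V / 4))) \<le> e / 8" by simp
    have "cmod ((\<integral>a. ?f a \<partial>mode_law \<theta> n) - J * complex_of_real (exp (- V / 4))) \<le> 3 / 8 * e + 3 / 8 * e + e / 8"
      using norm_diff_triangle_le[OF norm_diff_triangle_le[OF 1 2] 3] .
    then show ?case using e by linarith
  qed
  then show "\<exists>no. \<forall>n\<ge>no. norm ((\<integral>a. (\<Prod>k\<in>torus n. cis (Re (amplitude A c n k * a k))) \<partial>mode_law \<theta> n) -
      (\<integral>u. cis (Re ((\<Sum>x\<in>A. c x) * u)) \<partial>uniform_disc (sqrt (1 - green_const TYPE('d) / \<theta>))) *
      complex_of_real (exp (- (covariance_form 0 A c / \<theta>) / 4))) < e"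
    unfolding J_def j_def V_def s_def \<rho>_def by (simp add: eventually_sequentially)
qed

section \<open>Local weak limits\<close>

lemma cis_sum: "finite K \<Longrightarrow> cis (sum f K) = (\<Prod>k\<in>K. cis (f k))"
  by (induction rule: finite_induct) (simp_all flip: cis_mult)

text \<open>The characteristic functional of the field at sites of A is a product over modes, which
  is the form required by the quarter-turn average.\<close>

lemma cis_rpair_fourier:
  fixes A :: "(int ^ 'd) set"
  assumes n: "n > 0"
  shows "cis (rpair A c (\<lambda>x\<in>A. fourier n a (reduce n x))) = (\<Prod>k\<in>torus n. cis (Re (amplitude A c n k * a k)))"
proof -
  have "rpair A c (\<lambda>x\<in>A. fourier n a (reduce n x)) = (\<Sum>x\<in>A. \<Sum>k\<in>torus n. Re (c x * fmode n k x * a k))"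
    unfolding rpair_def
  proof (rule sum.cong[OF refl])
    fix x assume "x \<in> A"
    then have "c x * (\<lambda>x\<in>A. fourier n a (reduce n x)) x = (\<Sum>k\<in>torus n. c x * fmode n k x * a k)"
      using reduce_in_torus[OF n, of x] by (simp add: fourier_def fmode_reduce[OF n] sum_distrib_left mult_ac)
    then show "Re (c x * (\<lambda>x\<in>A. fourier n a (reduce n x)) x) = (\<Sum>k\<in>torus n. Re (c x * fmode n k x * a k))"
      by (simp only: Re_sum)
  qed
  also have "\<dots> = (\<Sum>k\<in>torus n. \<Sum>x\<in>A. Re (c x * fmode n k x * a k))" by (rule sum.swap)
  also have "\<dots> = (\<Sum>k\<in>torus n. Re (amplitude A c n k * a k))"
    by (simp only: amplitude_def sum_distrib_right Re_sum)
  finally show ?thesis by (simp only: cis_sum[OF finite_torus])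
qed

lemma measurable_torus_restrict:
  fixes A :: "(int ^ 'd) set"
  assumes "n > 0"
  shows "(\<lambda>\<psi>. \<lambda>x\<in>A. \<psi> (reduce n x)) \<in> measurable (cspace (torus n)) (Pi\<^sub>M A (\<lambda>_. borel :: complex measure))"
  by (intro measurable_restrict measurable_cspace_component reduce_in_torus assms)

text \<open>Chebyshev's inequality with the second moment bounded by 1.\<close>

lemma mode_law_tail:
  fixes x :: "int ^ 'd"
  assumes \<theta>: "\<theta> > 0" and n: "n > 0" and x: "x \<in> torus n" and R: "R > 0"
  shows "{a \<in> space (mode_law \<theta> n). R < cmod (fourier n a x)} \<in> sets (mode_law \<theta> n)"
    and "measure (mode_law \<theta> n) {a \<in> space (mode_law \<theta> n). R < cmod (fourier n a x)} \<le> 1 / R\<^sup>2"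
proof -
  let ?M = "mode_law \<theta> n :: (int ^ 'd \<Rightarrow> complex) measure"
  let ?S = "{a \<in> space ?M. R < cmod (fourier n a x)}"
  interpret prob_space ?M by (rule prob_space_mode_law[OF \<theta> n])
  have "measurable ?M (borel :: complex measure) = measurable (cspace (torus n)) borel"
    by (rule measurable_cong_sets) simp_all
  then have "(\<lambda>a. fourier n a x) \<in> borel_measurable ?M"
    using measurable_compose[OF measurable_fourier measurable_cspace_component[OF x]] by (simp only:)
  from measurable_compose[OF this borel_measurable_norm]
  have f: "(\<lambda>a. cmod (fourier n a x)) \<in> borel_measurable ?M" .
  then show S: "?S \<in> sets ?M" unfolding borel_measurable_iff_greater by (rule spec)
  have f2: "(\<lambda>a. ennreal ((cmod (fourier n a x))\<^sup>2)) \<in> borel_measurable ?M"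
    by (rule measurable_compose[OF borel_measurable_power[OF f] measurable_ennreal])
  have "emeasure ?M ?S = (\<integral>\<^sup>+a. indicator ?S a \<partial>?M)" by (rule nn_integral_indicator[OF S, symmetric])
  also have "\<dots> \<le> (\<integral>\<^sup>+a. ennreal (1 / R\<^sup>2) * ennreal ((cmod (fourier n a x))\<^sup>2) \<partial>?M)"
  proof (rule nn_integral_mono)
    fix a
    show "indicator ?S a \<le> ennreal (1 / R\<^sup>2) * ennreal ((cmod (fourier n a x))\<^sup>2)"
    proof (cases "a \<in> ?S")
      case True
      then have "R\<^sup>2 \<le> (cmod (fourier n a x))\<^sup>2" using R by (intro power_mono) auto
      then have "1 \<le> 1 / R\<^sup>2 * (cmod (fourier n a x))\<^sup>2" using R by (simp add: field_simps)
      then show ?thesis using True by (simp flip: ennreal_mult)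
    qed auto
  qed
  also have "\<dots> = ennreal (1 / R\<^sup>2) * (\<integral>\<^sup>+a. ennreal ((cmod (fourier n a x))\<^sup>2) \<partial>?M)"
    by (rule nn_integral_cmult[OF f2])
  also have "\<dots> \<le> ennreal (1 / R\<^sup>2) * 1"
    by (intro mult_left_mono mode_law_second_moment \<theta> n x) auto
  finally show "measure ?M ?S \<le> 1 / R\<^sup>2"
    unfolding emeasure_eq_measure mult_1_right using R by (subst (asm) ennreal_le_iff) auto
qed

text \<open>Tightness follows from the second moments in the same way for every \<theta> > 0, so
  both regimes reduce to convergence of characteristic functions.\<close>

lemma local_weak_conv_of_char:
  fixes X :: "'w \<Rightarrow> int ^ 'd \<Rightarrow> complex"
  assumes \<theta>: "\<theta> > 0" and M: "prob_space M" and X: "\<And>x. (\<lambda>\<omega>. X \<omega> x) \<in> borel_measurable M"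
    and char: "\<And>A c. finite A \<Longrightarrow> (\<lambda>n. \<integral>a. (\<Prod>k\<in>torus n. cis (Re (amplitude A c n k * a k))) \<partial>mode_law \<theta> n)
      \<longlonglongrightarrow> (\<integral>\<omega>. cis (rpair A c (X \<omega>)) \<partial>M)"
  shows "local_weak_conv (spherical_law \<theta>) M X"
  unfolding local_weak_conv_def
proof (intro allI impI)
  fix A :: "(int ^ 'd) set" assume A: "finite A"
  let ?P = "Pi\<^sub>M A (\<lambda>_. borel) :: (int ^ 'd \<Rightarrow> complex) measure"
  define h where "h n a = (\<lambda>x\<in>A. fourier n a (reduce n x))" for n and a :: "int ^ 'd \<Rightarrow> complex"
  define \<mu> where "\<mu> n = distr (spherical_law \<theta> n) ?P (\<lambda>\<psi>. \<lambda>x\<in>A. \<psi> (reduce n x))" for n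
  define \<nu> where "\<nu> = distr M ?P (\<lambda>\<omega>. \<lambda>x\<in>A. X \<omega> x)"
  have F: "fourier n \<in> measurable (mode_law \<theta> n :: (int ^ 'd \<Rightarrow> complex) measure) (cspace (torus n))" for n
    using measurable_fourier measurable_cong_sets[OF sets_mode_law refl] by blast
  have h: "h n \<in> measurable (mode_law \<theta> n) ?P" if "n > 0" for n
    using measurable_comp[OF F measurable_torus_restrict[OF that]] by (simp add: h_def[abs_def] comp_def)
  have \<mu>h: "\<mu> n = distr (mode_law \<theta> n) ?P (h n)" if "n \<ge> 3" for n
    unfolding \<mu>_def spherical_law_eq_distr[OF that]
    by (subst distr_distr[OF measurable_torus_restrict F]) (use that in \<open>auto simp: comp_def h_def[abs_def]\<close>)
  have hX: "(\<lambda>\<omega>. \<lambda>x\<in>A. X \<omega> x) \<in> measurable M ?P" by (intro measurable_restrict X)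
  \<comment> \<open>The Fourier representation holds for n \<ge> 3; the sequence is shifted by 3,
    which does not affect the limit.\<close>
  have "weak_conv_on (product_topology (\<lambda>_. euclidean) A) (\<lambda>n. \<mu> (n + 3)) \<nu>"
  proof (rule weak_conv_on_char[OF A])
    show "prob_space (\<mu> (n + 3))" for n
      unfolding \<mu>h[OF le_add2]
      by (rule prob_space.prob_space_distr[OF prob_space_mode_law[OF \<theta>] h]) auto
    show "prob_space \<nu>" unfolding \<nu>_def by (rule prob_space.prob_space_distr[OF M hX])
  next
    fix c :: "int ^ 'd \<Rightarrow> complex"
    have re: "(\<lambda>u. Re (z * u)) \<in> borel_measurable borel" and cis: "cis \<in> borel_measurable borel" for z
      by (intro borel_measurable_continuous_onI continuous_intros)+
    have "(\<lambda>\<psi>. Re (c x * \<psi> x)) \<in> borel_measurable ?P" if "x \<in> A" for x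
      using measurable_component_singleton[OF that, of "\<lambda>_. borel"] re by (rule measurable_compose)
    then have "(\<lambda>\<psi>. \<Sum>x\<in>A. Re (c x * \<psi> x)) \<in> borel_measurable ?P" by (rule borel_measurable_sum)
    from measurable_compose[OF this cis]
    have cm: "(\<lambda>\<psi>. cis (rpair A c \<psi>)) \<in> borel_measurable ?P" unfolding rpair_def .
    have "(\<integral>\<psi>. cis (rpair A c \<psi>) \<partial>\<mu> (n + 3)) =
        (\<integral>a. (\<Prod>k\<in>torus (n + 3). cis (Re (amplitude A c (n + 3) k * a k))) \<partial>mode_law \<theta> (n + 3))" for n
    proof -
      have n: "n + 3 > 0" by simp
      show ?thesis unfolding \<mu>h[OF le_add2] integral_distr[OF h[OF n] cm] h_def cis_rpair_fourier[OF n] ..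
    qed
    moreover have "(\<integral>\<psi>. cis (rpair A c \<psi>) \<partial>\<nu>) = (\<integral>\<omega>. cis (rpair A c (X \<omega>)) \<partial>M)"
      unfolding \<nu>_def integral_distr[OF hX cm] by (simp add: rpair_def)
    ultimately show "(\<lambda>n. \<integral>\<psi>. cis (rpair A c \<psi>) \<partial>\<mu> (n + 3)) \<longlonglongrightarrow> (\<integral>\<psi>. cis (rpair A c \<psi>) \<partial>\<nu>)"
      using LIMSEQ_ignore_initial_segment[OF char[OF A, of c], of 3] by (simp only:)
  next
    fix \<epsilon> :: real assume \<epsilon>: "\<epsilon> > 0"
    \<comment> \<open>The union bound over A gives card A / R^2 \<le> \<epsilon>; the summand 1
      keeps R positive for empty A.\<close>
    define R where "R = sqrt ((real (card A) + 1) / \<epsilon>)"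
    have R: "R > 0" "R\<^sup>2 = (real (card A) + 1) / \<epsilon>" using \<epsilon> by (auto simp: R_def add_nonneg_pos)
    have "measure (\<mu> (n + 3)) (space (\<mu> (n + 3)) - PiE A (\<lambda>_. cball 0 R)) \<le> \<epsilon>" for n
    proof -
      have n: "n + 3 > 0" by simp
      let ?M = "mode_law \<theta> (n + 3) :: (int ^ 'd \<Rightarrow> complex) measure"
      let ?S = "\<lambda>x. {a \<in> space ?M. R < cmod (fourier (n + 3) a (reduce (n + 3) x))}"
      interpret M: prob_space ?M by (rule prob_space_mode_law[OF \<theta> n])
      note S = mode_law_tail[OF \<theta> n reduce_in_torus[OF n] R(1)]
      have B: "space ?P - PiE A (\<lambda>_. cball 0 R) \<in> sets ?P"
        using A by (intro sets.Diff sets.top sets_PiM_I_finite) auto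
      have "measure (\<mu> (n + 3)) (space (\<mu> (n + 3)) - PiE A (\<lambda>_. cball 0 R)) =
          measure ?M (h (n + 3) -` (space ?P - PiE A (\<lambda>_. cball 0 R)) \<inter> space ?M)"
        unfolding \<mu>h[OF le_add2] space_distr by (rule measure_distr[OF h[OF n] B])
      also have "\<dots> \<le> measure ?M (\<Union>x\<in>A. ?S x)"
      proof (rule M.finite_measure_mono)
        show "h (n + 3) -` (space ?P - PiE A (\<lambda>_. cball 0 R)) \<inter> space ?M \<subseteq> (\<Union>x\<in>A. ?S x)"
        proof
          fix a assume a: "a \<in> h (n + 3) -` (space ?P - PiE A (\<lambda>_. cball 0 R)) \<inter> space ?M"
          have "h (n + 3) a \<notin> PiE A (\<lambda>_. cball 0 R)" using a by blast
          moreover have "h (n + 3) a \<in> extensional A" unfolding h_def by (rule restrict_extensional)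
          ultimately obtain x where x: "x \<in> A" "h (n + 3) a x \<notin> cball 0 R" unfolding PiE_iff by blast
          have "R < cmod (fourier (n + 3) a (reduce (n + 3) x))"
            using x by (simp only: h_def restrict_apply' mem_cball dist_0_norm not_le)
          then show "a \<in> (\<Union>x\<in>A. ?S x)" using x(1) a by blast
        qed
        show "(\<Union>x\<in>A. ?S x) \<in> sets ?M" by (intro sets.finite_UN A S(1))
      qed
      also have "\<dots> \<le> (\<Sum>x\<in>A. measure ?M (?S x))" by (intro measure_UNION_le A S(1))
      also have "\<dots> \<le> (\<Sum>x\<in>A. 1 / R\<^sup>2)" by (intro sum_mono S(2))
      also have "\<dots> = real (card A) / (real (card A) + 1) * \<epsilon>" unfolding R(2) by simp
      also have "\<dots> \<le> 1 * \<epsilon>" using \<epsilon> by (intro mult_right_mono) auto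
      finally show ?thesis by (simp only: mult_1_left)
    qed
    then show "\<exists>R. \<forall>n. measure (\<mu> (n + 3)) (space (\<mu> (n + 3)) - PiE A (\<lambda>_. cball 0 R)) \<le> \<epsilon>" by blast
  qed (simp_all add: \<mu>_def \<nu>_def)
  note W = this[unfolded weak_conv_on_def, rule_format]
  have "weak_conv_on (product_topology (\<lambda>_. euclidean) A) \<mu> \<nu>"
    unfolding weak_conv_on_def by (intro allI impI) (rule LIMSEQ_offset[where k = 3, OF W])
  then show "weak_conv_on (product_topology (\<lambda>_. euclidean) A)
      (\<lambda>n. distr (spherical_law \<theta> n) ?P (\<lambda>\<psi>. \<lambda>x\<in>A. \<psi> (reduce n x))) (distr M ?P (\<lambda>\<omega>. \<lambda>x\<in>A. X \<omega> x))"
    unfolding \<mu>_def \<nu>_def .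
qed

lemma rpair_scale: "rpair A c (\<lambda>x. z * \<phi> x) = rpair A (\<lambda>x. c x * z) \<phi>"
  by (simp only: rpair_def mult.assoc)

lemma (in prob_space) scaled_massive_gff_char:
  fixes \<Phi> :: "'a \<Rightarrow> int ^ 'd \<Rightarrow> complex"
  assumes \<theta>: "\<theta> > 0" and gff: "massive_gff m M \<Phi>" and A: "finite A"
  shows "expectation (\<lambda>\<omega>. cis (rpair A (\<lambda>x. c x * complex_of_real (\<theta> powr (-1/2))) (\<Phi> \<omega>))) =
    complex_of_real (exp (- (covariance_form m A c / \<theta>) / 4))"
proof -
  define r where "r = \<theta> powr (-1/2)"
  have "r * r = \<theta> powr (-1)" unfolding r_def by (simp flip: powr_add)
  then have r: "r * r = 1 / \<theta>" using \<theta> by (simp add: powr_minus inverse_eq_divide)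
  have "Re (c x * of_real r * cnj (c y * of_real r)) = r * r * Re (c x * cnj (c y))" for x y
    by (simp add: algebra_simps)
  then have "covariance_form m A (\<lambda>x. c x * of_real r) = r * r * covariance_form m A c"
    by (simp only: covariance_form_def sum_distrib_left mult.assoc)
  then have "covariance_form m A (\<lambda>x. c x * of_real r) = covariance_form m A c / \<theta>" unfolding r by simp
  then show ?thesis
    unfolding massive_gff_char[OF gff A] by (simp only: covariance_form_def r_def)
qed

lemma massive_gff_component:
  assumes "massive_gff m M \<Phi>"
  shows "(\<lambda>\<omega>. \<Phi> \<omega> x) \<in> borel_measurable M"
proof -
  have "\<Phi> \<in> measurable M field_space"
    using assms by (simp only: massive_gff_def complex_gaussian_process_def)
  from measurable_compose[OF this measurable_component_singleton[OF UNIV_I]] show ?thesis .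
qed

lemma local_weak_conv_subcritical:
  fixes \<Phi> :: "'w \<Rightarrow> int ^ 'd \<Rightarrow> complex"
  assumes d: "CARD('d::finite) \<ge> 3" and \<theta>: "\<theta> > 0" and m: "m > 0" "mass_integral TYPE('d) m = \<theta>"
    and M: "prob_space M" and gff: "massive_gff m M \<Phi>"
  shows "local_weak_conv (spherical_law \<theta>) M (\<lambda>\<omega> x. complex_of_real (\<theta> powr (-1/2)) * \<Phi> \<omega> x)"
proof (rule local_weak_conv_of_char[OF \<theta> M])
  fix A :: "(int ^ 'd) set" and c :: "int ^ 'd \<Rightarrow> complex" assume A: "finite A"
  show "(\<lambda>n. \<integral>a. (\<Prod>k\<in>torus n. cis (Re (amplitude A c n k * a k))) \<partial>mode_law \<theta> n) \<longlonglongrightarrow>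
      (\<integral>\<omega>. cis (rpair A c (\<lambda>x. complex_of_real (\<theta> powr (-1/2)) * \<Phi> \<omega> x)) \<partial>M)"
    unfolding rpair_scale prob_space.scaled_massive_gff_char[OF M \<theta> gff A]
    using m by (intro subcritical_char_limit d \<theta>) (auto simp: mass_integral_eq)
qed (intro borel_measurable_times borel_measurable_const massive_gff_component[OF gff])

text \<open>Independence factorises the characteristic function of the limit. At equality the disc
  degenerates to a point and the limit theorem with m0 = 0 applies instead of the one for the disc
  of positive radius.\<close>

lemma local_weak_conv_supercritical:
  fixes \<Phi> :: "'w \<Rightarrow> int ^ 'd \<Rightarrow> complex"
  assumes d: "CARD('d::finite) \<ge> 3" and \<theta>: "\<theta> > 0" and \<theta>C: "\<theta> \<ge> green_const TYPE('d)"
    and M: "prob_space M" and gff: "massive_gff 0 M \<Phi>" and U: "U \<in> borel_measurable M"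
    and dU: "distr M borel U = uniform_disc (sqrt (1 - green_const TYPE('d) / \<theta>))"
    and ind: "indep_of_field M U \<Phi>"
  shows "local_weak_conv (spherical_law \<theta>) M (\<lambda>\<omega> x. complex_of_real (\<theta> powr (-1/2)) * \<Phi> \<omega> x + U \<omega>)"
proof (rule local_weak_conv_of_char[OF \<theta> M])
  fix A :: "(int ^ 'd) set" and c :: "int ^ 'd \<Rightarrow> complex" assume A: "finite A"
  have \<Phi>: "\<Phi> \<in> measurable M field_space"
    using gff by (simp only: massive_gff_def complex_gaussian_process_def)
  define j where "j = (\<Sum>x\<in>A. c x)"
  let ?c = "\<lambda>x. c x * complex_of_real (\<theta> powr (-1/2))"
  have cm: "(\<lambda>u. cis (Re (j * u))) \<in> borel_measurable borel"
    by (intro borel_measurable_continuous_onI continuous_intros)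
  have "rpair A c (\<lambda>x. complex_of_real (\<theta> powr (-1/2)) * \<Phi> \<omega> x + U \<omega>) = rpair A ?c (\<Phi> \<omega>) + Re (j * U \<omega>)" for \<omega>
    unfolding rpair_scale[symmetric] j_def
    by (simp only: rpair_def distrib_left plus_complex.sel sum.distrib sum_distrib_right Re_sum)
  then have "(\<integral>\<omega>. cis (rpair A c (\<lambda>x. complex_of_real (\<theta> powr (-1/2)) * \<Phi> \<omega> x + U \<omega>)) \<partial>M) =
      (\<integral>\<omega>. cis (rpair A ?c (\<Phi> \<omega>)) \<partial>M) * (\<integral>\<omega>. cis (Re (j * U \<omega>)) \<partial>M)"
    by (simp only: prob_space.indep_of_field_char[OF M ind U \<Phi> A])
  also have "(\<integral>\<omega>. cis (Re (j * U \<omega>)) \<partial>M) = (\<integral>u. cis (Re (j * u)) \<partial>distr M borel U)"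
    by (rule integral_distr[OF U cm, symmetric])
  finally have e: "(\<integral>\<omega>. cis (rpair A c (\<lambda>x. complex_of_real (\<theta> powr (-1/2)) * \<Phi> \<omega> x + U \<omega>)) \<partial>M) =
      (\<integral>u. cis (Re (j * u)) \<partial>uniform_disc (sqrt (1 - green_const TYPE('d) / \<theta>))) *
      complex_of_real (exp (- (covariance_form 0 A c / \<theta>) / 4))"
    unfolding dU prob_space.scaled_massive_gff_char[OF M \<theta> gff A] by (simp only: mult.commute)
  show "(\<lambda>n. \<integral>a. (\<Prod>k\<in>torus n. cis (Re (amplitude A c n k * a k))) \<partial>mode_law \<theta> n) \<longlonglongrightarrow>
      (\<integral>\<omega>. cis (rpair A c (\<lambda>x. complex_of_real (\<theta> powr (-1/2)) * \<Phi> \<omega> x + U \<omega>)) \<partial>M)"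
  proof (cases "\<theta> = green_const TYPE('d)")
    case True
    have "sqrt (1 - green_const TYPE('d) / \<theta>) = 0" using True \<theta> by simp
    then have "uniform_disc (sqrt (1 - green_const TYPE('d) / \<theta>)) = return borel 0" by (simp add: uniform_disc_def)
    moreover have "(\<integral>u. cis (Re (j * u)) \<partial>return borel 0) = 1"
      by (subst integral_return[OF _ cm]) auto
    ultimately have e1: "(\<integral>u. cis (Re (j * u)) \<partial>uniform_disc (sqrt (1 - green_const TYPE('d) / \<theta>))) = 1" by simp
    show ?thesis unfolding e e1 mult_1_left
      using True by (intro subcritical_char_limit d \<theta>) (auto simp: green_const_eq[OF d])
  next
    case False
    then show ?thesis unfolding e j_def using \<theta>C by (intro supercritical_char_limit d \<theta>) simp
  qed
qed (intro borel_measurable_add borel_measurable_times borel_measurable_const massive_gff_component[OF gff] U)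

lemma AE_zero_critical:
  fixes U :: "'w \<Rightarrow> complex"
  assumes \<theta>: "\<theta> > 0" and U: "U \<in> borel_measurable M" and \<theta>C: "\<theta> = green_const TYPE('d::finite)"
    and dU: "distr M borel U = uniform_disc (sqrt (1 - green_const TYPE('d) / \<theta>))"
  shows "AE \<omega> in M. U \<omega> = 0"
proof -
  have "sqrt (1 - green_const TYPE('d) / \<theta>) = 0" using \<theta>C \<theta> by simp
  then have "distr M borel U = return borel 0" using dU by (simp add: uniform_disc_def)
  moreover have "AE u in return borel (0::complex). u = 0" by (subst AE_return) auto
  ultimately have "AE u in distr M borel U. u = 0" by (simp only:)
  then show ?thesis by (subst (asm) AE_distr_iff[OF U]) auto
qed

theorem theorem1p2:
  fixes \<theta> :: real
  assumes "CARD('d::finite) \<ge> 3" and "\<theta> > 0"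
  shows
    "(\<theta> < green_const TYPE('d) \<longrightarrow>
        (\<exists>!m. m > 0 \<and> mass_integral TYPE('d) m = \<theta>) \<and>
        (\<forall>m > 0. mass_integral TYPE('d) m = \<theta> \<longrightarrow>
          (\<forall>(M :: 'w measure) (\<Phi> :: 'w \<Rightarrow> int ^ 'd \<Rightarrow> complex).
             prob_space M \<and> massive_gff m M \<Phi> \<longrightarrow>
             local_weak_conv (spherical_law \<theta>) M
               (\<lambda>\<omega> x. complex_of_real (\<theta> powr (-1/2)) * \<Phi> \<omega> x)))) \<and>
     (\<theta> \<ge> green_const TYPE('d) \<longrightarrow>
        (\<forall>(M :: 'w measure) (\<Phi> :: 'w \<Rightarrow> int ^ 'd \<Rightarrow> complex) (U :: 'w \<Rightarrow> complex).
           prob_space M \<and> massive_gff 0 M \<Phi> \<and>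
           U \<in> borel_measurable M \<and>
           distr M borel U = uniform_disc (sqrt (1 - green_const TYPE('d) / \<theta>)) \<and>
           indep_of_field M U \<Phi> \<longrightarrow>
           local_weak_conv (spherical_law \<theta>) M
             (\<lambda>\<omega> x. complex_of_real (\<theta> powr (-1/2)) * \<Phi> \<omega> x + U \<omega>) \<and>
           (\<theta> = green_const TYPE('d) \<longrightarrow> (AE \<omega> in M. U \<omega> = 0))))"
proof (intro conjI impI, goal_cases)
  case 1
  then show ?case by (rule ex1_mass[OF assms])
next
  case 2
  show ?case
    by (intro allI impI, elim conjE, (rule local_weak_conv_subcritical[OF assms]; assumption))
next
  case 3
  show ?case
    by (intro allI impI, elim conjE, intro conjI impI,
        (rule local_weak_conv_supercritical[OF assms 3]; assumption),
        (rule AE_zero_critical[OF assms(2)]; assumption))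
qed

end
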